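(* Let $r\ge 4$. The complete list of physical invariants of $D_{r,3}$ (the affine algebra $D_r^{(1)}$ at level $3$) is: - $C_i$ and $C_i\,\mathcal{I}[J_v]$, valid for all $r$; - in addition, for $r\equiv4\pmod 8$: $C_i\,M$ for $M=\mathcal{I}[J_s]$, $\mathcal{I}[J_c]$, $\mathcal{I}[J_s]\,\mathcal{I}[J_c]$ and $\mathcal{I}[J_c]\,\mathcal{I}[J_s]$; - in addition, when $8$ divides $r$: $C_i\,M\,C_j$ for $M=\mathcal{I}[J_s]$ and $\mathcal{I}[J_v]\,\mathcal{I}[J_s]$; - finally, for $D_{7,3}$, there are the exceptionals $C_i\,\mathcal{E}(D_{7,3})$, where $$\mathcal{E}(D_{7,3})=\sum_{J\in\mathcal{J}_d}|\chi_{J0}+\chi_{J(\Lambda_1+\Lambda_5)}|^2+\sum_{J\in\mathcal{J}_d}|\chi_{J\Lambda_3}+\chi_{J(\Lambda_1+\Lambda_6+\Lambda_7)}|^2;$$ here $C_i$ and $C_j$ are any conjugations (i.e. $i,j\in\{0,1\}$ for $r\ne4$, and $i,j\in\{0,1,\ldots,5\}$ for $r=4$).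
   Context: **Weights.** For $r\ge4$, the set $P_+$ of level-$k$ integrable highest weights of $D_r^{(1)}$ consists of all $\lambda=\sum_{i=0}^r\lambda_i\Lambda_i$ with $\lambda_i\in\mathbb{Z}_{\ge0}$ and $k=\lambda_0+\lambda_1+2\lambda_2+\cdots+2\lambda_{r-2}+\lambda_{r-1}+\lambda_r$, where $\Lambda_i$ are the fundamental weights. Here $k=3$. The $\Lambda_0$-component is determined by the others and is dropped from the notation; the weight $k\Lambda_0$ is written $0$. Let $\rho=\sum_i\Lambda_i$ and $n=k+2r-2=2r+1$. **Kac–Peterson matrices.** With $\bar\lambda=\sum_{i\ge1}\lambda_i\Lambda_i$ and $\bar\rho$ the finite parts, $W$ the finite Weyl group of $D_r$, $\Delta_+$ its positive roots, $h^\vee=2r-2$, and the invariant form normalised so that roots have norm 2, $$S_{\lambda\mu}=\mathrm{i}^{|\Delta_+|}\,n^{-r/2}\,|P/Q^\vee|^{-1/2}\sum_{w\in W}\det(w)\exp\!\Big[-\tfrac{2\pi \mathrm{i}}{n}\big(w(\bar\lambda+\bar\rho)\,|\,\bar\mu+\bar\rho\big)\Big],\qquad T_{\lambda\mu}=\delta_{\lambda,\mu}\exp\!\Big[\tfrac{\pi \mathrm{i}\,(\bar\lambda+\bar\rho)^2}{n}-\tfrac{\pi \mathrm{i}\,\bar\rho^2}{h^\vee}\Big]$$ for $\lambda,\mu\in P_+$, where $P$ is the weight lattice and $Q^\vee$ the coroot lattice of $D_r$. **Physical invariant.** A matrix $M=(M_{\mu\nu})_{\mu,\nu\in P_+}$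 with $MS=SM$, $MT=TM$, all $M_{\mu\nu}\in\mathbb{Z}_{\ge0}$, and $M_{00}=1$. A matrix $M$ is identified with the formal sesquilinear expression $\sum_{\mu,\nu}M_{\mu\nu}\chi_\mu\chi_\nu^*$ in symbols $\chi_\mu$, $\mu\in P_+$ (the characters, treated as independent); so $\mathcal{E}(D_{7,3})$ is the matrix of coefficients of the displayed expression. **Conjugations.** $C_0=I$ (the identity), and $C_1$ interchanges $\lambda_{r-1}\leftrightarrow\lambda_r$. When $r=4$ there are four further conjugations $C_2,\ldots,C_5$, so that $C_0,\ldots,C_5$ correspond to the six permutations of the labels $\lambda_1,\lambda_3,\lambda_4$. Each conjugation $C$ is also viewed as the permutation matrix $C_{\lambda\mu}=\delta_{\mu,C\lambda}$. **Simple currents.** $J_v\lambda=(\lambda_1,\lambda_0,\lambda_2,\ldots,\lambda_{r-2},\lambda_r,\lambda_{r-1})$; $J_s\lambda=(\lambda_r,\lambda_{r-1},\lambda_{r-2},\ldots,\lambda_1,\lambda_0)$ for $r$ even and $J_s\lambda=(\lambda_{r-1},\lambda_r,\lambda_{r-2},\ldots,\lambda_1,\lambda_0)$ for $r$ odd; $J_c=J_v\circ J_s$; $\mathcal{J}_d=\{\mathrm{id},J_v,J_s,J_c\}$. **Simple current invariants.** Put $Q_{J_v}(\mu)=\frac{\mu_{r-1}+\mu_r}{2}$, $Q_{J_s}(\mu)=\sum_{j=1}^{r-2}\frac{j\mu_j}{2}-\frac{r-2}{4}\mu_{r-1}-\frac r4\mu_r$, and $Q_{J_c}=Q_{J_v}+Q_{J_s}$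 (these matter only modulo 1). For a simple current $J$ of order $N$, $$\mathcal{I}[J]_{\mu,\nu}=\sum_{\ell=1}^{N}\delta_{J^\ell\mu,\nu}\,\delta^1\Big(Q_J(\mu)+\frac{\ell}{2N}R(J)\Big),$$ where $\delta^1(x)=1$ if $x\in\mathbb{Z}$ and $0$ otherwise. At level $k=3$: $R(J_v)=6$ and $N=2$ for $J_v$; and for $r$ even (the only case where they are used here) $N=2$ and $R(J_s)=R(J_c)=3r/2$ for $J_s$ and $J_c$. Juxtaposition denotes matrix product. *)

theory Defs
  imports Complex_Main "Jordan_Normal_Form.Determinant"
begin

section \<open>The finite root system \<open>D\<^sub>r\<close>\<close>

text \<open>
  The root system is realised in \<open>\<real>\<^sup>r\<close> with orthonormal basis
  \<open>\<epsilon>\<^sub>1, \<dots>, \<epsilon>\<^sub>r\<close>, where \<open>\<epsilon>\<^sub>i\<close> is \<open>unit_vec r (i - 1)\<close>; the invariant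
  form, normalised so that roots have norm 2, is then the standard scalar product.
  The simple roots are \<open>\<epsilon>\<^sub>i - \<epsilon>\<^sub>i\<^sub>+\<^sub>1\<close> for \<open>i < r\<close> and \<open>\<epsilon>\<^sub>r\<^sub>-\<^sub>1 + \<epsilon>\<^sub>r\<close>.
\<close>

definition pos_roots :: "nat \<Rightarrow> real vec set" where
  "pos_roots r =
     {unit_vec r i - unit_vec r j | i j. i < j \<and> j < r} \<union>
     {unit_vec r i + unit_vec r j | i j. i < j \<and> j < r}"

definition roots :: "nat \<Rightarrow> real vec set" where
  "roots r = pos_roots r \<union> uminus ` pos_roots r"

definition reflection_mat :: "nat \<Rightarrow> real vec \<Rightarrow> real mat" where
  "reflection_mat r \<alpha> =
     mat r r (\<lambda>(i, j). (if i = j then 1 else 0) - 2 * (\<alpha> $ i) * (\<alpha> $ j) / (\<alpha> \<bullet> \<alpha>))"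

inductive_set weyl_group :: "nat \<Rightarrow> real mat set" for r :: nat where
  one: "1\<^sub>m r \<in> weyl_group r"
| refl: "\<alpha> \<in> roots r \<Longrightarrow> w \<in> weyl_group r \<Longrightarrow> reflection_mat r \<alpha> * w \<in> weyl_group r"

text \<open>The basis dual to the simple coroots, indexed by \<open>1 \<le> i \<le> r\<close>.\<close>

definition fund_weight :: "nat \<Rightarrow> nat \<Rightarrow> real vec" where
  "fund_weight r i = vec r (\<lambda>j.
     if i = r then 1/2
     else if i = r - 1 then (if j = r - 1 then - 1/2 else 1/2)
     else (if j < i then 1 else 0))"

definition int_span :: "nat \<Rightarrow> real vec set \<Rightarrow> real vec set" where
  "int_span r B = {vec r (\<lambda>j. \<Sum>b\<in>B. of_int (c b) * b $ j) | c :: real vec \<Rightarrow> int. True}"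

definition weight_lattice :: "nat \<Rightarrow> real vec set" where
  "weight_lattice r = int_span r (fund_weight r ` {1..r})"

definition coroot_lattice :: "nat \<Rightarrow> real vec set" where
  "coroot_lattice r = int_span r ((\<lambda>\<alpha>. (2 / (\<alpha> \<bullet> \<alpha>)) \<cdot>\<^sub>v \<alpha>) ` roots r)"

definition lattice_index :: "nat \<Rightarrow> nat" where
  "lattice_index r = card (weight_lattice r //
     {(x, y). x \<in> weight_lattice r \<and> y \<in> weight_lattice r \<and> x - y \<in> coroot_lattice r})"

section \<open>Integrable highest weights of \<open>D\<^sub>r\<^sup>(\<^sup>1\<^sup>)\<close>\<close>

text \<open>
  An affine weight is the function \<open>i \<mapsto> \<lambda>\<^sub>i\<close> of its Dynkin labels, including the label
  \<open>\<lambda>\<^sub>0\<close>; labels beyond \<open>r\<close> are 0.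
\<close>

type_synonym weight = "nat \<Rightarrow> nat"

definition P_plus :: "nat \<Rightarrow> nat \<Rightarrow> weight set" where
  "P_plus r k = {\<mu>. (\<forall>i>r. \<mu> i = 0) \<and>
     k = \<mu> 0 + \<mu> 1 + (\<Sum>i=2..r-2. 2 * \<mu> i) + \<mu> (r - 1) + \<mu> r}"

text \<open>
  The level-\<open>k\<close> weight with finite Dynkin labels \<open>a\<^sub>1, \<dots>, a\<^sub>r\<close>, the label of
  \<open>\<Lambda>\<^sub>0\<close> being determined by the level.
\<close>

definition with_level :: "nat \<Rightarrow> nat \<Rightarrow> weight \<Rightarrow> weight" where
  "with_level r k a = a(0 := k - (a 1 + (\<Sum>i=2..r-2. 2 * a i) + a (r - 1) + a r))"

definition Lam :: "nat \<Rightarrow> weight" where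
  "Lam i = (\<lambda>j. if j = i then 1 else 0)"

definition vacuum :: "nat \<Rightarrow> weight" where
  "vacuum k = (\<lambda>i. if i = 0 then k else 0)"

definition fin_part :: "nat \<Rightarrow> weight \<Rightarrow> real vec" where
  "fin_part r \<mu> = vec r (\<lambda>j. \<Sum>i=1..r. real (\<mu> i) * fund_weight r i $ j)"

definition rho_bar :: "nat \<Rightarrow> real vec" where
  "rho_bar r = fin_part r (\<lambda>_. 1)"

section \<open>Matrices over a finite index set of weights\<close>

text \<open>
  A matrix with rows and columns in \<open>P\<close> is a function vanishing outside \<open>P \<times> P\<close>, so that
  equality of matrices is equality of functions.
\<close>

type_synonym wmat = "weight \<Rightarrow> weight \<Rightarrow> complex"

definition mat_on :: "weight set \<Rightarrow> wmat \<Rightarrow> wmat" where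
  "mat_on P f = (\<lambda>\<mu> \<nu>. if \<mu> \<in> P \<and> \<nu> \<in> P then f \<mu> \<nu> else 0)"

definition mat_mul :: "weight set \<Rightarrow> wmat \<Rightarrow> wmat \<Rightarrow> wmat" where
  "mat_mul P A B = mat_on P (\<lambda>\<mu> \<nu>. \<Sum>\<kappa>\<in>P. A \<mu> \<kappa> * B \<kappa> \<nu>)"

abbreviation mat_mul3 :: "wmat \<Rightarrow> nat \<Rightarrow> wmat \<Rightarrow> wmat" ("(_ \<odot>\<^bsub>_\<^esub> _)" [70, 0, 71] 70) where
  "A \<odot>\<^bsub>r\<^esub> B \<equiv> mat_mul (P_plus r 3) A B"

section \<open>Kac--Peterson matrices and physical invariants\<close>

text \<open>The height \<open>n = k + h\<^sup>\<or>\<close> with \<open>h\<^sup>\<or> = 2r - 2\<close>.\<close>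

definition height :: "nat \<Rightarrow> nat \<Rightarrow> nat" where
  "height r k = k + 2 * r - 2"

definition S_mat :: "nat \<Rightarrow> nat \<Rightarrow> wmat" where
  "S_mat r k = mat_on (P_plus r k) (\<lambda>\<mu> \<nu>.
     \<i> ^ card (pos_roots r)
     * of_real (real (height r k) powr (- real r / 2))
     * of_real (real (lattice_index r) powr (- 1 / 2))
     * (\<Sum>w\<in>weyl_group r. of_real (det w) *
          exp (- (2 * of_real pi * \<i> / of_nat (height r k))
               * of_real ((w *\<^sub>v (fin_part r \<mu> + rho_bar r)) \<bullet> (fin_part r \<nu> + rho_bar r)))))"

definition T_mat :: "nat \<Rightarrow> nat \<Rightarrow> wmat" where
  "T_mat r k = mat_on (P_plus r k) (\<lambda>\<mu> \<nu>.
     if \<mu> = \<nu> then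
       exp (of_real pi * \<i> / of_nat (height r k)
              * of_real ((fin_part r \<mu> + rho_bar r) \<bullet> (fin_part r \<mu> + rho_bar r))
            - of_real pi * \<i> / of_nat (2 * r - 2) * of_real (rho_bar r \<bullet> rho_bar r))
     else 0)"

definition physical_invariant :: "nat \<Rightarrow> nat \<Rightarrow> wmat \<Rightarrow> bool" where
  "physical_invariant r k M \<longleftrightarrow>
     (\<forall>\<mu> \<nu>. \<mu> \<notin> P_plus r k \<or> \<nu> \<notin> P_plus r k \<longrightarrow> M \<mu> \<nu> = 0) \<and>
     mat_mul (P_plus r k) M (S_mat r k) = mat_mul (P_plus r k) (S_mat r k) M \<and>
     mat_mul (P_plus r k) M (T_mat r k) = mat_mul (P_plus r k) (T_mat r k) M \<and>
     (\<forall>\<mu>\<in>P_plus r k. \<forall>\<nu>\<in>P_plus r k. M \<mu> \<nu> \<in> \<nat>) \<and>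
     M (vacuum k) (vacuum k) = 1"

section \<open>Conjugations\<close>

text \<open>
  For \<open>r = 4\<close> these are the six maps permuting the labels \<open>\<lambda>\<^sub>1, \<lambda>\<^sub>3, \<lambda>\<^sub>4\<close>.
\<close>

definition conjugations :: "nat \<Rightarrow> (weight \<Rightarrow> weight) set" where
  "conjugations r =
     (if r = 4 then {(\<lambda>\<mu>. \<mu> \<circ> \<pi>) | \<pi>. \<pi> permutes {1, 3, 4}}
      else {id, (\<lambda>\<mu>. \<mu>(r - 1 := \<mu> r, r := \<mu> (r - 1)))})"

definition conj_mats :: "nat \<Rightarrow> wmat set" where
  "conj_mats r =
     (\<lambda>C. mat_on (P_plus r 3) (\<lambda>\<mu> \<nu>. if \<nu> = C \<mu> then 1 else 0)) ` conjugations r"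

section \<open>Simple currents and their invariants\<close>

definition J_v :: "nat \<Rightarrow> weight \<Rightarrow> weight" where
  "J_v r \<mu> = \<mu>(0 := \<mu> 1, 1 := \<mu> 0, r - 1 := \<mu> r, r := \<mu> (r - 1))"

definition J_s :: "nat \<Rightarrow> weight \<Rightarrow> weight" where
  "J_s r \<mu> = (\<lambda>i.
     if i > r then \<mu> i
     else if even r then \<mu> (r - i)
     else if i = 0 then \<mu> (r - 1)
     else if i = 1 then \<mu> r
     else if i = r - 1 then \<mu> 1
     else if i = r then \<mu> 0
     else \<mu> (r - i))"

definition J_c :: "nat \<Rightarrow> weight \<Rightarrow> weight" where
  "J_c r = J_v r \<circ> J_s r"

definition simple_currents :: "nat \<Rightarrow> (weight \<Rightarrow> weight) set" where
  "simple_currents r = {id, J_v r, J_s r, J_c r}"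

definition Q_v :: "nat \<Rightarrow> weight \<Rightarrow> real" where
  "Q_v r \<mu> = (real (\<mu> (r - 1)) + real (\<mu> r)) / 2"

definition Q_s :: "nat \<Rightarrow> weight \<Rightarrow> real" where
  "Q_s r \<mu> = (\<Sum>j=1..r-2. real j * real (\<mu> j) / 2)
     - (real r - 2) / 4 * real (\<mu> (r - 1)) - real r / 4 * real (\<mu> r)"

definition Q_c :: "nat \<Rightarrow> weight \<Rightarrow> real" where
  "Q_c r \<mu> = Q_v r \<mu> + Q_s r \<mu>"

text \<open>
  The level-3 matrix \<open>\<I>[J]\<close>, for a simple current \<open>J\<close> of order \<open>N\<close> with charge \<open>Q\<close> and
  \<open>R = R(J)\<close>.
\<close>

definition sc_invariant ::
    "nat \<Rightarrow> (weight \<Rightarrow> weight) \<Rightarrow> (weight \<Rightarrow> real) \<Rightarrow> nat \<Rightarrow> real \<Rightarrow> wmat" where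
  "sc_invariant r J Q N R = mat_on (P_plus r 3) (\<lambda>\<mu> \<nu>.
     \<Sum>l=1..N. (if (J ^^ l) \<mu> = \<nu> then 1 else 0)
             * (if Q \<mu> + real l / (2 * real N) * R \<in> \<int> then 1 else 0))"

definition I_v :: "nat \<Rightarrow> wmat" where
  "I_v r = sc_invariant r (J_v r) (Q_v r) 2 6"

text \<open>
  The next two have their intended meaning for even \<open>r\<close> only, where \<open>J\<^sub>s\<close> and \<open>J\<^sub>c\<close>
  have order 2.
\<close>

definition I_s :: "nat \<Rightarrow> wmat" where
  "I_s r = sc_invariant r (J_s r) (Q_s r) 2 (3 * real r / 2)"

definition I_c :: "nat \<Rightarrow> wmat" where
  "I_c r = sc_invariant r (J_c r) (Q_c r) 2 (3 * real r / 2)"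

section \<open>The exceptional invariant of \<open>D\<^sub>7\<close> at level 3\<close>

text \<open>
  Formal linear combinations of the symbols \<open>\<chi>\<^sub>\<mu>\<close> are represented by their coefficient
  functions; \<open>sq_mod a\<close> is the coefficient matrix of \<open>|\<Sum>\<^sub>\<mu> a\<^sub>\<mu> \<chi>\<^sub>\<mu>|\<^sup>2\<close>.
\<close>

definition chi :: "weight \<Rightarrow> weight \<Rightarrow> complex" where
  "chi \<kappa> = (\<lambda>\<mu>. if \<mu> = \<kappa> then 1 else 0)"

definition sq_mod :: "(weight \<Rightarrow> complex) \<Rightarrow> wmat" where
  "sq_mod a = (\<lambda>\<mu> \<nu>. a \<mu> * cnj (a \<nu>))"

definition E_D73 :: wmat where
  "E_D73 =
     (let fw = with_level 7 3;
          w15 = fw (\<lambda>i. Lam 1 i + Lam 5 i);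
          w3 = fw (Lam 3);
          w167 = fw (\<lambda>i. Lam 1 i + Lam 6 i + Lam 7 i)
      in mat_on (P_plus 7 3) (\<lambda>\<mu> \<nu>.
        (\<Sum>J\<in>simple_currents 7. sq_mod (\<lambda>\<kappa>. chi (J (vacuum 3)) \<kappa> + chi (J w15) \<kappa>) \<mu> \<nu>) +
        (\<Sum>J\<in>simple_currents 7. sq_mod (\<lambda>\<kappa>. chi (J w3) \<kappa> + chi (J w167) \<kappa>) \<mu> \<nu>)))"

end

theory Submission
  imports Defs "HOL-Number_Theory.Cong"
begin

text \<open>
  At level 3 the weights are the \<open>4 (r + 2)\<close> images of \<open>r + 2\<close> base weights under the simple
  currents. In these coordinates \<open>S\<close> is a constant times a tensor product \<open>X \<otimes> G\<close> and \<open>T\<close> is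
  a product of phases: the \<open>4 \<times> 4\<close> matrix \<open>G\<close> collects the monodromy charges of the simple
  currents, and \<open>X\<close> consists of the cosines \<open>cos (2 \<pi> b c / n)\<close>, \<open>n = 2 r + 1\<close>, with a \<open>2 \<times> 2\<close>
  correction for the pair of base weights exchanged by \<open>C\<^sub>1\<close>. Since \<open>n\<close> is odd, words in \<open>S\<close> and
  \<open>T\<close> act as a scalar on one tensor factor, so each block of an invariant commutes with \<open>X\<close> and with
  all its Galois conjugates. Positivity of the vacuum column, together with the phases, which force
  \<open>b\<^sup>2 \<equiv> c\<^sup>2 (mod n)\<close>, leaves only permutations as \<open>X\<close>-parts, except that for \<open>n = 15\<close> the Galois
  parities allow one extra coupling of the vacuum. The \<open>G\<close>-part is a \<open>4 \<times> 4\<close> problem depending on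
  \<open>r\<close> modulo 8. For \<open>r = 4\<close> the correction equals \<open>3/4\<close>, which makes three rows of \<open>X\<close>
  interchangeable: this is triality.
\<close>

section \<open>Signs of residues and Galois parities\<close>

text \<open>A shifted base weight has as coordinates all of r, r - 1, ..., 0 but one, up to a sign.
  Its Weyl sum is half an r x r minor of an (r + 1) x (r + 1) cosine matrix plus half a determinant
  of sines. The inverse of that cosine matrix is again a cosine matrix, so Jacobi's formula makes
  each minor a single cosine: this is the origin of X. The sine determinant survives as one constant
  \<kappa> on the pair of weights that leave out 0. The tests applied to a block avoid the entries
  containing \<kappa>; for r = 4 its value has to be computed. Multiplication of the residues by a
  unit t permutes the rows of X up to sign, and a nonnegative entry of an invariant can only be
  related to another one if the signs agree. For the vacuum this becomes an elementary question
  about a square root z of 1 modulo n: doubling drives z to n / 3, and a few test multipliers leave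
  z = 4, n = 15.\<close>

definition sres :: "nat \<Rightarrow> nat \<Rightarrow> nat" where
  "sres n t = (if 2 * (t mod n) < n then t mod n else n - t mod n)"

text \<open>As \<open>n\<close> is odd, each class {t, -t} modulo \<open>n\<close> has exactly one
  representative below n / 2, and \<open>sres\<close> picks it.\<close>

lemma sres_eqI:
  assumes "2 * v < n" "[v = t] (mod n) \<or> [v + t = 0] (mod n)" "odd n"
  shows "sres n t = v"
  using assms(2)
proof
  assume "[v = t] (mod n)"
  then have "t mod n = v" using assms(1) by (simp add: cong_def)
  then show ?thesis using assms(1) by (simp add: sres_def)
next
  assume *: "[v + t = 0] (mod n)"
  then have "(v + t mod n) mod n = 0" by (simp add: cong_def mod_add_right_eq)
  moreover have "t mod n < n" using assms(1) by (intro mod_less_divisor) auto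
  moreover have "v < n" using assms(1) by simp
  moreover obtain k where k: "v + t mod n = n * k"
    using calculation(1) by (metis dvdE mod_eq_0_iff_dvd)
  ultimately have "n * k < n * 2" by linarith
  then have "k = 0 \<or> k = 1" by auto
  then have "v + t mod n = 0 \<or> v + t mod n = n" using k by auto
  then show ?thesis using assms(1) by (auto simp: sres_def)
qed

lemma sres_cong: "[t = t'] (mod n) \<Longrightarrow> sres n t = sres n t'"
  by (simp add: sres_def cong_def)

lemma sres_small: "2 * v < n \<Longrightarrow> sres n v = v"
  by (simp add: sres_def)

lemma sres_bound:
  assumes "odd n"
  shows "2 * sres n t < n"
proof -
  have "2 * (t mod n) \<noteq> n" using assms by (metis even_mult_iff even_numeral)
  moreover have "t mod n < n" using assms by (intro mod_less_divisor) (auto elim: oddE)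
  ultimately show ?thesis by (auto simp: sres_def)
qed

lemma sres_cases: "n > 0 \<Longrightarrow> [sres n t = t] (mod n) \<or> [sres n t + t = 0] (mod n)"
  by (auto simp: sres_def cong_def mod_add_right_eq[symmetric, of _ t])

text \<open>A hypothetical partner of the vacuum, rescaled so that the vacuum itself becomes the
  residue 1: \<open>z\<close> is a square root of 1 because \<open>T\<close> separates different
  squares, and \<open>par\<close> is the Galois parity rule for the pair (1, z).\<close>

context
  fixes n z :: nat
  assumes n: "odd n" "n \<ge> 9" and z: "z > 1" "2 * z < n" and sq: "[z * z = 1] (mod n)"
    and par: "\<And>t. coprime t n \<Longrightarrow> even (sres n (t * z) + sres n t + z + 1)"
begin

text \<open>Test with the power of two that first carries \<open>z\<close> past n / 2: then 2^k z
  reflects to the odd number n - 2^k z, while 2^k is even and its own least residue.\<close>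

lemma parity_root_even: "even z"
proof (rule ccontr)
  assume oz: "odd z"
  have "n < 2 ^ (n + 1) * 1" using less_exp[of "n + 1"] by linarith
  also have "\<dots> \<le> 2 ^ (n + 1) * z" using z by (intro mult_le_mono) auto
  finally have "\<exists>k. 2 ^ (k + 1) * z > n" by blast
  define k where "k = (LEAST k. 2 ^ (k + 1) * z > n)"
  have k: "2 ^ (k + 1) * z > n"
    unfolding k_def by (rule LeastI_ex) fact
  have "k \<noteq> 0" using k z by (cases k) auto
  then obtain j where j: "k = Suc j" by (cases k) auto
  have "\<not> 2 ^ (j + 1) * z > n"
    using not_less_Least[of j "\<lambda>k. 2 ^ (k + 1) * z > n"] j unfolding k_def by auto
  moreover have "2 ^ (j + 1) * z \<noteq> n" using n by auto
  ultimately have j1: "2 ^ k * z < n" using j by auto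
  have "2 * 2 ^ k \<le> 2 ^ k * z" using z by simp
  then have t: "2 * 2 ^ k < n" using j1 by linarith
  have s1: "sres n (2 ^ k) = 2 ^ k" using t by (intro sres_small)
  have s2: "sres n (2 ^ k * z) = n - 2 ^ k * z"
    using j1 k n by (intro sres_eqI) (auto simp: cong_def)
  have "even ((2::nat) ^ k)" using j by simp
  moreover have "odd (n - 2 ^ k * z)" using j1 n j by auto
  moreover have "coprime (2 ^ k) n" using n by simp
  ultimately show False using par[of "2 ^ k"] s1 s2 oz by auto
qed

text \<open>Otherwise the multiplier 2 reflects nothing and leaves the sum with the parity of z + 1,
  which is odd.\<close>

lemma parity_root_ge: "4 * z > n"
proof (rule ccontr)
  assume "\<not> 4 * z > n"
  then have "4 * z < n" using n by (cases "4 * z = n") auto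
  then have "sres n (2 * z) = 2 * z" "sres n 2 = 2" using n by (auto intro!: sres_small)
  then show False using par[of 2] n parity_root_even by auto
qed

text \<open>On the interval from n / 4 to n / 2, doubling and reflecting sends w to n - 2 w, which
  multiplies the distance 3 w - n by -2. Parity forbids leaving the interval, so a distance of at
  least 4 would grow without bound.\<close>

lemma parity_root_third: "\<bar>3 * int z - int n\<bar> < 4"
proof (rule ccontr)
  define d where "d = 3 * int z - int n"
  assume "\<not> ?thesis"
  then have d4: "\<bar>d\<bar> \<ge> 4" by (simp add: d_def)
  \<comment> \<open>With |d| at least 4, the interval itself bounds 2^(k + 3) by \<open>n\<close>:
    just enough for 2^(k + 2) to be its own least residue when it serves as the next test
    multiplier.\<close>
  have bound: "2 ^ (k + 3) < int n"
    if "3 * int w = int n + (-2) ^ k * d" "4 * w > n" "2 * w < n" for k w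
  proof -
    have "\<bar>(-2) ^ k * d\<bar> * 2 < int n" using that by linarith
    then have "2 ^ k * \<bar>d\<bar> * 2 < int n" by (simp add: abs_mult power_abs)
    moreover have "(2::int) ^ k * 4 \<le> 2 ^ k * \<bar>d\<bar>" using d4 by (intro mult_left_mono) auto
    ultimately have "2 ^ k * 4 * 2 < int n" by linarith
    then show ?thesis by (simp add: power_add)
  qed
  have ind: "\<exists>w. sres n (2 ^ k * z) = w \<and> 3 * int w = int n + (-2) ^ k * d \<and> 4 * w > n \<and> 2 * w < n" for k
  proof (induction k)
    case 0
    show ?case using sres_small[of z n] z parity_root_ge by (auto simp: d_def)
  next
    case (Suc k)
    then obtain w where w: "sres n (2 ^ k * z) = w" "3 * int w = int n + (-2) ^ k * d"
      "4 * w > n" "2 * w < n" by blast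
    define w' where "w' = n - 2 * w"
    have w': "2 * w' < n" "w' + 2 * w = n" using w by (auto simp: w'_def)
    have c: "[w = 2 ^ k * z] (mod n) \<or> [w + 2 ^ k * z = 0] (mod n)"
      using sres_cases[of n "2 ^ k * z"] w(1) n by auto
    have c': "[w' = 2 * (2 ^ k * z)] (mod n) \<or> [w' + 2 * (2 ^ k * z) = 0] (mod n)"
      using c
    proof
      assume "[w = 2 ^ k * z] (mod n)"
      then have "[w' + 2 * w = w' + 2 * (2 ^ k * z)] (mod n)"
        by (intro cong_add cong_mult cong_refl)
      then show ?thesis using w'(2) by (auto simp: cong_def)
    next
      assume "[w + 2 ^ k * z = 0] (mod n)"
      then have "[w' + 2 * (w + 2 ^ k * z) = w' + 2 * 0] (mod n)"
        by (intro cong_add cong_mult cong_refl)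
      then have "[(w' + 2 * w) + 2 * (2 ^ k * z) = w'] (mod n)" by (simp add: algebra_simps)
      then have "[n + 2 * (2 ^ k * z) = w'] (mod n)" unfolding w'(2) .
      then have "[2 * (2 ^ k * z) = w'] (mod n)" by (simp add: cong_def)
      then show ?thesis by (auto intro: cong_sym)
    qed
    have s1: "sres n (2 ^ Suc k * z) = w'"
      using sres_eqI[OF w'(1) c' n(1)] by (simp add: mult.assoc)
    have three: "3 * int w' = int n + (-2) ^ Suc k * d"
      using w(2) w'(2) by (simp add: algebra_simps)
    have "4 * w' > n"
    proof (rule ccontr)
      assume "\<not> 4 * w' > n"
      then have lt: "2 * (2 * w') < n" using n by (cases "4 * w' = n") auto
      have c2: "[2 * w' = 2 * (2 * (2 ^ k * z))] (mod n) \<or> [2 * w' + 2 * (2 * (2 ^ k * z)) = 0] (mod n)"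
        using c' cong_scalar_left[of w' "2 * (2 ^ k * z)" n 2]
          cong_scalar_left[of "w' + 2 * (2 ^ k * z)" 0 n 2] by (auto simp: algebra_simps)
      have s2: "sres n (2 ^ (k + 2) * z) = 2 * w'"
        using sres_eqI[OF lt c2 n(1)] by (simp add: mult.assoc)
      have "2 ^ (k + 3) < int n" using bound w by blast
      then have "int (2 ^ (k + 3)) < int n" by simp
      then have "2 ^ (k + 3) < n" by (simp only: of_nat_less_iff)
      then have "2 * 2 ^ (k + 2) < n" by (simp add: power_add)
      then have "sres n (2 ^ (k + 2)) = 2 ^ (k + 2)" by (rule sres_small)
      moreover have "coprime (2 ^ (k + 2)) n" using n by (simp del: power_add_numeral2 power_Suc)
      ultimately show False using par[of "2 ^ (k + 2)"] s2 parity_root_even by (auto simp del: power_Suc)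
    qed
    then show ?case using s1 three w' by blast
  qed
  then have "2 ^ (n + 3) < int n" using bound by blast
  moreover have "int n < 2 ^ n" using of_nat_less_iff[of n "2 ^ n", where ?'a = int] less_exp[of n] by simp
  moreover have "(2::int) ^ n \<le> 2 ^ (n + 3)" by (rule power_increasing) auto
  ultimately show False by linarith
qed

text \<open>The distance 3 z - n is odd, so it is one of -3, -1, 1, 3. The values -1 and 1 make
  \<open>n\<close> divide 9 z^2 - 1 = 9 (z^2 - 1) + 8, hence 8. In the other two cases n = 3 m, and
  a congruence modulo 3 together with one test multiplier refutes everything except m = 5 in the
  first.\<close>

lemma parity_root_exceptional: "n = 15 \<and> z = 4"
proof -
  have sqd: "int n dvd int z * int z - 1"
    using sq by (metis cong_iff_dvd_diff cong_int_iff of_nat_1 of_nat_mult)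
  have "odd (3 * int z - int n)" using n parity_root_even by simp
  then have "3 * int z - int n = -3 \<or> 3 * int z - int n = -1 \<or> 3 * int z - int n = 1 \<or> 3 * int z - int n = 3"
    using parity_root_third by presburger
  then consider "int n = 3 * int z + 3" | "int n = 3 * int z - 3"
    | "int n = 3 * int z + 1 \<or> int n = 3 * int z - 1"
    by auto
  then show ?thesis
  proof cases
    case 1
    define m where "m = z + 1"
    have nm: "n = 3 * m" and zm: "z = m - 1" and m: "m > 2" "odd m"
      using 1 z parity_root_even by (auto simp: m_def)
    have "int z * int z - 1 = int m * (int m - 2)" using m by (simp add: zm of_nat_diff algebra_simps)
    then have "3 * int m dvd int m * (int m - 2)" using sqd nm by simp
    then have d3: "3 dvd int m - 2" using m by (simp add: mult.commute)
    then have m3: "m mod 3 = 2" by presburger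
    show ?thesis
    proof (cases "m > 6")
      case True
      \<comment> \<open>Test multiplier m + 3: it is even, below n / 2 because m > 6, and its
        product with z = m - 1 has the residue m - 3, also even, while z + 1 is odd.\<close>
      have cop: "coprime (m + 3) n"
      proof -
        have "\<not> 3 dvd m" using m3 by (simp add: dvd_eq_mod_eq_0)
        then have "coprime m 3" using prime_imp_coprime[of 3 m] by (simp add: coprime_commute)
        moreover have "gcd (m + 3) m = gcd 3 m" by (metis add.commute gcd.commute gcd_add1)
        ultimately have "coprime (m + 3) m" by (simp add: coprime_iff_gcd_eq_1 gcd.commute)
        moreover have "coprime (m + 3) 3" using \<open>coprime m 3\<close> by (simp add: coprime_iff_gcd_eq_1)
        ultimately show ?thesis by (simp add: nm)
      qed
      obtain q where q: "m = 3 * q + 2" using m3 by (metis div_mult_mod_eq mult.commute)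
      have s1: "sres n (m + 3) = m + 3" using True by (intro sres_small) (auto simp: nm)
      have s2: "sres n ((m + 3) * z) = m - 3"
      proof (rule sres_eqI)
        have "(m + 3) * z = (m - 3) + n * (q + 1)"
          using True unfolding nm zm q by (simp add: algebra_simps)
        then show "[m - 3 = (m + 3) * z] (mod n) \<or> [m - 3 + (m + 3) * z = 0] (mod n)"
          by (metis cong_def mod_mult_self2)
      qed (use True n nm in auto)
      show ?thesis using par[OF cop] s1 s2 parity_root_even True by auto
    next
      case False
      then have "m = 5" using m m3 by (cases "m = 3 \<or> m = 4 \<or> m = 5 \<or> m = 6") auto
      then show ?thesis using nm zm by simp
    qed
  next
    case 2
    define m where "m = z - 1"
    have nm: "n = 3 * m" and zm: "z = m + 1" and m: "m > 2" "odd m"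
      using 2 z n parity_root_even by (auto simp: m_def)
    have "int z * int z - 1 = int m * (int m + 2)" by (simp add: zm algebra_simps)
    then have "3 * int m dvd int m * (int m + 2)" using sqd nm by simp
    then have d3: "3 dvd int m + 2" using m by (simp add: mult.commute)
    then have m3: "m mod 3 = 1" by presburger
    \<comment> \<open>Test multiplier -1/2 modulo \<open>n\<close>: t z is congruent to -(2 m - t),
      so the two residues add up to the even number 2 m, against the odd z + 1.\<close>
    define t where "t = (n - 1) div 2"
    have t: "2 * t + 1 = n" using n by (auto simp: t_def elim!: oddE)
    have cop: "coprime t n"
    proof -
      have "coprime (2 * t) (2 * t + 1)" by simp
      then show ?thesis unfolding t by (simp add: coprime_mult_left_iff)
    qed
    have "t mod 3 = 1" using t nm by presburger
    then obtain q where q: "t = 3 * q + 1" by (metis div_mult_mod_eq mult.commute)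
    have s1: "sres n t = t" using t by (intro sres_small) auto
    have tm: "t < 2 * m" "2 * (2 * m - t) < n" using t nm m by auto
    have s2: "sres n (t * z) = 2 * m - t"
    proof (rule sres_eqI)
      have "2 * m - t + t * z = 2 * m + t * m" using tm by (simp add: zm algebra_simps)
      also have "\<dots> = n * (q + 1)" by (simp add: nm q algebra_simps)
      finally show "[2 * m - t = t * z] (mod n) \<or> [2 * m - t + t * z = 0] (mod n)"
        by (simp add: cong_def)
    qed (use tm n in auto)
    show ?thesis using par[OF cop] s1 s2 parity_root_even tm by auto
  next
    case 3
    then have "int n = 3 * int z + 1 \<or> int n = 3 * int z - 1" .
    then have "int n dvd (3 * int z - 1) * (3 * int z + 1)"
      using dvd_triv_left dvd_triv_right by metis
    moreover have "(3 * int z - 1) * (3 * int z + 1) = 9 * (int z * int z - 1) + 8"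
      by (simp add: algebra_simps)
    ultimately have "int n dvd 8" using sqd
      by (metis dvd_add_right_iff dvd_mult)
    then have "n \<le> 8" by (auto dest: zdvd_imp_le)
    then show ?thesis using n by simp
  qed
qed

end

section \<open>Roots of unity and Gauss sums\<close>

definition zt :: "nat \<Rightarrow> int \<Rightarrow> complex" where
  "zt n k = cis (2 * pi * real_of_int k / real n)"

definition ck :: "nat \<Rightarrow> int \<Rightarrow> real" where
  "ck n k = cos (2 * pi * real_of_int k / real n)"

lemma zt_0 [simp]: "zt n 0 = 1"
  by (simp add: zt_def)

lemma zt_add: "zt n (a + b) = zt n a * zt n b"
  by (simp add: zt_def cis_mult ring_distribs add_divide_distrib)

lemma zt_nonzero [simp]: "zt n a \<noteq> 0"
  by (simp add: zt_def)

lemma zt_power: "zt n a ^ k = zt n (int k * a)"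
  by (simp add: zt_def DeMoivre algebra_simps)

lemma zt_multiple: assumes "n > 0" shows "zt n (int n * a) = 1"
  using assms cis_multiple_2pi[of "real_of_int a"] by (simp add: zt_def mult.commute mult.left_commute)

lemma zt_eq_iff:
  assumes "n > 0"
  shows "zt n a = zt n b \<longleftrightarrow> [a = b] (mod int n)"
proof -
  have "zt n a = zt n b \<longleftrightarrow> zt n (a - b) = 1"
    using zt_add[of n "a - b" b] by simp
  also have "\<dots> \<longleftrightarrow> cos (2 * pi * real_of_int (a - b) / real n) = 1"
    by (auto simp: zt_def complex_eq_iff cos_one_sin_zero)
  also have "\<dots> \<longleftrightarrow> (\<exists>k::int. real_of_int (a - b) = real_of_int (int n * k))"
  proof -
    have "2 * pi * real_of_int (a - b) / real n = real_of_int k * 2 * pi \<longleftrightarrow>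
        2 * pi * real_of_int (a - b) = 2 * pi * real_of_int (int n * k)" for k
      using assms by (auto simp: divide_eq_eq mult_ac)
    then show ?thesis by (simp add: cos_one_2pi_int)
  qed
  also have "\<dots> \<longleftrightarrow> [a = b] (mod int n)"
    unfolding of_int_eq_iff by (auto simp: cong_iff_dvd_diff dvd_def)
  finally show ?thesis .
qed

lemma zt_cong: "n > 0 \<Longrightarrow> [a = b] (mod int n) \<Longrightarrow> zt n a = zt n b"
  by (simp add: zt_eq_iff)

lemma ck_zt: "complex_of_real (ck n k) = (zt n k + zt n (- k)) / 2"
  by (simp add: ck_def zt_def complex_eq_iff)

lemma ck_0 [simp]: "ck n 0 = 1"
  by (simp add: ck_def)

lemma ck_minus [simp]: "ck n (- k) = ck n k"
  by (simp add: ck_def)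

lemma ck_cong: 
  assumes "n > 0" "[a = b] (mod int n)"
  shows "ck n a = ck n b"
  using zt_cong[OF assms] by (simp add: ck_def zt_def complex_eq_iff)

lemma ck_mult: "ck n a * ck n b = (ck n (a + b) + ck n (a - b)) / 2"
  by (simp add: ck_def cos_add cos_diff ring_distribs add_divide_distrib diff_divide_distrib)

lemma sum_zt:
  assumes "n > 0"
  shows "(\<Sum>u<n. zt n (int u * v)) = (if int n dvd v then of_nat n else 0)"
proof (cases "int n dvd v")
  case True
  then have "zt n (int u * v) = 1" for u
    using zt_cong[OF assms, of "int u * v" 0] by (simp add: cong_0_iff)
  then show ?thesis using True by simp
next
  case False
  have "zt n v \<noteq> 1" using False zt_eq_iff[OF assms, of v 0] by (simp add: cong_0_iff)
  moreover have "zt n v ^ n = 1" by (simp add: zt_power zt_multiple[OF assms])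
  ultimately have "(\<Sum>u<n. zt n v ^ u) = 0" by (simp add: geometric_sum)
  then show ?thesis using False by (simp add: zt_power)
qed

lemma sum_ck:
  assumes "n > 0"
  shows "(\<Sum>u<n. complex_of_real (ck n (int u * v))) = (if int n dvd v then of_nat n else 0)"
  using sum_zt[OF assms, of v] sum_zt[OF assms, of "- v"]
  by (simp add: ck_zt sum.distrib flip: sum_divide_distrib)

lemma sum_periodic_shift:
  fixes f :: "int \<Rightarrow> 'a::comm_monoid_add"
  assumes "\<And>u. f (u + int n) = f u"
  shows "(\<Sum>u<n. f (int u + c)) = (\<Sum>u<n. f (int u))"
proof -
  have step: "(\<Sum>u<n. f (int u + (c + 1))) = (\<Sum>u<n. f (int u + c))" for c
  proof (cases n)
    case (Suc m)
    have "(\<Sum>u<Suc m. f (int u + (c + 1))) = (\<Sum>u<m. f (int (Suc u) + c)) + f (c + int n)"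
      using Suc by (simp add: algebra_simps)
    also have "f (c + int n) = f (int 0 + c)" using assms[of c] by simp
    finally show ?thesis unfolding Suc by (subst (2) sum.lessThan_Suc_shift) (simp add: add.commute)
  qed simp
  show ?thesis
  proof (induction c rule: int_induct[where k = 0])
    case (step1 i) then show ?case using step by simp
  next
    case (step2 i) then show ?case using step[of "i - 1"] by simp
  qed simp
qed

section \<open>Half sums over residues, orthogonality of cosines, Gauss sums\<close>

definition hsum :: "nat \<Rightarrow> (nat \<Rightarrow> complex) \<Rightarrow> complex" where
  "hsum r f = f 0 / 2 + (\<Sum>d=1..r. f d)"

text \<open>The residues d and n - d contribute equally and 0 is its own negative, hence the weight
  1/2 at 0 in \<open>hsum\<close>.\<close>

lemma hsum_full:
  assumes "\<And>u. f (u + int (2 * r + 1)) = f u" "\<And>u. f (- u) = f u"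
  shows "hsum r (\<lambda>d. f (int d)) = (\<Sum>u<2 * r + 1. f (int u)) / 2"
proof -
  have "{..<2 * r + 1} = insert 0 ({1..r} \<union> {r + 1..2 * r})" by auto
  then have "(\<Sum>u<2 * r + 1. f (int u)) = f 0 + ((\<Sum>d=1..r. f (int d)) + (\<Sum>d=r + 1..2 * r. f (int d)))"
    by (simp add: sum.union_disjoint)
  also have "(\<Sum>d=r + 1..2 * r. f (int d)) = (\<Sum>d=1..r. f (int d))"
  proof (rule sum.reindex_bij_witness[of _ "\<lambda>d. 2 * r + 1 - d" "\<lambda>d. 2 * r + 1 - d"])
    fix d assume d: "d \<in> {r + 1..2 * r}"
    have "f (int (2 * r + 1 - d)) = f (- int d + int (2 * r + 1))" using d by (simp add: of_nat_diff)
    then show "f (int (2 * r + 1 - d)) = f (int d)" unfolding assms .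
  qed auto
  finally show ?thesis by (simp add: hsum_def)
qed

lemma hsum_cmult: "hsum r (\<lambda>d. c * f d) = c * hsum r f"
  by (simp add: hsum_def sum_distrib_left distrib_left)

lemma hsum_cong: "(\<And>d. d \<le> r \<Longrightarrow> f d = g d) \<Longrightarrow> hsum r f = hsum r g"
  by (simp add: hsum_def)

definition kern :: "nat \<Rightarrow> nat \<Rightarrow> nat \<Rightarrow> nat \<Rightarrow> real" where
  "kern n i b c = ck n (int i * int b * int c)"

lemma kern_sym: "kern n i b c = kern n i c b"
  by (simp add: kern_def algebra_simps)

lemma kern_0 [simp]: "kern n i 0 c = 1" "kern n i b 0 = 1"
  by (simp_all add: kern_def)

text \<open>A product of two cosines splits into the frequencies i (b + c) and i (b - c). In the
  range up to \<open>r\<close> the first vanishes modulo \<open>n\<close> only for b = c = 0 and the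
  second only for b = c.\<close>

lemma kern_orthogonal:
  assumes n: "n = 2 * r + 1" and i: "coprime i n" and bc: "b \<le> r" "c \<le> r"
  shows "hsum r (\<lambda>d. of_real (kern n i b d) * of_real (kern n i d c)) =
    (if b = c then (if b = 0 then of_nat n / 2 else of_nat n / 4) else 0)"
proof -
  have n0: "n > 0" using n by simp
  let ?f = "\<lambda>u. complex_of_real (ck n (int i * int b * u) * ck n (int i * u * int c))"
  have per: "?f (u + int (2 * r + 1)) = ?f u" for u
  proof -
    have "ck n (int i * int b * (u + int n)) = ck n (int i * int b * u)"
      "ck n (int i * (u + int n) * int c) = ck n (int i * u * int c)"
      by (rule ck_cong[OF n0]; simp add: cong_iff_dvd_diff algebra_simps)+
    then show ?thesis by (simp add: n)
  qed
  have ev: "?f (- u) = ?f u" for u by simp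
  have dv: "int n dvd int i * k \<longleftrightarrow> int n dvd k" for k
    using i by (simp add: coprime_dvd_mult_right_iff coprime_commute)
  have "hsum r (\<lambda>d. of_real (kern n i b d) * of_real (kern n i d c)) = hsum r (\<lambda>d. ?f (int d))"
    by (simp add: kern_def)
  also have "\<dots> = (\<Sum>u<n. ?f (int u)) / 2"
    using hsum_full[of ?f r, OF per ev] by (simp add: n)
  also have "(\<Sum>u<n. ?f (int u)) = (\<Sum>u<n. (complex_of_real (ck n (int u * (int i * (int b + int c))))
      + complex_of_real (ck n (int u * (int i * (int b - int c))))) / 2)"
    by (intro sum.cong HOL.refl) (simp add: ck_mult algebra_simps)
  also have "\<dots> = ((if int n dvd (int b + int c) then of_nat n else 0) +
      (if int n dvd (int b - int c) then of_nat n else 0)) / 2"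
    by (simp add: sum.distrib sum_ck[OF n0] dv flip: sum_divide_distrib)
  also have "int n dvd (int b + int c) \<longleftrightarrow> b = 0 \<and> c = 0"
    using bc n zdvd_imp_le[of "int n" "int b + int c"] by (auto intro: ccontr)
  also have "int n dvd (int b - int c) \<longleftrightarrow> b = c"
    using bc n dvd_imp_le_int[of "int b - int c" "int n"] by (cases "b = c") auto
  finally show ?thesis by (auto simp: field_simps)
qed

definition gauss :: "nat \<Rightarrow> int \<Rightarrow> complex" where
  "gauss n a = (\<Sum>u<n. zt n (a * int u * int u))"

text \<open>\<open>b\<close> is 1 / (4 a) modulo \<open>n\<close>, so shifting \<open>u\<close> by 2
  b v absorbs the linear term.\<close>

lemma gauss_complete_square:
  assumes n: "n > 0" and ab: "[4 * a * b = 1] (mod int n)"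
  shows "(\<Sum>u<n. zt n (a * int u * int u + int u * v)) = zt n (- b * v * v) * gauss n a"
proof -
  let ?f = "\<lambda>u. zt n (a * u * u)"
  have per: "?f (u + int n) = ?f u" for u
    by (rule zt_cong[OF n]) (simp add: cong_iff_dvd_diff algebra_simps)
  have "zt n (a * int u * int u + int u * v) = zt n (- b * v * v) * ?f (int u + 2 * b * v)" for u
  proof -
    have "int n dvd 4 * a * b - 1" using ab by (simp add: cong_iff_dvd_diff)
    then have "int n dvd (4 * a * b - 1) * (- int u * v - b * v * v)" by (rule dvd_mult2)
    moreover have "(a * int u * int u + int u * v) - (- b * v * v + a * (int u + 2 * b * v) * (int u + 2 * b * v))
      = (4 * a * b - 1) * (- int u * v - b * v * v)"
      by (simp add: algebra_simps)
    ultimately show ?thesis unfolding zt_add[symmetric]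
      by (intro zt_cong[OF n]) (simp add: cong_iff_dvd_diff)
  qed
  then have "(\<Sum>u<n. zt n (a * int u * int u + int u * v)) = zt n (- b * v * v) * (\<Sum>u<n. ?f (int u + 2 * b * v))"
    by (simp add: sum_distrib_left)
  also have "(\<Sum>u<n. ?f (int u + 2 * b * v)) = gauss n a"
    unfolding gauss_def by (rule sum_periodic_shift[of ?f, OF per])
  finally show ?thesis .
qed

text \<open>If it vanished, so would every sum with a linear term; but summing those over
  \<open>v\<close> leaves only u = 0 by orthogonality, with value \<open>n\<close>.\<close>

lemma gauss_nonzero:
  assumes n: "n > 0" and ab: "[4 * a * b = 1] (mod int n)"
  shows "gauss n a \<noteq> 0"
proof
  assume "gauss n a = 0"
  then have "(\<Sum>v<n. \<Sum>u<n. zt n (a * int u * int u + int u * int v)) = 0"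
    by (simp add: gauss_complete_square[OF assms])
  moreover have "(\<Sum>v<n. \<Sum>u<n. zt n (a * int u * int u + int u * int v)) =
      (\<Sum>u<n. zt n (a * int u * int u) * (\<Sum>v<n. zt n (int v * int u)))"
    by (subst sum.swap) (simp add: zt_add sum_distrib_left mult.commute)
  also have "\<dots> = (\<Sum>u<n. if u = 0 then of_nat n else 0)"
    by (intro sum.cong HOL.refl) (auto simp: sum_zt[OF n] dest: nat_dvd_not_less)
  also have "\<dots> = of_nat n" using n by simp
  finally show False using n \<open>(\<Sum>v<n. _ v) = 0\<close> by simp
qed

text \<open>Both cosines expand into four quadratic sums that differ only in the linear term.
  Completing the square gives the exponents -\<beta> (b + c)^2 and -\<beta> (b - c)^2, whose cross
  terms recombine to a cosine of frequency 2 \<beta>. Up to diagonal phases, a power of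
  \<open>T\<close> between two cosine matrices yields a Galois conjugate of the cosine
  matrix.\<close>

lemma kern_gauss:
  assumes n: "n = 2 * r + 1" and ab: "[4 * a * int \<beta> = 1] (mod int n)"
  shows "hsum r (\<lambda>d. of_real (kern n 1 b d) * zt n (a * int d * int d) * of_real (kern n 1 d c)) =
    gauss n a / 2 * zt n (- int \<beta> * (int b * int b + int c * int c)) * of_real (kern n (2 * \<beta>) b c)"
proof -
  have n0: "n > 0" using n by simp
  let ?f = "\<lambda>u. of_real (ck n (int b * u)) * zt n (a * u * u) * of_real (ck n (u * int c))"
  have per: "?f (u + int (2 * r + 1)) = ?f u" for u
  proof -
    have "ck n (int b * (u + int n)) = ck n (int b * u)" "ck n ((u + int n) * int c) = ck n (u * int c)"
      by (rule ck_cong[OF n0]; simp add: cong_iff_dvd_diff algebra_simps)+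
    moreover have "zt n (a * (u + int n) * (u + int n)) = zt n (a * u * u)"
      by (rule zt_cong[OF n0]) (simp add: cong_iff_dvd_diff algebra_simps)
    ultimately show ?thesis by (simp add: n)
  qed
  have ev: "?f (- u) = ?f u" for u by simp
  have "hsum r (\<lambda>d. of_real (kern n 1 b d) * zt n (a * int d * int d) * of_real (kern n 1 d c))
    = (\<Sum>u<n. ?f (int u)) / 2"
    using hsum_full[of ?f r, OF per ev] by (simp add: kern_def n)
  also have "(\<Sum>u<n. ?f (int u)) = (\<Sum>u<n. (
        zt n (a * int u * int u + int u * (int b + int c)) + zt n (a * int u * int u + int u * (int b - int c))
      + zt n (a * int u * int u + int u * (- int b + int c)) + zt n (a * int u * int u + int u * (- int b - int c))) / 4)"
  proof (rule sum.cong[OF HOL.refl])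
    fix u :: nat
    have e: "a * int u * int u + int u * (int b + int c) = int b * int u + a * int u * int u + int u * int c"
      "a * int u * int u + int u * (int b - int c) = int b * int u + a * int u * int u + - (int u * int c)"
      "a * int u * int u + int u * (- int b + int c) = - (int b * int u) + a * int u * int u + int u * int c"
      "a * int u * int u + int u * (- int b - int c) = - (int b * int u) + a * int u * int u + - (int u * int c)"
      by (simp_all add: algebra_simps)
    show "?f (int u) = (
        zt n (a * int u * int u + int u * (int b + int c)) + zt n (a * int u * int u + int u * (int b - int c))
      + zt n (a * int u * int u + int u * (- int b + int c)) + zt n (a * int u * int u + int u * (- int b - int c))) / 4"
      unfolding e zt_add ck_zt by (simp add: field_simps)
  qed
  also have "\<dots> = gauss n a * (zt n (- int \<beta> * (int b + int c) * (int b + int c))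
      + zt n (- int \<beta> * (int b - int c) * (int b - int c))) / 2"
  proof -
    have q: "- int \<beta> * (- int b + int c) * (- int b + int c) = - int \<beta> * (int b - int c) * (int b - int c)"
      "- int \<beta> * (- int b - int c) * (- int b - int c) = - int \<beta> * (int b + int c) * (int b + int c)"
      by (simp_all add: algebra_simps)
    show ?thesis
      unfolding sum_divide_distrib[symmetric] sum.distrib gauss_complete_square[OF n0 ab] q
      by (simp add: field_simps)
  qed
  also have "zt n (- int \<beta> * (int b + int c) * (int b + int c)) =
      zt n (- int \<beta> * (int b * int b + int c * int c)) * zt n (- (2 * int \<beta> * int b * int c))"
    unfolding zt_add[symmetric] by (simp add: algebra_simps)
  also have "zt n (- int \<beta> * (int b - int c) * (int b - int c)) =
      zt n (- int \<beta> * (int b * int b + int c * int c)) * zt n (2 * int \<beta> * int b * int c)"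
    unfolding zt_add[symmetric] by (simp add: algebra_simps)
  finally show ?thesis by (simp add: kern_def ck_zt field_simps)
qed

section \<open>The commutant of a tensor product\<close>

definition mprod :: "'i set \<Rightarrow> ('i \<Rightarrow> 'i \<Rightarrow> complex) \<Rightarrow> ('i \<Rightarrow> 'i \<Rightarrow> complex) \<Rightarrow> 'i \<Rightarrow> 'i \<Rightarrow> complex" where
  "mprod I A B = (\<lambda>x y. \<Sum>k\<in>I. A x k * B k y)"

definition commutes :: "'i set \<Rightarrow> ('i \<Rightarrow> 'i \<Rightarrow> complex) \<Rightarrow> ('i \<Rightarrow> 'i \<Rightarrow> complex) \<Rightarrow> bool" where
  "commutes I M A \<longleftrightarrow> (\<forall>x\<in>I. \<forall>y\<in>I. mprod I M A x y = mprod I A M x y)"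

lemma mprod_assoc: "mprod I (mprod I A B) C = mprod I A (mprod I B C)"
  unfolding mprod_def sum_distrib_left sum_distrib_right
  by (intro ext, subst sum.swap) (simp add: mult.assoc)

lemma mprod_cong:
  "(\<And>k. k \<in> I \<Longrightarrow> A x k = A' x k) \<Longrightarrow> (\<And>k. k \<in> I \<Longrightarrow> B k y = B' k y) \<Longrightarrow> mprod I A B x y = mprod I A' B' x y"
  by (simp add: mprod_def)

lemma commutes_mprod:
  assumes "commutes I M A" "commutes I M B"
  shows "commutes I M (mprod I A B)"
  unfolding commutes_def
proof (intro ballI)
  fix x y assume xy: "x \<in> I" "y \<in> I"
  have "mprod I M (mprod I A B) x y = mprod I (mprod I M A) B x y" by (simp add: mprod_assoc)
  also have "\<dots> = mprod I (mprod I A M) B x y"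
    using assms(1) xy by (rule_tac mprod_cong) (auto simp: commutes_def)
  also have "\<dots> = mprod I A (mprod I M B) x y" by (simp add: mprod_assoc)
  also have "\<dots> = mprod I A (mprod I B M) x y"
    using assms(2) xy by (rule_tac mprod_cong) (auto simp: commutes_def)
  finally show "mprod I M (mprod I A B) x y = mprod I (mprod I A B) M x y" by (simp add: mprod_assoc)
qed

text \<open>A diagonal that is constant along the support of \<open>M\<close> commutes with
  \<open>M\<close>; powers of \<open>T\<close> enter the words in this form.\<close>

lemma commutes_diag_left:
  assumes "commutes I M A" "\<And>x y. x \<in> I \<Longrightarrow> y \<in> I \<Longrightarrow> M x y \<noteq> 0 \<Longrightarrow> d x = d y"
  shows "commutes I M (\<lambda>x y. d x * A x y)"
  unfolding commutes_def
proof (intro ballI)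
  fix x y assume xy: "x \<in> I" "y \<in> I"
  have "M x k * (d k * A k y) = d x * (M x k * A k y)" if "k \<in> I" for k
    using assms(2)[OF xy(1) that] by (cases "M x k = 0") auto
  then have "mprod I M (\<lambda>x y. d x * A x y) x y = d x * mprod I M A x y"
    unfolding mprod_def sum_distrib_left by (rule sum.cong[OF HOL.refl])
  also have "\<dots> = d x * mprod I A M x y" using assms(1) xy by (simp add: commutes_def)
  finally show "mprod I M (\<lambda>x y. d x * A x y) x y = mprod I (\<lambda>x y. d x * A x y) M x y"
    by (simp add: mprod_def sum_distrib_left mult.assoc)
qed

definition tens :: "('a \<Rightarrow> 'a \<Rightarrow> complex) \<Rightarrow> ('b \<Rightarrow> 'b \<Rightarrow> complex) \<Rightarrow> 'a \<times> 'b \<Rightarrow> 'a \<times> 'b \<Rightarrow> complex" where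
  "tens A B x y = A (fst x) (fst y) * B (snd x) (snd y)"

lemma tens_Pair [simp]: "tens A B (x, g) (y, h) = A x y * B g h"
  by (simp add: tens_def)

lemma mprod_tens: "mprod (I \<times> J) (tens A B) (tens A' B') = tens (mprod I A A') (mprod J B B')"
  unfolding mprod_def tens_def
  by (intro ext) (simp add: sum_product sum.cartesian_product' mult_ac)

section \<open>The two tensor factors of S and T\<close>

type_synonym cell = "nat \<times> bool \<times> bool"

text \<open>The index \<open>j\<close> stands for the residue \<open>r - j\<close> modulo \<open>n\<close>; the indices \<open>r\<close> and \<open>r + 1\<close>
  both stand for 0, with half the weight each.\<close>

definition dhalf :: "nat \<Rightarrow> nat \<Rightarrow> real" where
  "dhalf r j = (if j < r then 1 else 1/2)"

text \<open>The antisymmetric vector on the two indices of residue 0. Cosines cannot tell these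
  indices apart; the sine determinants live on this vector alone.\<close>

definition xsg :: "nat \<Rightarrow> nat \<Rightarrow> real" where
  "xsg r j = (if j = r then 1 else if j = r + 1 then -1 else 0)"

definition xsign :: "nat \<Rightarrow> nat \<Rightarrow> real" where
  "xsign r j = dhalf r j * (-1) ^ (r - j)"

definition xform :: "nat \<Rightarrow> (nat \<Rightarrow> nat \<Rightarrow> complex) \<Rightarrow> complex \<Rightarrow> nat \<Rightarrow> nat \<Rightarrow> complex" where
  "xform r f e j k = of_real (xsign r j * xsign r k) * f (r - j) (r - k) + e * of_real (xsg r j * xsg r k)"

lemma xform_cong:
  "(\<And>b c. b \<le> r \<Longrightarrow> c \<le> r \<Longrightarrow> f b c = g b c) \<Longrightarrow> xform r f e = xform r g e"
  by (intro ext) (simp add: xform_def)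

lemma sum_fold:
  fixes r :: nat
  shows "(\<Sum>l<r + 2. h l) = (\<Sum>d=1..r. h (r - d)) + h r + (h (r + 1) :: complex)"
proof -
  have "(\<Sum>l<r. h l) = (\<Sum>d=1..r. h (r - d))"
    by (rule sum.reindex_bij_witness[of _ "\<lambda>d. r - d" "\<lambda>d. r - d"]) auto
  then show ?thesis by (simp add: numeral_2_eq_2)
qed

text \<open>The first summand takes equal values at \<open>r\<close> and \<open>r + 1\<close>, so it
  is orthogonal to \<open>xsg\<close>, whose squared length is 2; hence the factor in 2 e e'. The
  two weights 1/2 at these indices have squares adding up to 1/2, the weight of 0 in
  \<open>hsum\<close>.\<close>

lemma xform_mult:
  "mprod {..<r + 2} (xform r f e) (xform r g e') =
   xform r (\<lambda>b c. hsum r (\<lambda>d. f b d * g d c)) (2 * e * e')"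
proof (intro ext)
  fix j k
  have "mprod {..<r + 2} (xform r f e) (xform r g e') j k =
    (\<Sum>d=1..r. of_real (xsign r j * xsign r k) * (f (r - j) d * g d (r - k)))
     + of_real (xsign r j * xsign r k) * (f (r - j) 0 * g 0 (r - k)) / 2
     + 2 * e * e' * of_real (xsg r j * xsg r k)"
    unfolding mprod_def sum_fold
    by (simp add: xform_def xsg_def[of r r] xsg_def[of r "Suc r"] xsign_def[of r r] xsign_def[of r "Suc r"]
        dhalf_def[of r r] dhalf_def[of r "Suc r"])
      (auto simp: algebra_simps xsg_def[of r "r - _"] xsign_def[of r "r - _"] dhalf_def[of r "r - _"]
        simp flip: power_add mult_2 intro!: sum.cong)
  then show "mprod {..<r + 2} (xform r f e) (xform r g e') j k =
      xform r (\<lambda>b c. hsum r (\<lambda>d. f b d * g d c)) (2 * e * e') j k"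
    by (simp add: xform_def hsum_def sum_distrib_left[symmetric] algebra_simps)
qed

definition Xmat :: "nat \<Rightarrow> complex \<Rightarrow> nat \<Rightarrow> nat \<Rightarrow> complex" where
  "Xmat r \<kappa> = xform r (\<lambda>b c. of_real (kern (2 * r + 1) 1 b c)) \<kappa>"

text \<open>The flags (p, q) stand for p times \<open>J_s\<close> and q times \<open>J_v\<close>, up
  to the parity shift built into \<open>Wt\<close>. The entries are monodromies between simple
  currents, i^r being that of each spinor current with itself.\<close>

definition Gmat :: "nat \<Rightarrow> bool \<times> bool \<Rightarrow> bool \<times> bool \<Rightarrow> complex" where
  "Gmat r g h = (if fst g \<and> snd h then -1 else 1) * (if snd g \<and> fst h then -1 else 1) *
     (if fst g \<and> fst h then \<i> ^ r else 1)"

text \<open>Since 2 r = n - 1, \<open>r\<close> is -1/2 modulo \<open>n\<close>: this is the n-th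
  root of unity of exponent -b^2 / 2, where b = r - j.\<close>

definition Xphase :: "nat \<Rightarrow> nat \<Rightarrow> complex" where
  "Xphase r j = zt (2 * r + 1) (int (r * (r - j) * (r - j)))"

text \<open>Twists exp (2 pi i h) of the simple currents, whose conformal weights h at level 3 are
  0, 3/2 and, for both spinor currents, 3 r / 8.\<close>

definition Gphase :: "nat \<Rightarrow> bool \<times> bool \<Rightarrow> complex" where
  "Gphase r g = (if fst g then cis (3 * pi * real r / 4) else if snd g then -1 else 1)"

definition Cells :: "nat \<Rightarrow> cell set" where
  "Cells r = {..<r + 2} \<times> UNIV"

lemma sum_UNIV_bool2:
  fixes f :: "bool \<times> bool \<Rightarrow> 'a :: comm_monoid_add"
  shows "(\<Sum>g\<in>UNIV. f g) = f (False, False) + f (False, True) + f (True, False) + f (True, True)"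
proof -
  have "(UNIV :: (bool \<times> bool) set) = {(False, False), (False, True), (True, False), (True, True)}"
    by (auto simp: UNIV_bool)
  then have "(\<Sum>g\<in>UNIV. f g) = (\<Sum>g\<in>{(False, False), (False, True), (True, False), (True, True)}. f g)"
    by (rule arg_cong)
  then show ?thesis by (simp add: add.assoc)
qed

lemma i_power_cases: "\<i> ^ r = 1 \<or> \<i> ^ r = -1 \<or> \<i> ^ r = \<i> \<or> \<i> ^ r = -\<i>"
  by (induction r) auto

text \<open>G^2 is 4 times charge conjugation, which exchanges the spinor currents exactly when
  \<open>r\<close> is odd; so four factors of \<open>S\<close> act as a scalar on the
  currents.\<close>

lemma Gmat_4: "mprod UNIV (mprod UNIV (Gmat r) (Gmat r)) (mprod UNIV (Gmat r) (Gmat r)) g h = (if g = h then 16 else 0)"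
  using i_power_cases[of r]
  by (cases g; cases h) (auto simp: mprod_def sum_UNIV_bool2 Gmat_def algebra_simps)

lemma Gphase_8: "Gphase r g ^ 8 = 1"
  using cis_multiple_2pi[of "3 * real r"] by (auto simp: Gphase_def DeMoivre algebra_simps)

lemma coprime_self_double_plus_1: "coprime r (2 * r + 1 :: nat)"
  by (rule coprimeI) (metis dvd_add_right_iff dvd_mult)

section \<open>Galois conjugates of X from words in S and T\<close>

locale S_T_commutant =
  fixes r n :: nat and \<kappa> :: complex and M :: "cell \<Rightarrow> cell \<Rightarrow> nat"
  assumes r_pos: "r > 0" and n_def: "n = 2 * r + 1"
    and comm_S: "commutes (Cells r) (\<lambda>x y. of_nat (M x y)) (tens (Xmat r \<kappa>) (Gmat r))"
    and comm_T: "\<And>j g k h. j < r + 2 \<Longrightarrow> k < r + 2 \<Longrightarrow> M (j, g) (k, h) \<noteq> 0 \<Longrightarrow>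
      Xphase r j * Gphase r g = Xphase r k * Gphase r h"
begin

lemma n_pos: "n > 0" by (simp add: n_def)

text \<open>Eighth powers remove \<open>Gphase\<close>, and the factor 8 r left in the exponent is a
  unit modulo the odd \<open>n\<close>.\<close>

lemma Xphase_eq:
  assumes "j < r + 2" "k < r + 2" "M (j, g) (k, h) \<noteq> 0"
  shows "[(r - j) * (r - j) = (r - k) * (r - k)] (mod n)"
proof -
  have "Xphase r j ^ 8 = Xphase r k ^ 8"
    using arg_cong[OF comm_T[OF assms], of "\<lambda>z. z ^ 8"] by (simp add: power_mult_distrib Gphase_8)
  then have "[int 8 * int (r * (r - j) * (r - j)) = int 8 * int (r * (r - k) * (r - k))] (mod int n)"
    unfolding Xphase_def n_def[symmetric] zt_power zt_eq_iff[OF n_pos] .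
  then have "[(8 * r) * ((r - j) * (r - j)) = (8 * r) * ((r - k) * (r - k))] (mod n)"
    unfolding of_nat_mult[symmetric] cong_int_iff by (simp only: mult.assoc)
  moreover have "coprime (8 * r) n"
  proof -
    have "coprime r (2 * r + 1)" by (rule coprime_self_double_plus_1)
    moreover have "coprime (2 ^ 3) (2 * r + 1)" by (simp del: power_numeral)
    ultimately show ?thesis by (simp add: n_def)
  qed
  ultimately show ?thesis by (simp add: cong_mult_lcancel_nat)
qed

lemma Gphase_eq:
  assumes "j < r + 2" "M (j, g) (j, h) \<noteq> 0"
  shows "Gphase r g = Gphase r h"
  using comm_T[OF assms(1,1,2)] by (simp add: Xphase_def)

text \<open>The word \<open>S T\<^sup>8\<^sup>t S\<^sup>3\<close> acts as a scalar on the second tensor factor; completing the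
  square turns its first factor into a Galois conjugate of \<open>S\<close>.\<close>

lemma block_commutes:
  assumes i: "coprime i n"
  obtains \<gamma> \<delta> where "\<gamma> \<noteq> 0"
    "\<And>g h. commutes {..<r + 2} (\<lambda>j k. of_nat (M (j, g) (k, h)))
        (xform r (\<lambda>b c. \<gamma> * of_real (kern n i b c)) \<delta>)"
proof -
  let ?M = "\<lambda>x y. complex_of_nat (M x y)"
  let ?X = "{..<r + 2}"
  \<comment> \<open>\<open>r + 1\<close> is 1/2 modulo \<open>n\<close>, so 2 \<beta> is congruent
    to \<open>i\<close>; it becomes the frequency in \<open>kern_gauss\<close>.\<close>
  define \<beta> where "\<beta> = i * (r + 1)"
  have cop: "coprime (16 * r * i) n"
  proof -
    have "coprime r (2 * r + 1)" by (rule coprime_self_double_plus_1)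
    moreover have "coprime (2 ^ 4) (2 * r + 1)" by (simp del: power_numeral)
    ultimately show ?thesis using i by (simp add: n_def)
  qed
  obtain t where t: "[16 * r * i * t = 1] (mod n)"
    using cong_solve_coprime_nat[OF cop] by auto
  \<comment> \<open>The exponent of T^(8 t) on the first factor; \<open>t\<close> was chosen to make
    it the inverse of 4 \<beta>.\<close>
  define a where "a = int (8 * r * t)"
  have "[2 * (r + 1) * (16 * r * i * t) = 1 * 1] (mod n)"
  proof (intro cong_mult t)
    have "2 * (r + 1) = n + 1" by (simp add: n_def)
    then show "[2 * (r + 1) = 1] (mod n)" unfolding cong_def by (metis mod_add_self1)
  qed
  then have "[int (2 * (r + 1) * (16 * r * i * t)) = int 1] (mod int n)"
    unfolding cong_int_iff by simp
  moreover have "int (2 * (r + 1) * (16 * r * i * t)) = 4 * a * int \<beta>"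
    by (simp add: a_def \<beta>_def algebra_simps)
  ultimately have ab: "[4 * a * int \<beta> = 1] (mod int n)" by simp
  let ?f = "\<lambda>b c. complex_of_real (kern n 1 b c)"
  let ?d = "\<lambda>x :: cell. zt n (a * int (r - fst x) * int (r - fst x))"
  have d: "?d x = ?d y" if "x \<in> Cells r" "y \<in> Cells r" "?M x y \<noteq> 0" for x y
  proof -
    have "[(r - fst x) * (r - fst x) = (r - fst y) * (r - fst y)] (mod n)"
      using that Xphase_eq[of "fst x" "fst y" "snd x" "snd y"] by (auto simp: Cells_def)
    then have "[a * int ((r - fst x) * (r - fst x)) = a * int ((r - fst y) * (r - fst y))] (mod int n)"
      by (intro cong_scalar_left) (simp only: cong_int_iff)
    then show ?thesis by (intro zt_cong[OF n_pos]) (simp add: mult.assoc)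
  qed
  have X: "Xmat r \<kappa> = xform r ?f \<kappa>" by (simp add: Xmat_def n_def)
  let ?f' = "\<lambda>b c. zt n (a * int b * int b) * ?f b c"
  have TS: "(\<lambda>x y. ?d x * tens (Xmat r \<kappa>) (Gmat r) x y) = tens (xform r ?f' \<kappa>) (Gmat r)"
    by (intro ext) (auto simp: tens_def X xform_def xsg_def algebra_simps)
  have "commutes (Cells r) ?M (mprod (Cells r)
      (mprod (Cells r) (tens (Xmat r \<kappa>) (Gmat r)) (tens (xform r ?f' \<kappa>) (Gmat r)))
      (mprod (Cells r) (tens (Xmat r \<kappa>) (Gmat r)) (tens (Xmat r \<kappa>) (Gmat r))))"
    unfolding TS[symmetric] by (intro commutes_mprod commutes_diag_left comm_S d) auto
  then have c1: "commutes (Cells r) ?M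
      (tens (mprod ?X (mprod ?X (xform r ?f \<kappa>) (xform r ?f' \<kappa>)) (mprod ?X (xform r ?f \<kappa>) (xform r ?f \<kappa>)))
        (mprod UNIV (mprod UNIV (Gmat r) (Gmat r)) (mprod UNIV (Gmat r) (Gmat r))))"
    by (simp add: Cells_def mprod_tens X)
  define c where "c = gauss n a * of_nat n / 8"
  let ?h = "\<lambda>b c'. zt n (- int \<beta> * (int b * int b + int c' * int c')) * of_real (kern n i b c')"
  have ki: "kern n (2 * \<beta>) b c' = kern n i b c'" for b c'
  proof -
    have "int (2 * \<beta>) * int b * int c' - int i * int b * int c' = int n * (int i * int b * int c')"
      by (simp add: \<beta>_def n_def algebra_simps)
    then show ?thesis unfolding kern_def
      by (intro ck_cong[OF n_pos]) (simp add: cong_iff_dvd_diff)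
  qed
  have hs: "hsum r (\<lambda>d. hsum r (\<lambda>d'. ?f b d' * ?f' d' d) * hsum r (\<lambda>d'. ?f d d' * ?f d' c')) = c * ?h b c'"
    if bc: "b \<le> r" "c' \<le> r" for b c'
  proof -
    have "hsum r (\<lambda>d. hsum r (\<lambda>d'. ?f b d' * ?f' d' d) * hsum r (\<lambda>d'. ?f d d' * ?f d' c'))
      = hsum r (\<lambda>d. gauss n a / 2 * ?h b d * (if d = c' then (if d = 0 then of_nat n / 2 else of_nat n / 4) else 0))"
    proof (rule hsum_cong)
      fix d assume "d \<le> r"
      have "hsum r (\<lambda>d'. ?f b d' * ?f' d' d) = gauss n a / 2 * ?h b d"
        using kern_gauss[OF n_def ab, of b d] by (simp add: ki mult.assoc)
      then show "hsum r (\<lambda>d'. ?f b d' * ?f' d' d) * hsum r (\<lambda>d'. ?f d d' * ?f d' c') =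
          gauss n a / 2 * ?h b d * (if d = c' then (if d = 0 then of_nat n / 2 else of_nat n / 4) else 0)"
        using kern_orthogonal[OF n_def _ \<open>d \<le> r\<close> bc(2), of 1] by simp
    qed
    also have "\<dots> = c * ?h b c'"
    proof (cases "c' = 0")
      case False
      then have "(\<Sum>d = 1..r. gauss n a / 2 * ?h b d * (if d = c' then (if d = 0 then of_nat n / 2 else of_nat n / 4) else 0))
        = (\<Sum>d = 1..r. if d = c' then c * ?h b c' else 0)"
        by (intro sum.cong) (auto simp: c_def)
      then show ?thesis using False bc by (simp add: hsum_def)
    qed (simp add: hsum_def c_def)
    finally show ?thesis .
  qed
  define e where "e = 2 * (2 * \<kappa> * \<kappa>) * (2 * \<kappa> * \<kappa>)"
  have c2: "commutes (Cells r) ?M (tens (xform r (\<lambda>b c'. c * ?h b c') e) (\<lambda>g h. if g = h then 16 else 0))"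
  proof -
    have *: "xform r (\<lambda>b c'. hsum r (\<lambda>d. hsum r (\<lambda>d'. ?f b d' * ?f' d' d) * hsum r (\<lambda>d'. ?f d d' * ?f d' c'))) e
      = xform r (\<lambda>b c'. c * ?h b c') e"
      by (rule xform_cong) (rule hs)
    have **: "mprod UNIV (mprod UNIV (Gmat r) (Gmat r)) (mprod UNIV (Gmat r) (Gmat r)) = (\<lambda>g h. if g = h then 16 else 0)"
      by (intro ext) (rule Gmat_4)
    show ?thesis using c1 unfolding xform_mult ** e_def[symmetric] * .
  qed
  have c_nz: "c \<noteq> 0" using gauss_nonzero[OF n_pos ab] n_pos by (simp add: c_def)
  \<comment> \<open>The second factor is now 16 times the identity, so the relation holds block by
    block. The diagonal phases left by \<open>kern_gauss\<close> are constant along the support of a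
    block and cancel.\<close>
  have blk: "commutes ?X (\<lambda>j k. of_nat (M (j, g) (k, h))) (xform r (\<lambda>b c'. c * of_real (kern n i b c')) e)" for g h
    unfolding commutes_def
  proof (intro ballI)
    fix j k assume jk: "j \<in> ?X" "k \<in> ?X"
    let ?A = "\<lambda>j k. ?M (j, g) (k, h)"
    let ?z = "\<lambda>j. zt n (- int \<beta> * (int (r - j) * int (r - j)))"
    let ?U = "xform r (\<lambda>b c'. c * of_real (kern n i b c')) e"
    have z: "?z j' = ?z k'" if "j' \<in> ?X" "k' \<in> ?X" "?A j' k' \<noteq> 0" for j' k'
    proof -
      have "[- int \<beta> * int ((r - j') * (r - j')) = - int \<beta> * int ((r - k') * (r - k'))] (mod int n)"
        using that Xphase_eq[of j' k' g h] by (intro cong_scalar_left) (simp only: cong_int_iff lessThan_iff of_nat_eq_0_iff, simp)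
      then show ?thesis by (intro zt_cong[OF n_pos]) (simp add: mult.assoc)
    qed
    have xf: "xform r (\<lambda>b c'. c * ?h b c') e j' k' = ?z j' * ?z k' * ?U j' k'" for j' k'
    proof -
      have "zt n (- int \<beta> * (int (r - j') * int (r - j') + int (r - k') * int (r - k'))) = ?z j' * ?z k'"
        by (simp add: algebra_simps flip: zt_add)
      then show ?thesis by (auto simp: xform_def xsg_def algebra_simps)
    qed
    have "mprod (Cells r) ?M (tens (xform r (\<lambda>b c'. c * ?h b c') e) (\<lambda>g h. if g = h then 16 else 0)) (j, g) (k, h)
      = (\<Sum>l<r + 2. 16 * (?A j l * xform r (\<lambda>b c'. c * ?h b c') e l k))"
      unfolding mprod_def Cells_def sum.cartesian_product'
      by (intro sum.cong HOL.refl) (cases h, auto simp: sum_UNIV_bool2)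
    also have "\<dots> = (\<Sum>l<r + 2. 16 * ?z j * ?z k * (?A j l * ?U l k))"
    proof (intro sum.cong HOL.refl)
      fix l assume "l \<in> {..<r + 2}"
      then show "16 * (?A j l * xform r (\<lambda>b c'. c * ?h b c') e l k) = 16 * ?z j * ?z k * (?A j l * ?U l k)"
        using z[OF jk(1), of l] unfolding xf by (cases "?A j l = 0") auto
    qed
    also have "\<dots> = 16 * ?z j * ?z k * mprod ?X ?A ?U j k" unfolding mprod_def sum_distrib_left ..
    finally have L: "mprod (Cells r) ?M (tens (xform r (\<lambda>b c'. c * ?h b c') e) (\<lambda>g h. if g = h then 16 else 0)) (j, g) (k, h)
       = 16 * ?z j * ?z k * mprod ?X ?A ?U j k" .
    have "mprod (Cells r) (tens (xform r (\<lambda>b c'. c * ?h b c') e) (\<lambda>g h. if g = h then 16 else 0)) ?M (j, g) (k, h)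
      = (\<Sum>l<r + 2. 16 * (xform r (\<lambda>b c'. c * ?h b c') e j l * ?A l k))"
      unfolding mprod_def Cells_def sum.cartesian_product'
      by (intro sum.cong HOL.refl) (cases g, auto simp: sum_UNIV_bool2)
    also have "\<dots> = (\<Sum>l<r + 2. 16 * ?z j * ?z k * (?U j l * ?A l k))"
    proof (intro sum.cong HOL.refl)
      fix l assume "l \<in> {..<r + 2}"
      then show "16 * (xform r (\<lambda>b c'. c * ?h b c') e j l * ?A l k) = 16 * ?z j * ?z k * (?U j l * ?A l k)"
        using z[OF _ jk(2), of l] unfolding xf by (cases "?A l k = 0") auto
    qed
    also have "\<dots> = 16 * ?z j * ?z k * mprod ?X ?U ?A j k" unfolding mprod_def sum_distrib_left ..
    finally have R: "mprod (Cells r) (tens (xform r (\<lambda>b c'. c * ?h b c') e) (\<lambda>g h. if g = h then 16 else 0)) ?M (j, g) (k, h)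
       = 16 * ?z j * ?z k * mprod ?X ?U ?A j k" .
    have "16 * ?z j * ?z k * mprod ?X ?A ?U j k = 16 * ?z j * ?z k * mprod ?X ?U ?A j k"
    proof -
      have "(j, g) \<in> Cells r" "(k, h) \<in> Cells r" using jk by (auto simp: Cells_def)
      then show ?thesis using c2 unfolding commutes_def L[symmetric] R[symmetric] by blast
    qed
    then show "mprod ?X ?A ?U j k = mprod ?X ?U ?A j k" by simp
  qed
  show ?thesis by (rule that[OF c_nz blk])
qed

end

section \<open>The Weyl group of type D\<close>

definition spm :: "nat \<Rightarrow> (nat \<Rightarrow> nat) \<Rightarrow> (nat \<Rightarrow> real) \<Rightarrow> real mat" where
  "spm r \<sigma> \<epsilon> = mat r r (\<lambda>(i, j). if j = \<sigma> i then \<epsilon> i else 0)"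

lemma spm_carrier [simp]: "spm r \<sigma> \<epsilon> \<in> carrier_mat r r" "dim_row (spm r \<sigma> \<epsilon>) = r" "dim_col (spm r \<sigma> \<epsilon>) = r"
  by (simp_all add: spm_def)

lemma spm_cong: "(\<And>i. i < r \<Longrightarrow> \<sigma> i = \<sigma>' i) \<Longrightarrow> (\<And>i. i < r \<Longrightarrow> \<epsilon> i = \<epsilon>' i) \<Longrightarrow> spm r \<sigma> \<epsilon> = spm r \<sigma>' \<epsilon>'"
  by (intro eq_matI) (auto simp: spm_def)

lemma spm_one: "1\<^sub>m r = spm r id (\<lambda>_. 1)"
  by (intro eq_matI) (auto simp: spm_def)

lemma spm_mult:
  assumes "\<sigma> permutes {0..<r}"
  shows "spm r \<sigma> \<epsilon> * spm r \<tau> \<eta> = spm r (\<tau> \<circ> \<sigma>) (\<lambda>i. \<epsilon> i * \<eta> (\<sigma> i))"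
proof (intro eq_matI)
  fix i j assume "i < dim_row (spm r (\<tau> \<circ> \<sigma>) (\<lambda>i. \<epsilon> i * \<eta> (\<sigma> i)))" "j < dim_col (spm r (\<tau> \<circ> \<sigma>) (\<lambda>i. \<epsilon> i * \<eta> (\<sigma> i)))"
  then have ij: "i < r" "j < r" by simp_all
  have \<sigma>i: "\<sigma> i < r" using permutes_in_image[OF assms, of i] ij by simp
  have "(spm r \<sigma> \<epsilon> * spm r \<tau> \<eta>) $$ (i, j) = (\<Sum>k = 0..<r. spm r \<sigma> \<epsilon> $$ (i, k) * spm r \<tau> \<eta> $$ (k, j))"
    using ij by (simp add: scalar_prod_def)
  also have "\<dots> = (\<Sum>k = 0..<r. if k = \<sigma> i then \<epsilon> i * (if j = \<tau> (\<sigma> i) then \<eta> (\<sigma> i) else 0) else 0)"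
    using ij by (intro sum.cong) (auto simp: spm_def)
  also have "\<dots> = spm r (\<tau> \<circ> \<sigma>) (\<lambda>i. \<epsilon> i * \<eta> (\<sigma> i)) $$ (i, j)"
    using ij \<sigma>i by (simp add: spm_def)
  finally show "(spm r \<sigma> \<epsilon> * spm r \<tau> \<eta>) $$ (i, j) = spm r (\<tau> \<circ> \<sigma>) (\<lambda>i. \<epsilon> i * \<eta> (\<sigma> i)) $$ (i, j)" .
qed simp_all

lemma spm_mult_vec:
  assumes "\<sigma> permutes {0..<r}" "i < r" "v \<in> carrier_vec r"
  shows "(spm r \<sigma> \<epsilon> *\<^sub>v v) $ i = \<epsilon> i * v $ (\<sigma> i)"
proof -
  have \<sigma>i: "\<sigma> i < r" using permutes_in_image[OF assms(1), of i] assms by simp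
  have "(spm r \<sigma> \<epsilon> *\<^sub>v v) $ i = (\<Sum>k = 0..<r. spm r \<sigma> \<epsilon> $$ (i, k) * v $ k)"
    using assms by (simp add: scalar_prod_def)
  also have "\<dots> = (\<Sum>k = 0..<r. if k = \<sigma> i then \<epsilon> i * v $ (\<sigma> i) else 0)"
    using assms by (intro sum.cong) (auto simp: spm_def)
  finally show ?thesis using \<sigma>i by simp
qed

lemma det_spm:
  assumes "\<sigma> permutes {0..<r}"
  shows "det (spm r \<sigma> \<epsilon>) = signof \<sigma> * (\<Prod>i=0..<r. \<epsilon> i)"
proof -
  have "det (spm r \<sigma> \<epsilon>) = (\<Sum>p\<in>{p. p permutes {0..<r}}. signof p * (\<Prod>i = 0..<r. spm r \<sigma> \<epsilon> $$ (i, p i)))"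
    by (rule det_def') simp
  also have "\<dots> = (\<Sum>p\<in>{p. p permutes {0..<r}}. if p = \<sigma> then signof \<sigma> * (\<Prod>i=0..<r. \<epsilon> i) else 0)"
  proof (rule sum.cong[OF HOL.refl])
    fix p assume p: "p \<in> {p. p permutes {0..<r}}"
    show "signof p * (\<Prod>i = 0..<r. spm r \<sigma> \<epsilon> $$ (i, p i)) = (if p = \<sigma> then signof \<sigma> * (\<Prod>i=0..<r. \<epsilon> i) else 0)"
    proof (cases "p = \<sigma>")
      case True
      have "spm r \<sigma> \<epsilon> $$ (i, \<sigma> i) = \<epsilon> i" if "i < r" for i
        using that permutes_in_image[OF assms, of i] by (simp add: spm_def)
      then show ?thesis using True by simp
    next
      case False
      then obtain i where i: "p i \<noteq> \<sigma> i" by blast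
      then have "i < r" using p assms by (cases "i < r") (auto simp: permutes_def)
      then have "spm r \<sigma> \<epsilon> $$ (i, p i) = 0" using i p permutes_in_image[of p "{0..<r}" i] by (simp add: spm_def)
      then have "(\<Prod>i = 0..<r. spm r \<sigma> \<epsilon> $$ (i, p i)) = 0" using \<open>i < r\<close> by (intro prod_zero) auto
      then show ?thesis using False by simp
    qed
  qed
  also have "\<dots> = signof \<sigma> * (\<Prod>i=0..<r. \<epsilon> i)"
    using assms by (simp add: finite_permutations)
  finally show ?thesis .
qed

definition even_signs :: "nat \<Rightarrow> (nat \<Rightarrow> real) set" where
  "even_signs r = {\<epsilon> \<in> {0..<r} \<rightarrow>\<^sub>E {1, -1}. (\<Prod>i=0..<r. \<epsilon> i) = 1}"

lemma finite_even_signs [simp]: "finite (even_signs r)"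
  unfolding even_signs_def by (rule finite_subset[of _ "{0..<r} \<rightarrow>\<^sub>E {1, -1}"]) (auto intro: finite_PiE)

lemma reflection_minus:
  assumes "i < j" "j < r"
  shows "reflection_mat r (unit_vec r i - unit_vec r j) = spm r (Transposition.transpose i j) (\<lambda>_. 1)"
proof -
  have "(unit_vec r i - unit_vec r j) \<bullet> (unit_vec r i - unit_vec r j) = (2 :: real)"
    using assms by (simp add: scalar_prod_minus_distrib minus_scalar_prod_distrib[of _ r])
  then show ?thesis
    using assms by (intro eq_matI) (auto simp: reflection_mat_def spm_def unit_vec_def Transposition.transpose_def)
qed

lemma reflection_plus:
  assumes "i < j" "j < r"
  shows "reflection_mat r (unit_vec r i + unit_vec r j) =
    spm r (Transposition.transpose i j) (\<lambda>k. if k = i \<or> k = j then -1 else 1)"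
proof -
  have "(unit_vec r i + unit_vec r j) \<bullet> (unit_vec r i + unit_vec r j) = (2 :: real)"
    using assms by (simp add: scalar_prod_add_distrib[of _ r] add_scalar_prod_distrib[of _ r])
  then show ?thesis
    using assms by (intro eq_matI) (auto simp: reflection_mat_def spm_def unit_vec_def Transposition.transpose_def)
qed

lemma reflection_uminus:
  assumes "dim_vec \<alpha> = r"
  shows "reflection_mat r (- \<alpha>) = reflection_mat r \<alpha>"
  using assms by (intro eq_matI) (auto simp: reflection_mat_def)

lemma reflection_roots:
  assumes "\<alpha> \<in> roots r"
  obtains i j \<epsilon> where "i < j" "j < r" "\<And>k. \<epsilon> k = 1 \<or> \<epsilon> k = -1" "(\<Prod>k=0..<r. \<epsilon> k) = 1"
    "reflection_mat r \<alpha> = spm r (Transposition.transpose i j) \<epsilon>"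
proof -
  have pr: "(\<Prod>k=0..<r. if k = i \<or> k = j then -1 else 1) = (1 :: real)" if "i < j" "j < r" for i j
  proof -
    have "(\<Prod>k=0..<r. if k = i \<or> k = j then -1 else 1) = (\<Prod>k\<in>{i, j}. (-1 :: real))"
      using that by (intro prod.mono_neutral_cong_right) auto
    then show ?thesis using that by simp
  qed
  have "\<exists>i j. i < j \<and> j < r \<and> (reflection_mat r \<alpha> = reflection_mat r (unit_vec r i - unit_vec r j) \<or>
     reflection_mat r \<alpha> = reflection_mat r (unit_vec r i + unit_vec r j))"
    using assms unfolding roots_def pos_roots_def by (auto simp: reflection_uminus; blast)
  then obtain i j where ij: "i < j" "j < r" and c: "reflection_mat r \<alpha> = reflection_mat r (unit_vec r i - unit_vec r j) \<or>
     reflection_mat r \<alpha> = reflection_mat r (unit_vec r i + unit_vec r j)" by blast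
  from c show ?thesis
  proof
    assume "reflection_mat r \<alpha> = reflection_mat r (unit_vec r i - unit_vec r j)"
    then show ?thesis using ij by (intro that[of i j "\<lambda>_. 1"]) (auto simp: reflection_minus)
  next
    assume "reflection_mat r \<alpha> = reflection_mat r (unit_vec r i + unit_vec r j)"
    then show ?thesis using ij pr[OF ij]
      by (intro that[of i j "\<lambda>k. if k = i \<or> k = j then -1 else 1"]) (auto simp: reflection_plus)
  qed
qed

lemma weyl_group_subset: "w \<in> weyl_group r \<Longrightarrow> \<exists>\<sigma> \<epsilon>. \<sigma> permutes {0..<r} \<and> \<epsilon> \<in> even_signs r \<and> w = spm r \<sigma> \<epsilon>"
proof (induction rule: weyl_group.induct)
  case one
  have "1\<^sub>m r = spm r id (restrict (\<lambda>_. 1) {0..<r})" unfolding spm_one by (rule spm_cong) auto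
  moreover have "restrict (\<lambda>_. 1) {0..<r} \<in> even_signs r" by (auto simp: even_signs_def)
  ultimately show ?case using permutes_id by blast
next
  case (refl \<alpha> w)
  then obtain \<sigma> \<epsilon> where w: "\<sigma> permutes {0..<r}" "\<epsilon> \<in> even_signs r" "w = spm r \<sigma> \<epsilon>" by blast
  from refl(1) obtain i j \<eta> where \<alpha>: "i < j" "j < r" "\<And>k. \<eta> k = 1 \<or> \<eta> k = -1" "(\<Prod>k=0..<r. \<eta> k) = 1"
    "reflection_mat r \<alpha> = spm r (Transposition.transpose i j) \<eta>" by (rule reflection_roots) blast
  let ?t = "Transposition.transpose i j"
  have t: "?t permutes {0..<r}" using \<alpha> by (intro permutes_swap_id) auto
  have tk: "?t k < r" if "k < r" for k using permutes_in_image[OF t, of k] that by simp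
  let ?\<epsilon> = "restrict (\<lambda>k. \<eta> k * \<epsilon> (?t k)) {0..<r}"
  have "reflection_mat r \<alpha> * w = spm r (\<sigma> \<circ> ?t) ?\<epsilon>"
    unfolding \<alpha>(5) w(3) spm_mult[OF t] by (rule spm_cong) auto
  moreover have "?\<epsilon> \<in> even_signs r"
  proof -
    have "\<epsilon> k \<in> {1, -1}" if "k < r" for k using w(2) that by (auto simp: even_signs_def PiE_def Pi_def)
    then have "\<eta> k * \<epsilon> (?t k) \<in> {1, -1}" if "k < r" for k using \<alpha>(3)[of k] tk[OF that] by fastforce
    moreover have "(\<Prod>k=0..<r. \<epsilon> (?t k)) = (\<Prod>k=0..<r. \<epsilon> k)"
      using prod.permute[OF t, of \<epsilon>] by (simp add: comp_def)
    ultimately show ?thesis using w(2) \<alpha>(4) by (auto simp: even_signs_def prod.distrib)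
  qed
  moreover have "(\<sigma> \<circ> ?t) permutes {0..<r}" using permutes_compose[OF t w(1)] .
  ultimately show ?case by blast
qed

lemma weyl_group_transpose:
  assumes "i < r" "j < r" "i \<noteq> j" "w \<in> weyl_group r"
  shows "spm r (Transposition.transpose i j) (\<lambda>_. 1) * w \<in> weyl_group r"
    "spm r (Transposition.transpose i j) (\<lambda>k. if k = i \<or> k = j then -1 else 1) * w \<in> weyl_group r"
proof -
  define a where "a = min i j"
  define b where "b = max i j"
  have ab: "a < b" "b < r" using assms by (auto simp: a_def b_def)
  have "Transposition.transpose i j = Transposition.transpose a b"
    "(\<lambda>k. if k = i \<or> k = j then -1 else 1) = (\<lambda>k. if k = a \<or> k = b then -1 else (1 :: real))"
    by (auto simp: a_def b_def min_def max_def transpose_commute)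
  moreover have "unit_vec r a - unit_vec r b \<in> roots r" "unit_vec r a + unit_vec r b \<in> roots r"
    using ab by (auto simp: roots_def pos_roots_def)
  then have "reflection_mat r (unit_vec r a - unit_vec r b) * w \<in> weyl_group r"
      "reflection_mat r (unit_vec r a + unit_vec r b) * w \<in> weyl_group r"
    using assms(4) by (auto intro: weyl_group.refl)
  ultimately show "spm r (Transposition.transpose i j) (\<lambda>_. 1) * w \<in> weyl_group r"
    "spm r (Transposition.transpose i j) (\<lambda>k. if k = i \<or> k = j then -1 else 1) * w \<in> weyl_group r"
    unfolding reflection_minus[OF ab] reflection_plus[OF ab] by simp_all
qed

lemma weyl_group_perm:
  assumes "\<sigma> permutes {0..<r}"
  shows "spm r \<sigma> (\<lambda>_. 1) \<in> weyl_group r"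
  using finite_atLeastLessThan assms
proof (induction rule: permutes_rev_induct)
  case id
  then show ?case using weyl_group.one[of r] by (simp add: spm_one id_def)
next
  case (swap a b p)
  have "Transposition.transpose a b permutes {0..<r}" using swap by (intro permutes_swap_id) auto
  then have "spm r (Transposition.transpose a b) (\<lambda>_. 1) * spm r p (\<lambda>_. 1) = spm r (p \<circ> Transposition.transpose a b) (\<lambda>_. 1)"
    by (simp add: spm_mult)
  moreover have "spm r (Transposition.transpose a b) (\<lambda>_. 1) * spm r p (\<lambda>_. 1) \<in> weyl_group r"
    using swap by (intro weyl_group_transpose) auto
  ultimately show ?case by (simp add: comp_def)
qed

text \<open>Minus signs are removed in pairs: the reflections in \<epsilon>_i - \<epsilon>_j and
  \<epsilon>_i + \<epsilon>_j compose to the sign change at \<open>i\<close> and \<open>j\<close>,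
  and the product condition guarantees a second minus sign.\<close>

lemma weyl_group_superset:
  assumes "\<sigma> permutes {0..<r}" "\<And>i. i < r \<Longrightarrow> \<epsilon> i = 1 \<or> \<epsilon> i = -1" "(\<Prod>i=0..<r. \<epsilon> i) = 1"
  shows "spm r \<sigma> \<epsilon> \<in> weyl_group r"
  using assms(2,3)
proof (induction "card {i. i < r \<and> \<epsilon> i = -1}" arbitrary: \<epsilon> rule: less_induct)
  case less
  let ?N = "{i. i < r \<and> \<epsilon> i = -1}"
  have fin: "finite ?N" by simp
  show ?case
  proof (cases "?N = {}")
    case True
    then have "spm r \<sigma> \<epsilon> = spm r \<sigma> (\<lambda>_. 1)" using less.prems by (intro spm_cong) auto
    then show ?thesis using weyl_group_perm[OF assms(1)] by simp
  next
    case False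
    then obtain i where i: "i < r" "\<epsilon> i = -1" by blast
    have "\<exists>j<r. j \<noteq> i \<and> \<epsilon> j = -1"
    proof (rule ccontr)
      assume "\<not> ?thesis"
      then have "(\<Prod>k=0..<r. \<epsilon> k) = (\<Prod>k=0..<r. if k = i then -1 else 1)"
        using less.prems i by (intro prod.cong) auto
      then show False using less.prems(2) i by simp
    qed
    then obtain j where j: "j < r" "j \<noteq> i" "\<epsilon> j = -1" by blast
    define \<eta> where "\<eta> k = (if k = i \<or> k = j then 1 else \<epsilon> k)" for k
    let ?s = "\<lambda>k. if k = i \<or> k = j then -1 else (1 :: real)"
    let ?t = "Transposition.transpose i j"
    have t: "?t permutes {0..<r}" using i j by (intro permutes_swap_id) auto
    have "{k. k < r \<and> \<eta> k = -1} \<subset> ?N" using i by (auto simp: \<eta>_def)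
    then have "card {k. k < r \<and> \<eta> k = -1} < card ?N" by (intro psubset_card_mono fin)
    moreover have "(\<Prod>k=0..<r. \<eta> k) = 1"
    proof -
      have "(\<Prod>k=0..<r. ?s k) = (\<Prod>k\<in>{i, j}. (-1 :: real))"
        using i j by (intro prod.mono_neutral_cong_right) auto
      then have "(\<Prod>k=0..<r. ?s k) = 1" using j by simp
      moreover have "(\<Prod>k=0..<r. \<epsilon> k) = (\<Prod>k=0..<r. ?s k * \<eta> k)"
        using i j by (intro prod.cong) (auto simp: \<eta>_def)
      ultimately show ?thesis using less.prems(2) by (simp add: prod.distrib)
    qed
    moreover have "\<eta> k = 1 \<or> \<eta> k = -1" if "k < r" for k using less.prems(1)[OF that] by (auto simp: \<eta>_def)
    ultimately have "spm r \<sigma> \<eta> \<in> weyl_group r" using less.hyps[of \<eta>] by blast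
    then have "spm r ?t ?s * (spm r ?t (\<lambda>_. 1) * spm r \<sigma> \<eta>) \<in> weyl_group r"
      using i j by (intro weyl_group_transpose) auto
    also have "spm r ?t ?s * (spm r ?t (\<lambda>_. 1) * spm r \<sigma> \<eta>) = spm r \<sigma> \<epsilon>"
      unfolding spm_mult[OF t] comp_assoc
      using i j by (intro spm_cong) (auto simp: \<eta>_def Transposition.transpose_def)
    finally show ?thesis .
  qed
qed

lemma spm_inj:
  assumes "\<sigma> permutes {0..<r}" "\<sigma>' permutes {0..<r}" "\<epsilon> \<in> even_signs r" "\<epsilon>' \<in> even_signs r" "spm r \<sigma> \<epsilon> = spm r \<sigma>' \<epsilon>'"
  shows "\<sigma> = \<sigma>' \<and> \<epsilon> = \<epsilon>'"
proof -
  have nz: "\<epsilon> i \<noteq> 0" if "i < r" for i using assms(3) that by (auto simp: even_signs_def PiE_def Pi_def)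
  have *: "\<sigma> i = \<sigma>' i \<and> \<epsilon> i = \<epsilon>' i" if i: "i < r" for i
  proof -
    have \<sigma>i: "\<sigma> i < r" using permutes_in_image[OF assms(1), of i] i by simp
    have "spm r \<sigma> \<epsilon> $$ (i, \<sigma> i) = spm r \<sigma>' \<epsilon>' $$ (i, \<sigma> i)" using assms(5) by simp
    then show ?thesis using i \<sigma>i nz[OF i] by (simp add: spm_def split: if_splits)
  qed
  have "\<sigma> = \<sigma>'" using * assms(1,2) by (intro ext) (metis atLeastLessThan_iff permutes_not_in zero_le)
  moreover have "\<epsilon> = \<epsilon>'" using * assms(3,4) by (intro PiE_ext[of _ "{0..<r}"]) (auto simp: even_signs_def)
  ultimately show ?thesis by blast
qed

lemma weyl_group_eq:
  "bij_betw (\<lambda>(\<sigma>, \<epsilon>). spm r \<sigma> \<epsilon>) ({\<sigma>. \<sigma> permutes {0..<r}} \<times> even_signs r) (weyl_group r)"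
proof (rule bij_betwI')
  fix x y assume "x \<in> {\<sigma>. \<sigma> permutes {0..<r}} \<times> even_signs r" "y \<in> {\<sigma>. \<sigma> permutes {0..<r}} \<times> even_signs r"
  then show "((\<lambda>(\<sigma>, \<epsilon>). spm r \<sigma> \<epsilon>) x = (\<lambda>(\<sigma>, \<epsilon>). spm r \<sigma> \<epsilon>) y) = (x = y)"
    using spm_inj by (cases x; cases y) auto
next
  fix x assume "x \<in> {\<sigma>. \<sigma> permutes {0..<r}} \<times> even_signs r"
  then show "(\<lambda>(\<sigma>, \<epsilon>). spm r \<sigma> \<epsilon>) x \<in> weyl_group r"
    by (auto intro!: weyl_group_superset simp: even_signs_def PiE_def Pi_def)
next
  fix w assume "w \<in> weyl_group r"
  then show "\<exists>x\<in>{\<sigma>. \<sigma> permutes {0..<r}} \<times> even_signs r. w = (\<lambda>(\<sigma>, \<epsilon>). spm r \<sigma> \<epsilon>) x"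
    using weyl_group_subset[of w r] by force
qed

section \<open>Weyl sums as a cosine and a sine determinant\<close>

definition alt_sum :: "nat \<Rightarrow> (real \<Rightarrow> complex) \<Rightarrow> (nat \<Rightarrow> real) \<Rightarrow> (nat \<Rightarrow> real) \<Rightarrow> complex" where
  "alt_sum r g l m = (\<Sum>\<sigma>\<in>{\<sigma>. \<sigma> permutes {0..<r}}. signof \<sigma> * (\<Prod>i=0..<r. g (l (\<sigma> i) * m i)))"

lemma alt_sum_det: "alt_sum r g l m = det (mat r r (\<lambda>(i, j). g (l j * m i)))"
proof -
  have "det (mat r r (\<lambda>(i, j). g (l j * m i))) =
    (\<Sum>p\<in>{p. p permutes {0..<r}}. signof p * (\<Prod>i = 0..<r. mat r r (\<lambda>(i, j). g (l j * m i)) $$ (i, p i)))"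
    by (rule det_def') simp
  also have "\<dots> = alt_sum r g l m"
    unfolding alt_sum_def
  proof (intro sum.cong HOL.refl arg_cong2[where f = "(*)"] prod.cong)
    fix p i assume "p \<in> {p. p permutes {0..<r}}" "i \<in> {0..<r}"
    then show "mat r r (\<lambda>(i, j). g (l j * m i)) $$ (i, p i) = g (l (p i) * m i)"
      using permutes_in_image[of p "{0..<r}" i] by simp
  qed
  finally show ?thesis ..
qed

lemma alt_sum_cong:
  assumes "\<And>i. i < r \<Longrightarrow> l i = l' i" "\<And>i. i < r \<Longrightarrow> m i = m' i"
  shows "alt_sum r g l m = alt_sum r g l' m'"
  unfolding alt_sum_det using assms by (intro arg_cong[where f = det] eq_matI) auto

lemma alt_sum_sym: "alt_sum r g l m = alt_sum r g m l"
proof -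
  have "mat r r (\<lambda>(i, j). g (l j * m i)) = transpose_mat (mat r r (\<lambda>(i, j). g (m j * l i)))"
    by (intro eq_matI) (auto simp: mult.commute)
  then show ?thesis unfolding alt_sum_det by (simp add: det_transpose[of _ r])
qed

lemma alt_sum_perm:
  assumes \<tau>: "\<tau> permutes {0..<r}"
  shows "alt_sum r g (\<lambda>i. l (\<tau> i)) m = signof \<tau> * alt_sum r g l m"
proof -
  have s: "signof \<tau> * signof \<tau> = (1 :: complex)" by (simp add: sign_def)
  have "signof \<tau> * alt_sum r g l m = (\<Sum>\<sigma>\<in>{\<sigma>. \<sigma> permutes {0..<r}}. signof \<tau> * (signof (\<tau> \<circ> \<sigma>) * (\<Prod>i=0..<r. g (l ((\<tau> \<circ> \<sigma>) i) * m i))))"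
    unfolding alt_sum_def sum_distrib_left
    by (rule setum_permutations_compose_left[OF \<tau>])
  also have "\<dots> = alt_sum r g (\<lambda>i. l (\<tau> i)) m"
    unfolding alt_sum_def
  proof (intro sum.cong HOL.refl)
    fix \<sigma> assume "\<sigma> \<in> {\<sigma>. \<sigma> permutes {0..<r}}"
    then have "signof (\<tau> \<circ> \<sigma>) = signof \<tau> * (signof \<sigma> :: complex)"
      using signof_compose[OF \<tau>, of \<sigma> r] by simp
    then show "signof \<tau> * (signof (\<tau> \<circ> \<sigma>) * (\<Prod>i=0..<r. g (l ((\<tau> \<circ> \<sigma>) i) * m i))) =
      signof \<sigma> * (\<Prod>i=0..<r. g (l (\<tau> (\<sigma> i)) * m i))"
      using s by (simp flip: mult.assoc)
  qed
  finally show ?thesis ..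
qed

text \<open>An odd \<open>g\<close> lets the signs out, where their product is 1; an even
  \<open>g\<close> does not see them.\<close>

lemma alt_sum_signs:
  assumes "\<And>i. i < r \<Longrightarrow> \<delta> i = 1 \<or> \<delta> i = -1" "(\<Prod>i=0..<r. \<delta> i) = 1"
    and g: "(\<forall>x. g (- x) = g x) \<or> (\<forall>x. g (- x) = - g x)"
  shows "alt_sum r g (\<lambda>i. \<delta> i * l i) m = alt_sum r g l m"
  unfolding alt_sum_def
proof (intro sum.cong HOL.refl arg_cong2[where f = "(*)"])
  fix \<sigma> assume "\<sigma> \<in> {\<sigma>. \<sigma> permutes {0..<r}}"
  then have \<sigma>: "\<sigma> permutes {0..<r}" by simp
  have \<sigma>i: "\<sigma> i < r" if "i < r" for i using permutes_in_image[OF \<sigma>, of i] that by simp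
  from g show "(\<Prod>i=0..<r. g (\<delta> (\<sigma> i) * l (\<sigma> i) * m i)) = (\<Prod>i=0..<r. g (l (\<sigma> i) * m i))"
  proof
    assume "\<forall>x. g (- x) = g x"
    then have "g (\<delta> (\<sigma> i) * l (\<sigma> i) * m i) = g (l (\<sigma> i) * m i)" if "i < r" for i
      using assms(1)[OF \<sigma>i[OF that]] by auto
    then show ?thesis by simp
  next
    assume "\<forall>x. g (- x) = - g x"
    then have "g (\<delta> (\<sigma> i) * l (\<sigma> i) * m i) = of_real (\<delta> (\<sigma> i)) * g (l (\<sigma> i) * m i)" if "i < r" for i
      using assms(1)[OF \<sigma>i[OF that]] by auto
    then have "(\<Prod>i=0..<r. g (\<delta> (\<sigma> i) * l (\<sigma> i) * m i)) =
        of_real (\<Prod>i=0..<r. \<delta> (\<sigma> i)) * (\<Prod>i=0..<r. g (l (\<sigma> i) * m i))"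
      by (simp add: prod.distrib)
    also have "(\<Prod>i=0..<r. \<delta> (\<sigma> i)) = (\<Prod>i=0..<r. \<delta> i)"
      using prod.permute[OF \<sigma>, of \<delta>] by (simp add: comp_def)
    finally show ?thesis using assms(2) by simp
  qed
qed

definition en :: "nat \<Rightarrow> real \<Rightarrow> complex" where
  "en n t = cis (- (2 * pi * t / real n))"

lemma en_add: "en n (s + t) = en n s * en n t"
  by (simp add: en_def cis_mult add_divide_distrib ring_distribs)

definition weyl_sum :: "nat \<Rightarrow> nat \<Rightarrow> (nat \<Rightarrow> real) \<Rightarrow> (nat \<Rightarrow> real) \<Rightarrow> complex" where
  "weyl_sum r n l m = (\<Sum>\<sigma>\<in>{\<sigma>. \<sigma> permutes {0..<r}}. \<Sum>\<epsilon>\<in>even_signs r.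
     signof \<sigma> * (\<Prod>i=0..<r. en n (\<epsilon> i * l (\<sigma> i) * m i)))"

lemma weyl_sum_eq:
  assumes "v \<in> carrier_vec r" "u \<in> carrier_vec r"
  shows "(\<Sum>w\<in>weyl_group r. of_real (det w) * exp (- (2 * of_real pi * \<i> / of_nat n) * of_real ((w *\<^sub>v v) \<bullet> u)))
    = weyl_sum r n (\<lambda>i. v $ i) (\<lambda>i. u $ i)"
proof -
  let ?h = "\<lambda>w. complex_of_real (det w) * exp (- (2 * of_real pi * \<i> / of_nat n) * of_real ((w *\<^sub>v v) \<bullet> u))"
  have "(\<Sum>w\<in>weyl_group r. ?h w) = (\<Sum>x\<in>{\<sigma>. \<sigma> permutes {0..<r}} \<times> even_signs r. ?h ((\<lambda>(\<sigma>, \<epsilon>). spm r \<sigma> \<epsilon>) x))"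
    by (rule sum.reindex_bij_betw[symmetric, OF weyl_group_eq])
  also have "\<dots> = (\<Sum>\<sigma>\<in>{\<sigma>. \<sigma> permutes {0..<r}}. \<Sum>\<epsilon>\<in>even_signs r. ?h (spm r \<sigma> \<epsilon>))"
    by (simp add: sum.cartesian_product')
  also have "\<dots> = weyl_sum r n (\<lambda>i. v $ i) (\<lambda>i. u $ i)"
    unfolding weyl_sum_def
  proof (intro sum.cong HOL.refl arg_cong2[where f = "(*)"])
    fix \<sigma> \<epsilon> assume "\<sigma> \<in> {\<sigma>. \<sigma> permutes {0..<r}}" and \<epsilon>: "\<epsilon> \<in> even_signs r"
    then have \<sigma>: "\<sigma> permutes {0..<r}" by simp
    show "complex_of_real (det (spm r \<sigma> \<epsilon>)) = signof \<sigma>"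
      using \<epsilon> by (simp add: det_spm[OF \<sigma>] even_signs_def)
    have "(spm r \<sigma> \<epsilon> *\<^sub>v v) \<bullet> u = (\<Sum>i=0..<r. \<epsilon> i * v $ (\<sigma> i) * u $ i)"
      using assms by (auto simp: scalar_prod_def spm_mult_vec[OF \<sigma>] intro!: sum.cong simp del: index_mult_mat_vec)
    then have "exp (- (2 * of_real pi * \<i> / of_nat n) * of_real ((spm r \<sigma> \<epsilon> *\<^sub>v v) \<bullet> u)) =
      exp (\<Sum>i=0..<r. - (2 * of_real pi * \<i> / of_nat n) * of_real (\<epsilon> i * v $ (\<sigma> i) * u $ i))"
      by (simp add: sum_distrib_left)
    also have "\<dots> = (\<Prod>i=0..<r. en n (\<epsilon> i * v $ (\<sigma> i) * u $ i))"
      by (simp add: exp_sum en_def cis_conv_exp mult_ac)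
    finally show "exp (- (2 * of_real pi * \<i> / of_nat n) * of_real ((spm r \<sigma> \<epsilon> *\<^sub>v v) \<bullet> u)) =
      (\<Prod>i=0..<r. en n (\<epsilon> i * v $ (\<sigma> i) * u $ i))" .
  qed
  finally show ?thesis .
qed

text \<open>The constraint on the product of the signs is the projector (1 + \<Prod> \<epsilon>) / 2
  on unconstrained signs, and unconstrained sums factorise over the coordinates.\<close>

lemma sum_even_signs:
  fixes f :: "nat \<Rightarrow> real \<Rightarrow> complex"
  shows "(\<Sum>\<epsilon>\<in>even_signs r. \<Prod>i=0..<r. f i (\<epsilon> i)) =
    ((\<Prod>i=0..<r. f i 1 + f i (-1)) + (\<Prod>i=0..<r. f i 1 - f i (-1))) / 2"
proof -
  let ?P = "{0..<r} \<rightarrow>\<^sub>E {1, -1 :: real}"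
  have fin: "finite ?P" by (rule finite_PiE) auto
  have pm: "(\<Prod>i=0..<r. \<epsilon> i) = 1 \<or> (\<Prod>i=0..<r. \<epsilon> i) = -1" if "\<epsilon> \<in> ?P" for \<epsilon>
  proof -
    have "\<bar>\<Prod>i=0..<r. \<epsilon> i\<bar> = (\<Prod>i=0..<r. \<bar>\<epsilon> i\<bar>)" by (rule abs_prod)
    also have "\<dots> = 1" using that by (intro prod.neutral) (auto simp: PiE_def Pi_def)
    finally show ?thesis by linarith
  qed
  have 1: "(\<Prod>i=0..<r. f i 1 + f i (-1)) = (\<Sum>\<epsilon>\<in>?P. \<Prod>i=0..<r. f i (\<epsilon> i))"
    using prod_sum_PiE[of "{0..<r}" "\<lambda>_. {1, -1 :: real}" f] by simp
  have 2: "(\<Prod>i=0..<r. f i 1 - f i (-1)) = (\<Sum>\<epsilon>\<in>?P. \<Prod>i=0..<r. of_real (\<epsilon> i) * f i (\<epsilon> i))"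
    using prod_sum_PiE[of "{0..<r}" "\<lambda>_. {1, -1 :: real}" "\<lambda>i e. of_real e * f i e"] by simp
  have "(\<Prod>i=0..<r. f i 1 + f i (-1)) + (\<Prod>i=0..<r. f i 1 - f i (-1)) =
    (\<Sum>\<epsilon>\<in>?P. (1 + of_real (\<Prod>i=0..<r. \<epsilon> i)) * (\<Prod>i=0..<r. f i (\<epsilon> i)))"
    unfolding 1 2 by (simp add: sum.distrib prod.distrib ring_distribs)
  also have "\<dots> = (\<Sum>\<epsilon>\<in>even_signs r. 2 * (\<Prod>i=0..<r. f i (\<epsilon> i)))"
  proof (rule sum.mono_neutral_cong_right[OF fin])
    show "even_signs r \<subseteq> ?P" by (auto simp: even_signs_def)
    show "\<forall>\<epsilon>\<in>?P - even_signs r. (1 + of_real (\<Prod>i=0..<r. \<epsilon> i)) * (\<Prod>i=0..<r. f i (\<epsilon> i)) = 0"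
    proof
      fix \<epsilon> assume "\<epsilon> \<in> ?P - even_signs r"
      then have "(\<Prod>i=0..<r. \<epsilon> i) = -1" using pm[of \<epsilon>] by (auto simp: even_signs_def)
      then show "(1 + of_real (\<Prod>i=0..<r. \<epsilon> i)) * (\<Prod>i=0..<r. f i (\<epsilon> i)) = 0"
        by (simp only:) simp
    qed
    show "(1 + of_real (\<Prod>i=0..<r. \<epsilon> i)) * (\<Prod>i=0..<r. f i (\<epsilon> i)) = 2 * (\<Prod>i=0..<r. f i (\<epsilon> i))"
      if "\<epsilon> \<in> even_signs r" for \<epsilon> using that by (simp add: even_signs_def)
  qed
  finally show ?thesis by (simp flip: sum_distrib_left)
qed

definition cos2 :: "nat \<Rightarrow> real \<Rightarrow> complex" where
  "cos2 n t = of_real (2 * cos (2 * pi * t / real n))"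

definition sin2 :: "nat \<Rightarrow> real \<Rightarrow> complex" where
  "sin2 n t = - 2 * \<i> * of_real (sin (2 * pi * t / real n))"

text \<open>In each coordinate the sum and the difference of the two exponentials are a cosine and a
  sine, so the type D Weyl sum is the mean of two determinants.\<close>

lemma weyl_sum_alt: "weyl_sum r n l m = (alt_sum r (cos2 n) l m + alt_sum r (sin2 n) l m) / 2"
proof -
  have e: "en n (1 * a * b) + en n (- 1 * a * b) = cos2 n (a * b)"
    "en n (1 * a * b) - en n (- 1 * a * b) = sin2 n (a * b)" for a b
    by (simp_all add: en_def cos2_def sin2_def complex_eq_iff)
  have "weyl_sum r n l m = (\<Sum>\<sigma>\<in>{\<sigma>. \<sigma> permutes {0..<r}}. signof \<sigma> *
    (((\<Prod>i=0..<r. cos2 n (l (\<sigma> i) * m i)) + (\<Prod>i=0..<r. sin2 n (l (\<sigma> i) * m i))) / 2))"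
    unfolding weyl_sum_def sum_distrib_left[symmetric]
    using sum_even_signs[of "\<lambda>i e. en n (e * l (_ i) * m i)" r] by (simp only: e)
  also have "\<dots> = (alt_sum r (cos2 n) l m + alt_sum r (sin2 n) l m) / 2"
    unfolding alt_sum_def sum.distrib[symmetric] sum_divide_distrib
    by (intro sum.cong HOL.refl) (simp add: ring_distribs)
  finally show ?thesis .
qed

section \<open>Symmetries and translations of Weyl sums\<close>

lemma weyl_sum_cong:
  assumes "\<And>i. i < r \<Longrightarrow> l i = l' i" "\<And>i. i < r \<Longrightarrow> m i = m' i"
  shows "weyl_sum r n l m = weyl_sum r n l' m'"
  unfolding weyl_sum_alt using alt_sum_cong[OF assms, of r "\<lambda>_. _"] assms
  by (auto intro!: arg_cong2[where f = "(+)"] arg_cong2[where f = "(/)"] alt_sum_cong)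

lemma weyl_sum_sym: "weyl_sum r n l m = weyl_sum r n m l"
  unfolding weyl_sum_alt using alt_sum_sym by metis

lemma weyl_sum_perm:
  assumes "\<tau> permutes {0..<r}"
  shows "weyl_sum r n (\<lambda>i. l (\<tau> i)) m = signof \<tau> * weyl_sum r n l m"
  unfolding weyl_sum_alt alt_sum_perm[OF assms] by (simp add: ring_distribs)

lemma weyl_sum_signs:
  assumes "\<And>i. i < r \<Longrightarrow> \<delta> i = 1 \<or> \<delta> i = -1" "(\<Prod>i=0..<r. \<delta> i) = 1"
  shows "weyl_sum r n (\<lambda>i. \<delta> i * l i) m = weyl_sum r n l m"
proof -
  have "alt_sum r (cos2 n) (\<lambda>i. \<delta> i * l i) m = alt_sum r (cos2 n) l m"
    using assms by (rule alt_sum_signs) (simp_all add: cos2_def)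
  moreover have "alt_sum r (sin2 n) (\<lambda>i. \<delta> i * l i) m = alt_sum r (sin2 n) l m"
    using assms by (rule alt_sum_signs) (simp_all add: sin2_def)
  ultimately show ?thesis unfolding weyl_sum_alt by simp
qed

lemma even_signsD: "\<epsilon> \<in> even_signs r \<Longrightarrow> i < r \<Longrightarrow> \<epsilon> i = 1 \<or> \<epsilon> i = -1"
  by (auto simp: even_signs_def PiE_def Pi_def)

text \<open>The permutation moves the shifted entry to some coordinate \<open>k\<close>, but the
  factor is \<eta> wherever it lands, because the coordinates of \<open>m\<close> are all integral
  or all half-integral.\<close>

lemma weyl_sum_shift_first:
  assumes n: "n > 0" and r: "r > 0" and m: "\<And>i. i < r \<Longrightarrow> cis (2 * pi * m i) = of_real \<eta>" and \<eta>: "\<eta> = 1 \<or> \<eta> = -1"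
  shows "weyl_sum r n (\<lambda>i. if i = 0 then real n + l 0 else l i) m = of_real \<eta> * weyl_sum r n l m"
  unfolding weyl_sum_def sum_distrib_left
proof (intro sum.cong HOL.refl)
  fix \<sigma> \<epsilon> assume "\<sigma> \<in> {\<sigma>. \<sigma> permutes {0..<r}}" and \<epsilon>: "\<epsilon> \<in> even_signs r"
  then have \<sigma>: "\<sigma> permutes {0..<r}" by simp
  define k where "k = inv_into UNIV \<sigma> 0"
  have k: "k < r" "\<sigma> k = 0" using permutes_in_image[OF permutes_inv[OF \<sigma>], of 0] r permutes_inverses(1)[OF \<sigma>]
    by (auto simp: k_def)
  have k': "\<sigma> i = 0 \<longleftrightarrow> i = k" for i using k permutes_inj[OF \<sigma>] by (metis injD)
  have "en n (\<epsilon> k * real n * m k) = of_real \<eta>"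
  proof -
    have "en n (\<epsilon> k * real n * m k) = cis (- (\<epsilon> k * (2 * pi * m k)))" using n by (simp add: en_def mult_ac)
    also have "\<dots> = of_real \<eta>"
      using even_signsD[OF \<epsilon> k(1)] m[OF k(1)] \<eta> by (auto simp: complex_eq_iff)
    finally show ?thesis .
  qed
  then have "en n (\<epsilon> i * (if \<sigma> i = 0 then real n + l 0 else l (\<sigma> i)) * m i) =
     (if i = k then of_real \<eta> else 1) * en n (\<epsilon> i * l (\<sigma> i) * m i)" if "i < r" for i
    using k k'[of i] by (cases "i = k") (simp_all add: ring_distribs en_add)
  then have "(\<Prod>i=0..<r. en n (\<epsilon> i * (if \<sigma> i = 0 then real n + l 0 else l (\<sigma> i)) * m i)) =
     of_real \<eta> * (\<Prod>i=0..<r. en n (\<epsilon> i * l (\<sigma> i) * m i))"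
    using k by (simp add: prod.distrib)
  then show "signof \<sigma> * (\<Prod>i=0..<r. en n (\<epsilon> i * (if \<sigma> i = 0 then real n + l 0 else l (\<sigma> i)) * m i)) =
    of_real \<eta> * (signof \<sigma> * (\<Prod>i=0..<r. en n (\<epsilon> i * l (\<sigma> i) * m i)))"
    by simp
qed

lemma cis_sum: "finite A \<Longrightarrow> cis (\<Sum>i\<in>A. f i) = (\<Prod>i\<in>A. cis (f i))"
  by (induction A rule: finite_induct) (simp_all flip: cis_mult)

text \<open>For half-integral \<open>m\<close> a sign at one coordinate changes the factor there by
  that sign; the product of the signs is 1 on even sign changes, so one common factor
  remains.\<close>

lemma weyl_sum_shift_half:
  assumes n: "n > 0" and m: "\<And>i. i < r \<Longrightarrow> cis (2 * pi * m i) = of_real \<eta>" and \<eta>: "\<eta> = 1 \<or> \<eta> = -1"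
  shows "weyl_sum r n (\<lambda>i. real n / 2 + l i) m = cis (- (pi * (\<Sum>i=0..<r. m i))) * weyl_sum r n l m"
proof -
  define c where "c = cis (- (pi * (\<Sum>i=0..<r. m i)))"
  have "weyl_sum r n (\<lambda>i. real n / 2 + l i) m = c * weyl_sum r n l m"
  unfolding weyl_sum_def sum_distrib_left
proof (intro sum.cong HOL.refl)
  fix \<sigma> \<epsilon> assume "\<sigma> \<in> {\<sigma>. \<sigma> permutes {0..<r}}" and \<epsilon>: "\<epsilon> \<in> even_signs r"
  have e: "en n (\<epsilon> i * (real n / 2) * m i) = cis (- (pi * m i)) * (if \<eta> = 1 then 1 else of_real (\<epsilon> i))" if i: "i < r" for i
  proof -
    have "en n (\<epsilon> i * (real n / 2) * m i) = cis (- (\<epsilon> i * (pi * m i)))" using n by (simp add: en_def mult_ac)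
    also have "\<dots> = cis (- (pi * m i)) * (if \<eta> = 1 then 1 else of_real (\<epsilon> i))"
    proof (cases "\<epsilon> i = 1")
      case False
      then have "\<epsilon> i = -1" using even_signsD[OF \<epsilon> i] by simp
      moreover have "cis (pi * m i) = cis (- (pi * m i)) * of_real \<eta>"
        unfolding m[OF i, symmetric] by (simp add: cis_mult)
      ultimately show ?thesis using \<eta> by auto
    qed simp
    finally show ?thesis .
  qed
  have "(\<Prod>i=0..<r. en n (\<epsilon> i * (real n / 2 + l (\<sigma> i)) * m i)) =
     (\<Prod>i=0..<r. cis (- (pi * m i)) * (if \<eta> = 1 then 1 else of_real (\<epsilon> i)) * en n (\<epsilon> i * l (\<sigma> i) * m i))"
    by (intro prod.cong HOL.refl) (simp add: e[symmetric] ring_distribs en_add)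
  also have "\<dots> = (\<Prod>i=0..<r. cis (- (pi * m i))) * (if \<eta> = 1 then 1 else of_real (\<Prod>i=0..<r. \<epsilon> i)) *
      (\<Prod>i=0..<r. en n (\<epsilon> i * l (\<sigma> i) * m i))"
    by (simp add: prod.distrib)
  also have "\<dots> = cis (- (pi * (\<Sum>i=0..<r. m i))) * (\<Prod>i=0..<r. en n (\<epsilon> i * l (\<sigma> i) * m i))"
    using \<epsilon> by (simp add: even_signs_def cis_sum[symmetric] sum_negf sum_distrib_left)
  finally show "signof \<sigma> * (\<Prod>i=0..<r. en n (\<epsilon> i * (real n / 2 + l (\<sigma> i)) * m i)) =
    c * (signof \<sigma> * (\<Prod>i=0..<r. en n (\<epsilon> i * l (\<sigma> i) * m i)))"
    by (simp add: c_def)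
qed
  then show ?thesis unfolding c_def .
qed

declare sum.lessThan_Suc [simp del] add_2_eq_Suc [simp del] add_2_eq_Suc' [simp del]

section \<open>The tensor part\<close>

lemma sres_cong_minus:
  assumes "odd n" "[t + t' = 0] (mod n)"
  shows "sres n t = sres n t'"
proof (rule sres_eqI)
  define v where "v = sres n t'"
  have "[v = t'] (mod n) \<or> [v + t' = 0] (mod n)"
    unfolding v_def using assms(1) by (intro sres_cases) (auto elim: oddE)
  then show "[v = t] (mod n) \<or> [v + t = 0] (mod n)"
  proof
    assume "[v = t'] (mod n)"
    then have "[v + t = t' + t] (mod n)" by (intro cong_add cong_refl)
    also have "[t' + t = 0] (mod n)" using assms(2) by (simp add: add.commute)
    finally show ?thesis ..
  next
    assume "[v + t' = 0] (mod n)"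
    also have "[0 = t + t'] (mod n)" using assms(2) by (rule cong_sym)
    finally show ?thesis by (simp add: cong_add_rcancel_nat)
  qed
qed (use assms sres_bound in auto)

definition cc :: "nat \<Rightarrow> nat \<Rightarrow> nat \<Rightarrow> nat \<Rightarrow> real" where
  "cc r i j k = xsign r j * xsign r k * kern (2 * r + 1) i (r - j) (r - k)"

lemma cc_sym: "cc r i j k = cc r i k j"
  by (simp add: cc_def kern_sym)

lemma xform_cc: "xform r (\<lambda>b c. \<gamma> * of_real (kern (2 * r + 1) i b c)) \<delta> j k =
    \<gamma> * of_real (cc r i j k) + \<delta> * of_real (xsg r j * xsg r k)"
  by (simp add: xform_def cc_def)

lemma xform_cc_mult:
  assumes "coprime i (2 * r + 1)" "j < r + 2" "k < r + 2"
  shows "mprod {..<r + 2} (xform r (\<lambda>b c. \<gamma> * of_real (kern (2 * r + 1) i b c)) \<delta>)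
     (xform r (\<lambda>b c. \<gamma>' * of_real (kern (2 * r + 1) i b c)) \<delta>') j k =
    (if j < r \<or> k < r then if j = k then \<gamma> * \<gamma>' * of_nat (2 * r + 1) / 4 else 0
     else \<gamma> * \<gamma>' * of_nat (2 * r + 1) / 8 + (if j = k then 2 * \<delta> * \<delta>' else - 2 * \<delta> * \<delta>'))"
proof -
  have *: "hsum r (\<lambda>d. (\<gamma> * of_real (kern (2 * r + 1) i (r - j) d)) * (\<gamma>' * of_real (kern (2 * r + 1) i d (r - k)))) =
    \<gamma> * \<gamma>' * (if r - j = r - k then if r - j = 0 then of_nat (2 * r + 1) / 2 else of_nat (2 * r + 1) / 4 else 0)"
  proof -
    have "hsum r (\<lambda>d. (\<gamma> * of_real (kern (2 * r + 1) i (r - j) d)) * (\<gamma>' * of_real (kern (2 * r + 1) i d (r - k)))) =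
      hsum r (\<lambda>d. \<gamma> * \<gamma>' * (of_real (kern (2 * r + 1) i (r - j) d) * of_real (kern (2 * r + 1) i d (r - k))))"
      by (intro hsum_cong) (simp add: mult_ac)
    then show ?thesis
      unfolding hsum_cmult using kern_orthogonal[OF HOL.refl assms(1), of "r - j" "r - k"] by simp
  qed
  show ?thesis
  proof (cases "j < r \<or> k < r")
    case True
    then have jk: "r - j = r - k \<longleftrightarrow> j = k" by auto
    have "xsg r j * xsg r k = 0" using True by (auto simp: xsg_def)
    moreover have "xsign r j * xsign r j = 1" if "j < r" using that
      by (simp add: xsign_def dhalf_def flip: power_add mult_2)
    ultimately show ?thesis unfolding xform_mult xform_def * jk using True
      by (auto simp flip: of_real_mult)
  next
    case False
    then have "(j = r \<or> j = r + 1) \<and> (k = r \<or> k = r + 1)" using assms by auto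
    then show ?thesis unfolding xform_mult xform_def *
      by (auto simp: xsg_def xsign_def dhalf_def)
  qed
qed

lemma xform_cc_square:
  assumes "coprime i (2 * r + 1)" "j < r" "k < r + 2"
  shows "mprod {..<r + 2} (xform r (\<lambda>b c. \<gamma> * of_real (kern (2 * r + 1) i b c)) \<delta>)
     (xform r (\<lambda>b c. \<gamma> * of_real (kern (2 * r + 1) i b c)) \<delta>) j k =
    (if j = k then \<gamma>\<^sup>2 * of_nat (2 * r + 1) / 4 else 0)"
  using xform_cc_mult[of i r j k \<gamma> \<delta> \<gamma> \<delta>] assms by (simp add: power2_eq_square)

definition vac :: "nat \<Rightarrow> nat \<Rightarrow> real" where
  "vac r l = dhalf r l * cos (pi * real (r - l) / real (2 * r + 1))"

lemma vac_pos: "vac r l > 0"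
proof -
  have "real (r - l) / real (2 * r + 1) < 1 / 2" by (simp add: field_simps)
  then have "pi * (real (r - l) / real (2 * r + 1)) < pi * (1 / 2)" by (intro mult_strict_left_mono) auto
  then have "cos (pi * (real (r - l) / real (2 * r + 1))) > 0" by (intro cos_gt_zero_pi) (auto intro: less_le_trans[of _ 0])
  then show ?thesis by (simp add: vac_def dhalf_def)
qed

text \<open>Index 0 is the residue \<open>r\<close>, that is -1/2 modulo \<open>n\<close>, where the
  cosine becomes (-1)^b cos (pi b / n); the sign is cancelled by \<open>xsign\<close>. So the vacuum
  row of X is positive up to one global sign.\<close>

lemma cc_vac: assumes "r > 0" shows "cc r 1 0 l = (-1) ^ r * vac r l"
proof -
  define b where "b = r - l"
  have "2 * pi * real_of_int (int r * int b) / real (2 * r + 1) = real b * pi - pi * real b / real (2 * r + 1)"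
    by (simp add: field_simps)
  then have "kern (2 * r + 1) 1 r b = (-1) ^ b * cos (pi * real b / real (2 * r + 1))"
    by (simp add: kern_def ck_def cos_diff)
  then show ?thesis using assms
    by (simp add: cc_def vac_def xsign_def dhalf_def[of r 0] flip: b_def)
qed

section \<open>A single block: Galois conjugation against positivity\<close>

locale X_commutant =
  fixes r n :: nat and A :: "nat \<Rightarrow> nat \<Rightarrow> nat"
  assumes r4: "r \<ge> 4" and n_def: "n = 2 * r + 1"
    and comm: "\<And>i. coprime i n \<Longrightarrow> \<exists>\<gamma> \<delta>. \<gamma> \<noteq> 0 \<and> commutes {..<r + 2} (\<lambda>j k. of_nat (A j k))
      (xform r (\<lambda>b c. \<gamma> * of_real (kern n i b c)) \<delta>)"
    and sq: "\<And>j k. j < r + 2 \<Longrightarrow> k < r + 2 \<Longrightarrow> A j k \<noteq> 0 \<Longrightarrow> [(r - j) * (r - j) = (r - k) * (r - k)] (mod n)"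
begin

lemma transposed: "X_commutant r n (\<lambda>j k. A k j)"
proof
  fix i assume "coprime i n"
  from comm[OF this] obtain \<gamma> \<delta> where *: "\<gamma> \<noteq> 0" "commutes {..<r + 2} (\<lambda>j k. of_nat (A j k))
      (xform r (\<lambda>b c. \<gamma> * of_real (kern n i b c)) \<delta>)" by blast
  have sym: "xform r (\<lambda>b c. \<gamma> * of_real (kern n i b c)) \<delta> j k = xform r (\<lambda>b c. \<gamma> * of_real (kern n i b c)) \<delta> k j" for j k
    by (simp add: xform_def kern_sym[of n i "r - j"])
  have "commutes {..<r + 2} (\<lambda>j k. of_nat (A k j)) (xform r (\<lambda>b c. \<gamma> * of_real (kern n i b c)) \<delta>)"
    unfolding commutes_def
  proof (intro ballI)
    fix j k assume "j \<in> {..<r + 2}" "k \<in> {..<r + 2}"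
    then have "mprod {..<r + 2} (\<lambda>j k. of_nat (A j k)) (xform r (\<lambda>b c. \<gamma> * of_real (kern n i b c)) \<delta>) k j =
      mprod {..<r + 2} (xform r (\<lambda>b c. \<gamma> * of_real (kern n i b c)) \<delta>) (\<lambda>j k. of_nat (A j k)) k j"
      using *(2) by (auto simp: commutes_def)
    then show "mprod {..<r + 2} (\<lambda>j k. of_nat (A k j)) (xform r (\<lambda>b c. \<gamma> * of_real (kern n i b c)) \<delta>) j k =
      mprod {..<r + 2} (xform r (\<lambda>b c. \<gamma> * of_real (kern n i b c)) \<delta>) (\<lambda>j k. of_nat (A k j)) j k"
      unfolding mprod_def by (subst (asm) (1 2) sym) (simp add: mult.commute)
  qed
  with *(1) show "\<exists>\<gamma> \<delta>. \<gamma> \<noteq> 0 \<and> commutes {..<r + 2} (\<lambda>j k. of_nat (A k j)) (xform r (\<lambda>b c. \<gamma> * of_real (kern n i b c)) \<delta>)"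
    by blast
qed (use r4 n_def sq in \<open>auto intro: cong_sym\<close>)

text \<open>Each conjugate squares to a multiple of the identity on the indices below
  \<open>r\<close>; there the unknown \<delta> comes with a factor \<open>xsg\<close>, which is 0,
  and \<gamma> cancels.\<close>

lemma conj_eq:
  assumes i: "coprime i n" and jk: "j < r" "k < r"
  shows "(\<Sum>l<r + 2. \<Sum>m<r + 2. cc r i j l * real (A l m) * cc r i m k) = real n / 4 * real (A j k)"
proof -
  obtain \<gamma> \<delta> where \<gamma>: "\<gamma> \<noteq> 0" and c: "commutes {..<r + 2} (\<lambda>j k. of_nat (A j k))
      (xform r (\<lambda>b c. \<gamma> * of_real (kern n i b c)) \<delta>)" using comm[OF i] by blast
  let ?X = "{..<r + 2}" and ?A = "\<lambda>j k. complex_of_nat (A j k)"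
  let ?U = "xform r (\<lambda>b c. \<gamma> * of_real (kern n i b c)) \<delta>"
  have U: "?U j l = \<gamma> * of_real (cc r i j l)" "?U l k = \<gamma> * of_real (cc r i l k)" for l
    using jk unfolding n_def xform_cc by (auto simp: xsg_def)
  have "mprod ?X ?U (mprod ?X ?A ?U) j k = mprod ?X ?U (mprod ?X ?U ?A) j k"
    using c jk by (rule_tac mprod_cong) (auto simp: commutes_def)
  also have "\<dots> = mprod ?X (mprod ?X ?U ?U) ?A j k" by (simp add: mprod_assoc)
  also have "\<dots> = (\<Sum>l<r + 2. (if j = l then \<gamma>\<^sup>2 * of_nat n / 4 * ?A l k else 0))"
    unfolding mprod_def[of _ _ ?A] n_def using xform_cc_square[OF i[unfolded n_def] jk(1), of _ \<gamma> \<delta>]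
    by (intro sum.cong) auto
  also have "\<dots> = \<gamma>\<^sup>2 * (of_nat n / 4 * ?A j k)" using jk by simp
  also have "mprod ?X ?U (mprod ?X ?A ?U) j k =
      \<gamma>\<^sup>2 * of_real (\<Sum>l<r + 2. \<Sum>m<r + 2. cc r i j l * real (A l m) * cc r i m k)"
    unfolding mprod_def U sum_distrib_left of_real_sum by (intro sum.cong HOL.refl) (simp add: power2_eq_square)
  finally have "complex_of_real (\<Sum>l<r + 2. \<Sum>m<r + 2. cc r i j l * real (A l m) * cc r i m k) = of_real (real n / 4 * real (A j k))"
    using \<gamma> by simp
  then show ?thesis unfolding of_real_eq_iff .
qed

text \<open>The unknown \<delta> enters only through the indices \<open>r\<close> and
  \<open>r + 1\<close>; the side conditions make exactly those terms vanish.\<close>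

lemma comm_real:
  assumes jl: "j < r + 2" "l < r + 2" and "l < r \<or> A j r = 0 \<and> A j (r + 1) = 0" "j < r \<or> A r l = 0 \<and> A (r + 1) l = 0"
  shows "(\<Sum>k<r + 2. real (A j k) * cc r 1 k l) = (\<Sum>k<r + 2. cc r 1 j k * real (A k l))"
proof -
  obtain \<gamma> \<delta> where \<gamma>: "\<gamma> \<noteq> 0" and c: "commutes {..<r + 2} (\<lambda>j k. of_nat (A j k))
      (xform r (\<lambda>b c. \<gamma> * of_real (kern n 1 b c)) \<delta>)" using comm[of 1] by auto
  let ?X = "{..<r + 2}" and ?A = "\<lambda>j k. complex_of_nat (A j k)"
  let ?U = "xform r (\<lambda>b c. \<gamma> * of_real (kern n 1 b c)) \<delta>"
  have 1: "mprod ?X ?A ?U j l = \<gamma> * of_real (\<Sum>k<r + 2. real (A j k) * cc r 1 k l)"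
    unfolding mprod_def sum_distrib_left of_real_sum n_def xform_cc
    using assms(3) by (intro sum.cong HOL.refl) (auto simp: xsg_def algebra_simps)
  have 2: "mprod ?X ?U ?A j l = \<gamma> * of_real (\<Sum>k<r + 2. cc r 1 j k * real (A k l))"
    unfolding mprod_def sum_distrib_left of_real_sum n_def xform_cc
    using assms(4) by (intro sum.cong HOL.refl) (auto simp: xsg_def algebra_simps)
  have "mprod ?X ?A ?U j l = mprod ?X ?U ?A j l" using c jl by (auto simp: commutes_def)
  then have "complex_of_real (\<Sum>k<r + 2. real (A j k) * cc r 1 k l) = of_real (\<Sum>k<r + 2. cc r 1 j k * real (A k l))"
    using \<gamma> unfolding 1 2 by simp
  then show ?thesis unfolding of_real_eq_iff .
qed

text \<open>Conjugation at the vacuum writes \<open>A 0 0\<close> as a combination of all the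
  nonnegative entries with positive coefficients.\<close>

lemma vacuum_zero:
  assumes "A 0 0 = 0" "j < r + 2" "k < r + 2"
  shows "A j k = 0"
proof -
  have "(\<Sum>l<r + 2. \<Sum>m<r + 2. cc r 1 0 l * real (A l m) * cc r 1 m 0) = 0"
    using conj_eq[of 1 0 0] assms(1) r4 by simp
  moreover have "cc r 1 0 l * real (A l m) * cc r 1 m 0 = vac r l * real (A l m) * vac r m" for l m
  proof -
    have "cc r 1 0 l = (-1) ^ r * vac r l" "cc r 1 m 0 = (-1) ^ r * vac r m"
      using r4 cc_vac[of r] cc_sym[of r 1 m 0] by simp_all
    moreover have "(-1) ^ r * (-1) ^ r = (1 :: real)" by (simp flip: power_add mult_2)
    ultimately show ?thesis by (simp add: algebra_simps)
  qed
  ultimately have "(\<Sum>l<r + 2. \<Sum>m<r + 2. vac r l * real (A l m) * vac r m) = 0" by (simp only:)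
  then have "(\<Sum>m<r + 2. vac r j * real (A j m) * vac r m) = 0"
    using assms(2) by (subst (asm) sum_nonneg_eq_0_iff)
      (auto intro!: sum_nonneg mult_nonneg_nonneg less_imp_le[OF vac_pos])
  then have "vac r j * real (A j k) * vac r k = 0"
    using assms(3) by (subst (asm) sum_nonneg_eq_0_iff)
      (auto intro!: mult_nonneg_nonneg less_imp_le[OF vac_pos])
  then show ?thesis using vac_pos[of r j] vac_pos[of r k] by simp
qed

text \<open>Multiplication by the unit \<open>t\<close> turns each row of the cosine matrix into
  another row, up to a sign made of two parities. Conjugation therefore relates \<open>A j k\<close>
  to another entry with the product of two such signs, and both entries are nonnegative.\<close>

lemma parity_rule:
  assumes t: "coprime t n" and jk: "j < r" "k < r" and nz: "A j k \<noteq> 0"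
  shows "even ((r - j) + sres n (t * (r - j)) + (r - k) + sres n (t * (r - k)))"
proof -
  have odd: "odd n" by (simp add: n_def)
  define s where "s j = r - sres n (t * (r - j))" for j
  have s: "0 < sres n (t * (r - j)) \<and> sres n (t * (r - j)) \<le> r" if "j < r" for j
  proof -
    have "\<not> n dvd t * (r - j)"
      using t that by (auto simp: coprime_dvd_mult_right_iff coprime_commute n_def dest: dvd_imp_le)

    moreover have "2 * sres n (t * (r - j)) < n" using odd by (rule sres_bound)
    ultimately show ?thesis
      using sres_cases[of n "t * (r - j)"] odd
      by (auto simp: n_def cong_def dvd_eq_mod_eq_0 intro!: gr0I)
  qed
  have sj: "s j < r" "r - s j = sres n (t * (r - j))" if "j < r" for j
    using s[OF that] that by (auto simp: s_def)
  have row: "cc r t j l = (-1) ^ ((r - j) + (r - s j)) * cc r 1 (s j) l" if j: "j < r" for j l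
  proof -
    have "kern n t (r - j) (r - l) = kern n 1 (r - s j) (r - l)"
    proof -
      have "[int (sres n (t * (r - j))) = int (t * (r - j))] (mod int n) \<or>
          [int (sres n (t * (r - j))) = - int (t * (r - j))] (mod int n)"
        using sres_cases[of n "t * (r - j)"] odd
        unfolding cong_int_iff[symmetric] cong_iff_dvd_diff by (auto simp: n_def)
      then show ?thesis
      proof
        assume "[int (sres n (t * (r - j))) = int (t * (r - j))] (mod int n)"
        then have "[int (sres n (t * (r - j))) * int (r - l) = int (t * (r - j)) * int (r - l)] (mod int n)"
          by (rule cong_scalar_right)
        then show ?thesis using ck_cong[of n] sj(2)[OF j] unfolding kern_def by (simp add: n_def)
      next
        assume "[int (sres n (t * (r - j))) = - int (t * (r - j))] (mod int n)"
        then have "[int (sres n (t * (r - j))) * int (r - l) = - int (t * (r - j)) * int (r - l)] (mod int n)"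
          by (rule cong_scalar_right)
        then have "ck n (int (r - s j) * int (r - l)) = ck n (- (int t * int (r - j) * int (r - l)))"
          using ck_cong[of n] sj(2)[OF j] by (simp add: n_def)
        then show ?thesis unfolding kern_def by simp
      qed
    qed
    moreover have "xsign r j = (-1) ^ ((r - j) + (r - s j)) * xsign r (s j)"
    proof -
      have "(-1) ^ (r - s j) * (-1) ^ (r - s j) = (1 :: real)" by (simp flip: power_add mult_2)
      then show ?thesis using sj(1)[OF j] j unfolding power_add xsign_def dhalf_def by (simp only: if_True mult_1 mult.assoc mult_1_right)
    qed
    ultimately show ?thesis unfolding cc_def n_def[symmetric] by (simp only: mult.assoc)
  qed
  have "real n / 4 * real (A j k) = (\<Sum>l<r + 2. \<Sum>m<r + 2. cc r t j l * real (A l m) * cc r t m k)"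
    using conj_eq[OF t jk] by simp
  also have "\<dots> = (-1) ^ ((r - j) + (r - s j) + (r - k) + (r - s k)) *
      (\<Sum>l<r + 2. \<Sum>m<r + 2. cc r 1 (s j) l * real (A l m) * cc r 1 m (s k))"
    unfolding sum_distrib_left cc_sym[of r t _ k] row[OF jk(1)] row[OF jk(2)]
    by (intro sum.cong HOL.refl) (simp add: power_add cc_sym[of r "Suc 0" _ "s k"])
  also have "\<dots> = (-1) ^ ((r - j) + (r - s j) + (r - k) + (r - s k)) * (real n / 4 * real (A (s j) (s k)))"
    using conj_eq[of 1, OF _ sj(1)[OF jk(1)] sj(1)[OF jk(2)]] by simp
  finally have e: "real n / 4 * real (A j k) =
      (-1) ^ ((r - j) + (r - s j) + (r - k) + (r - s k)) * (real n / 4 * real (A (s j) (s k)))" .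
  have pos: "real n / 4 * real (A j k) > 0" using nz by (simp add: n_def)
  have "even ((r - j) + (r - s j) + (r - k) + (r - s k))"
  proof (rule ccontr)
    assume "odd ((r - j) + (r - s j) + (r - k) + (r - s k))"
    then have "real n / 4 * real (A j k) = - (real n / 4 * real (A (s j) (s k)))" using e by simp
    moreover have "real n / 4 * real (A (s j) (s k)) \<ge> 0" by simp
    ultimately show False using pos by linarith
  qed
  then show ?thesis using sj(2) jk by simp
qed

lemma vacuum_row:
  assumes "A 0 k \<noteq> 0" "k < r + 2"
  shows "k = 0 \<or> r = 7 \<and> k = 5"
proof -
  have odd: "odd n" and n9: "n \<ge> 9" using r4 by (auto simp: n_def)
  define b where "b = r - k"
  have sq': "[b * b = r * r] (mod n)" using sq[OF _ assms(2,1)] r4 by (auto simp: b_def intro: cong_sym)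
  have rr: "[2 * r + 1 = 0] (mod n)" by (simp add: n_def cong_def)
  have four: "[4 * (r * r) = 1] (mod n)"
  proof -
    have "int n dvd int (4 * (r * r)) - int 1"
      by (rule dvdI[of _ _ "2 * int r - 1"]) (simp add: n_def algebra_simps)
    then show ?thesis unfolding cong_int_iff[symmetric] cong_iff_dvd_diff .
  qed
  have "k < r"
  proof (rule ccontr)
    assume "\<not> k < r"
    then have "b = 0" by (simp add: b_def)
    then have "[0 = 4 * (r * r)] (mod n)" using cong_scalar_left[OF sq', of 4] by simp
    then have "[0 = 1] (mod n)" using four by (rule cong_trans)
    then show False using n9 by (simp add: cong_def)
  qed
  then have b: "0 < b" "b \<le> r" by (auto simp: b_def)
  \<comment> \<open>Multiplying residues by 2 takes the vacuum residue \<open>r\<close> to -1, so in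
    these units the vacuum is 1 and its partner is \<open>z\<close>, a square root of 1.\<close>
  define z where "z = sres n (2 * b)"
  have z: "z = (if 4 * b < n then 2 * b else n - 2 * b)" using b by (auto simp: z_def sres_def n_def)
  have zc: "[z = 2 * b] (mod n) \<or> [z + 2 * b = 0] (mod n)"
    unfolding z_def using n9 by (intro sres_cases) auto
  have zz: "[z * z = 1] (mod n)"
  proof -
    have "[int z * int z = (2 * int b) * (2 * int b)] (mod int n)"
      using zc
    proof
      assume "[z + 2 * b = 0] (mod n)"
      then have "[int z = - (2 * int b)] (mod int n)"
        unfolding cong_int_iff[symmetric] cong_iff_dvd_diff by simp
      from cong_mult[OF this this] show ?thesis by simp
    next
      assume "[z = 2 * b] (mod n)"
      from cong_mult[OF this this] show ?thesis unfolding cong_int_iff[symmetric] by simp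
    qed
    then have "[int (z * z) = int (4 * (b * b))] (mod int n)" by simp
    then have "[z * z = 4 * (b * b)] (mod n)" unfolding cong_int_iff .
    also have "[4 * (b * b) = 4 * (r * r)] (mod n)" using sq' by (rule cong_scalar_left)
    also note four
    finally show ?thesis .
  qed
  have step: "even (r + sres n t + b + sres n (t * z))" if t: "coprime t n" for t
  proof -
    \<comment> \<open>Using 2 t in \<open>parity_rule\<close> passes to the units in which the
      vacuum is 1.\<close>
    have "coprime (2 * t) n" using t odd by simp
    from parity_rule[OF this _ \<open>k < r\<close> assms(1)] r4
    have "even (r + sres n (2 * t * r) + b + sres n (2 * t * b))" by (simp add: b_def)
    moreover have "sres n (2 * t * r) = sres n t"
      using cong_scalar_left[OF rr, of t] by (intro sres_cong_minus odd) (simp add: algebra_simps)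
    moreover have "sres n (2 * t * b) = sres n (t * z)"
      using zc
    proof
      assume "[z = 2 * b] (mod n)"
      from cong_scalar_left[OF this, of t] show ?thesis
        by (intro sres_cong) (simp add: cong_sym algebra_simps)
    next
      assume "[z + 2 * b = 0] (mod n)"
      from cong_scalar_left[OF this, of t] show ?thesis
        by (intro sres_cong_minus odd) (simp add: algebra_simps)
    qed
    ultimately show ?thesis by simp
  qed
  have z1: "1 \<le> z" "2 * z < n"
    using z b sres_bound[OF odd, of "2 * b"] unfolding z_def[symmetric] by (auto simp: n_def)
  \<comment> \<open>The case t = 1 trades the parity of r + b for that of z + 1, the form that
    \<open>parity_root_exceptional\<close> expects.\<close>
  have "even (r + 1 + b + z)" using step[of 1] n9 z1 by (simp add: sres_small)
  then have par: "even (sres n (t * z) + sres n t + z + 1)" if "coprime t n" for t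
    using step[OF that] by presburger
  show ?thesis
  proof (cases "z = 1")
    case True
    then have "b = r" using z b by (auto simp: n_def split: if_splits)
    then show ?thesis using \<open>k < r\<close> unfolding b_def by linarith
  next
    case False
    then have "z > 1" using z1 by simp
    from parity_root_exceptional[OF odd n9 this z1(2) zz par]
    have "n = 15" "z = 4" by auto
    then have "r = 7" by (simp add: n_def)
    have "b = 2" using z \<open>n = 15\<close> \<open>z = 4\<close> by (simp split: if_splits) presburger
    then show ?thesis using \<open>r = 7\<close> unfolding b_def by arith
  qed
qed

end

section \<open>The possible X-parts: permutations and the case n = 15\<close>

lemma sum_nine:
  fixes f :: "nat \<Rightarrow> real"
  shows "(\<Sum>k<7 + 2. f k) = f 0 + f 1 + f 2 + f 3 + f 4 + f 5 + f 6 + f 7 + f 8"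
  by (simp add: sum.lessThan_Suc eval_nat_numeral)

text \<open>Modulo 15, multiplication by 4 exchanges, up to sign, the residues 7 and 2 (indices 0
  and 5) and the residues 4 and 1 (indices 3 and 6). The other residues are divisible by 3 or 5 and
  fixed up to sign, so in those columns rows 0 and 5 differ only by their opposite
  \<open>xsign\<close>.\<close>

lemma cc7:
  "l \<in> {1, 2, 4, 7, 8} \<Longrightarrow> cc 7 1 5 l = - cc 7 1 0 l"
  "cc 7 1 5 5 = cc 7 1 0 0" "cc 7 1 5 3 = cc 7 1 0 6" "cc 7 1 5 6 = cc 7 1 0 3"
proof -
  have c: "ck 15 a = ck 15 b" if "[a = b] (mod 15) \<or> [a = - b] (mod 15)" for a b
    using that ck_cong[of 15 a b] ck_cong[of 15 a "- b"] by auto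
  show "l \<in> {1, 2, 4, 7, 8} \<Longrightarrow> cc 7 1 5 l = - cc 7 1 0 l"
    using c[of 42 12] c[of 35 10] c[of 21 6] by (auto simp: cc_def kern_def xsign_def dhalf_def cong_def)
  show "cc 7 1 5 5 = cc 7 1 0 0" "cc 7 1 5 3 = cc 7 1 0 6" "cc 7 1 5 6 = cc 7 1 0 3"
    using c[of 4 49] c[of 8 7] c[of 2 28] by (auto simp: cc_def kern_def xsign_def dhalf_def cong_def)
qed

text \<open>For r = 4 triality exchanges the indices 1, 4 and 5; otherwise only the pair of residue
  0 can be swapped, as C_1 does.\<close>

definition X_auts :: "nat \<Rightarrow> (nat \<Rightarrow> nat) set" where
  "X_auts r = (if r = 4 then {\<pi>. \<pi> permutes {1, 4, 5}} else {id, Transposition.transpose r (r + 1)})"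

definition perm_mat :: "('a \<Rightarrow> 'a) \<Rightarrow> 'a \<Rightarrow> 'a \<Rightarrow> nat" where
  "perm_mat \<pi> x y = (if y = \<pi> x then 1 else 0)"

text \<open>The two blocks are the classes of residues exchanged by the square root 4 of 1 modulo
  15; indices with residue divisible by 3 or 5 are projected out.\<close>

definition X_exc :: "nat \<Rightarrow> nat \<Rightarrow> nat" where
  "X_exc j k = (if {j, k} \<subseteq> {0, 5} \<or> {j, k} \<subseteq> {3, 6} then 1 else 0)"

text \<open>The cosine is injective on [0, pi]. An index below \<open>r\<close> can tie with the
  half-weighted ones only through cos (pi / 3) = 1/2.\<close>

lemma vac_eqD:
  assumes "vac r j = vac r k" "j < r"
  shows "if k < r then j = k else 3 * (r - j) = 2 * r + 1"
proof -
  define x where "x l = real (r - l) / real (2 * r + 1)" for l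
  have x: "0 \<le> pi * x l" "pi * x l \<le> pi" for l
  proof -
    have "0 \<le> x l" "x l \<le> 1" by (simp_all add: x_def divide_simps)
    then show "0 \<le> pi * x l" "pi * x l \<le> pi" using mult_left_mono[of "x l" 1 pi] by simp_all
  qed
  have v: "vac r l = dhalf r l * cos (pi * x l)" for l by (simp add: vac_def x_def)
  show ?thesis
  proof (cases "k < r")
    case True
    then have "cos (pi * x j) = cos (pi * x k)" using assms by (simp add: v dhalf_def)
    then have "pi * x j = pi * x k" using x by (rule_tac cos_inj_pi)
    then have "real (r - j) = real (r - k)" by (simp add: x_def del: of_nat_diff of_nat_add)
    then have "r - j = r - k" by (simp only: of_nat_eq_iff)
    then have "j = k" using True assms(2) by linarith
    then show ?thesis using True by simp
  next
    case False
    then have "x k = 0" by (simp add: x_def)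
    then have "cos (pi * x j) = cos (pi / 3)"
      using assms False by (simp add: v dhalf_def cos_60)
    then have "pi * x j = pi / 3" using x by (rule_tac cos_inj_pi) auto
    then have "x j = 1 / 3" by (metis mult.right_neutral nonzero_mult_div_cancel_left pi_neq_zero times_divide_eq_right)
    then have "3 * real (r - j) = real (2 * r + 1)" unfolding x_def by (simp add: divide_eq_eq del: of_nat_diff)
    then have "real (3 * (r - j)) = real (2 * r + 1)" by (simp del: of_nat_diff)
    then have "3 * (r - j) = 2 * r + 1" by (simp only: of_nat_eq_iff)
    then show ?thesis using False by simp
  qed
qed

context X_commutant
begin

text \<open>Commutation in column 0, where \<open>A\<close> has the single entry 1, makes
  \<open>vac\<close> an eigenvector with eigenvalue 1.\<close>

lemma vacuum_rows_sum:
  assumes col: "\<forall>k<r + 2. A k 0 = (if k = 0 then 1 else 0)" and j: "j < r + 2"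
  shows "(\<Sum>k<r + 2. real (A j k) * vac r k) = vac r j"
proof -
  have v: "cc r 1 k 0 = (-1) ^ r * vac r k" for k using cc_vac[of r k] cc_sym[of r 1 k 0] r4 by simp
  have "(\<Sum>k<r + 2. real (A j k) * cc r 1 k 0) = (\<Sum>k<r + 2. cc r 1 j k * real (A k 0))"
    using col j r4 by (intro comm_real) auto
  also have "\<dots> = (\<Sum>k<r + 2. if k = 0 then cc r 1 j 0 else 0)"
    using col by (intro sum.cong) auto
  also have "\<dots> = cc r 1 j 0" by simp
  finally have "(-1) ^ r * (\<Sum>k<r + 2. real (A j k) * vac r k) = (-1) ^ r * vac r j"
    unfolding v sum_distrib_left by (simp only: mult.left_commute)
  then show ?thesis by simp
qed

text \<open>The vacuum column of \<open>S\<close> is a positive eigenvector of \<open>A\<close> and \<open>A\<^sup>T\<close>, so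
  \<open>A A\<^sup>T\<close> has diagonal entries at most 1.\<close>

lemma permutation_rows:
  assumes row: "\<forall>k<r + 2. A 0 k = (if k = 0 then 1 else 0)"
    and col: "\<forall>k<r + 2. A k 0 = (if k = 0 then 1 else 0)"
  obtains \<pi> where "\<pi> permutes {..<r + 2}" "\<And>j k. j < r + 2 \<Longrightarrow> k < r + 2 \<Longrightarrow> A j k = perm_mat \<pi> j k"
    "\<And>j. vac r (\<pi> j) = vac r j"
proof -
  interpret T: X_commutant r n "\<lambda>j k. A k j" by (rule transposed)
  have rs: "(\<Sum>k<r + 2. real (A j k) * vac r k) = vac r j" if "j < r + 2" for j
    using vacuum_rows_sum[OF col that] .
  have cs: "(\<Sum>j<r + 2. real (A j k) * vac r j) = vac r k" if "k < r + 2" for k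
    using T.vacuum_rows_sum[OF row that] .
  have "\<exists>l<r + 2. A j l = 1 \<and> (\<forall>k<r + 2. k \<noteq> l \<longrightarrow> A j k = 0)" if j: "j < r + 2" for j
  proof -
    \<comment> \<open>The right-hand side is entry \<open>j\<close> of A A^T applied to
      \<open>vac\<close>; keeping only its diagonal term bounds the sum of squares of row
      \<open>j\<close> by 1.\<close>
    have "(\<Sum>l<r + 2. real (A j l * A j l)) * vac r j \<le> (\<Sum>l<r + 2. real (A j l) * (\<Sum>k<r + 2. real (A k l) * vac r k))"
      unfolding sum_distrib_right
    proof (rule sum_mono)
      fix l assume "l \<in> {..<r + 2}"
      have "real (A j l) * vac r j \<le> (\<Sum>k<r + 2. real (A k l) * vac r k)"
        using j by (intro member_le_sum) (auto intro!: mult_nonneg_nonneg less_imp_le[OF vac_pos])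
      then have "real (A j l) * (real (A j l) * vac r j) \<le> real (A j l) * (\<Sum>k<r + 2. real (A k l) * vac r k)"
        by (intro mult_left_mono) auto
      then show "real (A j l * A j l) * vac r j \<le> real (A j l) * (\<Sum>k<r + 2. real (A k l) * vac r k)"
        by (simp add: mult.assoc)
    qed
    also have "\<dots> = (\<Sum>l<r + 2. real (A j l) * vac r l)" using cs by (intro sum.cong) auto
    also have "\<dots> = vac r j" using rs[OF j] .
    finally have "(\<Sum>l<r + 2. real (A j l * A j l)) \<le> 1" using vac_pos[of r j] by simp
    then have le: "(\<Sum>l<r + 2. A j l * A j l) \<le> 1" unfolding of_nat_sum[symmetric] by linarith
    have "\<exists>l<r + 2. A j l \<noteq> 0"
    proof (rule ccontr)
      assume "\<not> ?thesis"
      then have "(\<Sum>k<r + 2. real (A j k) * vac r k) = 0" by (intro sum.neutral) auto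
      then show False using rs[OF j] vac_pos[of r j] by simp
    qed
    then obtain l where l: "l < r + 2" "A j l \<noteq> 0" by blast
    have split: "(\<Sum>k<r + 2. A j k * A j k) = A j l * A j l + (\<Sum>k\<in>{..<r + 2} - {l}. A j k * A j k)"
      using l by (intro sum.remove) auto
    have "A j l * A j l \<ge> 1" using l by (simp add: Suc_leI)
    then have "A j l * A j l = 1" "(\<Sum>k\<in>{..<r + 2} - {l}. A j k * A j k) = 0" using le split by linarith+
    then show ?thesis using l by auto
  qed
  then obtain f where f: "\<And>j. j < r + 2 \<Longrightarrow> f j < r + 2 \<and> A j (f j) = 1 \<and> (\<forall>k<r + 2. k \<noteq> f j \<longrightarrow> A j k = 0)"
    by metis
  define \<pi> where "\<pi> j = (if j < r + 2 then f j else j)" for j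
  have A: "A j k = perm_mat \<pi> j k" if "j < r + 2" "k < r + 2" for j k
    using f[OF that(1)] that by (auto simp: \<pi>_def perm_mat_def)
  have "{..<r + 2} \<subseteq> \<pi> ` {..<r + 2}"
  proof
    fix k assume k: "k \<in> {..<r + 2}"
    show "k \<in> \<pi> ` {..<r + 2}"
    proof (rule ccontr)
      assume "k \<notin> \<pi> ` {..<r + 2}"
      then have "(\<Sum>j<r + 2. real (A j k) * vac r j) = 0"
        using A k by (intro sum.neutral) (auto simp: perm_mat_def)
      then show False using cs[of k] k vac_pos[of r k] by simp
    qed
  qed
  moreover have "\<pi> ` {..<r + 2} \<subseteq> {..<r + 2}" using f by (auto simp: \<pi>_def)
  ultimately have im: "\<pi> ` {..<r + 2} = {..<r + 2}" by blast
  have "inj_on \<pi> {..<r + 2}" by (rule eq_card_imp_inj_on) (auto simp: im)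
  then have "\<pi> permutes {..<r + 2}"
    using im by (intro bij_imp_permutes) (auto simp: bij_betw_def \<pi>_def)
  moreover have "vac r (\<pi> j) = vac r j" for j
  proof (cases "j < r + 2")
    case True
    have "(\<Sum>k<r + 2. real (A j k) * vac r k) = (\<Sum>k<r + 2. if k = \<pi> j then vac r k else 0)"
      using A True by (intro sum.cong) (auto simp: perm_mat_def)
    also have "\<dots> = vac r (\<pi> j)" using f[OF True] True by (simp add: \<pi>_def)
    finally show ?thesis using rs[OF True] by simp
  qed (simp add: \<pi>_def)
  ultimately show ?thesis using that A by blast
qed

text \<open>Equal vacuum entries leave one ambiguity, between the residue n / 3 and the pair of
  residue 0. Unless n = 9 it is refuted in the column of residue 3, where all three cosines are 1
  but the weights are 1 and 1/2 up to sign.\<close>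

lemma automorphism:
  assumes row: "\<forall>k<r + 2. A 0 k = (if k = 0 then 1 else 0)"
    and col: "\<forall>k<r + 2. A k 0 = (if k = 0 then 1 else 0)"
  shows "\<exists>\<pi>\<in>X_auts r. \<forall>j<r + 2. \<forall>k<r + 2. A j k = perm_mat \<pi> j k"
proof -
  obtain \<pi> where \<pi>: "\<pi> permutes {..<r + 2}" and A: "\<And>j k. j < r + 2 \<Longrightarrow> k < r + 2 \<Longrightarrow> A j k = perm_mat \<pi> j k"
    and v: "\<And>j. vac r (\<pi> j) = vac r j"
    by (rule permutation_rows[OF row col]) blast
  have fix_or: "\<pi> j = j \<or> 3 * (r - j) = n \<and> \<pi> j \<ge> r" if "j < r" for j
    using vac_eqD[OF v[of j, symmetric] that] by (auto simp: n_def split: if_splits)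
  have lt: "\<pi> j < r + 2" if "j < r + 2" for j using permutes_in_image[OF \<pi>, of j] that by simp
  show ?thesis
  proof (cases "r = 4")
    case True
    then have "\<pi> j = j" if "j \<in> {..<r + 2} - {1, 4, 5}" for j
      using fix_or[of j] that by (auto simp: n_def)
    then have "\<pi> permutes {1, 4, 5}" using permutes_superset[OF \<pi>, of "{1, 4, 5}"] by blast
    then show ?thesis using A True by (auto simp: X_auts_def)
  next
    case False
    have "\<pi> j = j" if j: "j < r" for j
    proof (rule ccontr)
      assume "\<pi> j \<noteq> j"
      then have j3: "3 * (r - j) = n" and \<pi>j: "\<pi> j \<ge> r" using fix_or[OF j] by auto
      define l where "l = r - 3"
      have l: "l < r" "r - l = 3" using r4 by (auto simp: l_def)
      \<comment> \<open>For n = 9 the residue 3 would itself be n / 3; otherwise it is fixed and can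
        serve as a test column.\<close>
      have "n \<noteq> 9" using False by (simp add: n_def)
      then have \<pi>l: "\<pi> l = l" using fix_or[OF l(1)] l(2) by auto
      have "(\<Sum>k<r + 2. real (A j k) * cc r 1 k l) = (\<Sum>k<r + 2. cc r 1 j k * real (A k l))"
        using j l by (intro comm_real) auto
      also have "(\<Sum>k<r + 2. real (A j k) * cc r 1 k l) = (\<Sum>k<r + 2. if k = \<pi> j then cc r 1 k l else 0)"
        using A j by (intro sum.cong) (auto simp: perm_mat_def)
      also have "\<dots> = cc r 1 (\<pi> j) l" using lt[of j] j by simp
      also have "(\<Sum>k<r + 2. cc r 1 j k * real (A k l)) = (\<Sum>k<r + 2. if k = l then cc r 1 j k else 0)"
      proof (rule sum.cong[OF HOL.refl])
        fix k assume "k \<in> {..<r + 2}"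
        moreover have "\<pi> k = l \<longleftrightarrow> k = l" using \<pi>l permutes_inj[OF \<pi>] by (metis injD)
        ultimately show "cc r 1 j k * real (A k l) = (if k = l then cc r 1 j k else 0)"
          using A[of k l] l by (auto simp: perm_mat_def)
      qed
      also have "\<dots> = cc r 1 j l" using l by simp
      finally have eq: "cc r 1 (\<pi> j) l = cc r 1 j l" .
      have "xsign r l \<noteq> 0" by (simp add: xsign_def dhalf_def)
      moreover have "kern (2 * r + 1) 1 (r - j) (r - l) = 1"
      proof -
        have *: "int 1 * int (r - j) * int (r - l) = int n" using j3 l by simp
        show ?thesis using ck_cong[of n "int n" 0] unfolding kern_def n_def[symmetric] *
          by (simp add: n_def cong_def)
      qed
      moreover have "r - \<pi> j = 0" using \<pi>j by simp
      ultimately have "xsign r (\<pi> j) = xsign r j" using eq by (simp add: cc_def)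
      then have "1 / 2 = (-1 :: real) ^ (r - j)" using \<pi>j j by (simp add: xsign_def dhalf_def)
      then show False by (cases "even (r - j)") auto
    qed
    then have "\<forall>x\<in>{..<r + 2} - {r, r + 1}. \<pi> x = x" by auto
    then have "\<pi> permutes {r, r + 1}" using permutes_superset[OF \<pi>, of "{r, r + 1}"] by blast
    then have "\<pi> \<in> {id, Transposition.transpose r (r + 1)}" unfolding permutes_doubleton_iff by simp
    then show ?thesis using A False unfolding X_auts_def by auto
  qed
qed

lemma comm_real_7:
  assumes "r = 7" "j < 9" "l < 9" "l < 7 \<or> A j 7 = 0 \<and> A j 8 = 0" "j < 7 \<or> A 7 l = 0 \<and> A 8 l = 0"
  shows "(\<Sum>k<7 + 2. real (A j k) * cc 7 1 k l) = (\<Sum>k<7 + 2. cc 7 1 j k * real (A k l))"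
  using comm_real[of j l] assms(2-) unfolding assms(1) by simp

text \<open>Rows 0 and 5 of X are opposite in the listed columns. A vacuum row with entries 1 and p
  thus gives 1 - p times a positive number there, and this equals a positive combination of the
  entries of the column. Hence p is 1 and the column is 0.\<close>

lemma exceptional_zero_col:
  assumes r7: "r = 7" and 1: "A 0 0 = 1" and p: "A 0 5 \<noteq> 0"
  shows "A 0 5 = 1" "\<And>k l. k < 9 \<Longrightarrow> l \<in> {1, 2, 4, 7, 8} \<Longrightarrow> A k l = 0"
proof -
  have z: "A 0 k = 0" if "k \<in> {1, 2, 3, 4, 6, 7, 8}" for k
  proof (rule ccontr)
    assume "A 0 k \<noteq> 0"
    from vacuum_row[OF this] that r7 show False by auto
  qed
  have e: "(1 - real (A 0 5)) * vac 7 l = (\<Sum>k<9. vac 7 k * real (A k l))" if l: "l \<in> {1, 2, 4, 7, 8}" for l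
  proof -
    have "(\<Sum>k<7 + 2. real (A 0 k) * cc 7 1 k l) = (\<Sum>k<7 + 2. cc 7 1 0 k * real (A k l))"
      using l z[of 7] z[of 8] by (intro comm_real_7[OF r7]) auto
    moreover have "(\<Sum>k<7 + 2. real (A 0 k) * cc 7 1 k l) = cc 7 1 0 l + real (A 0 5) * cc 7 1 5 l"
      unfolding sum_nine by (simp add: z 1)
    ultimately show ?thesis
      using cc7(1)[OF l] cc_vac[of 7] by (simp add: algebra_simps sum_negf)
  qed
  have nonneg: "vac 7 k * real m \<ge> 0" for k m
    by (intro mult_nonneg_nonneg less_imp_le[OF vac_pos]) auto
  have "(1 - real (A 0 5)) * vac 7 4 = (\<Sum>k<9. vac 7 k * real (A k 4))" by (rule e) simp
  also have "\<dots> \<ge> 0" by (intro sum_nonneg nonneg)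
  finally have "0 \<le> (1 - real (A 0 5)) * vac 7 4" .
  then have "real (A 0 5) \<le> 1" using vac_pos[of 7 4] by (simp add: zero_le_mult_iff not_le)
  then show p1: "A 0 5 = 1" using p by simp
  fix k l :: nat assume k: "k < 9" and l: "l \<in> {1, 2, 4, 7, 8}"
  have "(\<Sum>k<9. vac 7 k * real (A k l)) = 0" using e[OF l] p1 by simp
  then have "vac 7 k * real (A k l) = 0"
    using k by (subst (asm) sum_nonneg_eq_0_iff) (auto intro: nonneg)
  then show "A k l = 0" using vac_pos[of 7 k] by simp
qed

lemma exceptional:
  assumes r7: "r = 7" and 1: "A 0 0 = 1" and p: "A 0 5 \<noteq> 0"
  shows "j < 9 \<Longrightarrow> k < 9 \<Longrightarrow> A j k = X_exc j k"
proof -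
  interpret T: X_commutant r n "\<lambda>j k. A k j" by (rule transposed)
  note zc = exceptional_zero_col(2)[OF r7 1 p] and p1 = exceptional_zero_col(1)[OF r7 1 p]
  have z: "A 0 k = 0" "A k 0 = 0" if "k \<in> {1, 2, 3, 4, 6, 7, 8}" for k
  proof -
    show "A 0 k = 0"
    proof (rule ccontr)
      assume "A 0 k \<noteq> 0"
      from vacuum_row[OF this] that r7 show False by auto
    qed
    show "A k 0 = 0"
    proof (rule ccontr)
      assume "A k 0 \<noteq> 0"
      from T.vacuum_row[OF this] that r7 show False by auto
    qed
  qed
  have v: "cc 7 1 0 l = - vac 7 l" "cc 7 1 l 0 = - vac 7 l" for l
    using cc_vac[of 7 l] cc_sym[of 7 1 l 0] by auto
  have "A 5 0 = A 0 5"
  proof -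
    have "(\<Sum>k<7 + 2. real (A 0 k) * cc 7 1 k 0) = (\<Sum>k<7 + 2. cc 7 1 0 k * real (A k 0))"
      by (rule comm_real_7[OF r7]) auto
    then show ?thesis unfolding sum_nine v using vac_pos[of 7 5] by (simp add: z 1)
  qed
  then have q: "A 5 0 = 1" using p1 by simp
  have zr: "A l k = 0" if "k < 9" "l \<in> {1, 2, 4, 7, 8}" for k l
    using T.exceptional_zero_col(2)[OF r7 1 _ that] q by simp
  \<comment> \<open>The residues 7 and 2 have square 4 modulo 15, the residues 4 and 1 have square
    1.\<close>
  have sqz: "A j k = 0" if "j \<in> {0, 5} \<and> k \<in> {3, 6} \<or> j \<in> {3, 6} \<and> k \<in> {0, 5}" for j k
    using sq[of j k] that r7 by (cases "A j k = 0") (auto simp: cong_def n_def)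
  have A55: "A 5 5 = 1"
  proof -
    have "(\<Sum>k<7 + 2. real (A 5 k) * cc 7 1 k 0) = (\<Sum>k<7 + 2. cc 7 1 5 k * real (A k 0))"
      by (rule comm_real_7[OF r7]) auto
    then have "cc 7 1 0 0 + real (A 5 5) * cc 7 1 5 0 = cc 7 1 5 0 + cc 7 1 5 5"
      unfolding sum_nine by (simp add: z 1 q zc sqz)
    then have "- vac 7 0 + real (A 5 5) * - vac 7 5 = - vac 7 5 + - vac 7 0" unfolding cc7(2) v .
    then show ?thesis using vac_pos[of 7 5] by simp
  qed
  have bounds: "vac 7 3 < vac 7 6" "vac 7 6 < 2 * vac 7 3"
  proof -
    show "vac 7 3 < vac 7 6" unfolding vac_def dhalf_def by (auto intro!: cos_monotone_0_pi)
    have "cos (pi / 3) < cos (4 * pi / 15)" by (intro cos_monotone_0_pi) (auto simp: field_simps)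
    then have "1 < 2 * cos (4 * pi / 15)" by (simp add: cos_60)
    then have "cos (pi / 15) < 2 * cos (4 * pi / 15)" using cos_le_one[of "pi / 15"] by linarith
    then show "vac 7 6 < 2 * vac 7 3" by (simp add: vac_def dhalf_def mult.commute)
  qed
  \<comment> \<open>The ratio of the two vacuum entries lies strictly between 1 and 2: for y = 0 it
    would put x strictly between 2 and 3, and for y at least 2 the right-hand side is too
    large.\<close>
  have solve: "x = 1 \<and> y = 1" if e: "vac 7 3 + vac 7 6 = vac 7 3 * real x + vac 7 6 * real y" for x y :: nat
  proof -
    consider "y = 0" | "y = 1" | "y \<ge> 2" by linarith
    then show ?thesis
    proof cases
      case 1
      then have "vac 7 3 * real x = vac 7 3 + vac 7 6" using e by simp
      then have "vac 7 3 * 2 < vac 7 3 * real x" "vac 7 3 * real x < vac 7 3 * 3"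
        using bounds by linarith+
      then have "2 < real x" "real x < 3"
        using vac_pos[of 7 3] by (simp_all only: mult_less_cancel_left_pos)
      then have "2 < x" "x < 3" by simp_all
      then show ?thesis by simp
    next
      case 2
      then show ?thesis using e vac_pos[of 7 3] by simp
    next
      case 3
      then have "vac 7 6 * 2 \<le> vac 7 6 * real y" using vac_pos[of 7 6] by (intro mult_left_mono) auto
      moreover have "0 \<le> vac 7 3 * real x" using vac_pos[of 7 3] by simp
      ultimately show ?thesis using e bounds by linarith
    qed
  qed
  have 3: "A 3 3 = 1 \<and> A 6 3 = 1"
  proof -
    have "(\<Sum>k<7 + 2. real (A 0 k) * cc 7 1 k 3) = (\<Sum>k<7 + 2. cc 7 1 0 k * real (A k 3))"
      by (rule comm_real_7[OF r7]) auto
    then have "cc 7 1 0 3 + cc 7 1 5 3 = cc 7 1 0 3 * real (A 3 3) + cc 7 1 0 6 * real (A 6 3)"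
      unfolding sum_nine by (simp add: z 1 p1 zr sqz)
    then show ?thesis unfolding cc7 v by (intro solve) linarith
  qed
  have 6: "A 3 6 = 1 \<and> A 6 6 = 1"
  proof -
    have "(\<Sum>k<7 + 2. real (A 0 k) * cc 7 1 k 6) = (\<Sum>k<7 + 2. cc 7 1 0 k * real (A k 6))"
      by (rule comm_real_7[OF r7]) auto
    then have "cc 7 1 0 6 + cc 7 1 5 6 = cc 7 1 0 3 * real (A 3 6) + cc 7 1 0 6 * real (A 6 6)"
      unfolding sum_nine by (simp add: z 1 p1 zr sqz)
    then show ?thesis unfolding cc7 v by (intro solve) linarith
  qed
  assume jk: "j < 9" "k < 9"
  consider "j \<in> {1, 2, 4, 7, 8}" | "k \<in> {1, 2, 4, 7, 8}"
    | "j \<in> {0, 5} \<and> k \<in> {3, 6} \<or> j \<in> {3, 6} \<and> k \<in> {0, 5}"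
    | "j \<in> {0, 5} \<and> k \<in> {0, 5}" | "j \<in> {3, 6} \<and> k \<in> {3, 6}"
  proof -
    have "i \<in> {1, 2, 4, 7, 8} \<or> i \<in> {0, 5} \<or> i \<in> {3, 6}" if "i < 9" for i :: nat
      using that by auto
    then show ?thesis using that jk by metis
  qed
  then show "A j k = X_exc j k"
  proof cases
    case 1
    then show ?thesis using zr[OF jk(2) 1] by (auto simp: X_exc_def)
  next
    case 2
    then show ?thesis using zc[OF jk(1) 2] by (auto simp: X_exc_def)
  next
    case 3
    then show ?thesis using sqz[OF 3] by (auto simp: X_exc_def)
  next
    case 4
    then show ?thesis using 1 p1 q A55 by (auto simp: X_exc_def)
  next
    case 5
    then show ?thesis using \<open>A 3 3 = 1 \<and> A 6 3 = 1\<close> 6 by (auto simp: X_exc_def)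
  qed
qed

theorem classification:
  assumes "A 0 0 = 1"
  shows "(\<exists>\<pi>\<in>X_auts r. \<forall>j<r + 2. \<forall>k<r + 2. A j k = perm_mat \<pi> j k) \<or>
    r = 7 \<and> (\<forall>j<r + 2. \<forall>k<r + 2. A j k = X_exc j k)"
proof -
  interpret T: X_commutant r n "\<lambda>j k. A k j" by (rule transposed)
  consider "r = 7" "A 0 5 \<noteq> 0" | "r = 7" "A 5 0 \<noteq> 0" | "r = 7 \<longrightarrow> A 0 5 = 0 \<and> A 5 0 = 0"
    by (cases "r = 7"; cases "A 0 5 = 0"; cases "A 5 0 = 0") simp_all
  then show ?thesis
  proof cases
    case 1
    then show ?thesis using exceptional[OF 1(1) assms 1(2)] by (intro disjI2 conjI allI impI) simp_all
  next
    case 2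
    have "X_exc j k = X_exc k j" for j k by (auto simp: X_exc_def)
    then have "A j k = X_exc j k" if "j < 9" "k < 9" for j k
      using T.exceptional[OF 2(1) assms 2(2) that(2,1)] by simp
    then show ?thesis using 2(1) by (intro disjI2 conjI allI impI) simp_all
  next
    case 3
    have "\<exists>\<pi>\<in>X_auts r. \<forall>j<r + 2. \<forall>k<r + 2. A j k = perm_mat \<pi> j k"
    proof (rule automorphism)
      show "\<forall>k<r + 2. A 0 k = (if k = 0 then 1 else 0)"
      proof (intro allI impI)
        fix k assume k: "k < r + 2"
        show "A 0 k = (if k = 0 then 1 else 0)"
        proof (cases "A 0 k = 0")
          case True
          then show ?thesis using assms by (cases "k = 0") auto
        next
          case False
          from vacuum_row[OF this k] have "k = 0" using False 3 by blast
          then show ?thesis using assms by simp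
        qed
      qed
      show "\<forall>k<r + 2. A k 0 = (if k = 0 then 1 else 0)"
      proof (intro allI impI)
        fix k assume k: "k < r + 2"
        show "A k 0 = (if k = 0 then 1 else 0)"
        proof (cases "A k 0 = 0")
          case True
          then show ?thesis using assms by (cases "k = 0") auto
        next
          case False
          from T.vacuum_row[OF this k] have "k = 0" using False 3 by blast
          then show ?thesis using assms by simp
        qed
      qed
    qed
    then show ?thesis ..
  qed
qed

end

section \<open>The simple current part\<close>

text \<open>Exchanges the spinor currents. It is the current part both of C_1 and of
  \<open>I_v\<close>; the X-part of \<open>I_v\<close> is trivial, that of C_1 is not.\<close>

definition gC :: "bool \<times> bool \<Rightarrow> bool \<times> bool" where
  "gC g = (fst g, snd g \<noteq> fst g)"

abbreviation g_e :: "bool \<times> bool" where "g_e \<equiv> (False, False)"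
abbreviation g_v :: "bool \<times> bool" where "g_v \<equiv> (False, True)"
abbreviation g_s :: "bool \<times> bool" where "g_s \<equiv> (True, False)"
abbreviation g_c :: "bool \<times> bool" where "g_c \<equiv> (True, True)"

text \<open>Coefficients of \<chi>_e + \<chi>_a times the conjugate of \<chi>_e + \<chi>_b: an
  extension by a spinor current on either side.\<close>

definition ext_mat :: "bool \<times> bool \<Rightarrow> bool \<times> bool \<Rightarrow> bool \<times> bool \<Rightarrow> bool \<times> bool \<Rightarrow> nat" where
  "ext_mat a b g h = (if g \<in> {g_e, a} \<and> h \<in> {g_e, b} then 1 else 0)"

text \<open>For r congruent to 4 modulo 8 the three nontrivial currents all have twist -1 and G is
  unchanged by permuting them; for 8 dividing \<open>r\<close> the spinor currents have twist 1 and
  can couple to the vacuum.\<close>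

definition G_invs :: "nat \<Rightarrow> (bool \<times> bool \<Rightarrow> bool \<times> bool \<Rightarrow> nat) set" where
  "G_invs r = {perm_mat id, perm_mat gC}
     \<union> (if r mod 8 = 4 then {perm_mat \<tau> | \<tau>. bij \<tau> \<and> \<tau> g_e = g_e} else {})
     \<union> (if 8 dvd r then {ext_mat a b | a b. a \<in> {g_s, g_c} \<and> b \<in> {g_s, g_c}} else {})"

lemma G_invs_cases:
  assumes "m \<in> G_invs r"
  shows "(\<exists>\<tau>. \<tau> g_e = g_e \<and> bij \<tau> \<and> m = perm_mat \<tau>) \<or>
    (\<exists>a\<in>{g_s, g_c}. \<exists>b\<in>{g_s, g_c}. m = ext_mat a b)"
proof -
  have "bij gC" by (rule involuntory_imp_bij) (auto simp: gC_def)
  moreover have "gC g_e = g_e" "id g_e = g_e" "bij (id :: bool \<times> bool \<Rightarrow> _)" by (auto simp: gC_def)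
  moreover from assms have "m = perm_mat id \<or> m = perm_mat gC \<or> (\<exists>\<tau>. m = perm_mat \<tau> \<and> bij \<tau> \<and> \<tau> g_e = g_e) \<or>
     (\<exists>a\<in>{g_s, g_c}. \<exists>b\<in>{g_s, g_c}. m = ext_mat a b)"
    unfolding G_invs_def by (auto split: if_splits)
  ultimately show ?thesis by metis
qed

lemma sum_pair:
  fixes f :: "bool \<times> bool \<Rightarrow> complex"
  assumes "a \<in> {g_s, g_c}" "\<And>g. g \<notin> {g_e, a} \<Longrightarrow> f g = 0"
  shows "(\<Sum>g\<in>UNIV. f g) = f g_e + f a"
proof -
  have "(\<Sum>g\<in>UNIV. f g) = (\<Sum>g\<in>{g_e, a}. f g)"
    using assms(2) by (intro sum.mono_neutral_right) auto
  then show ?thesis using assms(1) by auto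
qed

lemma perm_mat_of_sums:
  fixes m :: "'a::finite \<Rightarrow> 'a \<Rightarrow> nat"
  assumes "\<And>g. (\<Sum>h\<in>UNIV. m g h) = 1" "\<And>h. (\<Sum>g\<in>UNIV. m g h) = 1"
  obtains \<tau> where "bij \<tau>" "m = perm_mat \<tau>"
proof -
  have "\<exists>h. m g h = 1 \<and> (\<forall>h'. h \<noteq> h' \<longrightarrow> m g h' = 0)" for g
    using assms(1)[of g] sum_eq_1_iff[of UNIV "m g"] by auto
  then obtain \<tau> where \<tau>: "\<And>g. m g (\<tau> g) = 1 \<and> (\<forall>h'. \<tau> g \<noteq> h' \<longrightarrow> m g h' = 0)"
    by metis
  have m: "m = perm_mat \<tau>" using \<tau> by (intro ext) (auto simp: perm_mat_def)
  have "surj \<tau>"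
    unfolding surj_def
  proof
    fix h
    have "(\<Sum>g\<in>UNIV. m g h) \<noteq> 0" using assms(2) by simp
    then obtain g where "m g h \<noteq> 0" by (meson sum.neutral)
    then show "\<exists>g. h = \<tau> g" using m by (auto simp: perm_mat_def split: if_splits)
  qed
  then have "bij \<tau>" by (simp add: bij_def finite_UNIV_surj_inj)
  then show ?thesis using m that by blast
qed

lemma Gphase_spinor: "Gphase r (True, q) = zt 8 (3 * int r)"
  by (simp add: Gphase_def zt_def algebra_simps)

lemma Gphase_vector: "Gphase r g_e = zt 8 0" "Gphase r g_v = zt 8 4"
  by (simp_all add: Gphase_def zt_def)

lemma Gmat_e: "Gmat r g g_e = 1" "Gmat r g_e g = 1"
  by (simp_all add: Gmat_def)

context
  fixes r :: nat and m :: "bool \<times> bool \<Rightarrow> bool \<times> bool \<Rightarrow> nat"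
  assumes comm: "commutes UNIV (\<lambda>g h. of_nat (m g h)) (Gmat r)"
    and phase: "\<And>g h. m g h \<noteq> 0 \<Longrightarrow> Gphase r g = Gphase r h"
    and vacuum: "m g_e g_e = 1"
begin

text \<open>Row and column \<open>g_e\<close> of G consist of ones, so the \<open>g_e\<close> column
  of the commutation relation expresses the row sums of \<open>m\<close> by its vacuum
  column.\<close>

lemma G_row: "(\<Sum>h\<in>UNIV. complex_of_nat (m g h)) = (\<Sum>h\<in>UNIV. Gmat r g h * of_nat (m h g_e))"
  using comm[unfolded commutes_def mprod_def, rule_format, of g g_e] by (simp add: Gmat_e)

lemma G_col: "(\<Sum>g\<in>UNIV. complex_of_nat (m g h)) = (\<Sum>g\<in>UNIV. of_nat (m g_e g) * Gmat r g h)"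
  using comm[unfolded commutes_def mprod_def, rule_format, of g_e h] by (simp add: Gmat_e)

lemma G_phase_zero:
  "m g_e g_v = 0" "m g_v g_e = 0"
  "\<not> 8 dvd r \<Longrightarrow> m g_e (True, q) = 0" "\<not> 8 dvd r \<Longrightarrow> m (True, q) g_e = 0"
  "r mod 8 \<noteq> 4 \<Longrightarrow> m g_v (True, q) = 0" "r mod 8 \<noteq> 4 \<Longrightarrow> m (True, q) g_v = 0"
proof -
  have ev: "zt 8 0 \<noteq> zt 8 4" by (subst zt_eq_iff) (auto simp: cong_def)
  have es: "zt 8 0 \<noteq> zt 8 (3 * int r)" if "\<not> 8 dvd r" using that
    by (subst zt_eq_iff) (auto simp: cong_def, presburger)
  have vs: "zt 8 4 \<noteq> zt 8 (3 * int r)" if "r mod 8 \<noteq> 4" using that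
    by (subst zt_eq_iff) (auto simp: cong_def, presburger)
  show "m g_e g_v = 0" "m g_v g_e = 0"
    using phase[of g_e g_v] phase[of g_v g_e] ev unfolding Gphase_vector by fastforce+
  show "m g_e (True, q) = 0" "m (True, q) g_e = 0" if "\<not> 8 dvd r"
    using phase[of g_e "(True, q)"] phase[of "(True, q)" g_e] es[OF that]
    unfolding Gphase_vector Gphase_spinor by fastforce+
  show "m g_v (True, q) = 0" "m (True, q) g_v = 0" if "r mod 8 \<noteq> 4"
    using phase[of g_v "(True, q)"] phase[of "(True, q)" g_v] vs[OF that]
    unfolding Gphase_vector Gphase_spinor by fastforce+
qed

text \<open>A trivial vacuum row and column make all row and column sums 1, so \<open>m\<close> is a
  permutation fixing \<open>g_e\<close>; unless r is 4 modulo 8, the twists also fix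
  \<open>g_v\<close>.\<close>

lemma G_perm:
  assumes "m g_e g_s = 0" "m g_e g_c = 0" "m g_s g_e = 0" "m g_c g_e = 0"
  shows "m \<in> G_invs r"
proof -
  have "(\<Sum>h\<in>UNIV. m g h) = 1" for g
  proof -
    have "complex_of_nat (\<Sum>h\<in>UNIV. m g h) = 1"
      unfolding of_nat_sum G_row by (simp add: sum_UNIV_bool2 assms G_phase_zero vacuum Gmat_e)
    then show ?thesis by (simp only: of_nat_eq_1_iff)
  qed
  moreover have "(\<Sum>g\<in>UNIV. m g h) = 1" for h
  proof -
    have "complex_of_nat (\<Sum>g\<in>UNIV. m g h) = 1"
      unfolding of_nat_sum G_col by (simp add: sum_UNIV_bool2 assms G_phase_zero vacuum Gmat_e)
    then show ?thesis by (simp only: of_nat_eq_1_iff)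
  qed
  ultimately obtain \<tau> where \<tau>: "bij \<tau>" "m = perm_mat \<tau>" by (rule perm_mat_of_sums)
  have e: "\<tau> g_e = g_e" using vacuum \<tau> by (auto simp: perm_mat_def split: if_splits)
  show ?thesis
  proof (cases "r mod 8 = 4")
    case True
    then show ?thesis using \<tau> e by (auto simp: G_invs_def)
  next
    case False
    have v: "\<tau> g_v = g_v"
    proof -
      have "m g_v (\<tau> g_v) \<noteq> 0" by (simp add: \<tau> perm_mat_def)
      then show ?thesis using G_phase_zero False by (cases "\<tau> g_v"; cases "fst (\<tau> g_v)"; cases "snd (\<tau> g_v)") auto
    qed
    have inj: "\<tau> x = \<tau> y \<longleftrightarrow> x = y" for x y using \<tau>(1) by (simp add: bij_is_inj inj_eq)
    have all: "P g" if "P g_e" "P g_v" "P g_s" "P g_c" for P and g :: "bool \<times> bool"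
      using that by (cases g) (metis (full_types))
    have sc: "\<tau> g_s \<in> {g_s, g_c}" "\<tau> g_c \<in> {g_s, g_c}"
    proof -
      have four: "x = g_e \<or> x = g_v \<or> x = g_s \<or> x = g_c" for x :: "bool \<times> bool" by (cases x) auto
      show "\<tau> g_s \<in> {g_s, g_c}" "\<tau> g_c \<in> {g_s, g_c}"
        using four[of "\<tau> g_s"] four[of "\<tau> g_c"] inj[of g_s g_e] inj[of g_s g_v] inj[of g_c g_e] inj[of g_c g_v]
        unfolding e v by blast+
    qed
    have "\<tau> = id \<or> \<tau> = gC"
    proof (cases "\<tau> g_s = g_s")
      case True
      then have "\<tau> g_c = g_c" using sc inj[of g_s g_c] by auto
      then have "\<tau> g = id g" for g by (rule_tac all) (auto simp: e v True)
      then show ?thesis by blast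
    next
      case False
      then have s: "\<tau> g_s = g_c" using sc by auto
      then have "\<tau> g_c = g_s" using sc inj[of g_s g_c] by auto
      then have "\<tau> g = gC g" for g by (rule_tac all) (auto simp: e v s gC_def)
      then show ?thesis by blast
    qed
    then show ?thesis using \<tau> by (auto simp: G_invs_def)
  qed
qed

theorem G_classification: "m \<in> G_invs r"
proof (cases "8 dvd r")
  case False
  then show ?thesis by (intro G_perm G_phase_zero(3,4))
next
  case True
  then have r8: "r mod 8 \<noteq> 4" by auto
  have ir: "\<i> ^ r = 1"
  proof -
    obtain q where "r = 4 * (2 * q)" using True by (auto elim!: dvdE)
    then show ?thesis by (simp add: power_mult)
  qed
  note z = G_phase_zero(1,2) G_phase_zero(5,6)[OF r8]
  have c: "a = b" if "complex_of_int a = complex_of_int b" for a b using that by simp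
  \<comment> \<open>Here i^r = 1, so G is real and these are integer equations. The first one, with
    \<open>m g_v g_v\<close> nonnegative, lets at most one spinor current couple to the
    vacuum.\<close>
  have R: "int (m g_v g_v) = 1 - int (m g_s g_e) - int (m g_c g_e)"
    "int (m g_s g_e) + int (m g_s g_s) + int (m g_s g_c) = 1 + int (m g_s g_e) - int (m g_c g_e)"
    "int (m g_c g_e) + int (m g_c g_s) + int (m g_c g_c) = 1 - int (m g_s g_e) + int (m g_c g_e)"
    using G_row[of g_v] G_row[of g_s] G_row[of g_c]
    by (rule_tac c; simp add: sum_UNIV_bool2 z vacuum Gmat_def ir)+
  have C: "int (m g_v g_v) = 1 - int (m g_e g_s) - int (m g_e g_c)"
    "int (m g_e g_s) + int (m g_s g_s) + int (m g_c g_s) = 1 + int (m g_e g_s) - int (m g_e g_c)"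
    "int (m g_e g_c) + int (m g_s g_c) + int (m g_c g_c) = 1 - int (m g_e g_s) + int (m g_e g_c)"
    using G_col[of g_v] G_col[of g_s] G_col[of g_c]
    by (rule_tac c; simp add: sum_UNIV_bool2 z vacuum Gmat_def ir)+
  have "m g_s g_e + m g_c g_e \<le> 1" using R(1) by linarith
  moreover have "m g_s g_e + m g_c g_e = m g_e g_s + m g_e g_c" using R(1) C(1) by linarith
  ultimately have "m g_s g_e + m g_c g_e = 0 \<and> m g_e g_s + m g_e g_c = 0 \<or>
      m g_s g_e + m g_c g_e = Suc 0 \<and> m g_e g_s + m g_e g_c = Suc 0"
    by (cases "m g_s g_e + m g_c g_e") simp_all
  then consider "m g_s g_e = 0" "m g_c g_e = 0" "m g_e g_s = 0" "m g_e g_c = 0"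
    | "m g_s g_e = 1" "m g_c g_e = 0" "m g_e g_s = 1" "m g_e g_c = 0"
    | "m g_s g_e = 1" "m g_c g_e = 0" "m g_e g_c = 1" "m g_e g_s = 0"
    | "m g_c g_e = 1" "m g_s g_e = 0" "m g_e g_s = 1" "m g_e g_c = 0"
    | "m g_c g_e = 1" "m g_s g_e = 0" "m g_e g_c = 1" "m g_e g_s = 0"
    unfolding add_is_0 add_is_1 One_nat_def by (elim disjE conjE) simp_all
  then show ?thesis
  proof cases
    case 1
    then show ?thesis by (intro G_perm)
  next
    case 2
    then have "m g_v g_v = 0" "m g_s g_s = 1" "m g_s g_c = 0" "m g_c g_s = 0" "m g_c g_c = 0"
      using R C by linarith+
    then have "\<forall>g h. m g h = ext_mat g_s g_s g h"
      using 2 z vacuum unfolding split_paired_All all_bool_eq by (simp add: ext_mat_def)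
    then have "m = ext_mat g_s g_s" by blast
    then show ?thesis using True unfolding G_invs_def by auto
  next
    case 3
    then have "m g_v g_v = 0" "m g_s g_s = 0" "m g_s g_c = 1" "m g_c g_s = 0" "m g_c g_c = 0"
      using R C by linarith+
    then have "\<forall>g h. m g h = ext_mat g_s g_c g h"
      using 3 z vacuum unfolding split_paired_All all_bool_eq by (simp add: ext_mat_def)
    then have "m = ext_mat g_s g_c" by blast
    then show ?thesis using True unfolding G_invs_def by auto
  next
    case 4
    then have "m g_v g_v = 0" "m g_s g_s = 0" "m g_s g_c = 0" "m g_c g_s = 1" "m g_c g_c = 0"
      using R C by linarith+
    then have "\<forall>g h. m g h = ext_mat g_c g_s g h"
      using 4 z vacuum unfolding split_paired_All all_bool_eq by (simp add: ext_mat_def)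
    then have "m = ext_mat g_c g_s" by blast
    then show ?thesis using True unfolding G_invs_def by auto
  next
    case 5
    then have "m g_v g_v = 0" "m g_s g_s = 0" "m g_s g_c = 0" "m g_c g_s = 0" "m g_c g_c = 1"
      using R C by linarith+
    then have "\<forall>g h. m g h = ext_mat g_c g_c g h"
      using 5 z vacuum unfolding split_paired_All all_bool_eq by (simp add: ext_mat_def)
    then have "m = ext_mat g_c g_c" by blast
    then show ?thesis using True unfolding G_invs_def by auto
  qed
qed

end

section \<open>Combining the two factors\<close>

definition X_invs :: "nat \<Rightarrow> (nat \<Rightarrow> nat \<Rightarrow> nat) set" where
  "X_invs r = perm_mat ` X_auts r \<union> (if r = 7 then {X_exc} else {})"

context S_T_commutant
begin

lemma block_X_commutant:
  assumes "r \<ge> 4"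
  shows "X_commutant r n (\<lambda>j k. M (j, g) (k, h))"
proof
  fix i assume "coprime i n"
  then show "\<exists>\<gamma> \<delta>. \<gamma> \<noteq> 0 \<and> commutes {..<r + 2} (\<lambda>j k. of_nat (M (j, g) (k, h)))
      (xform r (\<lambda>b c. \<gamma> * of_real (kern n i b c)) \<delta>)"
    by (rule block_commutes) blast
qed (use assms n_def Xphase_eq in auto)

lemma Xmat_cc: "Xmat r \<kappa> = xform r (\<lambda>b c. 1 * of_real (kern (2 * r + 1) 1 b c)) \<kappa>"
  by (simp add: Xmat_def)

text \<open>Multiplying X \<otimes> G by U \<otimes> 1, with U from the case i = 1 of
  \<open>block_commutes\<close>, gives X U \<otimes> G. Row and column 0 of X U vanish off the
  diagonal, so the entries at index 0 isolate G.\<close>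

lemma vacuum_block_commutes: "commutes UNIV (\<lambda>g h. of_nat (M (0, g) (0, h))) (Gmat r)"
proof -
  let ?X = "{..<r + 2}" and ?M = "\<lambda>x y. complex_of_nat (M x y)"
  obtain \<gamma> \<delta> where \<gamma>: "\<gamma> \<noteq> 0" and blk: "\<And>g h. commutes ?X (\<lambda>j k. of_nat (M (j, g) (k, h)))
        (xform r (\<lambda>b c. \<gamma> * of_real (kern n 1 b c)) \<delta>)"
    using block_commutes[of 1] by auto
  let ?U = "xform r (\<lambda>b c. \<gamma> * of_real (kern n 1 b c)) \<delta>"
  let ?id = "\<lambda>g h :: bool \<times> bool. if g = h then 1 else (0 :: complex)"
  have "commutes (Cells r) ?M (tens ?U ?id)"
    unfolding commutes_def
  proof (intro ballI)
    fix x y assume xy: "x \<in> Cells r" "y \<in> Cells r"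
    obtain j g k h where [simp]: "x = (j, g)" "y = (k, h)" by (cases x; cases y)
    have jk: "j \<in> ?X" "k \<in> ?X" using xy by (auto simp: Cells_def)
    have "mprod (Cells r) ?M (tens ?U ?id) x y = mprod ?X (\<lambda>j k. of_nat (M (j, g) (k, h))) ?U j k"
      unfolding mprod_def Cells_def sum.cartesian_product'
      by (intro sum.cong HOL.refl) (cases h, auto simp: sum_UNIV_bool2)
    also have "\<dots> = mprod ?X ?U (\<lambda>j k. of_nat (M (j, g) (k, h))) j k"
      using blk jk unfolding commutes_def by blast
    also have "\<dots> = mprod (Cells r) (tens ?U ?id) ?M x y"
      unfolding mprod_def Cells_def sum.cartesian_product'
      by (intro sum.cong HOL.refl) (cases g, auto simp: sum_UNIV_bool2)
    finally show "mprod (Cells r) ?M (tens ?U ?id) x y = mprod (Cells r) (tens ?U ?id) ?M x y" .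
  qed
  then have "commutes (Cells r) ?M (mprod (Cells r) (tens (Xmat r \<kappa>) (Gmat r)) (tens ?U ?id))"
    by (intro commutes_mprod comm_S)
  moreover define V where "V = mprod ?X (Xmat r \<kappa>) ?U"
  moreover have "mprod UNIV (Gmat r) ?id = Gmat r"
    by (intro ext) (auto simp: mprod_def if_distrib[of "\<lambda>x. _ * x"] cong: if_cong)
  ultimately have c: "commutes (Cells r) ?M (tens V (Gmat r))"
    by (simp add: Cells_def mprod_tens)
  define d where "d = \<gamma> * of_nat n / 4"
  have d: "d \<noteq> 0" using \<gamma> n_pos by (simp add: d_def)
  have V: "V j 0 = (if j = 0 then d else 0)" "V 0 j = (if j = 0 then d else 0)" if "j < r + 2" for j
    using that r_pos xform_cc_mult[of 1 r j 0 1 \<kappa> \<gamma> \<delta>] xform_cc_mult[of 1 r 0 j 1 \<kappa> \<gamma> \<delta>]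
    unfolding V_def Xmat_cc n_def d_def by auto
  show ?thesis
    unfolding commutes_def
  proof (intro ballI)
    fix g h :: "bool \<times> bool"
    have "mprod (Cells r) ?M (tens V (Gmat r)) (0, g) (0, h) =
      (\<Sum>j<r + 2. if j = 0 then d * mprod UNIV (\<lambda>g h. of_nat (M (0, g) (0, h))) (Gmat r) g h else 0)"
      unfolding mprod_def Cells_def sum.cartesian_product'
      by (intro sum.cong HOL.refl) (auto simp: V sum_distrib_left mult_ac)
    also have "\<dots> = d * mprod UNIV (\<lambda>g h. of_nat (M (0, g) (0, h))) (Gmat r) g h" by simp
    finally have L: "mprod (Cells r) ?M (tens V (Gmat r)) (0, g) (0, h) =
      d * mprod UNIV (\<lambda>g h. of_nat (M (0, g) (0, h))) (Gmat r) g h" .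
    have "mprod (Cells r) (tens V (Gmat r)) ?M (0, g) (0, h) =
      (\<Sum>j<r + 2. if j = 0 then d * mprod UNIV (Gmat r) (\<lambda>g h. of_nat (M (0, g) (0, h))) g h else 0)"
      unfolding mprod_def Cells_def sum.cartesian_product'
      by (intro sum.cong HOL.refl) (auto simp: V sum_distrib_left mult_ac)
    also have "\<dots> = d * mprod UNIV (Gmat r) (\<lambda>g h. of_nat (M (0, g) (0, h))) g h" by simp
    finally have R: "mprod (Cells r) (tens V (Gmat r)) ?M (0, g) (0, h) =
      d * mprod UNIV (Gmat r) (\<lambda>g h. of_nat (M (0, g) (0, h))) g h" .
    have "(0, g) \<in> Cells r" "(0, h) \<in> Cells r" by (auto simp: Cells_def)
    then show "mprod UNIV (\<lambda>g h. of_nat (M (0, g) (0, h))) (Gmat r) g h =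
        mprod UNIV (Gmat r) (\<lambda>g h. of_nat (M (0, g) (0, h))) g h"
      using c d L R unfolding commutes_def by (metis mult_left_cancel)
  qed
qed

text \<open>On the pair of residue 0 the product with X is 1/2 + 1/2 on the diagonal and 1/2 - 1/2
  off it; the constants 4 / n and 1 / (4 \<kappa>) produce these halves.\<close>

definition Xinv :: "nat \<Rightarrow> nat \<Rightarrow> complex" where
  "Xinv = xform r (\<lambda>b c. (4 / of_nat n) * of_real (kern (2 * r + 1) 1 b c)) (1 / (4 * \<kappa>))"

lemma Xmat_inverse:
  assumes "\<kappa> \<noteq> 0" "j < r + 2" "k < r + 2"
  shows "mprod {..<r + 2} (Xmat r \<kappa>) Xinv j k = (if j = k then 1 else 0)"
    "mprod {..<r + 2} Xinv (Xmat r \<kappa>) j k = (if j = k then 1 else 0)"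
  unfolding Xmat_cc Xinv_def n_def[symmetric]
  using xform_cc_mult[of 1 r j k 1 \<kappa> "4 / of_nat n" "1 / (4 * \<kappa>)", folded n_def]
    xform_cc_mult[of 1 r j k "4 / of_nat n" "1 / (4 * \<kappa>)" 1 \<kappa>, folded n_def] assms n_pos
  by (auto simp: field_simps)

lemma Xmat_cancel_right:
  assumes \<kappa>: "\<kappa> \<noteq> 0" and "\<And>j k. j < r + 2 \<Longrightarrow> k < r + 2 \<Longrightarrow> mprod {..<r + 2} A (Xmat r \<kappa>) j k = mprod {..<r + 2} B (Xmat r \<kappa>) j k"
    and jk: "j < r + 2" "k < r + 2"
  shows "A j k = B j k"
proof -
  let ?X = "{..<r + 2}"
  have *: "mprod ?X (mprod ?X A (Xmat r \<kappa>)) Xinv j k = A j k" for A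
  proof -
    have "mprod ?X (mprod ?X A (Xmat r \<kappa>)) Xinv j k = mprod ?X A (mprod ?X (Xmat r \<kappa>) Xinv) j k"
      by (simp add: mprod_assoc)
    also have "\<dots> = (\<Sum>l<r + 2. if l = k then A j k else 0)"
      unfolding mprod_def[of _ A] using Xmat_inverse(1)[OF \<kappa> _ jk(2)] by (intro sum.cong) auto
    also have "\<dots> = A j k" using jk by simp
    finally show ?thesis .
  qed
  have "mprod ?X (mprod ?X A (Xmat r \<kappa>)) Xinv j k = mprod ?X (mprod ?X B (Xmat r \<kappa>)) Xinv j k"
    using assms(2) jk by (rule_tac mprod_cong) auto
  then show ?thesis unfolding * .
qed

lemma Xmat_cancel_left:
  assumes \<kappa>: "\<kappa> \<noteq> 0" and "\<And>j k. j < r + 2 \<Longrightarrow> k < r + 2 \<Longrightarrow> mprod {..<r + 2} (Xmat r \<kappa>) A j k = mprod {..<r + 2} (Xmat r \<kappa>) B j k"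
    and jk: "j < r + 2" "k < r + 2"
  shows "A j k = B j k"
proof -
  let ?X = "{..<r + 2}"
  have *: "mprod ?X Xinv (mprod ?X (Xmat r \<kappa>) A) j k = A j k" for A
  proof -
    have "mprod ?X Xinv (mprod ?X (Xmat r \<kappa>) A) j k = mprod ?X (mprod ?X Xinv (Xmat r \<kappa>)) A j k"
      by (simp add: mprod_assoc)
    also have "\<dots> = (\<Sum>l<r + 2. if j = l then A j k else 0)"
      unfolding mprod_def[of _ _ A] using Xmat_inverse(2)[OF \<kappa> jk(1)] by (intro sum.cong) auto
    also have "\<dots> = A j k" using jk by simp
    finally show ?thesis .
  qed
  have "mprod ?X Xinv (mprod ?X (Xmat r \<kappa>) A) j k = mprod ?X Xinv (mprod ?X (Xmat r \<kappa>) B) j k"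
    using assms(2) jk by (rule_tac mprod_cong) auto
  then show ?thesis unfolding * .
qed

lemma S_entry:
  assumes "j < r + 2" "k < r + 2"
  shows "(\<Sum>h'\<in>UNIV. Gmat r h' h * mprod {..<r + 2} (\<lambda>j k. of_nat (M (j, g) (k, h'))) (Xmat r \<kappa>) j k) =
    (\<Sum>g'\<in>UNIV. Gmat r g g' * mprod {..<r + 2} (Xmat r \<kappa>) (\<lambda>j k. of_nat (M (j, g') (k, h))) j k)"
proof -
  have "(j, g) \<in> Cells r" "(k, h) \<in> Cells r" using assms by (auto simp: Cells_def)
  then have "mprod (Cells r) (\<lambda>x y. of_nat (M x y)) (tens (Xmat r \<kappa>) (Gmat r)) (j, g) (k, h) =
    mprod (Cells r) (tens (Xmat r \<kappa>) (Gmat r)) (\<lambda>x y. of_nat (M x y)) (j, g) (k, h)"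
    using comm_S unfolding commutes_def by blast
  then show ?thesis
    unfolding mprod_def Cells_def sum.cartesian_product'
    by (subst (asm) (1 2) sum.swap) (simp add: sum_distrib_left mult_ac)
qed

text \<open>The vacuum corner \<open>m\<close> decides everything: \<open>m g h = 0\<close> kills
  the whole block by positivity, and where it is nonzero, commutation with X \<otimes> G identifies
  the block with the vacuum block after cancelling X.\<close>

theorem product_form:
  assumes r4: "r \<ge> 4" and \<kappa>: "\<kappa> \<noteq> 0" and vacuum: "M (0, g_e) (0, g_e) = 1"
  obtains a m where "a \<in> X_invs r" "m \<in> G_invs r"
    "\<And>j g k h. j < r + 2 \<Longrightarrow> k < r + 2 \<Longrightarrow> M (j, g) (k, h) = a j k * m g h"
proof -
  let ?X = "{..<r + 2}"
  define m where "m g h = M (0, g) (0, h)" for g h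
  have m: "m \<in> G_invs r"
  proof (rule G_classification)
    show "commutes UNIV (\<lambda>g h. of_nat (m g h)) (Gmat r)" unfolding m_def by (rule vacuum_block_commutes)
  qed (use Gphase_eq[of 0] vacuum in \<open>auto simp: m_def\<close>)
  define B where "B g h j k = complex_of_nat (M (j, g) (k, h))" for g h j k
  have zero: "B g h j k = 0" if "m g h = 0" "j < r + 2" "k < r + 2" for g h j k
    using X_commutant.vacuum_zero[OF block_X_commutant[OF r4]] that by (simp add: m_def B_def)
  have zero': "mprod ?X (B g h) A j k = 0" "mprod ?X A (B g h) j k = 0"
    if "m g h = 0" "j < r + 2" "k < r + 2" for g h j k A
    using zero[OF that(1)] that unfolding mprod_def by (auto intro!: sum.neutral)
  have entry: "(\<Sum>h'\<in>UNIV. Gmat r h' h * mprod ?X (B g h') (Xmat r \<kappa>) j k) =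
    (\<Sum>g'\<in>UNIV. Gmat r g g' * mprod ?X (Xmat r \<kappa>) (B g' h) j k)" if "j < r + 2" "k < r + 2" for g h j k
    using S_entry[OF that] unfolding B_def .
  have same: "B g h j k = B g_e g_e j k" if gh: "m g h \<noteq> 0" and jk: "j < r + 2" "k < r + 2" for g h j k
  proof -
    consider \<tau> where "\<tau> g_e = g_e" "bij \<tau>" "m = perm_mat \<tau>"
      | a b where "a \<in> {g_s, g_c}" "b \<in> {g_s, g_c}" "m = ext_mat a b"
      using G_invs_cases[OF m] by blast
    then show ?thesis
    proof cases
      case (1 \<tau>)
      \<comment> \<open>One block in row \<open>g\<close> and one in column \<open>g_e\<close>
        survive, each with coefficient 1 because row and column \<open>g_e\<close> of G are
        ones.\<close>
      have col: "mprod ?X (B g (\<tau> g)) (Xmat r \<kappa>) j k = mprod ?X (Xmat r \<kappa>) (B g_e g_e) j k"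
        if jk: "j < r + 2" "k < r + 2" for g j k
      proof -
        have "(\<Sum>h'\<in>UNIV. Gmat r h' g_e * mprod ?X (B g h') (Xmat r \<kappa>) j k) =
          (\<Sum>h'\<in>UNIV. if h' = \<tau> g then mprod ?X (B g (\<tau> g)) (Xmat r \<kappa>) j k else 0)"
          using zero'(1)[OF _ jk, of g] 1(3) by (intro sum.cong) (auto simp: Gmat_e perm_mat_def)
        moreover have "(\<Sum>g'\<in>UNIV. Gmat r g g' * mprod ?X (Xmat r \<kappa>) (B g' g_e) j k) =
          (\<Sum>g'\<in>UNIV. if g' = g_e then mprod ?X (Xmat r \<kappa>) (B g_e g_e) j k else 0)"
        proof (rule sum.cong[OF HOL.refl])
          fix g'
          have "m g' g_e = 0" if "g' \<noteq> g_e"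
            using 1 that by (auto simp: perm_mat_def dest: bij_is_inj) (metis bij_pointE)
          then show "Gmat r g g' * mprod ?X (Xmat r \<kappa>) (B g' g_e) j k =
              (if g' = g_e then mprod ?X (Xmat r \<kappa>) (B g_e g_e) j k else 0)"
            using zero'(2)[OF _ jk, of g' g_e] by (auto simp: Gmat_e)
        qed
        ultimately show ?thesis using entry[OF jk, where h = g_e and g = g] by simp
      qed
      have h: "h = \<tau> g" using gh 1(3) by (auto simp: perm_mat_def split: if_splits)
      show ?thesis unfolding h
        by (rule Xmat_cancel_right[OF \<kappa> _ jk]) (simp add: col col[of _ _ g_e, unfolded 1(1)])
    next
      case (2 a b)
      have ab: "a = g_s \<or> a = g_c" "b = g_s \<or> b = g_c" using 2 by auto
      have Gv: "Gmat r g_v a = -1" "Gmat r b g_v = -1" using ab by (auto simp: Gmat_def)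
      have mz: "m g h = 0" if "g \<notin> {g_e, a} \<or> h \<notin> {g_e, b}" for g h using that 2(3) by (auto simp: ext_mat_def)
      \<comment> \<open>The row \<open>g_v\<close> of blocks is zero. Its equation says that X times
        the block (e, e) minus X times the block (a, e) is 0, as G has -1 between \<open>g_v\<close>
        and a spinor current.\<close>
      have ga: "B a g_e j k = B g_e g_e j k" if jk: "j < r + 2" "k < r + 2" for j k
      proof (rule Xmat_cancel_left[OF \<kappa> _ jk])
        fix j k assume jk: "j < r + 2" "k < r + 2"
        have "(\<Sum>h'\<in>UNIV. Gmat r h' g_e * mprod ?X (B g_v h') (Xmat r \<kappa>) j k) = 0"
          using zero'(1)[OF _ jk] mz[of g_v] ab by (intro sum.neutral) auto
        moreover have "(\<Sum>g'\<in>UNIV. Gmat r g_v g' * mprod ?X (Xmat r \<kappa>) (B g' g_e) j k) =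
          mprod ?X (Xmat r \<kappa>) (B g_e g_e) j k - mprod ?X (Xmat r \<kappa>) (B a g_e) j k"
          using sum_pair[OF 2(1), of "\<lambda>g'. Gmat r g_v g' * mprod ?X (Xmat r \<kappa>) (B g' g_e) j k"]
            zero'(2)[OF mz jk] by (simp add: Gv Gmat_e)
        ultimately show "mprod ?X (Xmat r \<kappa>) (B a g_e) j k = mprod ?X (Xmat r \<kappa>) (B g_e g_e) j k"
          using entry[OF jk, where h = g_e and g = g_v] by simp
      qed
      have gb: "B g b j k = B g g_e j k" if jk: "j < r + 2" "k < r + 2" for g j k
      proof (rule Xmat_cancel_right[OF \<kappa> _ jk])
        fix j k assume jk: "j < r + 2" "k < r + 2"
        have "(\<Sum>g'\<in>UNIV. Gmat r g g' * mprod ?X (Xmat r \<kappa>) (B g' g_v) j k) = 0"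
          using zero'(2)[OF _ jk] mz[of _ g_v] ab by (intro sum.neutral) auto
        moreover have "(\<Sum>h'\<in>UNIV. Gmat r h' g_v * mprod ?X (B g h') (Xmat r \<kappa>) j k) =
          mprod ?X (B g g_e) (Xmat r \<kappa>) j k - mprod ?X (B g b) (Xmat r \<kappa>) j k"
          using sum_pair[OF 2(2), of "\<lambda>h'. Gmat r h' g_v * mprod ?X (B g h') (Xmat r \<kappa>) j k"]
            zero'(1)[OF mz jk] by (simp add: Gv Gmat_e)
        ultimately show "mprod ?X (B g b) (Xmat r \<kappa>) j k = mprod ?X (B g g_e) (Xmat r \<kappa>) j k"
          using entry[OF jk, where h = g_v and g = g] by simp
      qed
      have "g \<in> {g_e, a} \<and> h \<in> {g_e, b}" using gh unfolding 2(3) ext_mat_def by presburger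
      then have "g = g_e \<or> g = a" "h = g_e \<or> h = b" by auto
      then show ?thesis using ga[OF jk] gb[OF jk, of g] by (elim disjE) (simp_all only:)
    qed
  qed
  have "m g h \<le> 1" for g h
    using m by (auto simp: G_invs_def perm_mat_def ext_mat_def split: if_splits)
  then have m01: "m g h = 0 \<or> m g h = 1" for g h by (simp only: le_Suc_eq One_nat_def le_zero_eq)
  have M: "M (j, g) (k, h) = M (j, g_e) (k, g_e) * m g h" if jk: "j < r + 2" "k < r + 2" for j g k h
    using m01[of g h]
  proof
    assume *: "m g h = 0"
    then show ?thesis using zero[OF * jk] by (simp add: B_def)
  next
    assume *: "m g h = 1"
    then show ?thesis using same[OF _ jk, of g h] by (simp add: B_def)
  qed
  from X_commutant.classification[OF block_X_commutant[OF r4, of g_e g_e] vacuum]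
  have "\<exists>a\<in>X_invs r. \<forall>j<r + 2. \<forall>k<r + 2. M (j, g_e) (k, g_e) = a j k"
  proof
    assume "\<exists>\<pi>\<in>X_auts r. \<forall>j<r + 2. \<forall>k<r + 2. M (j, g_e) (k, g_e) = perm_mat \<pi> j k"
    then show ?thesis unfolding X_invs_def by blast
  next
    assume "r = 7 \<and> (\<forall>j<r + 2. \<forall>k<r + 2. M (j, g_e) (k, g_e) = X_exc j k)"
    then show ?thesis by (intro bexI[of _ X_exc]) (simp_all add: X_invs_def)
  qed
  then obtain a where a: "a \<in> X_invs r" "\<forall>j<r + 2. \<forall>k<r + 2. M (j, g_e) (k, g_e) = a j k" by blast
  show ?thesis
  proof (rule that[OF a(1) m])
    fix j g k h assume jk: "j < r + 2" "k < r + 2"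
    show "M (j, g) (k, h) = a j k * m g h" using M[OF jk, of g h] a(2) jk by simp
  qed
qed

end

section \<open>Kac--Peterson matrices at level 3\<close>

lemma alt_sum_odd:
  assumes g: "\<And>x. g (- x) = - g x" and \<delta>: "\<And>i. i < r \<Longrightarrow> \<delta> i = 1 \<or> \<delta> i = -1"
  shows "alt_sum r g (\<lambda>i. \<delta> i * l i) m = of_real (\<Prod>i=0..<r. \<delta> i) * alt_sum r g l m"
  unfolding alt_sum_def sum_distrib_left
proof (intro sum.cong HOL.refl)
  fix \<sigma> assume "\<sigma> \<in> {\<sigma>. \<sigma> permutes {0..<r}}"
  then have \<sigma>: "\<sigma> permutes {0..<r}" by simp
  have "g (\<delta> (\<sigma> i) * l (\<sigma> i) * m i) = of_real (\<delta> (\<sigma> i)) * g (l (\<sigma> i) * m i)" if "i < r" for i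
    using \<delta>[of "\<sigma> i"] permutes_in_image[OF \<sigma>, of i] that g by auto
  then have "(\<Prod>i=0..<r. g (\<delta> (\<sigma> i) * l (\<sigma> i) * m i)) =
      of_real (\<Prod>i=0..<r. \<delta> (\<sigma> i)) * (\<Prod>i=0..<r. g (l (\<sigma> i) * m i))"
    by (simp add: prod.distrib)
  also have "(\<Prod>i=0..<r. \<delta> (\<sigma> i)) = (\<Prod>i=0..<r. \<delta> i)"
    using prod.permute[OF \<sigma>, of \<delta>] by (simp add: comp_def)
  finally show "signof \<sigma> * (\<Prod>i=0..<r. g (\<delta> (\<sigma> i) * l (\<sigma> i) * m i)) =
    of_real (\<Prod>i=0..<r. \<delta> i) * (signof \<sigma> * (\<Prod>i=0..<r. g (l (\<sigma> i) * m i)))" by simp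
qed

lemma alt_sum_even:
  assumes g: "\<And>x. g (- x) = g x" and "\<And>i. i < r \<Longrightarrow> l' i = l i \<or> l' i = - l i"
  shows "alt_sum r g l' m = alt_sum r g l m"
  unfolding alt_sum_det
proof (intro arg_cong[where f = det] eq_matI)
  fix i j assume "i < dim_row (mat r r (\<lambda>(i, j). g (l j * m i)))" "j < dim_col (mat r r (\<lambda>(i, j). g (l j * m i)))"
  then show "mat r r (\<lambda>(i, j). g (l' j * m i)) $$ (i, j) = mat r r (\<lambda>(i, j). g (l j * m i)) $$ (i, j)"
    using assms(2)[of j] g by auto
qed simp_all

lemma alt_sum_zero:
  assumes "g 0 = 0" "k < r" "l k = 0"
  shows "alt_sum r g l m = 0"
  unfolding alt_sum_def
proof (intro sum.neutral ballI)
  fix \<sigma> assume "\<sigma> \<in> {\<sigma>. \<sigma> permutes {0..<r}}"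
  then have \<sigma>: "\<sigma> permutes {0..<r}" by simp
  then obtain i where i: "i < r" "\<sigma> i = k" using assms(2) permutes_image[OF \<sigma>] by (metis atLeastLessThan_iff imageE zero_le)
  have "(\<Prod>i=0..<r. g (l (\<sigma> i) * m i)) = 0"
    using i assms by (intro prod_zero) (auto intro!: bexI[of _ i])
  then show "signof \<sigma> * (\<Prod>i=0..<r. g (l (\<sigma> i) * m i)) = 0" by simp
qed

text \<open>A base weight plus \<rho> in orthogonal coordinates: r, r - 1, ..., 0 with r - j left
  out. The indices \<open>r\<close> and \<open>r + 1\<close> both leave out 0 and differ in the sign
  of the last coordinate.\<close>

definition lbase :: "nat \<Rightarrow> nat \<Rightarrow> nat \<Rightarrow> real" where
  "lbase r j i = (if j = r + 1 then if i = r - 1 then -1 else real (r - i)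
     else if i < j then real (r - i) else real (r - i - 1))"

lemma sum_reverse_hsum: "(\<Sum>b=0..<Suc r. (if b = r then 1/2 else 1) * h (r - b)) = hsum r h"
proof -
  have "(\<Sum>b=0..<r. (if b = r then 1/2 else 1) * h (r - b)) = (\<Sum>d=1..r. h d)"
    by (rule sum.reindex_bij_witness[of _ "\<lambda>d. r - d" "\<lambda>d. r - d"]) auto
  then show ?thesis by (simp add: hsum_def)
qed

section \<open>Cosine and sine determinants\<close>

definition cosmat :: "nat \<Rightarrow> complex mat" where
  "cosmat r = mat (Suc r) (Suc r) (\<lambda>(a, b). 2 * of_real (kern (2 * r + 1) 1 (r - a) (r - b)))"

definition cosmat_inv :: "nat \<Rightarrow> complex mat" where
  "cosmat_inv r = mat (Suc r) (Suc r) (\<lambda>(a, b). of_real (dhalf r a * dhalf r b) * 2 *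
     of_real (kern (2 * r + 1) 1 (r - a) (r - b)) / of_nat (2 * r + 1))"

lemma cosmat_carrier [simp]: "cosmat r \<in> carrier_mat (Suc r) (Suc r)" "cosmat_inv r \<in> carrier_mat (Suc r) (Suc r)"
  "dim_row (cosmat r) = Suc r" "dim_col (cosmat r) = Suc r"
  "dim_row (cosmat_inv r) = Suc r" "dim_col (cosmat_inv r) = Suc r"
  by (simp_all add: cosmat_def cosmat_inv_def)

lemma cosmat_mult: "cosmat r * cosmat_inv r = 1\<^sub>m (Suc r)"
proof (intro eq_matI)
  fix a c assume "a < dim_row (1\<^sub>m (Suc r))" "c < dim_col (1\<^sub>m (Suc r))"
  then have ac: "a < Suc r" "c < Suc r" by simp_all
  let ?k = "\<lambda>b c. complex_of_real (kern (2 * r + 1) 1 b c)"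
  let ?n = "complex_of_nat (2 * r + 1)"
  have n: "?n \<noteq> 0" by (simp only: of_nat_eq_0_iff)
  have "(cosmat r * cosmat_inv r) $$ (a, c) = (\<Sum>b=0..<Suc r. 2 * ?k (r - a) (r - b) *
      (of_real (dhalf r b * dhalf r c) * 2 * ?k (r - b) (r - c) / ?n))"
    using ac by (simp add: scalar_prod_def cosmat_def cosmat_inv_def)
  also have "\<dots> = 4 * of_real (dhalf r c) / ?n * (\<Sum>b=0..<Suc r. (if b = r then 1/2 else 1) * (?k (r - a) (r - b) * ?k (r - b) (r - c)))"
    unfolding sum_distrib_left by (intro sum.cong HOL.refl) (auto simp: dhalf_def field_simps)
  also have "(\<Sum>b=0..<Suc r. (if b = r then 1/2 else 1) * (?k (r - a) (r - b) * ?k (r - b) (r - c))) =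
    hsum r (\<lambda>d. ?k (r - a) d * ?k d (r - c))"
    by (rule sum_reverse_hsum)
  also have "\<dots> = (if r - a = r - c then if r - a = 0 then ?n / 2 else ?n / 4 else 0)"
    by (rule kern_orthogonal) auto
  also have "r - a = r - c \<longleftrightarrow> a = c" using ac by auto
  finally show "(cosmat r * cosmat_inv r) $$ (a, c) = 1\<^sub>m (Suc r) $$ (a, c)"
    using ac n by (auto simp: dhalf_def simp del: of_nat_add of_nat_mult of_nat_Suc)
qed (simp_all add: cosmat_def cosmat_inv_def)

lemma det_cosmat_nonzero: "det (cosmat r) \<noteq> 0"
proof
  assume "det (cosmat r) = 0"
  moreover have "det (cosmat r) * det (cosmat_inv r) = 1"
    using det_mult[of "cosmat r" "Suc r" "cosmat_inv r"] by (simp add: cosmat_mult)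
  ultimately show False by simp
qed

text \<open>Jacobi's complementary minor formula, read off from the adjugate of the cosine matrix.\<close>

lemma cosmat_minor:
  assumes "j \<le> r" "k \<le> r"
  shows "det (mat_delete (cosmat r) j k) = (-1) ^ (j + k) * det (cosmat r) * cosmat_inv r $$ (k, j)"
proof -
  have c: "adj_mat (cosmat r) \<in> carrier_mat (Suc r) (Suc r)"
    "cosmat r * adj_mat (cosmat r) = det (cosmat r) \<cdot>\<^sub>m 1\<^sub>m (Suc r)"
    using adj_mat[of "cosmat r" "Suc r"] by simp_all
  have inv': "cosmat_inv r * cosmat r = 1\<^sub>m (Suc r)"
    using mat_mult_left_right_inverse[OF cosmat_carrier(1,2) cosmat_mult] .
  have "adj_mat (cosmat r) = cosmat_inv r * cosmat r * adj_mat (cosmat r)"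
    using c(1) by (simp add: inv')
  also have "\<dots> = cosmat_inv r * (det (cosmat r) \<cdot>\<^sub>m 1\<^sub>m (Suc r))"
    using c by (simp add: assoc_mult_mat[of _ "Suc r" "Suc r" _ "Suc r" _ "Suc r"])
  also have "\<dots> = det (cosmat r) \<cdot>\<^sub>m cosmat_inv r"
    by (simp add: mult_smult_distrib[of _ "Suc r" "Suc r" _ "Suc r"] right_mult_one_mat[of _ "Suc r" "Suc r"])
  finally have "adj_mat (cosmat r) $$ (k, j) = det (cosmat r) * cosmat_inv r $$ (k, j)"
    using assms by simp
  moreover have "adj_mat (cosmat r) $$ (k, j) = (-1) ^ (j + k) * det (mat_delete (cosmat r) j k)"
    using assms by (simp add: adj_mat_def cofactor_def)
  ultimately have "(-1) ^ (j + k) * ((-1) ^ (j + k) * det (mat_delete (cosmat r) j k)) =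
     (-1) ^ (j + k) * (det (cosmat r) * cosmat_inv r $$ (k, j))"
    by simp
  then show ?thesis by (simp add: mult.assoc[symmetric] flip: power_add mult_2)
qed

lemma cos2_ck: "cos2 n (real a * real b) = 2 * of_real (kern n 1 a b)"
  by (simp add: cos2_def kern_def ck_def)

text \<open>The coordinates of the two weights leave out r - j and r - k, so the matrix of cosines
  is \<open>cosmat\<close> with one row and one column deleted.\<close>

lemma alt_sum_cos_base:
  assumes "j \<le> r" "k \<le> r"
  shows "alt_sum r (cos2 (2 * r + 1)) (lbase r j) (lbase r k) = 
    2 * det (cosmat r) / of_nat (2 * r + 1) * of_real (xsign r j * xsign r k * kern (2 * r + 1) 1 (r - j) (r - k))"
proof -
  have "mat_delete (cosmat r) k j = mat r r (\<lambda>(a, b). cos2 (2 * r + 1) (lbase r j b * lbase r k a))"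
  proof (intro eq_matI)
    fix a b assume "a < dim_row (mat r r (\<lambda>(a, b). cos2 (2 * r + 1) (lbase r j b * lbase r k a)))"
      "b < dim_col (mat r r (\<lambda>(a, b). cos2 (2 * r + 1) (lbase r j b * lbase r k a)))"
    then have ab: "a < r" "b < r" by simp_all
    have "lbase r j b = real (r - (if b < j then b else Suc b))" "lbase r k a = real (r - (if a < k then a else Suc a))"
      using assms by (auto simp: lbase_def)
    then have "cos2 (2 * r + 1) (lbase r j b * lbase r k a) =
        2 * of_real (kern (2 * r + 1) 1 (r - (if a < k then a else Suc a)) (r - (if b < j then b else Suc b)))"
      by (simp only: cos2_ck kern_sym[of _ _ "r - (if b < j then b else Suc b)"])
    then show "mat_delete (cosmat r) k j $$ (a, b) = mat r r (\<lambda>(a, b). cos2 (2 * r + 1) (lbase r j b * lbase r k a)) $$ (a, b)"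
      using ab by (simp add: mat_delete_def cosmat_def)
  qed (simp_all add: mat_delete_def cosmat_def)
  then have "alt_sum r (cos2 (2 * r + 1)) (lbase r j) (lbase r k) = det (mat_delete (cosmat r) k j)"
    by (simp add: alt_sum_det)
  also have "\<dots> = (-1) ^ (k + j) * det (cosmat r) * cosmat_inv r $$ (j, k)"
    using assms by (intro cosmat_minor)
  also have "(-1) ^ (k + j) = ((-1) ^ ((r - j) + (r - k)) :: complex)"
  proof -
    obtain x y where "r = j + x" "r = k + y" using assms by (metis le_Suc_ex)
    then have "even (k + j) \<longleftrightarrow> even ((r - j) + (r - k))" by simp presburger
    then show ?thesis by (simp only: minus_one_power_iff)
  qed
  also have "\<dots> = (-1) ^ (r - j) * (-1) ^ (r - k)" by (rule power_add)
  finally show ?thesis using assms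
    by (simp add: cosmat_inv_def xsign_def mult_ac)
qed

definition sinmat :: "nat \<Rightarrow> complex mat" where
  "sinmat r = mat r r (\<lambda>(a, b). sin2 (2 * r + 1) (real (r - a) * real (r - b)))"

text \<open>Sines vanish at the residue 0, so the sum over r residues equals the half sum that
  orthogonality evaluates.\<close>

lemma sinmat_square: "sinmat r * sinmat r = (- of_nat (2 * r + 1)) \<cdot>\<^sub>m 1\<^sub>m r"
proof (intro eq_matI)
  fix a c assume "a < dim_row ((- of_nat (2 * r + 1)) \<cdot>\<^sub>m 1\<^sub>m r :: complex mat)" "c < dim_col ((- of_nat (2 * r + 1)) \<cdot>\<^sub>m 1\<^sub>m r :: complex mat)"
  then have ac: "a < r" "c < r" by simp_all
  define n where "n = 2 * r + 1"
  have n0: "n > 0" by (simp add: n_def)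
  let ?s = "\<lambda>x y. sin2 n (real x * real y)"
  have ss: "?s x y * ?s y z = 2 * (of_real (ck n (int y * (int x + int z))) - of_real (ck n (int y * (int x - int z))))" for x y z
  proof -
    have "sin u * sin v = (cos (u - v) - cos (u + v)) / 2" for u v :: real by (simp add: cos_add cos_diff)
    moreover have "2 * pi * (real x * real y) / real n - 2 * pi * (real y * real z) / real n = 2 * pi * real_of_int (int y * (int x - int z)) / real n"
      "2 * pi * (real x * real y) / real n + 2 * pi * (real y * real z) / real n = 2 * pi * real_of_int (int y * (int x + int z)) / real n"
      by (simp_all add: algebra_simps add_divide_distrib diff_divide_distrib)
    ultimately have 1: "sin (2 * pi * (real x * real y) / real n) * sin (2 * pi * (real y * real z) / real n) =
       (ck n (int y * (int x - int z)) - ck n (int y * (int x + int z))) / 2"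
      unfolding ck_def by metis
    have 2: "?s x y * ?s y z = of_real (- 4 * (sin (2 * pi * (real x * real y) / real n) * sin (2 * pi * (real y * real z) / real n)))"
      by (simp add: sin2_def mult_ac)
    show ?thesis unfolding 2 1 by simp
  qed
  have h: "hsum r (\<lambda>d. of_real (ck n (int d * v))) = (if int n dvd v then of_nat n / 2 else 0)" for v
  proof -
    let ?f = "\<lambda>u. complex_of_real (ck n (u * v))"
    have "?f (u + int (2 * r + 1)) = ?f u" for u
      using ck_cong[OF n0, of "(u + int n) * v" "u * v"] unfolding n_def[symmetric]
      by (simp add: cong_iff_dvd_diff algebra_simps)
    moreover have "?f (- u) = ?f u" for u by simp
    ultimately have "hsum r (\<lambda>d. ?f (int d)) = (\<Sum>u<n. ?f (int u)) / 2"
      using hsum_full[of ?f r] unfolding n_def by blast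
    then show ?thesis using sum_ck[OF n0, of v] by (auto split: if_splits)
  qed
  have "(sinmat r * sinmat r) $$ (a, c) = (\<Sum>b=0..<r. ?s (r - a) (r - b) * ?s (r - b) (r - c))"
    using ac by (simp add: scalar_prod_def sinmat_def n_def)
  also have "\<dots> = (\<Sum>b=0..<Suc r. (if b = r then 1/2 else 1) * (?s (r - a) (r - b) * ?s (r - b) (r - c)))"
    by (simp add: sin2_def)
  also have "\<dots> = hsum r (\<lambda>d. ?s (r - a) d * ?s d (r - c))"
    by (rule sum_reverse_hsum)
  also have "\<dots> = 2 * (hsum r (\<lambda>d. of_real (ck n (int d * (int (r - a) + int (r - c))))) -
      hsum r (\<lambda>d. of_real (ck n (int d * (int (r - a) - int (r - c))))))"
    unfolding ss by (simp add: hsum_def sum_subtractf sum_distrib_left algebra_simps)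
  also have "\<dots> = 2 * ((if int n dvd int (r - a) + int (r - c) then of_nat n / 2 else 0) -
      (if int n dvd int (r - a) - int (r - c) then of_nat n / 2 else 0))"
    by (simp only: h)
  also have "int n dvd int (r - a) + int (r - c) \<longleftrightarrow> False"
    using ac zdvd_imp_le[of "int n" "int (r - a) + int (r - c)"] by (auto simp: n_def)
  also have "int n dvd int (r - a) - int (r - c) \<longleftrightarrow> a = c"
    using ac dvd_imp_le_int[of "int (r - a) - int (r - c)" "int n"] by (cases "a = c") (auto simp: n_def)
  finally show "(sinmat r * sinmat r) $$ (a, c) = ((- of_nat (2 * r + 1)) \<cdot>\<^sub>m 1\<^sub>m r) $$ (a, c)"
    using ac unfolding n_def by (auto simp: field_simps)
qed (simp_all add: sinmat_def)

lemma det_sinmat_nonzero: "det (sinmat r) \<noteq> 0"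
proof
  assume "det (sinmat r) = 0"
  moreover have "det (sinmat r) * det (sinmat r) = (- of_nat (2 * r + 1)) ^ r"
    using det_mult[of "sinmat r" r "sinmat r"] unfolding sinmat_square by (simp add: sinmat_def)
  ultimately have "(- of_nat (2 * r + 1)) ^ r = (0 :: complex)" by simp
  then have "of_nat (2 * r + 1) = (0 :: complex)" by (simp only: power_eq_0_iff neg_equal_0_iff_equal)
  then show False by (simp only: of_nat_eq_0_iff)
qed

text \<open>Below \<open>r\<close> the last coordinate is 0 and kills the determinant of sines;
  \<open>r + 1\<close> differs from \<open>r\<close> by one sign.\<close>

lemma alt_sum_sin_base:
  assumes "r > 0" "j < r + 2" "k < r + 2"
  shows "alt_sum r (sin2 (2 * r + 1)) (lbase r j) (lbase r k) = det (sinmat r) * of_real (xsg r j * xsg r k)"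
proof -
  let ?A = "alt_sum r (sin2 (2 * r + 1))"
  have odd: "sin2 (2 * r + 1) (- x) = - sin2 (2 * r + 1) x" for x by (simp add: sin2_def)
  have z: "?A (lbase r j) m = 0" if "j < r" for j m
    using that assms(1) by (intro alt_sum_zero[of _ "r - 1"]) (auto simp: sin2_def lbase_def)
  have s: "?A (lbase r (r + 1)) m = - ?A (lbase r r) m" for m
  proof -
    let ?\<delta> = "\<lambda>i. if i = r - 1 then -1 else (1 :: real)"
    have "?A (lbase r (r + 1)) m = ?A (\<lambda>i. ?\<delta> i * lbase r r i) m"
      using assms(1) by (intro alt_sum_cong) (auto simp: lbase_def)
    also have "\<dots> = of_real (\<Prod>i=0..<r. ?\<delta> i) * ?A (lbase r r) m"
      by (rule alt_sum_odd[where \<delta> = ?\<delta> and l = "lbase r r" and g = "sin2 (2 * r + 1)"], rule odd) auto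
    also have "(\<Prod>i=0..<r. ?\<delta> i) = -1" using assms(1) by simp
    finally show ?thesis by simp
  qed
  have "?A (lbase r r) (lbase r r) = det (sinmat r)"
    unfolding alt_sum_det sinmat_def
    by (intro arg_cong[where f = det] eq_matI) (auto simp: lbase_def mult.commute)
  moreover have "j < r \<or> j = r \<or> j = r + 1" "k < r \<or> k = r \<or> k = r + 1" using assms by auto
  ultimately show ?thesis
    using z s z[of k "lbase r j"] s[of "lbase r r"] alt_sum_sym[of r "sin2 (2 * r + 1)" "lbase r j" "lbase r k"]
      alt_sum_sym[of r "sin2 (2 * r + 1)" "lbase r r" "lbase r (r + 1)"]
    by (elim disjE) (simp_all add: xsg_def)
qed

definition base_const :: "nat \<Rightarrow> complex" where
  "base_const r = det (cosmat r) / of_nat (2 * r + 1)"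

text \<open>The sine determinant in units of \<open>base_const\<close>, halved as in
  \<open>weyl_sum_alt\<close>; for r = 4 its value decides triality.\<close>

definition base_kappa :: "nat \<Rightarrow> complex" where
  "base_kappa r = det (sinmat r) / (2 * base_const r)"

lemma base_nonzero: "base_const r \<noteq> 0" "base_kappa r \<noteq> 0"
proof -
  have "complex_of_nat (2 * r + 1) \<noteq> 0" by (simp only: of_nat_eq_0_iff)
  then show "base_const r \<noteq> 0" using det_cosmat_nonzero[of r] by (simp add: base_const_def)
  then show "base_kappa r \<noteq> 0" using det_sinmat_nonzero[of r] by (simp add: base_kappa_def)
qed

lemma weyl_sum_base:
  assumes "r > 0" "j < r + 2" "k < r + 2"
  shows "weyl_sum r (2 * r + 1) (lbase r j) (lbase r k) = base_const r * Xmat r (base_kappa r) j k"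
proof -
  let ?A = "alt_sum r (cos2 (2 * r + 1))"
  have even: "cos2 (2 * r + 1) (- x) = cos2 (2 * r + 1) x" for x by (simp add: cos2_def)
  have m: "?A (lbase r j) m = ?A (lbase r (min j r)) m" if "j < r + 2" for j m
    using that by (rule_tac alt_sum_even, rule_tac even) (auto simp: lbase_def min_def)
  have "?A (lbase r j) (lbase r k) = ?A (lbase r (min j r)) (lbase r (min k r))"
    using m[OF assms(2)] m[OF assms(3)] alt_sum_sym by metis
  also have "\<dots> = 2 * det (cosmat r) / of_nat (2 * r + 1) * of_real (xsign r (min j r) * xsign r (min k r) *
      kern (2 * r + 1) 1 (r - min j r) (r - min k r))"
    by (rule alt_sum_cos_base) auto
  also have "xsign r (min j r) = xsign r j" by (auto simp: xsign_def dhalf_def min_def)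
  also have "xsign r (min k r) = xsign r k" by (auto simp: xsign_def dhalf_def min_def)
  also have "r - min j r = r - j" by simp
  also have "r - min k r = r - k" by simp
  finally have "?A (lbase r j) (lbase r k) = 2 * base_const r * of_real (xsign r j * xsign r k * kern (2 * r + 1) 1 (r - j) (r - k))"
    by (simp add: base_const_def)
  then show ?thesis
    unfolding weyl_sum_alt alt_sum_sin_base[OF assms] Xmat_def xform_def
    using base_nonzero(1)[of r] by (simp add: base_kappa_def field_simps)
qed

section \<open>Shifted weights and simple currents in orthogonal coordinates\<close>

definition lw :: "nat \<Rightarrow> weight \<Rightarrow> nat \<Rightarrow> real" where
  "lw r \<mu> j = (\<Sum>i=1..r. (real (\<mu> i) + 1) * fund_weight r i $ j)"

lemma lw_index: "j < r \<Longrightarrow> (fin_part r \<mu> + rho_bar r) $ j = lw r \<mu> j"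
  by (simp add: fin_part_def rho_bar_def lw_def ring_distribs sum.distrib)

lemma fin_part_rho_carrier [simp]: "fin_part r \<mu> + rho_bar r \<in> carrier_vec r"
  by (simp add: fin_part_def rho_bar_def)

lemma lw_diff:
  assumes "Suc j < r"
  shows "lw r \<mu> j - lw r \<mu> (Suc j) = real (\<mu> (Suc j)) + 1"
proof -
  have "lw r \<mu> j - lw r \<mu> (Suc j) = (\<Sum>i=1..r. (real (\<mu> i) + 1) * (fund_weight r i $ j - fund_weight r i $ Suc j))"
    by (simp add: lw_def right_diff_distrib flip: sum_subtractf)
  also have "\<dots> = (\<Sum>i=1..r. if i = Suc j then real (\<mu> (Suc j)) + 1 else 0)"
    using assms by (intro sum.cong HOL.refl) (auto simp: fund_weight_def)
  also have "\<dots> = real (\<mu> (Suc j)) + 1" using assms by simp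
  finally show ?thesis .
qed

lemma lw_last:
  assumes "r \<ge> 2"
  shows "lw r \<mu> (r - 2) + lw r \<mu> (r - 1) = real (\<mu> r) + 1"
proof -
  have "lw r \<mu> (r - 2) + lw r \<mu> (r - 1) = (\<Sum>i=1..r. (real (\<mu> i) + 1) * (fund_weight r i $ (r - 2) + fund_weight r i $ (r - 1)))"
    by (simp add: lw_def distrib_left flip: sum.distrib)
  also have "\<dots> = (\<Sum>i=1..r. if i = r then real (\<mu> r) + 1 else 0)"
    using assms by (intro sum.cong HOL.refl) (auto simp: fund_weight_def)
  also have "\<dots> = real (\<mu> r) + 1" using assms by simp
  finally show ?thesis .
qed

text \<open>The labels fix the differences of neighbouring coordinates and the sum of the last two;
  so the error is constant and twice it is 0.\<close>

lemma lw_unique: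
  assumes r: "r \<ge> 2" and d: "\<And>j. Suc j < r \<Longrightarrow> u j - u (Suc j) = real (\<nu> (Suc j)) + 1"
    and l: "u (r - 2) + u (r - 1) = real (\<nu> r) + 1" and j: "j < r"
  shows "lw r \<nu> j = u j"
proof -
  define e where "e j = lw r \<nu> j - u j" for j
  have e: "e j = e (Suc j)" if "Suc j < r" for j using lw_diff[OF that, of \<nu>] d[OF that] by (simp add: e_def)
  have const: "j < r \<Longrightarrow> e j = e 0" for j
    by (induction j) (use e in auto)
  have "e (r - 2) + e (r - 1) = 0" using lw_last[OF r, of \<nu>] l by (simp add: e_def)
  then have "e 0 = 0" using const[of "r - 2"] const[of "r - 1"] r by simp
  then show ?thesis using const[OF j] by (simp add: e_def)
qed

text \<open>The affine label: the highest root is \<epsilon>_1 + \<epsilon>_2, and 2 r + 1 is the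
  level plus the dual Coxeter number.\<close>

lemma lw_first:
  assumes r: "r \<ge> 4" and \<mu>: "\<mu> \<in> P_plus r 3"
  shows "real (2 * r + 1) - lw r \<mu> 0 - lw r \<mu> 1 = real (\<mu> 0) + 1"
proof -
  have "lw r \<mu> 0 + lw r \<mu> 1 = (\<Sum>i=1..r. (real (\<mu> i) + 1) * (fund_weight r i $ 0 + fund_weight r i $ 1))"
    by (simp add: lw_def distrib_left flip: sum.distrib)
  also have "\<dots> = (\<Sum>i=1..r. (real (\<mu> i) + 1) * (if i \<in> {2..r - 2} then 2 else 1))"
    using r by (intro sum.cong HOL.refl) (auto simp: fund_weight_def)
  also have "{1..r} = insert 1 ({2..r - 2} \<union> {r - 1, r})" using r by auto
  also have "(\<Sum>i\<in>insert 1 ({2..r - 2} \<union> {r - 1, r}). (real (\<mu> i) + 1) * (if i \<in> {2..r - 2} then 2 else 1)) =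
    real (\<mu> 1) + 1 + ((\<Sum>i=2..r - 2. (real (\<mu> i) + 1) * 2) + (real (\<mu> (r - 1)) + 1 + (real (\<mu> r) + 1)))"
  proof -
    let ?f = "\<lambda>i. (real (\<mu> i) + 1) * (if i \<in> {2..r - 2} then 2 else 1)"
    have "sum ?f (insert 1 ({2..r - 2} \<union> {r - 1, r})) = ?f 1 + sum ?f ({2..r - 2} \<union> {r - 1, r})"
      using r by (intro sum.insert) auto
    moreover have "sum ?f ({2..r - 2} \<union> {r - 1, r}) = sum ?f {2..r - 2} + sum ?f {r - 1, r}"
      using r by (intro sum.union_disjoint) auto
    moreover have "sum ?f {2..r - 2} = (\<Sum>i=2..r - 2. (real (\<mu> i) + 1) * 2)"
      by (intro sum.cong) auto
    moreover have "sum ?f {r - 1, r} = real (\<mu> (r - 1)) + 1 + (real (\<mu> r) + 1)"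
      using r by auto
    ultimately show ?thesis by simp
  qed
  also have "(\<Sum>i=2..r - 2. (real (\<mu> i) + 1) * 2) = (\<Sum>i=2..r - 2. 2 * real (\<mu> i)) + 2 * real (r - 3)"
    using r by (simp add: sum.distrib distrib_right mult.commute of_nat_diff)
  finally have "lw r \<mu> 0 + lw r \<mu> 1 = real (\<mu> 1 + (\<Sum>i=2..r - 2. 2 * \<mu> i) + \<mu> (r - 1) + \<mu> r) + 2 * real (r - 3) + 3"
    by simp
  moreover have "real 3 = real (\<mu> 0 + \<mu> 1 + (\<Sum>i=2..r - 2. 2 * \<mu> i) + \<mu> (r - 1) + \<mu> r)"
    using \<mu> by (simp add: P_plus_def)
  ultimately show ?thesis using r by (simp add: of_nat_diff)
qed

lemma sum_middle_rev:
  fixes \<mu> :: weight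
  assumes "r \<ge> 4"
  shows "(\<Sum>i=2..r - 2. 2 * \<mu> (r - i)) = (\<Sum>i=2..r - 2. 2 * (\<mu> i :: nat))"
  by (rule sum.reindex_bij_witness[of _ "\<lambda>i. r - i" "\<lambda>i. r - i"]) (use assms in auto)

lemma J_v_P_plus:
  assumes r: "r \<ge> 4" and \<mu>: "\<mu> \<in> P_plus r 3"
  shows "J_v r \<mu> \<in> P_plus r 3"
proof -
  have "(\<Sum>i=2..r - 2. 2 * J_v r \<mu> i) = (\<Sum>i=2..r - 2. 2 * \<mu> i)"
    by (intro sum.cong HOL.refl) (auto simp: J_v_def)
  then show ?thesis using assms by (auto simp: P_plus_def J_v_def)
qed

lemma J_s_P_plus:
  assumes r: "r \<ge> 4" and \<mu>: "\<mu> \<in> P_plus r 3"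
  shows "J_s r \<mu> \<in> P_plus r 3"
proof -
  have "(\<Sum>i=2..r - 2. 2 * J_s r \<mu> i) = (\<Sum>i=2..r - 2. 2 * \<mu> (r - i))"
    using r by (intro sum.cong HOL.refl) (auto simp: J_s_def)
  then show ?thesis using assms unfolding sum_middle_rev[OF r] by (auto simp: P_plus_def J_s_def)
qed

text \<open>Exchanging the labels at both ends of the diagram is an even sign change, at the first
  and the last coordinate, followed by a translation of the first coordinate by n.\<close>

lemma lw_J_v:
  assumes r: "r \<ge> 4" and \<mu>: "\<mu> \<in> P_plus r 3" and j: "j < r"
  shows "lw r (J_v r \<mu>) j = (if j = 0 then real (2 * r + 1) - lw r \<mu> 0 else if j = r - 1 then - lw r \<mu> j else lw r \<mu> j)"
proof (rule lw_unique[OF _ _ _ j])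
  have *: "Suc j = r - 1 \<Longrightarrow> j = r - 2" for j by simp
  fix j assume j: "Suc j < r"
  show "(if j = 0 then real (2 * r + 1) - lw r \<mu> 0 else if j = r - 1 then - lw r \<mu> j else lw r \<mu> j) -
    (if Suc j = 0 then real (2 * r + 1) - lw r \<mu> 0 else if Suc j = r - 1 then - lw r \<mu> (Suc j) else lw r \<mu> (Suc j)) =
    real (J_v r \<mu> (Suc j)) + 1"
  proof -
    have "Suc j = r - 1 \<Longrightarrow> lw r \<mu> j + lw r \<mu> (r - 1) = real (\<mu> r) + 1"
      using lw_last[of r \<mu>] r *[of j] by auto
    then show ?thesis
      using r j lw_diff[OF j, of \<mu>] lw_first[OF r \<mu>] by (auto simp: J_v_def)
  qed
next
  show "(if r - 2 = 0 then real (2 * r + 1) - lw r \<mu> 0 else if r - 2 = r - 1 then - lw r \<mu> (r - 2) else lw r \<mu> (r - 2)) +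
    (if r - 1 = 0 then real (2 * r + 1) - lw r \<mu> 0 else if r - 1 = r - 1 then - lw r \<mu> (r - 1) else lw r \<mu> (r - 1)) =
    real (J_v r \<mu> r) + 1"
    using r lw_diff[of "r - 2" r \<mu>] by (auto simp: J_v_def numeral_2_eq_2 Suc_diff_Suc)
qed (use r in auto)

text \<open>The one plus sign for odd \<open>r\<close> keeps the number of minus signs even, hence
  the sign change inside the Weyl group of type D.\<close>

definition sgn_s :: "nat \<Rightarrow> nat \<Rightarrow> real" where
  "sgn_s r i = (if odd r \<and> i = 0 then 1 else -1)"

lemma prod_sgn_s: "r > 0 \<Longrightarrow> (\<Prod>i=0..<r. sgn_s r i) = 1"
proof -
  assume r: "r > 0"
  have "(\<Prod>i=0..<r. sgn_s r i) = sgn_s r 0 * (\<Prod>i=1..<r. sgn_s r i)"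
    using r by (simp add: prod.atLeast_Suc_lessThan)
  also have "(\<Prod>i=1..<r. sgn_s r i) = (\<Prod>i=1..<r. -1)" by (intro prod.cong) (auto simp: sgn_s_def)
  also have "\<dots> = (-1) ^ (r - 1)" by simp
  finally show ?thesis using r by (auto simp: sgn_s_def minus_one_power_iff even_diff_nat)
qed

text \<open>The reversal of the diagram becomes a reversal of the coordinates, an even sign change
  and a translation by n / 2 in every coordinate.\<close>

lemma lw_J_s:
  assumes r: "r \<ge> 4" and \<mu>: "\<mu> \<in> P_plus r 3" and j: "j < r"
  shows "lw r (J_s r \<mu>) j = real (2 * r + 1) / 2 + sgn_s r j * lw r \<mu> (r - 1 - j)"
proof (rule lw_unique[OF _ _ _ j])
  fix j assume j: "Suc j < r"
  define k where "k = r - 1 - Suc j"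
  have k: "Suc k = r - 1 - j" "Suc k < r" using j by (auto simp: k_def)
  have d: "lw r \<mu> k - lw r \<mu> (Suc k) = real (\<mu> (Suc k)) + 1" using lw_diff[OF k(2)] .
  have s: "J_s r \<mu> (Suc j) = (if j = 0 \<and> odd r then \<mu> r else \<mu> (Suc k))"
    using r j k by (auto simp: J_s_def)
  show "real (2 * r + 1) / 2 + sgn_s r j * lw r \<mu> (r - 1 - j) -
     (real (2 * r + 1) / 2 + sgn_s r (Suc j) * lw r \<mu> (r - 1 - Suc j)) = real (J_s r \<mu> (Suc j)) + 1"
  proof (cases "j = 0 \<and> odd r")
    case True
    then have "k = r - 2" "Suc k = r - 1" using r by (auto simp: k_def)
    then show ?thesis unfolding s k(1)[symmetric] k_def[symmetric] using True lw_last[of r \<mu>] r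
      by (simp add: sgn_s_def)
  next
    case False
    then have "sgn_s r j = -1" "sgn_s r (Suc j) = -1" by (auto simp: sgn_s_def)
    then show ?thesis unfolding s k(1)[symmetric] k_def[symmetric] if_not_P[OF False] using d by simp
  qed
next
  have "r - 1 - (r - 2) = 1" "r - 1 - (r - 1) = 0" using r by auto
  then show "real (2 * r + 1) / 2 + sgn_s r (r - 2) * lw r \<mu> (r - 1 - (r - 2)) +
     (real (2 * r + 1) / 2 + sgn_s r (r - 1) * lw r \<mu> (r - 1 - (r - 1))) = real (J_s r \<mu> r) + 1"
    using r lw_first[OF r \<mu>] by (auto simp: sgn_s_def J_s_def)
qed (use r in auto)

text \<open>Apart from the label of \<Lambda>_0, these are the highest weights of the exterior
  powers of the vector representation; the r-th power splits into the indices \<open>r\<close> and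
  \<open>r + 1\<close>.\<close>

definition lamw :: "nat \<Rightarrow> nat \<Rightarrow> weight" where
  "lamw r j i = (if i = 0 then (if j = 0 then 3 else if j = 1 then 2 else 1)
     else if j = r + 1 then (if i = r - 1 then 2 else 0)
     else if j = r then (if i = r then 2 else 0)
     else if j = r - 1 then (if i = r - 1 \<or> i = r then 1 else 0)
     else if i = j then 1 else 0)"

lemma lamw_P_plus:
  assumes r: "r \<ge> 4" and j: "j < r + 2"
  shows "lamw r j \<in> P_plus r 3"
proof -
  have "(\<Sum>i=2..r - 2. 2 * lamw r j i) = (\<Sum>i=2..r - 2. if i = j then 2 else 0)"
    using r j by (intro sum.cong HOL.refl) (auto simp: lamw_def)
  also have "\<dots> = (if 2 \<le> j \<and> j \<le> r - 2 then 2 else 0)" by simp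
  finally have s: "(\<Sum>i=2..r - 2. 2 * lamw r j i) = (if 2 \<le> j \<and> j \<le> r - 2 then 2 else 0)" .
  have z: "\<forall>i>r. lamw r j i = 0" using r j by (auto simp: lamw_def)
  consider "j = 0" | "j = 1" | "2 \<le> j" "j \<le> r - 2" | "j = r - 1" | "j = r" | "j = r + 1"
    using j by linarith
  then have "3 = lamw r j 0 + lamw r j 1 + (if 2 \<le> j \<and> j \<le> r - 2 then 2 else 0) + lamw r j (r - 1) + lamw r j r"
    using r by cases (auto simp: lamw_def)
  then show ?thesis unfolding P_plus_def mem_Collect_eq s using z by blast
qed

lemma lw_lamw:
  assumes r: "r \<ge> 4" and j: "j < r + 2" and i: "i < r"
  shows "lw r (lamw r j) i = lbase r j i"
proof (rule lw_unique[OF _ _ _ i])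
  fix i assume i: "Suc i < r"
  then have "real (r - Suc i - 1) = real (r - i) - 2" "real (r - Suc i) = real (r - i) - 1" "real (r - i - 1) = real (r - i) - 1"
    by (simp_all add: of_nat_diff)
  then show "lbase r j i - lbase r j (Suc i) = real (lamw r j (Suc i)) + 1"
    using r j i by (auto simp: lbase_def lamw_def)
next
  show "lbase r j (r - 2) + lbase r j (r - 1) = real (lamw r j r) + 1"
    using r j by (auto simp: lbase_def lamw_def)
qed (use r in auto)

text \<open>Shifting the flag \<open>q\<close> of \<open>J\<^sub>v\<close> by the parity of \<open>j\<close> makes the charges independent of \<open>j\<close>,
  so that \<open>S\<close> and \<open>T\<close> factorise.\<close>

definition Wt :: "nat \<Rightarrow> cell \<Rightarrow> weight" where
  "Wt r x = (case x of (j, p, q) \<Rightarrow>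
     (if q \<noteq> odd (min j r) then J_v r else id) ((if p then J_s r else id) (lamw r j)))"

lemma J_s_lamw_P_plus: "r \<ge> 4 \<Longrightarrow> j < r + 2 \<Longrightarrow> (if p then J_s r else id) (lamw r j) \<in> P_plus r 3"
  using lamw_P_plus J_s_P_plus by auto

lemma Wt_P_plus: "r \<ge> 4 \<Longrightarrow> x \<in> Cells r \<Longrightarrow> Wt r x \<in> P_plus r 3"
proof -
  assume r: "r \<ge> 4" and x: "x \<in> Cells r"
  obtain j p q where xe: "x = (j, p, q)" by (cases x)
  define \<mu> where "\<mu> = (if p then J_s r else id) (lamw r j)"
  have "\<mu> \<in> P_plus r 3" unfolding \<mu>_def using x xe by (intro J_s_lamw_P_plus r) (auto simp: Cells_def)
  then show ?thesis using J_v_P_plus[OF r] unfolding Wt_def xe prod.case \<mu>_def[symmetric] by simp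
qed

lemma permutes_rev: "(\<lambda>i. if i < r then r - 1 - i else i) permutes {0..<(r::nat)}"
proof -
  let ?f = "\<lambda>i. if i < r then r - 1 - i else i"
  have "bij ?f" by (rule involuntory_imp_bij) auto
  then show ?thesis by (auto simp: permutes_def bij_iff)
qed

text \<open>The reversal is a product of \<open>r div 2\<close> disjoint transpositions, peeled off
  from the outside.\<close>

lemma sign_rev: "sign (\<lambda>i. if i < r then r - 1 - i else (i::nat)) = (-1) ^ (r div 2)"
proof -
  define R where "R k i = (if k \<le> i \<and> i < r - k then r - 1 - i else i)" for k i :: nat
  have base: "R (r div 2) = id" by (intro ext) (auto simp: R_def)
  have "R k permutes {0..<r}" for k
  proof -
    have "bij (R k)" by (rule involuntory_imp_bij) (auto simp: R_def)
    then show ?thesis by (auto simp: permutes_def bij_iff R_def)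
  qed
  then have perm: "permutation (R k)" for k by (rule permutes_imp_permutation[rotated]) simp
  have step: "sign (R k) = - sign (R (Suc k))" if "k < r div 2" for k
  proof -
    have "R k = Transposition.transpose k (r - 1 - k) \<circ> R (Suc k)"
      using that by (intro ext) (auto simp: R_def Transposition.transpose_def)
    then show ?thesis using that perm by (simp add: sign_compose permutation_swap_id sign_swap_id)
  qed
  have "d \<le> r div 2 \<Longrightarrow> sign (R (r div 2 - d)) = (-1) ^ d" for d
  proof (induction d)
    case (Suc d)
    then show ?case using step[of "r div 2 - Suc d"] by (simp add: Suc_diff_Suc)
  qed (simp add: base)
  from this[of "r div 2"] have "sign (R 0) = (-1) ^ (r div 2)" by simp
  moreover have "R 0 = (\<lambda>i. if i < r then r - 1 - i else i)" by (auto simp: R_def)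
  ultimately show ?thesis by simp
qed

section \<open>S on the orbits of the simple currents\<close>

definition ws :: "nat \<Rightarrow> weight \<Rightarrow> weight \<Rightarrow> complex" where
  "ws r \<mu> \<nu> = weyl_sum r (2 * r + 1) (lw r \<mu>) (lw r \<nu>)"

definition tot :: "nat \<Rightarrow> weight \<Rightarrow> real" where
  "tot r \<mu> = (\<Sum>i=0..<r. lw r \<mu> i)"

text \<open>\<open>p\<close> tells half-integral from integral coordinates, that is, spinor from
  tensor weights.\<close>

definition spin :: "nat \<Rightarrow> weight \<Rightarrow> bool \<Rightarrow> bool" where
  "spin r \<mu> p \<longleftrightarrow> (\<forall>i<r. cis (2 * pi * lw r \<mu> i) = (if p then -1 else 1))"

lemma ws_sym: "ws r \<mu> \<nu> = ws r \<nu> \<mu>"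
  unfolding ws_def by (rule weyl_sum_sym)

lemma ws_J_v:
  assumes r: "r \<ge> 4" and \<mu>: "\<mu> \<in> P_plus r 3" and \<nu>: "spin r \<nu> p"
  shows "ws r (J_v r \<mu>) \<nu> = (if p then -1 else 1) * ws r \<mu> \<nu>"
proof -
  let ?\<delta> = "\<lambda>i. if i = 0 \<or> i = r - 1 then -1 else (1 :: real)"
  let ?\<eta> = "if p then -1 else (1 :: real)"
  have "ws r (J_v r \<mu>) \<nu> = weyl_sum r (2 * r + 1)
      (\<lambda>i. if i = 0 then real (2 * r + 1) + ?\<delta> 0 * lw r \<mu> 0 else ?\<delta> i * lw r \<mu> i) (lw r \<nu>)"
    unfolding ws_def by (rule weyl_sum_cong) (auto simp: lw_J_v[OF r \<mu>])
  also have "\<dots> = of_real ?\<eta> * weyl_sum r (2 * r + 1) (\<lambda>i. ?\<delta> i * lw r \<mu> i) (lw r \<nu>)"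
    using r \<nu> by (intro weyl_sum_shift_first) (auto simp: spin_def)
  also have "weyl_sum r (2 * r + 1) (\<lambda>i. ?\<delta> i * lw r \<mu> i) (lw r \<nu>) = weyl_sum r (2 * r + 1) (lw r \<mu>) (lw r \<nu>)"
  proof (rule weyl_sum_signs)
    have "(\<Prod>i=0..<r. ?\<delta> i) = (\<Prod>i\<in>{0, r - 1}. (-1 :: real))"
      using r by (intro prod.mono_neutral_cong_right) auto
    then show "(\<Prod>i=0..<r. ?\<delta> i) = 1" using r by simp
  qed auto
  finally show ?thesis by (simp add: ws_def)
qed

lemma ws_J_s:
  assumes r: "r \<ge> 4" and \<mu>: "\<mu> \<in> P_plus r 3" and \<nu>: "spin r \<nu> p"
  shows "ws r (J_s r \<mu>) \<nu> = cis (- (pi * tot r \<nu>)) * (-1) ^ (r div 2) * ws r \<mu> \<nu>"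
proof -
  let ?rev = "\<lambda>i. if i < r then r - 1 - i else i"
  let ?\<eta> = "if p then -1 else (1 :: real)"
  have "ws r (J_s r \<mu>) \<nu> = weyl_sum r (2 * r + 1)
      (\<lambda>i. real (2 * r + 1) / 2 + sgn_s r i * lw r \<mu> (?rev i)) (lw r \<nu>)"
    unfolding ws_def by (rule weyl_sum_cong) (auto simp: lw_J_s[OF r \<mu>])
  also have "\<dots> = cis (- (pi * tot r \<nu>)) * weyl_sum r (2 * r + 1) (\<lambda>i. sgn_s r i * lw r \<mu> (?rev i)) (lw r \<nu>)"
    unfolding tot_def using \<nu> by (intro weyl_sum_shift_half[where \<eta> = ?\<eta>]) (auto simp: spin_def)
  also have "weyl_sum r (2 * r + 1) (\<lambda>i. sgn_s r i * lw r \<mu> (?rev i)) (lw r \<nu>) =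
      weyl_sum r (2 * r + 1) (\<lambda>i. lw r \<mu> (?rev i)) (lw r \<nu>)"
    using r by (intro weyl_sum_signs prod_sgn_s) (auto simp: sgn_s_def)
  also have "\<dots> = signof ?rev * weyl_sum r (2 * r + 1) (lw r \<mu>) (lw r \<nu>)"
    by (rule weyl_sum_perm[OF permutes_rev])
  also have "signof ?rev = ((-1) ^ (r div 2) :: complex)"
    unfolding sign_rev by simp
  finally show ?thesis by (simp add: ws_def mult.assoc)
qed

lemma spin_J_v:
  assumes r: "r \<ge> 4" and \<mu>: "\<mu> \<in> P_plus r 3" and s: "spin r \<mu> p"
  shows "spin r (J_v r \<mu>) p"
  unfolding spin_def
proof (intro allI impI)
  fix i assume i: "i < r"
  have neg: "cis (2 * pi * - lw r \<mu> j) = (if p then -1 else 1)" if "j < r" for j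
    using s that by (auto simp: spin_def complex_eq_iff)
  have "cis (2 * pi * (real (2 * r + 1) - lw r \<mu> 0)) = cis (2 * pi * real (2 * r + 1)) * cis (2 * pi * - lw r \<mu> 0)"
    by (simp add: cis_mult algebra_simps)
  also have "cis (2 * pi * real (2 * r + 1)) = 1" by (rule cis_multiple_2pi) simp
  finally show "cis (2 * pi * lw r (J_v r \<mu>) i) = (if p then -1 else 1)"
    unfolding lw_J_v[OF r \<mu> i] using neg[of 0] neg[OF i] r s i by (auto simp: spin_def)
qed

lemma cis_odd_pi: "cis (pi * real (2 * r + 1)) = -1"
proof -
  have "pi * real (2 * r + 1) = 2 * pi * real r + pi" by (simp add: algebra_simps)
  then have "cis (pi * real (2 * r + 1)) = cis (2 * pi * real r) * cis pi" by (simp only: cis_mult[symmetric])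
  also have "cis (2 * pi * real r) = 1" by (rule cis_multiple_2pi) simp
  finally show ?thesis by simp
qed

lemma spin_J_s:
  assumes r: "r \<ge> 4" and \<mu>: "\<mu> \<in> P_plus r 3" and s: "spin r \<mu> p"
  shows "spin r (J_s r \<mu>) (\<not> p)"
  unfolding spin_def
proof (intro allI impI)
  fix i assume i: "i < r"
  have "cis (2 * pi * (real (2 * r + 1) / 2 + sgn_s r i * lw r \<mu> (r - 1 - i))) =
     cis (pi * real (2 * r + 1)) * cis (sgn_s r i * (2 * pi * lw r \<mu> (r - 1 - i)))"
  proof -
    have "2 * pi * (N / 2 + x * y) = pi * N + x * (2 * pi * y)" for N x y :: real by (simp add: field_simps)
    then show ?thesis by (simp only: cis_mult[symmetric])
  qed
  also have "cis (sgn_s r i * (2 * pi * lw r \<mu> (r - 1 - i))) = (if p then -1 else 1)"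
    using s i by (auto simp: spin_def sgn_s_def complex_eq_iff)
  finally show "cis (2 * pi * lw r (J_s r \<mu>) i) = (if \<not> p then -1 else 1)"
    unfolding lw_J_s[OF r \<mu> i] cis_odd_pi by simp
qed

lemma spin_lamw:
  assumes r: "r \<ge> 4" and j: "j < r + 2"
  shows "spin r (lamw r j) False"
  unfolding spin_def
proof (intro allI impI)
  fix i assume i: "i < r"
  have "lbase r j i \<in> \<int>" by (auto simp: lbase_def)
  then show "cis (2 * pi * lw r (lamw r j) i) = (if False then -1 else 1)"
    unfolding lw_lamw[OF r j i] by (simp add: cis_multiple_2pi)
qed

text \<open>Up to the sign of the reversal, the factor that \<open>J_s\<close> on the other argument
  of \<open>S\<close> produces against this weight.\<close>

definition tphase :: "nat \<Rightarrow> weight \<Rightarrow> complex" where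
  "tphase r \<mu> = cis (- (pi * tot r \<mu>))"

lemma tphase_J_v:
  assumes r: "r \<ge> 4" and \<mu>: "\<mu> \<in> P_plus r 3" and s: "spin r \<mu> p"
  shows "tphase r (J_v r \<mu>) = - tphase r \<mu>"
proof -
  have "tot r (J_v r \<mu>) = (\<Sum>i=0..<r. lw r \<mu> i + (if i = 0 then real (2 * r + 1) - 2 * lw r \<mu> 0 else 0) +
      (if i = r - 1 then - 2 * lw r \<mu> (r - 1) else 0))"
    unfolding tot_def using r by (intro sum.cong HOL.refl) (auto simp: lw_J_v[OF r \<mu>])
  also have "\<dots> = tot r \<mu> + (real (2 * r + 1) - 2 * lw r \<mu> 0) - 2 * lw r \<mu> (r - 1)"
    using r by (simp add: sum.distrib tot_def)
  finally have "tphase r (J_v r \<mu>) = tphase r \<mu> * cis (- (pi * real (2 * r + 1))) * cis (2 * pi * lw r \<mu> 0) * cis (2 * pi * lw r \<mu> (r - 1))"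
  proof -
    assume t: "tot r (J_v r \<mu>) = tot r \<mu> + (real (2 * r + 1) - 2 * lw r \<mu> 0) - 2 * lw r \<mu> (r - 1)"
    have "- (pi * (t + (N - 2 * x) - 2 * y)) = - (pi * t) + - (pi * N) + 2 * pi * x + 2 * pi * y" for t N x y :: real
      by (simp add: algebra_simps)
    then show ?thesis unfolding tphase_def t by (simp only: cis_mult[symmetric])
  qed
  also have "cis (- (pi * real (2 * r + 1))) = -1" using cis_odd_pi[of r] by (simp add: complex_eq_iff)
  finally show ?thesis using s r by (auto simp: spin_def)
qed

lemma sum_sgn_s:
  assumes r: "r > 0"
  shows "(\<Sum>i=0..<r. sgn_s r i * f (r - 1 - i)) = - (\<Sum>i=0..<r. f i) + (if odd r then 2 * f (r - 1) else 0)"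
proof -
  have "(\<Sum>i=0..<r. sgn_s r i * f (r - 1 - i)) = (\<Sum>i=0..<r. - f (r - 1 - i) + (if i = 0 then if odd r then 2 * f (r - 1) else 0 else 0))"
    by (intro sum.cong HOL.refl) (auto simp: sgn_s_def)
  also have "\<dots> = - (\<Sum>i=0..<r. f (r - 1 - i)) + (if odd r then 2 * f (r - 1) else 0)"
    unfolding sum.distrib sum_negf using r by simp
  also have "(\<Sum>i=0..<r. f (r - 1 - i)) = (\<Sum>i=0..<r. f i)"
    by (rule sum.reindex_bij_witness[of _ "\<lambda>i. r - 1 - i" "\<lambda>i. r - 1 - i"]) auto
  finally show ?thesis .
qed

lemma cis_sgn_s_sum:
  assumes r: "r \<ge> 4" and s: "spin r \<mu> False"
  shows "cis (pi * (\<Sum>i=0..<r. sgn_s r i * lw r \<mu> (r - 1 - i))) = tphase r \<mu>"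
proof -
  have "cis (2 * pi * lw r \<mu> (r - 1)) = 1" using s r by (simp add: spin_def)
  moreover have "cis (pi * (- S + 2 * x)) = cis (- (pi * S)) * cis (2 * pi * x)" for S x
  proof -
    have "pi * (- S + 2 * x) = - (pi * S) + 2 * pi * x" by (simp add: algebra_simps)
    then show ?thesis by (simp only: cis_mult[symmetric])
  qed
  moreover have "(\<Sum>i=0..<r. sgn_s r i * lw r \<mu> (r - 1 - i)) = - tot r \<mu> + (if odd r then 2 * lw r \<mu> (r - 1) else 0)"
    using r unfolding tot_def by (intro sum_sgn_s) auto
  ultimately show ?thesis by (auto simp: tphase_def)
qed

lemma tphase_J_s:
  assumes r: "r \<ge> 4" and \<mu>: "\<mu> \<in> P_plus r 3" and s: "spin r \<mu> False"
  shows "tphase r (J_s r \<mu>) = \<i> ^ r * inverse (tphase r \<mu>)"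
proof -
  let ?S = "\<Sum>i=0..<r. sgn_s r i * lw r \<mu> (r - 1 - i)"
  have "tot r (J_s r \<mu>) = (\<Sum>i=0..<r. real (2 * r + 1) / 2 + sgn_s r i * lw r \<mu> (r - 1 - i))"
    unfolding tot_def using r by (intro sum.cong HOL.refl) (auto simp: lw_J_s[OF r \<mu>])
  also have "\<dots> = real r * (real (2 * r + 1) / 2) + ?S" by (simp add: sum.distrib)
  finally have "tphase r (J_s r \<mu>) = cis (- (pi * (real r * (real (2 * r + 1) / 2)))) * inverse (cis (pi * ?S))"
    by (simp add: tphase_def cis_mult cis_inverse algebra_simps)
  also have "cis (- (pi * (real r * (real (2 * r + 1) / 2)))) = cis (- (pi * (real (2 * r + 1) / 2))) ^ r"
    by (simp add: DeMoivre algebra_simps)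
  also have "cis (- (pi * (real (2 * r + 1) / 2))) = cis (- (pi * real r)) * (- \<i>)"
  proof -
    have "- (pi * (real (2 * r + 1) / 2)) = - (pi * real r) + - (pi / 2)" by (simp add: field_simps)
    then show ?thesis by (simp only: cis_mult[symmetric]) (simp add: complex_eq_iff)
  qed
  also have "cis (- (pi * real r)) = (-1) ^ r"
    by (simp add: complex_eq_iff mult.commute[of pi] minus_one_power_iff cos_npi sin_npi)
  also have "((-1) ^ r * (- \<i>)) ^ r = \<i> ^ r"
    by (cases "even r") (simp_all add: power_mult_distrib)
  finally show ?thesis unfolding cis_sgn_s_sum[OF r s] .
qed

lemma gauss_parity: "(-1 :: complex) ^ (\<Sum>i=0..<r. r - i) * (-1) ^ r = (-1) ^ (r div 2)"
proof -
  have "(\<Sum>i=0..<r. r - i) = (\<Sum>i=1..r. i)"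
    by (rule sum.reindex_bij_witness[of _ "\<lambda>i. r - i" "\<lambda>i. r - i"]) auto
  also have "\<dots> = r * (r + 1) div 2" by (induction r) auto
  finally have s: "(\<Sum>i=0..<r. r - i) = r * (r + 1) div 2" .
  have "even (r * (r + 1) div 2 + r) \<longleftrightarrow> even (r div 2)"
  proof -
    obtain q c where r: "r = 4 * q + c" "c < 4" by (metis div_mult_mod_eq mult.commute mod_less_divisor zero_less_numeral)
    then consider "c = 0" | "c = 1" | "c = 2" | "c = 3" by linarith
    then show ?thesis
    proof cases
      case 1
      have "r * (r + 1) div 2 = 2 * (q * (4 * q + 1))" unfolding r 1 by (simp add: algebra_simps)
      then show ?thesis by (simp add: r 1)
    next
      case 2
      have "r * (r + 1) div 2 = (4 * q + 1) * (2 * q + 1)" unfolding r 2 by (simp add: algebra_simps)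
      then show ?thesis by (simp add: r 2)
    next
      case 3
      have "r * (r + 1) div 2 = (2 * q + 1) * (4 * q + 3)" unfolding r 3 by (simp add: algebra_simps)
      then show ?thesis by (simp add: r 3)
    next
      case 4
      have "r * (r + 1) div 2 = (4 * q + 3) * (2 * q + 2)" unfolding r 4 by (simp add: algebra_simps)
      moreover have "odd ((4 * q + 3) div 2)" by presburger
      ultimately show ?thesis by (simp add: r 4)
    qed
  qed
  then show ?thesis unfolding s power_add[symmetric] by (simp only: minus_one_power_iff)
qed

lemma cis_pi_int: "cis (- (pi * real m)) = (-1) ^ m"
  by (simp add: complex_eq_iff mult.commute[of pi] minus_one_power_iff cos_npi sin_npi)

lemma tphase_lamw:
  assumes r: "r \<ge> 4" and j: "j < r + 2"
  shows "tphase r (lamw r j) = (-1) ^ (r div 2) * (-1) ^ min j r"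
proof -
  define t where "t = (\<Sum>i=0..<r. r - i)"
  have tr: "tot r (lamw r j) = real t - (if j = r + 1 then 2 else real (r - j))"
  proof -
    have "tot r (lamw r j) = (\<Sum>i=0..<r. lbase r j i)"
      unfolding tot_def by (intro sum.cong) (auto simp: lw_lamw[OF r j])
    also have "\<dots> = (\<Sum>i=0..<r. real (r - i) - (if j = r + 1 then if i = r - 1 then 2 else 0 else if i < j then 0 else 1))"
      by (intro sum.cong HOL.refl) (auto simp: lbase_def of_nat_diff)
    also have "\<dots> = real t - (if j = r + 1 then 2 else real (r - j))"
    proof -
      have "(\<Sum>i=0..<r. if i < j then 0 else (1 :: real)) = (\<Sum>i=j..<r. 1)" if "j \<le> r"
        using that by (intro sum.mono_neutral_cong_right) auto
      then show ?thesis using r j by (auto simp: sum_subtractf t_def)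
    qed
    finally show ?thesis .
  qed
  have t': "(-1) ^ t * (-1) ^ r = ((-1) ^ (r div 2) :: complex)"
    using gauss_parity[of r] unfolding t_def .
  show ?thesis
  proof (cases "j = r + 1")
    case True
    have "tphase r (lamw r j) = cis (- (pi * real t)) * cis (2 * pi)"
      unfolding tphase_def tr using True by (simp add: cis_mult algebra_simps)
    also have "cis (2 * pi) = 1" by simp
    moreover have "(-1) ^ r * (-1) ^ r = (1 :: complex)" by (simp flip: power_add mult_2)
    ultimately show ?thesis using True unfolding cis_pi_int t'[symmetric]
      by (simp add: min_def mult.assoc)
  next
    case False
    have "tphase r (lamw r j) = cis (- (pi * real t)) * inverse (cis (- (pi * real (r - j))))"
      unfolding tphase_def tr using False by (simp add: cis_mult cis_inverse algebra_simps)
    also have "\<dots> = (-1) ^ t * (-1) ^ (r - j)" unfolding cis_pi_int by (simp add: minus_one_power_iff)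
    also have "(-1 :: complex) ^ (r - j) = (-1) ^ r * (-1) ^ j"
    proof -
      have "j \<le> r" using j False by simp
      then have "even (r - j) \<longleftrightarrow> even (r + j)" by (simp add: even_diff_nat)
      then show ?thesis unfolding power_add[symmetric] by (simp only: minus_one_power_iff)
    qed
    finally show ?thesis using j False unfolding t'[symmetric] by (simp add: min_def mult.assoc)
  qed
qed

lemma spin_base:
  assumes "r \<ge> 4" "j < r + 2"
  shows "spin r ((if p then J_s r else id) (lamw r j)) p"
  using spin_J_s[OF assms(1) lamw_P_plus[OF assms] spin_lamw[OF assms]] spin_lamw[OF assms] by auto

lemma spin_Wt:
  assumes r: "r \<ge> 4" and j: "j < r + 2"
  shows "spin r (Wt r (j, p, q)) p"
proof -
  define \<mu> where "\<mu> = (if p then J_s r else id) (lamw r j)"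
  have "\<mu> \<in> P_plus r 3" "spin r \<mu> p" unfolding \<mu>_def using J_s_lamw_P_plus[OF r j] spin_base[OF r j] by blast+
  then show ?thesis unfolding Wt_def prod.case \<mu>_def[symmetric] using spin_J_v[OF r] by auto
qed

text \<open>\<open>J_v\<close> flips the sign of \<open>tphase\<close>, so shifting its flag by the
  parity of \<open>j\<close> absorbs the factor (-1)^min j r of the base weight.\<close>

lemma tphase_Wt:
  assumes r: "r \<ge> 4" and j: "j < r + 2"
  shows "tphase r (Wt r (j, p, q)) = (-1) ^ (r div 2) * (if q then -1 else 1) * (if p then \<i> ^ r else 1)"
proof -
  define \<mu> where "\<mu> = (if p then J_s r else id) (lamw r j)"
  have \<mu>: "\<mu> \<in> P_plus r 3" "spin r \<mu> p" unfolding \<mu>_def using J_s_lamw_P_plus[OF r j] spin_base[OF r j] by blast+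
  have t: "tphase r \<mu> = (-1) ^ (r div 2) * (-1) ^ min j r * (if p then \<i> ^ r else 1)"
    using tphase_J_s[OF r lamw_P_plus[OF r j] spin_lamw[OF r j]] unfolding \<mu>_def
    by (auto simp: tphase_lamw[OF r j] power_inverse[symmetric])
  have "tphase r (Wt r (j, p, q)) = (if q \<noteq> odd (min j r) then -1 else 1) * tphase r \<mu>"
    unfolding Wt_def prod.case \<mu>_def[symmetric] using tphase_J_v[OF r \<mu>] by auto
  then show ?thesis unfolding t minus_one_power_iff[of "min j r"] by auto
qed

text \<open>The currents are moved out of the left argument with the spin and phase of the right
  one, then out of the right argument against a base weight. With each \<open>J_s\<close> the factor
  (-1)^(r div 2) occurs twice and cancels.\<close>

lemma ws_Wt:
  assumes r: "r \<ge> 4" and j: "j < r + 2" and k: "k < r + 2"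
  shows "ws r (Wt r (j, g)) (Wt r (k, h)) = base_const r * (Xmat r (base_kappa r) j k * Gmat r g h)"
proof -
  obtain p q where g: "g = (p, q)" by (cases g)
  obtain p' q' where h: "h = (p', q')" by (cases h)
  define \<mu> where "\<mu> = (if p then J_s r else id) (lamw r j)"
  define \<nu> where "\<nu> = Wt r (k, h)"
  define \<nu>' where "\<nu>' = (if p' then J_s r else id) (lamw r k)"
  have \<mu>: "\<mu> \<in> P_plus r 3" "spin r \<mu> p" unfolding \<mu>_def using J_s_lamw_P_plus[OF r j] spin_base[OF r j] by blast+
  have \<nu>': "\<nu>' \<in> P_plus r 3" "spin r \<nu>' p'" unfolding \<nu>'_def using J_s_lamw_P_plus[OF r k] spin_base[OF r k] by blast+
  have \<nu>: "spin r \<nu> p'" unfolding \<nu>_def h by (rule spin_Wt[OF r k])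
  have sj: "spin r (lamw r j) False" by (rule spin_lamw[OF r j])
  have ss: "(-1) ^ (r div 2) * (-1) ^ (r div 2) = (1 :: complex)" by (simp flip: power_add mult_2)
  have 1: "ws r (Wt r (j, g)) \<nu> = (if q \<noteq> odd (min j r) \<and> p' then -1 else 1) * ws r \<mu> \<nu>"
    unfolding Wt_def g prod.case \<mu>_def[symmetric] using ws_J_v[OF r \<mu>(1) \<nu>] by auto
  have "ws r (J_s r (lamw r j)) \<nu> = ((-1) ^ (r div 2) * (-1) ^ (r div 2)) * ((if q' then -1 else 1) * (if p' then \<i> ^ r else 1) * ws r (lamw r j) \<nu>)"
    unfolding ws_J_s[OF r lamw_P_plus[OF r j] \<nu>] tphase_def[symmetric]
    unfolding \<nu>_def h tphase_Wt[OF r k] by (simp only: mult_ac)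
  then have 2: "ws r \<mu> \<nu> = (if p then (if q' then -1 else 1) * (if p' then \<i> ^ r else 1) else 1) * ws r (lamw r j) \<nu>"
    unfolding ss \<mu>_def by simp
  have "ws r \<nu> (lamw r j) = ws r \<nu>' (lamw r j)"
    unfolding \<nu>_def Wt_def h prod.case \<nu>'_def[symmetric] using ws_J_v[OF r \<nu>'(1) sj] by auto
  also have "ws r (J_s r (lamw r k)) (lamw r j) = ((-1) ^ (r div 2) * (-1) ^ (r div 2)) * ((-1) ^ min j r * ws r (lamw r k) (lamw r j))"
    unfolding ws_J_s[OF r lamw_P_plus[OF r k] sj] tphase_def[symmetric] tphase_lamw[OF r j] by (simp only: mult_ac)
  then have "ws r \<nu>' (lamw r j) = (if p' then (-1) ^ min j r else 1) * ws r (lamw r k) (lamw r j)"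
    unfolding ss \<nu>'_def by simp
  also have "ws r (lamw r k) (lamw r j) = ws r (lamw r j) (lamw r k)" by (rule ws_sym)
  also have "ws r (lamw r j) (lamw r k) = weyl_sum r (2 * r + 1) (lbase r j) (lbase r k)"
    unfolding ws_def by (rule weyl_sum_cong) (auto simp: lw_lamw r j k)
  also have "\<dots> = base_const r * Xmat r (base_kappa r) j k"
    using r j k by (intro weyl_sum_base) auto
  finally have 3: "ws r (lamw r j) \<nu> = (if p' then (-1) ^ min j r else 1) * (base_const r * Xmat r (base_kappa r) j k)"
    by (simp add: ws_sym[of r _ \<nu>])
  show ?thesis
    unfolding \<nu>_def[symmetric] 1 2 3 minus_one_power_iff[of "min j r"] by (auto simp: g h Gmat_def)
qed

section \<open>T on the orbits of the simple currents\<close>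

definition nphase :: "nat \<Rightarrow> weight \<Rightarrow> complex" where
  "nphase r \<mu> = cis (pi / real (2 * r + 1) * (\<Sum>i=0..<r. (lw r \<mu> i)\<^sup>2))"

lemma nphase_J_v:
  assumes r: "r \<ge> 4" and \<mu>: "\<mu> \<in> P_plus r 3" and s: "spin r \<mu> p"
  shows "nphase r (J_v r \<mu>) = (if p then 1 else -1) * nphase r \<mu>"
proof -
  let ?n = "real (2 * r + 1)"
  have n: "?n > 0" by simp
  have "(\<Sum>i=0..<r. (lw r (J_v r \<mu>) i)\<^sup>2) = (\<Sum>i=0..<r. (lw r \<mu> i)\<^sup>2 + (if i = 0 then ?n * (?n - 2 * lw r \<mu> 0) else 0))"
    using r by (intro sum.cong HOL.refl) (auto simp: lw_J_v[OF r \<mu>] power2_eq_square algebra_simps)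
  also have "\<dots> = (\<Sum>i=0..<r. (lw r \<mu> i)\<^sup>2) + ?n * (?n - 2 * lw r \<mu> 0)"
    using r by (simp add: sum.distrib)
  finally have "nphase r (J_v r \<mu>) = nphase r \<mu> * cis (pi / ?n * (?n * (?n - 2 * lw r \<mu> 0)))"
    unfolding nphase_def cis_mult by (simp only: distrib_left)
  also have "pi / ?n * (?n * (?n - 2 * lw r \<mu> 0)) = pi * ?n + - (2 * pi * lw r \<mu> 0)"
    using n by (simp add: right_diff_distrib)
  also have "cis (pi * ?n + - (2 * pi * lw r \<mu> 0)) = - cis (- (2 * pi * lw r \<mu> 0))"
    unfolding cis_mult[symmetric] cis_odd_pi by simp
  also have "cis (- (2 * pi * lw r \<mu> 0)) = (if p then -1 else 1)"
    using s r by (auto simp: spin_def complex_eq_iff)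
  finally show ?thesis by auto
qed

lemma nphase_J_s:
  assumes r: "r \<ge> 4" and \<mu>: "\<mu> \<in> P_plus r 3" and s: "spin r \<mu> False"
  shows "nphase r (J_s r \<mu>) = cis (pi * (real r * real (2 * r + 1) / 4)) * tphase r \<mu> * nphase r \<mu>"
proof -
  let ?n = "real (2 * r + 1)"
  let ?S = "\<Sum>i=0..<r. sgn_s r i * lw r \<mu> (r - 1 - i)"
  have n: "?n > 0" by simp
  have "(\<Sum>i=0..<r. (lw r (J_s r \<mu>) i)\<^sup>2) = (\<Sum>i=0..<r. ?n * ?n / 4 + ?n * (sgn_s r i * lw r \<mu> (r - 1 - i)) + (lw r \<mu> (r - 1 - i))\<^sup>2)"
    using r by (intro sum.cong HOL.refl) (auto simp: lw_J_s[OF r \<mu>] sgn_s_def power2_eq_square field_simps)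
  also have "\<dots> = real r * (?n * ?n / 4) + ?n * ?S + (\<Sum>i=0..<r. (lw r \<mu> (r - 1 - i))\<^sup>2)"
    by (simp only: sum.distrib sum_distrib_left[symmetric] sum_constant card_atLeastLessThan minus_nat.diff_0)
  also have "(\<Sum>i=0..<r. (lw r \<mu> (r - 1 - i))\<^sup>2) = (\<Sum>i=0..<r. (lw r \<mu> i)\<^sup>2)"
    by (rule sum.reindex_bij_witness[of _ "\<lambda>i. r - 1 - i" "\<lambda>i. r - 1 - i"]) auto
  also have "real r * (?n * ?n / 4) + ?n * ?S + (\<Sum>i=0..<r. (lw r \<mu> i)\<^sup>2) =
     ?n * (real r * ?n / 4 + ?S) + (\<Sum>i=0..<r. (lw r \<mu> i)\<^sup>2)"
    by (simp add: algebra_simps)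
  finally have "nphase r (J_s r \<mu>) = cis (pi / ?n * (?n * (real r * ?n / 4 + ?S))) * nphase r \<mu>"
    unfolding nphase_def cis_mult by (simp only: distrib_left)
  also have "pi / ?n * (?n * (real r * ?n / 4 + ?S)) = pi * (real r * ?n / 4) + pi * ?S"
    using n by (simp add: distrib_left)
  also have "cis (pi * (real r * ?n / 4) + pi * ?S) = cis (pi * (real r * ?n / 4)) * tphase r \<mu>"
    unfolding cis_mult[symmetric] cis_sgn_s_sum[OF r s] ..
  finally show ?thesis .
qed

text \<open>Leaving out the coordinate b = r - j lowers the squared length 1 + 4 + ... + r^2 by
  b^2.\<close>

lemma nphase_lamw:
  assumes r: "r \<ge> 4" and j: "j < r + 2"
  shows "nphase r (lamw r j) = cis (pi / real (2 * r + 1) * (\<Sum>i=0..<r. (real (r - i))\<^sup>2)) * (-1) ^ r * (-1) ^ min j r * Xphase r j"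
proof -
  let ?n = "real (2 * r + 1)"
  let ?c = "\<Sum>i=0..<r. (real (r - i))\<^sup>2"
  define b where "b = r - j"
  have n: "?n > 0" by simp
  have tele: "j \<le> r \<Longrightarrow> (\<Sum>i=j..<r. (real (r - i))\<^sup>2 - (real (r - i - 1))\<^sup>2) = (real (r - j))\<^sup>2"
  proof -
    assume jr: "j \<le> r"
    have "(\<Sum>i=j..<r. (real (r - i))\<^sup>2 - (real (r - i - 1))\<^sup>2) = (\<Sum>i=j..<r. - ((real (r - Suc i))\<^sup>2) - (- ((real (r - i))\<^sup>2)))"
      by (intro sum.cong) auto
    also have "\<dots> = - ((real (r - r))\<^sup>2) - (- ((real (r - j))\<^sup>2))"
      by (rule sum_Suc_diff'[OF jr])
    finally show ?thesis by simp
  qed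
  have "(\<Sum>i=0..<r. (lw r (lamw r j) i)\<^sup>2) = ?c - (real b)\<^sup>2"
  proof -
    have "(\<Sum>i=0..<r. (lw r (lamw r j) i)\<^sup>2) = (\<Sum>i=0..<r. (real (r - i))\<^sup>2 - (if i < j then 0 else (real (r - i))\<^sup>2 - (real (r - i - 1))\<^sup>2))"
    proof (intro sum.cong HOL.refl)
      fix i assume "i \<in> {0..<r}"
      then have i: "i < r" by simp
      have "i = r - 1 \<Longrightarrow> real (r - i) = 1" using r by simp
      then show "(lw r (lamw r j) i)\<^sup>2 = (real (r - i))\<^sup>2 - (if i < j then 0 else (real (r - i))\<^sup>2 - (real (r - i - 1))\<^sup>2)"
        unfolding lw_lamw[OF r j i] using i by (auto simp: lbase_def)
    qed
    also have "\<dots> = ?c - (\<Sum>i=0..<r. if i < j then 0 else (real (r - i))\<^sup>2 - (real (r - i - 1))\<^sup>2)"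
      by (rule sum_subtractf)
    also have "(\<Sum>i=0..<r. if i < j then 0 else (real (r - i))\<^sup>2 - (real (r - i - 1))\<^sup>2) = (\<Sum>i=j..<r. (real (r - i))\<^sup>2 - (real (r - i - 1))\<^sup>2)"
      by (intro sum.mono_neutral_cong_right) auto
    also have "\<dots> = (real b)\<^sup>2" using tele by (cases "j \<le> r") (auto simp: b_def)
    finally show ?thesis .
  qed
  then have "nphase r (lamw r j) = cis (pi / ?n * ?c) * cis (- (pi / ?n * (real b)\<^sup>2))"
  proof -
    assume *: "(\<Sum>i=0..<r. (lw r (lamw r j) i)\<^sup>2) = ?c - (real b)\<^sup>2"
    have "x * (y - z) = x * y + - (x * z)" for x y z :: real by (simp add: algebra_simps)
    then show ?thesis unfolding nphase_def cis_mult * by (simp only:)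
  qed
  \<comment> \<open>2 r = n - 1 turns the exponent -b^2 / 2 of an n-th root of unity into r b^2, at
    the price of the sign (-1)^b.\<close>
  also have "cis (- (pi / ?n * (real b)\<^sup>2)) = cis (- (pi * real (b * b))) * Xphase r j"
  proof -
    have "2 * pi * real_of_int (int (r * b * b)) / ?n = pi * real (b * b) + - (pi / ?n * (real b)\<^sup>2)"
      using n by (simp add: field_simps power2_eq_square)
    then have "Xphase r j = cis (pi * real (b * b)) * cis (- (pi / ?n * (real b)\<^sup>2))"
      unfolding Xphase_def b_def[symmetric] zt_def cis_mult by (simp only:)
    moreover have "cis (- (pi * real (b * b))) * cis (pi * real (b * b)) = 1" by (simp add: cis_mult)
    ultimately show ?thesis by (simp only: mult.assoc[symmetric] mult_1)
  qed
  also have "cis (- (pi * real (b * b))) = (-1) ^ r * (-1) ^ min j r"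
  proof -
    have "even (b * b) \<longleftrightarrow> even (r + min j r)"
    proof (cases "j \<le> r")
      case True
      then show ?thesis by (auto simp: b_def even_diff_nat)
    qed (simp add: b_def)
    then show ?thesis unfolding cis_pi_int power_add[symmetric] by (simp only: minus_one_power_iff)
  qed
  finally show ?thesis by (simp only: mult.assoc)
qed

lemma cis_three_quarter: "cis (pi * (real r * real (2 * r + 1) / 4)) * (-1) ^ (r div 2) = cis (3 * pi * real r / 4)"
proof -
  define s where "s = r div 2"
  have two: "cis (2 * pi * real m) = 1" for m by (rule cis_multiple_2pi) simp
  consider "r = 2 * s" | "r = 2 * s + 1" unfolding s_def by linarith
  then show ?thesis
  proof cases
    case 1
    have "pi * (real r * real (2 * r + 1) / 4) = 2 * pi * real (s * s) + pi / 2 * real s" unfolding 1 by (simp add: field_simps)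
    then have "cis (pi * (real r * real (2 * r + 1) / 4)) = cis (pi / 2 * real s)" by (simp only: cis_mult[symmetric] two mult_1)
    moreover have "3 * pi * real r / 4 = 2 * pi * real s + pi / 2 * real s + - (pi * real s)" unfolding 1 by (simp add: field_simps)
    then have "cis (3 * pi * real r / 4) = cis (pi / 2 * real s) * (-1) ^ s" by (simp only: cis_mult[symmetric] two mult_1 cis_pi_int)
    ultimately show ?thesis by (simp add: s_def)
  next
    case 2
    have "pi * (real r * real (2 * r + 1) / 4) = 2 * pi * real (s * s + s) + (pi / 2 * real s + 3 * pi / 4)" unfolding 2 by (simp add: field_simps)
    then have "cis (pi * (real r * real (2 * r + 1) / 4)) = cis (pi / 2 * real s + 3 * pi / 4)" by (simp only: cis_mult[symmetric] two mult_1)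
    moreover have "3 * pi * real r / 4 = 2 * pi * real s + (pi / 2 * real s + 3 * pi / 4) + - (pi * real s)" unfolding 2 by (simp add: field_simps)
    then have "cis (3 * pi * real r / 4) = cis (pi / 2 * real s + 3 * pi / 4) * (-1) ^ s" by (simp only: cis_mult[symmetric] two mult_1 cis_pi_int)
    ultimately show ?thesis by (simp add: s_def)
  qed
qed

lemma nphase_Wt:
  assumes r: "r \<ge> 4" and j: "j < r + 2"
  shows "nphase r (Wt r (j, g)) = cis (pi / real (2 * r + 1) * (\<Sum>i=0..<r. (real (r - i))\<^sup>2)) * (-1) ^ r * (Xphase r j * Gphase r g)"
proof -
  obtain p q where g: "g = (p, q)" by (cases g)
  define \<mu> where "\<mu> = (if p then J_s r else id) (lamw r j)"
  define c where "c = cis (pi / real (2 * r + 1) * (\<Sum>i=0..<r. (real (r - i))\<^sup>2)) * (-1) ^ r"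
  have \<mu>: "\<mu> \<in> P_plus r 3" "spin r \<mu> p" unfolding \<mu>_def using J_s_lamw_P_plus[OF r j] spin_base[OF r j] by blast+
  have 0: "nphase r (lamw r j) = c * (-1) ^ min j r * Xphase r j" unfolding c_def by (rule nphase_lamw[OF r j])
  have sj: "(-1) ^ min j r * (-1) ^ min j r = (1 :: complex)" by (simp flip: power_add mult_2)
  have "nphase r (J_s r (lamw r j)) = (cis (pi * (real r * real (2 * r + 1) / 4)) * (-1) ^ (r div 2)) * ((-1) ^ min j r * (-1) ^ min j r) * (c * Xphase r j)"
    unfolding nphase_J_s[OF r lamw_P_plus[OF r j] spin_lamw[OF r j]] 0 tphase_lamw[OF r j] by (simp only: mult_ac)
  then have 1: "nphase r (J_s r (lamw r j)) = cis (3 * pi * real r / 4) * (c * Xphase r j)"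
    unfolding sj cis_three_quarter by simp
  have "nphase r (Wt r (j, g)) = (if q \<noteq> odd (min j r) \<and> \<not> p then -1 else 1) * nphase r \<mu>"
    unfolding Wt_def g prod.case \<mu>_def[symmetric] using nphase_J_v[OF r \<mu>] by auto
  then show ?thesis unfolding c_def[symmetric] \<mu>_def using 0 1
    by (cases p) (auto simp: g Gphase_def minus_one_power_iff)
qed

section \<open>Finiteness of the weight lattice modulo the coroot lattice\<close>

lemma int_span_dim: "x \<in> int_span r B \<Longrightarrow> dim_vec x = r"
  by (auto simp: int_span_def)

lemma int_span_I: "vec r (\<lambda>j. \<Sum>b\<in>B. of_int (c b) * b $ j) \<in> int_span r B"
  unfolding int_span_def by blast

lemma int_span_add:
  assumes "x \<in> int_span r B" "y \<in> int_span r B"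
  shows "x + y \<in> int_span r B"
proof -
  obtain c d where "x = vec r (\<lambda>j. \<Sum>b\<in>B. of_int (c b) * b $ j)" "y = vec r (\<lambda>j. \<Sum>b\<in>B. of_int (d b) * b $ j)"
    using assms by (auto simp: int_span_def)
  then have "x + y = vec r (\<lambda>j. \<Sum>b\<in>B. of_int ((\<lambda>b. c b + d b) b) * b $ j)"
    by (intro eq_vecI) (auto simp: ring_distribs sum.distrib)
  then show ?thesis by (simp only: int_span_I)
qed

lemma int_span_smult:
  assumes "x \<in> int_span r B"
  shows "of_int z \<cdot>\<^sub>v x \<in> int_span r B"
proof -
  obtain c where "x = vec r (\<lambda>j. \<Sum>b\<in>B. of_int (c b) * b $ j)" using assms by (auto simp: int_span_def)
  then have "of_int z \<cdot>\<^sub>v x = vec r (\<lambda>j. \<Sum>b\<in>B. of_int ((\<lambda>b. z * c b) b) * b $ j)"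
    by (intro eq_vecI) (auto simp: sum_distrib_left mult.assoc)
  then show ?thesis by (simp only: int_span_I)
qed

lemma int_span_minus:
  assumes "x \<in> int_span r B" "y \<in> int_span r B"
  shows "x - y \<in> int_span r B"
proof -
  have "x - y = x + of_int (-1) \<cdot>\<^sub>v y" using int_span_dim[OF assms(1)] int_span_dim[OF assms(2)] by (intro eq_vecI) auto
  then show ?thesis using int_span_add[OF assms(1) int_span_smult[OF assms(2), of "-1"]] by simp
qed

lemma int_span_generator:
  assumes "finite B" "b \<in> B" "dim_vec b = r"
  shows "b \<in> int_span r B"
proof -
  let ?c = "\<lambda>b'. if b' = b then 1 else (0 :: int)"
  have "(\<Sum>b'\<in>B. of_int (?c b') * b' $ j) = b $ j" for j
  proof -
    have "(\<Sum>b'\<in>B. of_int (?c b') * b' $ j) = (\<Sum>b'\<in>B. if b' = b then b $ j else 0)"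
      by (intro sum.cong) auto
    then show ?thesis using assms by simp
  qed
  then have "vec r (\<lambda>j. \<Sum>b'\<in>B. of_int (?c b') * b' $ j) = b" using assms by (intro eq_vecI) auto
  then show ?thesis using int_span_I[of r ?c B] by (simp only:)
qed

lemma finite_roots: "finite (roots r)"
proof -
  have "pos_roots r \<subseteq> (\<lambda>(i, j). unit_vec r i - unit_vec r j) ` ({..<r} \<times> {..<r}) \<union>
     (\<lambda>(i, j). unit_vec r i + unit_vec r j) ` ({..<r} \<times> {..<r})"
    by (force simp: pos_roots_def)
  then have "finite (pos_roots r)" by (rule finite_subset) auto
  then show ?thesis by (simp add: roots_def)
qed

lemma root_in_coroot_lattice:
  assumes "i < j" "j < r"
  shows "unit_vec r i - unit_vec r j \<in> coroot_lattice r" "unit_vec r i + unit_vec r j \<in> coroot_lattice r"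
proof -
  have s: "(unit_vec r i - unit_vec r j) \<bullet> (unit_vec r i - unit_vec r j) = (2 :: real)"
    "(unit_vec r i + unit_vec r j) \<bullet> (unit_vec r i + unit_vec r j) = (2 :: real)"
    using assms by (simp_all add: scalar_prod_minus_distrib minus_scalar_prod_distrib[of _ r]
        scalar_prod_add_distrib[of _ r] add_scalar_prod_distrib[of _ r])
  have r: "unit_vec r i - unit_vec r j \<in> roots r" "unit_vec r i + unit_vec r j \<in> roots r"
    using assms by (auto simp: roots_def pos_roots_def)
  have "(2 / (\<alpha> \<bullet> \<alpha>)) \<cdot>\<^sub>v \<alpha> \<in> coroot_lattice r" if "\<alpha> \<in> roots r" "dim_vec \<alpha> = r" for \<alpha>
    unfolding coroot_lattice_def using that finite_roots by (intro int_span_generator) auto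
  from this[OF r(1)] this[OF r(2)] show "unit_vec r i - unit_vec r j \<in> coroot_lattice r" "unit_vec r i + unit_vec r j \<in> coroot_lattice r"
    by (simp_all add: s)
qed

text \<open>Twice a unit vector is the sum of the roots \<epsilon>_i - \<epsilon>_k and \<epsilon>_i
  + \<epsilon>_k.\<close>

lemma even_vec_in_coroot_lattice:
  assumes r: "r \<ge> 2"
  shows "vec r (\<lambda>j. 2 * of_int (z j)) \<in> coroot_lattice r"
proof -
  have two: "2 \<cdot>\<^sub>v unit_vec r i \<in> coroot_lattice r" if i: "i < r" for i
  proof -
    define k where "k = (if i = 0 then 1 else 0 :: nat)"
    have "(if i < k then unit_vec r i - unit_vec r k else of_int (-1) \<cdot>\<^sub>v (unit_vec r k - unit_vec r i)) +
        (if i < k then unit_vec r i + unit_vec r k else unit_vec r k + unit_vec r i) \<in> coroot_lattice r"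
      using root_in_coroot_lattice[of i k r] root_in_coroot_lattice[of k i r] i r
      unfolding coroot_lattice_def
      by (intro int_span_add) (auto simp: k_def intro!: int_span_smult[of _ _ _ "-1", simplified])
    also have "(if i < k then unit_vec r i - unit_vec r k else of_int (-1) \<cdot>\<^sub>v (unit_vec r k - unit_vec r i)) +
        (if i < k then unit_vec r i + unit_vec r k else unit_vec r k + unit_vec r i) = (2 :: real) \<cdot>\<^sub>v unit_vec r i"
      by (intro eq_vecI) (auto simp: k_def)
    finally show ?thesis .
  qed
  have "m \<le> r \<Longrightarrow> vec r (\<lambda>j. if j < m then 2 * of_int (z j) else 0) \<in> coroot_lattice r" for m
  proof (induction m)
    case 0
    have "vec r (\<lambda>j. if j < 0 then 2 * of_int (z j) else 0) = of_int 0 \<cdot>\<^sub>v ((2 :: real) \<cdot>\<^sub>v unit_vec r 0)"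
      by (intro eq_vecI) auto
    then show ?case using int_span_smult[OF two[of 0, unfolded coroot_lattice_def], of 0] r
      by (simp add: coroot_lattice_def)
  next
    case (Suc m)
    have "vec r (\<lambda>j. if j < Suc m then 2 * of_int (z j) else 0) =
       vec r (\<lambda>j. if j < m then 2 * of_int (z j) else 0) + of_int (z m) \<cdot>\<^sub>v ((2 :: real) \<cdot>\<^sub>v unit_vec r m)"
      using Suc.prems by (intro eq_vecI) (auto simp: less_Suc_eq)
    then show ?case using Suc two[of m] unfolding coroot_lattice_def by (auto intro!: int_span_add int_span_smult)
  qed
  from this[of r] have "vec r (\<lambda>j. if j < r then 2 * of_int (z j) else 0) \<in> coroot_lattice r" by simp
  also have "vec r (\<lambda>j. if j < r then 2 * of_int (z j) else 0) = vec r (\<lambda>j. 2 * of_int (z j))"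
    by (intro eq_vecI) auto
  finally show ?thesis .
qed

text \<open>Four times a weight lies in the coroot lattice, so \<open>P / Q\<^sup>\<or>\<close> is finite and
  the normalisation of \<open>S\<close> is not the junk value 0.\<close>

lemma lattice_index_pos:
  assumes r: "r \<ge> 2"
  shows "lattice_index r > 0"
proof -
  let ?B = "fund_weight r ` {1..r}"
  let ?x = "\<lambda>c :: real vec \<Rightarrow> int. vec r (\<lambda>j. \<Sum>b\<in>?B. of_int (c b) * b $ j)"
  let ?R = "{(x, y). x \<in> weight_lattice r \<and> y \<in> weight_lattice r \<and> x - y \<in> coroot_lattice r}"
  have x: "?x c \<in> weight_lattice r" for c unfolding weight_lattice_def int_span_def by blast
  have step: "?R `` {?x c} = ?R `` {?x d}" if cd: "\<And>b. b \<in> ?B \<Longrightarrow> c b - d b = 4 * e b" for c d e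
  proof -
    \<comment> \<open>Coordinates of fundamental weights lie in {1, 0, 1/2, -1/2}; \<open>f\<close>
      is twice the coordinate, as an integer.\<close>
    define f where "f b j = (if b $ j = 1 then 2 else if b $ j = 0 then 0 else if b $ j = 1/2 then 1 else -1 :: int)" for b :: "real vec" and j
    have f: "4 * b $ j = 2 * of_int (f b j)" if "b \<in> ?B" "j < r" for b j
    proof -
      have "fund_weight r i $ j \<in> {1, 0, 1/2, -1/2}" for i using that(2) by (simp add: fund_weight_def)
      then have "b $ j \<in> {1, 0, 1/2, -1/2}" using that(1) by blast
      then show ?thesis unfolding f_def by (elim insertE emptyE) simp_all
    qed
    have d1: "?x c - ?x d = vec r (\<lambda>j. 2 * of_int (\<Sum>b\<in>?B. e b * f b j))"
    proof (intro eq_vecI)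
      fix j assume "j < dim_vec (vec r (\<lambda>j. 2 * of_int (\<Sum>b\<in>?B. e b * f b j)) :: real vec)"
      then have j: "j < r" by simp
      have "(?x c - ?x d) $ j = (\<Sum>b\<in>?B. of_int (c b - d b) * b $ j)"
        using j by (simp add: sum_subtractf left_diff_distrib)
      also have "\<dots> = (\<Sum>b\<in>?B. of_int (e b) * (4 * b $ j))" using cd by (intro sum.cong) auto
      also have "\<dots> = (\<Sum>b\<in>?B. of_int (e b) * (2 * of_int (f b j)))" using f j by (intro sum.cong) auto
      also have "\<dots> = 2 * of_int (\<Sum>b\<in>?B. e b * f b j)" by (simp add: sum_distrib_left mult_ac)
      finally show "(?x c - ?x d) $ j = vec r (\<lambda>j. 2 * of_int (\<Sum>b\<in>?B. e b * f b j)) $ j" using j by simp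
    qed simp
    have q: "?x c - ?x d \<in> coroot_lattice r" unfolding d1 by (rule even_vec_in_coroot_lattice[OF r])
    have "?x c - y \<in> coroot_lattice r \<longleftrightarrow> ?x d - y \<in> coroot_lattice r" if y: "y \<in> weight_lattice r" for y
    proof
      have dy: "dim_vec y = r" using y unfolding weight_lattice_def by (rule int_span_dim)
      have 1: "?x d - y = (?x c - y) - (?x c - ?x d)" "?x c - y = (?x d - y) + (?x c - ?x d)"
        using dy by (intro eq_vecI; simp)+
      show "?x d - y \<in> coroot_lattice r" if "?x c - y \<in> coroot_lattice r"
        using that q unfolding 1(1) coroot_lattice_def by (rule int_span_minus)
      show "?x c - y \<in> coroot_lattice r" if "?x d - y \<in> coroot_lattice r"
        using that q unfolding 1(2) coroot_lattice_def by (rule int_span_add)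
    qed
    then show ?thesis using x by auto
  qed
  let ?C = "?B \<rightarrow>\<^sub>E {0..<4 :: int}"
  have "weight_lattice r // ?R \<subseteq> (\<lambda>c. ?R `` {?x c}) ` ?C"
  proof
    fix K assume "K \<in> weight_lattice r // ?R"
    then obtain y where y: "y \<in> weight_lattice r" "K = ?R `` {y}" by (auto simp: quotient_def)
    from y(1) obtain c where c: "y = ?x c" unfolding weight_lattice_def int_span_def by blast
    let ?d = "restrict (\<lambda>b. c b mod 4) ?B"
    have "?R `` {?x c} = ?R `` {?x ?d}"
      by (rule step[where e = "\<lambda>b. c b div 4"]) (auto simp: minus_mod_eq_mult_div)
    moreover have "?d \<in> ?C" by auto
    ultimately show "K \<in> (\<lambda>c. ?R `` {?x c}) ` ?C" unfolding y(2) c by blast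
  qed
  moreover have "finite ?C" by (intro finite_PiE) auto
  ultimately have "finite (weight_lattice r // ?R)" by (meson finite_imageI finite_subset)
  moreover have "weight_lattice r // ?R \<noteq> {}" using x[of "\<lambda>_. 0"] by (auto simp: quotient_def)
  ultimately show ?thesis by (simp add: lattice_index_def card_gt_0_iff)
qed

section \<open>The Kac-Peterson matrices in cell coordinates\<close>

definition S_const :: "nat \<Rightarrow> complex" where
  "S_const r = \<i> ^ card (pos_roots r) * of_real (real (2 * r + 1) powr (- real r / 2)) *
     of_real (real (lattice_index r) powr (- 1 / 2)) * base_const r"

lemma S_const_nonzero: "r \<ge> 2 \<Longrightarrow> S_const r \<noteq> 0"
  using lattice_index_pos[of r] base_nonzero(1)[of r] by (auto simp: S_const_def)

lemma S_mat_Wt: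
  assumes r: "r \<ge> 4" and x: "x \<in> Cells r" and y: "y \<in> Cells r"
  shows "S_mat r 3 (Wt r x) (Wt r y) = S_const r * tens (Xmat r (base_kappa r)) (Gmat r) x y"
proof -
  obtain j g k h where xy: "x = (j, g)" "y = (k, h)" by (cases x; cases y)
  have jk: "j < r + 2" "k < r + 2" using x y by (auto simp: xy Cells_def)
  have "height r 3 = 2 * r + 1" using r by (simp add: height_def)
  moreover have "weyl_sum r (2 * r + 1) (\<lambda>i. (fin_part r (Wt r x) + rho_bar r) $ i) (\<lambda>i. (fin_part r (Wt r y) + rho_bar r) $ i)
     = ws r (Wt r x) (Wt r y)"
    unfolding ws_def by (rule weyl_sum_cong) (auto simp: lw_index)
  ultimately show ?thesis
    using weyl_sum_eq[OF fin_part_rho_carrier fin_part_rho_carrier, of "2 * r + 1" r "Wt r x" "Wt r y"]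
      Wt_P_plus[OF r x] Wt_P_plus[OF r y] ws_Wt[OF r jk, of g h]
    by (simp add: S_mat_def mat_on_def S_const_def xy mult.assoc)
qed

definition T_const :: "nat \<Rightarrow> complex" where
  "T_const r = exp (- (of_real pi * \<i> / of_nat (2 * r - 2) * of_real (rho_bar r \<bullet> rho_bar r))) *
     (cis (pi / real (2 * r + 1) * (\<Sum>i=0..<r. (real (r - i))\<^sup>2)) * (-1) ^ r)"

lemma T_const_nonzero: "T_const r \<noteq> 0"
  by (simp add: T_const_def)

lemma T_mat_Wt:
  assumes r: "r \<ge> 4" and x: "x \<in> Cells r"
  shows "T_mat r 3 (Wt r x) (Wt r x) = T_const r * (Xphase r (fst x) * Gphase r (snd x))"
proof -
  let ?v = "fin_part r (Wt r x) + rho_bar r"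
  have h: "height r 3 = 2 * r + 1" using r by (simp add: height_def)
  have "?v \<bullet> ?v = (\<Sum>i=0..<r. (lw r (Wt r x) i)\<^sup>2)"
    by (auto simp: scalar_prod_def lw_index[symmetric] power2_eq_square rho_bar_def fin_part_def intro!: sum.cong)
  then have "exp (of_real pi * \<i> / of_nat (2 * r + 1) * of_real (?v \<bullet> ?v)) = nphase r (Wt r x)"
    by (simp add: nphase_def cis_conv_exp mult_ac)
  moreover have "nphase r (Wt r x) = cis (pi / real (2 * r + 1) * (\<Sum>i=0..<r. (real (r - i))\<^sup>2)) * (-1) ^ r *
     (Xphase r (fst x) * Gphase r (snd x))"
    using nphase_Wt[OF r, of "fst x" "snd x"] x by (auto simp: Cells_def)
  ultimately show ?thesis
    using Wt_P_plus[OF r x] unfolding T_mat_def mat_on_def h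
    by (simp add: exp_diff T_const_def exp_minus field_simps)
qed

section \<open>Cells enumerate the weights of level 3\<close>

lemma J_v_labels:
  assumes "r \<ge> 4"
  shows "J_v r \<mu> 0 = \<mu> 1" "J_v r \<mu> 1 = \<mu> 0" "J_v r \<mu> (r - 1) = \<mu> r" "J_v r \<mu> r = \<mu> (r - 1)"
    "2 \<le> i \<Longrightarrow> i \<le> r - 2 \<Longrightarrow> J_v r \<mu> i = \<mu> i" "i > r \<Longrightarrow> J_v r \<mu> i = \<mu> i"
  using assms by (auto simp: J_v_def)

lemma J_s_labels:
  assumes "r \<ge> 4"
  shows "J_s r \<mu> 0 = (if even r then \<mu> r else \<mu> (r - 1))" "J_s r \<mu> 1 = (if even r then \<mu> (r - 1) else \<mu> r)"
    "J_s r \<mu> (r - 1) = \<mu> 1" "J_s r \<mu> r = \<mu> 0"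
    "2 \<le> i \<Longrightarrow> i \<le> r - 2 \<Longrightarrow> J_s r \<mu> i = \<mu> (r - i)" "i > r \<Longrightarrow> J_s r \<mu> i = \<mu> i"
  using assms by (auto simp: J_s_def)

lemma weight_eqI:
  fixes \<mu> \<nu> :: weight
  assumes "\<mu> 0 = \<nu> 0" "\<mu> 1 = \<nu> 1" "\<mu> (r - 1) = \<nu> (r - 1)" "\<mu> r = \<nu> r"
    "\<And>i. 2 \<le> i \<Longrightarrow> i \<le> r - 2 \<Longrightarrow> \<mu> i = \<nu> i" "\<And>i. i > r \<Longrightarrow> \<mu> i = \<nu> i"
  shows "\<mu> = \<nu>"
proof
  fix i
  have "i = 0 \<or> i = 1 \<or> (2 \<le> i \<and> i \<le> r - 2) \<or> i = r - 1 \<or> i = r \<or> i > r" by linarith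
  then show "\<mu> i = \<nu> i" using assms by blast
qed

lemma J_v_J_v:
  assumes r: "r \<ge> 4"
  shows "J_v r (J_v r \<mu>) = \<mu>"
  by (rule weight_eqI[where r = r]) (simp_all only: J_v_labels[OF r])

lemma J_s_J_s:
  assumes r: "r \<ge> 4"
  shows "J_s r (J_s r \<mu>) = (if even r then \<mu> else J_v r \<mu>)"
proof (rule weight_eqI[where r = r])
  fix i assume i: "2 \<le> i" "i \<le> r - 2"
  then have "2 \<le> r - i" "r - i \<le> r - 2" "r - (r - i) = i" by auto
  then show "J_s r (J_s r \<mu>) i = (if even r then \<mu> else J_v r \<mu>) i"
    using i by (simp only: J_s_labels[OF r] J_v_labels[OF r] if_distribR if_cancel)
qed (cases "even r"; simp only: J_s_labels[OF r] J_v_labels[OF r] if_True if_False simp_thms)+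

lemma J_s_J_v:
  assumes r: "r \<ge> 4"
  shows "J_s r (J_v r \<mu>) = J_v r (J_s r \<mu>)"
proof (rule weight_eqI[where r = r])
  fix i assume i: "2 \<le> i" "i \<le> r - 2"
  then have "2 \<le> r - i" "r - i \<le> r - 2" by auto
  then show "J_s r (J_v r \<mu>) i = J_v r (J_s r \<mu>) i"
    using i by (simp only: J_s_labels[OF r] J_v_labels[OF r])
qed (cases "even r"; simp only: J_s_labels[OF r] J_v_labels[OF r] if_True if_False simp_thms)+

lemma J_v_inj: "r \<ge> 4 \<Longrightarrow> J_v r \<mu> = J_v r \<nu> \<Longrightarrow> \<mu> = \<nu>"
  using J_v_J_v by metis

lemma J_s_inj: "r \<ge> 4 \<Longrightarrow> J_s r \<mu> = J_s r \<nu> \<Longrightarrow> \<mu> = \<nu>"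
  using J_s_J_s J_v_J_v by metis

lemma lamw_values:
  assumes "r \<ge> 4"
  shows "lamw r j 0 = (if j = 0 then 3 else if j = 1 then 2 else 1)"
    "lamw r j 1 = (if j = 1 then 1 else 0)"
    "lamw r j (r - 1) = (if j = r + 1 then 2 else if j = r - 1 then 1 else 0)"
    "lamw r j r = (if j = r then 2 else if j = r - 1 then 1 else 0)"
    "2 \<le> i \<Longrightarrow> i \<le> r - 2 \<Longrightarrow> lamw r j i = (if i = j then 1 else 0)"
proof -
  have *: "r \<noteq> 0" "r - 1 \<noteq> 0" "r - 1 \<noteq> r" "r \<noteq> r - 1" "1 \<noteq> r" "r \<noteq> 1" "1 \<noteq> r - 1" "r - 1 \<noteq> 1"
    "(1::nat) \<noteq> 0" "r + 1 \<noteq> r" "r + 1 \<noteq> r - 1" "r \<noteq> r + 1" "r - 1 \<noteq> r + 1" "1 \<noteq> r + 1"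
    using assms by linarith+
  show "lamw r j 0 = (if j = 0 then 3 else if j = 1 then 2 else 1)" by (simp add: lamw_def)
  show "lamw r j 1 = (if j = 1 then 1 else 0)" unfolding lamw_def using * by auto
  show "lamw r j (r - 1) = (if j = r + 1 then 2 else if j = r - 1 then 1 else 0)"
    unfolding lamw_def by (cases "j = r + 1"; cases "j = r"; cases "j = r - 1") (simp_all only: * if_True if_False simp_thms, auto?)
  show "lamw r j r = (if j = r then 2 else if j = r - 1 then 1 else 0)"
    unfolding lamw_def by (cases "j = r + 1"; cases "j = r"; cases "j = r - 1") (simp_all only: * if_True if_False simp_thms, auto?)
  assume i: "2 \<le> i" "i \<le> r - 2"
  have **: "i \<noteq> 0" "i \<noteq> r - 1" "i \<noteq> r" "i \<noteq> r + 1" "r - 1 \<noteq> i" "r \<noteq> i" "r + 1 \<noteq> i" using i assms by linarith+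
  show "lamw r j i = (if i = j then 1 else 0)"
    unfolding lamw_def by (cases "j = r + 1"; cases "j = r"; cases "j = r - 1") (simp_all only: ** if_True if_False simp_thms, auto?)
qed

lemma lamw_eqD:
  assumes r: "r \<ge> 4" and j: "j < r + 2" and k: "k < r + 2" and e: "lamw r j = lamw r k"
  shows "j = k"
proof -
  have mid: "j = k" if "2 \<le> j" "j \<le> r - 2" "lamw r j = lamw r k" for j k
  proof -
    have "lamw r j j = lamw r k j" using that(3) by (rule fun_cong)
    then show ?thesis unfolding lamw_values(5)[OF r that(1,2)] by (cases "j = k") simp_all
  qed
  have other: "l = 0 \<or> l = 1 \<or> l = r - 1 \<or> l = r \<or> l = r + 1 \<or> 2 \<le> l \<and> l \<le> r - 2" if "l < r + 2" for l
    using that by linarith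
  \<comment> \<open>Base 4 digits of the labels at 0, r - 1 and r; \<open>d\<close> decodes the five
    special indices from the values 3, 2, 21, 33 and 9.\<close>
  define c where "c l = lamw r l 0 + 4 * lamw r l (r - 1) + 16 * lamw r l r" for l
  define d where "d m = (if m = 3 then 0 else if m = 2 then 1 else if m = 21 then r - 1 else if m = 33 then r else r + 1)" for m :: nat
  have c: "c 0 = 3" "c 1 = 2" "c (r - 1) = 21" "c r = 33" "c (r + 1) = 9"
    unfolding c_def lamw_values[OF r] using r by auto
  have dc: "d (c l) = l" if "l = 0 \<or> l = 1 \<or> l = r - 1 \<or> l = r \<or> l = r + 1" for l
    using that
  proof (elim disjE)
    assume "l = 0" show ?thesis unfolding \<open>l = 0\<close> c d_def by simp
  next
    assume "l = 1" show ?thesis unfolding \<open>l = 1\<close> c d_def by simp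
  next
    assume "l = r - 1" show ?thesis unfolding \<open>l = r - 1\<close> c d_def by simp
  next
    assume "l = r" show ?thesis unfolding \<open>l = r\<close> c d_def by simp
  next
    assume "l = r + 1" show ?thesis unfolding \<open>l = r + 1\<close> c d_def by simp
  qed
  have "d (c j) = d (c k)" unfolding c_def e ..
  then have special: "j = k" if "j = 0 \<or> j = 1 \<or> j = r - 1 \<or> j = r \<or> j = r + 1" "k = 0 \<or> k = 1 \<or> k = r - 1 \<or> k = r \<or> k = r + 1"
    unfolding dc[OF that(1)] dc[OF that(2)] .
  consider "2 \<le> j \<and> j \<le> r - 2" | "2 \<le> k \<and> k \<le> r - 2"
    | "j = 0 \<or> j = 1 \<or> j = r - 1 \<or> j = r \<or> j = r + 1" "k = 0 \<or> k = 1 \<or> k = r - 1 \<or> k = r \<or> k = r + 1"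
    using other[OF j] other[OF k] by argo
  then show ?thesis
  proof cases
    case 1
    then show ?thesis using mid[OF _ _ e] by blast
  next
    case 2
    then show ?thesis using mid[OF _ _ e[symmetric]] by blast
  next
    case 3
    then show ?thesis by (rule special)
  qed
qed

lemma lamw_labels:
  assumes "r \<ge> 4" "j < r + 2"
  shows "lamw r j 1 < lamw r j 0" "odd (lamw r j 0 + lamw r j 1)" "even (lamw r j (r - 1) + lamw r j r)"
  unfolding lamw_values[OF assms(1)] using assms(1) by auto

text \<open>The parity of the sum of the labels 0 and 1 shows whether \<open>J_s\<close> was
  applied. The order of the labels 0 and 1 for tensor weights, of r - 1 and r for spinor weights,
  shows whether \<open>J_v\<close> was.\<close>

lemma Wt_inj:
  assumes r: "r \<ge> 4" and x: "x \<in> Cells r" and y: "y \<in> Cells r" and e: "Wt r x = Wt r y"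
  shows "x = y"
proof -
  obtain j p q k p' q' where xy: "x = (j, p, q)" "y = (k, p', q')" by (cases x; cases y)
  have j: "j < r + 2" and k: "k < r + 2" using x y by (auto simp: xy Cells_def)
  define W where "W a p j = (if a then J_v r else id) ((if p then J_s r else id) (lamw r j))" for a p j
  have W: "Wt r (j, p, q) = W (q \<noteq> odd (min j r)) p j" for j p q by (simp add: Wt_def W_def)
  have odd: "odd (W a p j 0 + W a p j 1) \<longleftrightarrow> \<not> p" if "j < r + 2" for a p j
    using lamw_labels[OF r that]
    by (cases a; cases p) (simp_all add: W_def add.commute J_v_labels[OF r] J_s_labels[OF r] del: One_nat_def)
  have lt: "(if p then W a p j (r - 1) < W a p j r else W a p j 1 < W a p j 0) \<longleftrightarrow> \<not> a" if "j < r + 2" for a p j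
    using lamw_labels(1)[OF r that]
    by (cases a; cases p) (simp_all add: W_def J_v_labels[OF r] J_s_labels[OF r] del: One_nat_def)
  define a where "a = (q \<noteq> odd (min j r))"
  define b where "b = (q' \<noteq> odd (min k r))"
  have ww: "W a p j = W b p' k" using e by (simp add: xy W a_def b_def)
  have p: "p = p'" using odd[OF j, of a p] odd[OF k, of b p'] ww by auto
  have ab: "a = b" using lt[OF j, of p a] lt[OF k, of p' b] ww p by auto
  have "lamw r j = lamw r k"
  proof -
    have "(if p then J_s r else id) (lamw r j) = (if p then J_s r else id) (lamw r k)"
      using ww J_v_inj[OF r] unfolding W_def p ab by (cases b) (simp_all only: if_True if_False id_apply)
    then show ?thesis using J_s_inj[OF r] by (cases p) auto
  qed
  then have "j = k" using lamw_eqD[OF r j k] by simp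
  then show ?thesis using p ab by (auto simp: xy a_def b_def)
qed

text \<open>At level 3 an odd \<nu>_0 + \<nu>_1 leaves 0 or 2 units for the other labels; the
  condition on \<nu>_0 and \<nu>_1 selects one member of each \<open>J_v\<close> orbit, and six
  patterns remain.\<close>

lemma P_plus_base:
  assumes r: "r \<ge> 4" and \<nu>: "\<nu> \<in> P_plus r 3" and o: "odd (\<nu> 0 + \<nu> 1)" and lt: "\<nu> 1 < \<nu> 0"
  shows "\<exists>j<r + 2. \<nu> = lamw r j"
proof -
  define s where "s = (\<Sum>i=2..r - 2. \<nu> i)"
  have big: "\<nu> i = 0" if "i > r" for i using \<nu> that by (simp add: P_plus_def)
  have lev: "3 = \<nu> 0 + \<nu> 1 + 2 * s + \<nu> (r - 1) + \<nu> r"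
    using \<nu> by (simp add: P_plus_def s_def sum_distrib_left)
  have mid: "\<nu> i = 0" if "s = 0" "2 \<le> i" "i \<le> r - 2" for i using that by (simp add: s_def)
  have eqI: "\<nu> = lamw r j" if "\<nu> 0 = lamw r j 0" "\<nu> 1 = lamw r j 1" "\<nu> (r - 1) = lamw r j (r - 1)" "\<nu> r = lamw r j r"
    "\<And>i. 2 \<le> i \<Longrightarrow> i \<le> r - 2 \<Longrightarrow> \<nu> i = lamw r j i" "j < r + 2" for j
  proof (rule weight_eqI[where r = r])
    show "\<nu> i = lamw r j i" if "i > r" for i using that big[OF that] \<open>j < r + 2\<close> by (auto simp: lamw_def)
  qed (use that in blast)+
  consider "\<nu> 0 = 3" "\<nu> 1 = 0" "s = 0" "\<nu> (r - 1) = 0" "\<nu> r = 0"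
    | "\<nu> 0 = 2" "\<nu> 1 = 1" "s = 0" "\<nu> (r - 1) = 0" "\<nu> r = 0"
    | "\<nu> 0 = 1" "\<nu> 1 = 0" "s = 1" "\<nu> (r - 1) = 0" "\<nu> r = 0"
    | "\<nu> 0 = 1" "\<nu> 1 = 0" "s = 0" "\<nu> (r - 1) = 1" "\<nu> r = 1"
    | "\<nu> 0 = 1" "\<nu> 1 = 0" "s = 0" "\<nu> (r - 1) = 0" "\<nu> r = 2"
    | "\<nu> 0 = 1" "\<nu> 1 = 0" "s = 0" "\<nu> (r - 1) = 2" "\<nu> r = 0"
  proof -
    have "\<nu> 0 = 3 \<and> \<nu> 1 = 0 \<and> s = 0 \<and> \<nu> (r - 1) = 0 \<and> \<nu> r = 0 \<or>
      \<nu> 0 = 2 \<and> \<nu> 1 = 1 \<and> s = 0 \<and> \<nu> (r - 1) = 0 \<and> \<nu> r = 0 \<or>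
      \<nu> 0 = 1 \<and> \<nu> 1 = 0 \<and> 2 * s + \<nu> (r - 1) + \<nu> r = 2"
    proof -
      have "\<nu> 0 + \<nu> 1 \<le> 3" using lev by linarith
      then have "\<nu> 0 + \<nu> 1 = 1 \<or> \<nu> 0 + \<nu> 1 = 3" using o by presburger
      then show ?thesis
      proof
        assume "\<nu> 0 + \<nu> 1 = 1"
        then have "\<nu> 0 = 1" "\<nu> 1 = 0" using lt by linarith+
        then show ?thesis using lev by linarith
      next
        assume *: "\<nu> 0 + \<nu> 1 = 3"
        then have "s = 0" "\<nu> (r - 1) = 0" "\<nu> r = 0" using lev by linarith+
        moreover have "\<nu> 0 = 3 \<and> \<nu> 1 = 0 \<or> \<nu> 0 = 2 \<and> \<nu> 1 = 1" using * lt by linarith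
        ultimately show ?thesis by blast
      qed
    qed
    moreover have "2 * s + a + b = 2 \<Longrightarrow> s = 1 \<and> a = 0 \<and> b = 0 \<or> s = 0 \<and> a = 1 \<and> b = 1 \<or> s = 0 \<and> a = 0 \<and> b = 2 \<or> s = 0 \<and> a = 2 \<and> b = 0" for a b :: nat
      by presburger
    ultimately show ?thesis using that by metis
  qed
  then show ?thesis
  proof cases
    case 1
    show ?thesis using r 1 mid by (intro exI[of _ 0] conjI eqI) (auto simp: lamw_values[OF r] simp del: One_nat_def)
  next
    case 2
    show ?thesis using r 2 mid by (intro exI[of _ 1] conjI eqI) (auto simp: lamw_values[OF r] simp del: One_nat_def)
  next
    case 3
    then obtain j where j: "j \<in> {2..r - 2}" "\<nu> j = 1" "\<forall>i\<in>{2..r - 2}. j \<noteq> i \<longrightarrow> \<nu> i = 0"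
      using sum_eq_1_iff[of "{2..r - 2}" \<nu>] unfolding s_def by auto
    then have jj: "j \<noteq> 0" "j \<noteq> 1" "j \<noteq> r + 1" "j \<noteq> r" "j \<noteq> r - 1" "j < r + 2" using r by auto
    have "\<nu> = lamw r j"
    proof (rule eqI)
      show "\<nu> i = lamw r j i" if "2 \<le> i" "i \<le> r - 2" for i
        using that j(2,3) unfolding lamw_values(5)[OF r that] by auto
    qed (use 3 r jj in \<open>simp_all add: lamw_values[OF r] del: One_nat_def\<close>)
    then show ?thesis using jj by blast
  next
    case 4
    show ?thesis using r 4 mid by (intro exI[of _ "r - 1"] conjI eqI) (auto simp: lamw_values[OF r] simp del: One_nat_def)
  next
    case 5
    show ?thesis using r 5 mid by (intro exI[of _ r] conjI eqI) (auto simp: lamw_values[OF r] simp del: One_nat_def)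
  next
    case 6
    show ?thesis using r 6 mid by (intro exI[of _ "r + 1"] conjI eqI) (auto simp: lamw_values[OF r] simp del: One_nat_def)
  qed
qed

lemma P_plus_tensor:
  assumes r: "r \<ge> 4" and \<nu>: "\<nu> \<in> P_plus r 3" and o: "odd (\<nu> 0 + \<nu> 1)"
  shows "\<exists>j<r + 2. \<nu> = lamw r j \<or> \<nu> = J_v r (lamw r j)"
proof (cases "\<nu> 1 < \<nu> 0")
  case True
  then show ?thesis using P_plus_base[OF r \<nu> o] by blast
next
  case False
  moreover have "\<nu> 1 \<noteq> \<nu> 0" using o by auto
  ultimately have "J_v r \<nu> 1 < J_v r \<nu> 0" unfolding J_v_labels[OF r] by simp
  moreover have "odd (J_v r \<nu> 0 + J_v r \<nu> 1)" unfolding J_v_labels[OF r] using o by (simp add: add.commute)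
  ultimately obtain j where "j < r + 2" "J_v r \<nu> = lamw r j"
    using P_plus_base[OF r J_v_P_plus[OF r \<nu>]] by blast
  then show ?thesis using J_v_J_v[OF r, of \<nu>] by metis
qed

text \<open>At odd level exactly one of the label sums at the two ends of the diagram is odd, and
  \<open>J_s\<close> exchanges the two ends.\<close>

lemma Wt_surj:
  assumes r: "r \<ge> 4" and \<mu>: "\<mu> \<in> P_plus r 3"
  shows "\<exists>x\<in>Cells r. \<mu> = Wt r x"
proof -
  have 1: "\<exists>q. Wt r (j, p, q) = (if p then J_s r else id) (lamw r j)"
    "\<exists>q. Wt r (j, p, q) = J_v r ((if p then J_s r else id) (lamw r j))" for j p
    unfolding Wt_def prod.case
    by (rule exI[of _ "odd (min j r)"], simp, rule exI[of _ "even (min j r)"], simp)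
  show ?thesis
  proof (cases "odd (\<mu> 0 + \<mu> 1)")
    case True
    then obtain j where j: "j < r + 2" "\<mu> = lamw r j \<or> \<mu> = J_v r (lamw r j)" using P_plus_tensor[OF r \<mu>] by blast
    then have "\<exists>q. Wt r (j, False, q) = \<mu>" using 1[of j False] by auto
    then obtain q where "\<mu> = Wt r (j, False, q)" by blast
    then show ?thesis using j by (intro bexI[of _ "(j, False, q)"]) (auto simp: Cells_def)
  next
    case False
    \<comment> \<open>The inverse of \<open>J_s\<close>, whose square is \<open>J_v\<close> for odd
      \<open>r\<close>.\<close>
    define \<nu> where "\<nu> = (if even r then J_s r \<mu> else J_s r (J_v r \<mu>))"
    have \<nu>P: "\<nu> \<in> P_plus r 3" using J_s_P_plus[OF r] J_v_P_plus[OF r] \<mu> by (auto simp: \<nu>_def)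
    have \<nu>\<mu>: "J_s r \<nu> = \<mu>" using J_s_J_s[OF r] J_v_J_v[OF r] by (auto simp: \<nu>_def)
    have "3 = \<mu> 0 + \<mu> 1 + 2 * (\<Sum>i=2..r - 2. \<mu> i) + \<mu> (r - 1) + \<mu> r"
      using \<mu> by (simp add: P_plus_def sum_distrib_left)
    then have "odd (\<mu> (r - 1) + \<mu> r)" using False by presburger
    moreover have "\<mu> (r - 1) + \<mu> r = \<nu> 0 + \<nu> 1" using J_s_labels(3,4)[OF r, of \<nu>] unfolding \<nu>\<mu> by simp
    ultimately have "odd (\<nu> 0 + \<nu> 1)" by argo
    then obtain j where j: "j < r + 2" "\<nu> = lamw r j \<or> \<nu> = J_v r (lamw r j)" using P_plus_tensor[OF r \<nu>P] by blast
    then have "\<mu> = J_s r (lamw r j) \<or> \<mu> = J_v r (J_s r (lamw r j))" using \<nu>\<mu> J_s_J_v[OF r] by auto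
    then have "\<exists>q. Wt r (j, True, q) = \<mu>" using 1[of j True] by auto
    then obtain q where "\<mu> = Wt r (j, True, q)" by blast
    then show ?thesis using j by (intro bexI[of _ "(j, True, q)"]) (auto simp: Cells_def)
  qed
qed

lemma Wt_bij:
  assumes r: "r \<ge> 4"
  shows "bij_betw (Wt r) (Cells r) (P_plus r 3)"
  using Wt_inj[OF r] Wt_surj[OF r] Wt_P_plus[OF r]
  by (intro bij_betw_imageI inj_onI set_eqI) (auto simp: image_iff)

section \<open>Physical invariants as tensor products\<close>

definition Wt_inv :: "nat \<Rightarrow> weight \<Rightarrow> cell" where
  "Wt_inv r = the_inv_into (Cells r) (Wt r)"

definition lift :: "nat \<Rightarrow> (cell \<Rightarrow> cell \<Rightarrow> nat) \<Rightarrow> wmat" where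
  "lift r N = mat_on (P_plus r 3) (\<lambda>\<mu> \<nu>. of_nat (N (Wt_inv r \<mu>) (Wt_inv r \<nu>)))"

definition ntens :: "(nat \<Rightarrow> nat \<Rightarrow> nat) \<Rightarrow> (bool \<times> bool \<Rightarrow> bool \<times> bool \<Rightarrow> nat) \<Rightarrow> cell \<Rightarrow> cell \<Rightarrow> nat" where
  "ntens a m x y = a (fst x) (fst y) * m (snd x) (snd y)"

lemma finite_Cells [simp]: "finite (Cells r)"
  by (simp add: Cells_def)

lemma Wt_inv_Wt: "r \<ge> 4 \<Longrightarrow> x \<in> Cells r \<Longrightarrow> Wt_inv r (Wt r x) = x"
  unfolding Wt_inv_def by (rule the_inv_into_f_f[OF bij_betw_imp_inj_on[OF Wt_bij]])

lemma lift_Wt: "r \<ge> 4 \<Longrightarrow> x \<in> Cells r \<Longrightarrow> y \<in> Cells r \<Longrightarrow> lift r N (Wt r x) (Wt r y) = of_nat (N x y)"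
  by (simp add: lift_def mat_on_def Wt_P_plus Wt_inv_Wt)

lemma lift_outside: "\<mu> \<notin> P_plus r 3 \<or> \<nu> \<notin> P_plus r 3 \<Longrightarrow> lift r N \<mu> \<nu> = 0"
  by (auto simp: lift_def mat_on_def)

lemma wmat_eqI:
  assumes r: "r \<ge> 4" and "\<And>\<mu> \<nu>. \<mu> \<notin> P_plus r 3 \<or> \<nu> \<notin> P_plus r 3 \<Longrightarrow> M \<mu> \<nu> = 0"
    and "\<And>\<mu> \<nu>. \<mu> \<notin> P_plus r 3 \<or> \<nu> \<notin> P_plus r 3 \<Longrightarrow> M' \<mu> \<nu> = 0"
    and "\<And>x y. x \<in> Cells r \<Longrightarrow> y \<in> Cells r \<Longrightarrow> M (Wt r x) (Wt r y) = M' (Wt r x) (Wt r y)"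
  shows "M = M'"
proof (intro ext)
  fix \<mu> \<nu>
  show "M \<mu> \<nu> = M' \<mu> \<nu>"
  proof (cases "\<mu> \<in> P_plus r 3 \<and> \<nu> \<in> P_plus r 3")
    case True
    then obtain x y where "x \<in> Cells r" "y \<in> Cells r" "\<mu> = Wt r x" "\<nu> = Wt r y"
      using Wt_surj[OF r] by metis
    then show ?thesis using assms(4) by simp
  qed (use assms(2,3) in auto)
qed

lemma eq_liftI:
  assumes r: "r \<ge> 4" and "\<And>\<mu> \<nu>. \<mu> \<notin> P_plus r 3 \<or> \<nu> \<notin> P_plus r 3 \<Longrightarrow> M \<mu> \<nu> = 0"
    and "\<And>x y. x \<in> Cells r \<Longrightarrow> y \<in> Cells r \<Longrightarrow> M (Wt r x) (Wt r y) = of_nat (N x y)"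
  shows "M = lift r N"
  using assms by (intro wmat_eqI[OF r]) (auto simp: lift_Wt lift_outside)

lemma lift_cong:
  assumes "r \<ge> 4" "\<And>x y. x \<in> Cells r \<Longrightarrow> y \<in> Cells r \<Longrightarrow> N x y = N' x y"
  shows "lift r N = lift r N'"
  using assms by (intro eq_liftI) (auto simp: lift_Wt lift_outside)

lemma mat_mul_outside: "\<mu> \<notin> P \<or> \<nu> \<notin> P \<Longrightarrow> mat_mul P A B \<mu> \<nu> = 0"
  by (auto simp: mat_mul_def mat_on_def)

lemma mat_mul_Wt:
  assumes r: "r \<ge> 4" and x: "x \<in> Cells r" and y: "y \<in> Cells r"
  shows "mat_mul (P_plus r 3) A B (Wt r x) (Wt r y) =
    mprod (Cells r) (\<lambda>x y. A (Wt r x) (Wt r y)) (\<lambda>x y. B (Wt r x) (Wt r y)) x y"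
proof -
  have "(\<Sum>\<kappa>\<in>P_plus r 3. A (Wt r x) \<kappa> * B \<kappa> (Wt r y)) = (\<Sum>z\<in>Cells r. A (Wt r x) (Wt r z) * B (Wt r z) (Wt r y))"
    by (rule sum.reindex_bij_betw[symmetric, OF Wt_bij[OF r]])
  then show ?thesis using Wt_P_plus[OF r] x y by (simp add: mat_mul_def mat_on_def mprod_def)
qed

lemma mat_mul_lift:
  assumes r: "r \<ge> 4"
  shows "mat_mul (P_plus r 3) (lift r N) (lift r N') = lift r (\<lambda>x y. \<Sum>z\<in>Cells r. N x z * N' z y)"
  using r by (intro eq_liftI) (auto simp: mat_mul_outside mat_mul_Wt mprod_def lift_Wt)

lemma mat_mul_lift_ntens:
  assumes r: "r \<ge> 4"
  shows "mat_mul (P_plus r 3) (lift r (ntens a m)) (lift r (ntens a' m')) =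
    lift r (ntens (\<lambda>j k. \<Sum>l<r + 2. a j l * a' l k) (\<lambda>g h. \<Sum>f\<in>UNIV. m g f * m' f h))"
  unfolding mat_mul_lift[OF r]
proof (intro lift_cong r)
  fix x y
  show "(\<Sum>z\<in>Cells r. ntens a m x z * ntens a' m' z y) =
     ntens (\<lambda>j k. \<Sum>l<r + 2. a j l * a' l k) (\<lambda>g h. \<Sum>f\<in>UNIV. m g f * m' f h) x y"
    by (simp add: ntens_def Cells_def sum_product sum.cartesian_product' mult_ac) (rule sum.swap)
qed

lemma lift_ntens_cong:
  assumes "r \<ge> 4" "\<And>j k. j < r + 2 \<Longrightarrow> k < r + 2 \<Longrightarrow> a j k = a' j k" "\<And>g h. m g h = m' g h"
  shows "lift r (ntens a m) = lift r (ntens a' m')"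
  using assms by (intro lift_cong) (auto simp: ntens_def Cells_def)

lemma sum_perm_mat_left:
  assumes "finite I" "\<pi> x \<in> I"
  shows "(\<Sum>z\<in>I. perm_mat \<pi> x z * m z y) = m (\<pi> x) y"
proof -
  have "(\<Sum>z\<in>I. perm_mat \<pi> x z * m z y) = (\<Sum>z\<in>I. if z = \<pi> x then m (\<pi> x) y else 0)"
    by (intro sum.cong) (auto simp: perm_mat_def)
  then show ?thesis using assms by simp
qed

lemma X_auts_image: "r \<ge> 4 \<Longrightarrow> \<pi> \<in> X_auts r \<Longrightarrow> j < r + 2 \<Longrightarrow> \<pi> j < r + 2"
proof (cases "r = 4")
  case True
  assume "\<pi> \<in> X_auts r" "j < r + 2"
  then have "\<pi> permutes {1, 4, 5}" using True by (simp add: X_auts_def)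
  then show ?thesis using \<open>j < r + 2\<close> True permutes_in_image[of \<pi> "{1, 4, 5}" j] by (cases "j \<in> {1, 4, 5}") (auto simp: permutes_not_in)
next
  case False
  assume "\<pi> \<in> X_auts r" "j < r + 2"
  then show ?thesis using False by (auto simp: X_auts_def Transposition.transpose_def)
qed

lemma X_auts_0: "r \<ge> 4 \<Longrightarrow> \<pi> \<in> X_auts r \<Longrightarrow> \<pi> 0 = 0"
  by (auto simp: X_auts_def Transposition.transpose_def permutes_not_in split: if_splits)

lemma mat_mul_perm_left:
  assumes r: "r \<ge> 4" and \<pi>: "\<And>j. j < r + 2 \<Longrightarrow> \<pi> j < r + 2"
  shows "mat_mul (P_plus r 3) (lift r (ntens (perm_mat \<pi>) (perm_mat \<tau>))) (lift r (ntens a m)) =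
    lift r (ntens (\<lambda>j k. a (\<pi> j) k) (\<lambda>g h. m (\<tau> g) h))"
  unfolding mat_mul_lift_ntens[OF r] using r \<pi>
  by (intro lift_ntens_cong) (auto simp: sum_perm_mat_left)

text \<open>Transport along the bijection \<open>Wt\<close>. The nonzero constants of
  \<open>S\<close> and \<open>T\<close> cancel, and commuting with a diagonal matrix means being
  supported where its phases agree.\<close>

lemma physical_invariant_iff:
  assumes r: "r \<ge> 4"
  shows "physical_invariant r 3 M \<longleftrightarrow>
    (\<forall>\<mu> \<nu>. \<mu> \<notin> P_plus r 3 \<or> \<nu> \<notin> P_plus r 3 \<longrightarrow> M \<mu> \<nu> = 0) \<and>
    commutes (Cells r) (\<lambda>x y. M (Wt r x) (Wt r y)) (tens (Xmat r (base_kappa r)) (Gmat r)) \<and>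
    (\<forall>x\<in>Cells r. \<forall>y\<in>Cells r. M (Wt r x) (Wt r y) \<noteq> 0 \<longrightarrow>
      Xphase r (fst x) * Gphase r (snd x) = Xphase r (fst y) * Gphase r (snd y)) \<and>
    (\<forall>x\<in>Cells r. \<forall>y\<in>Cells r. M (Wt r x) (Wt r y) \<in> \<nat>) \<and>
    M (Wt r (0, g_e)) (Wt r (0, g_e)) = 1"
proof -
  let ?P = "P_plus r 3" and ?C = "Cells r" and ?M = "\<lambda>x y. M (Wt r x) (Wt r y)"
  let ?S = "tens (Xmat r (base_kappa r)) (Gmat r)"
  have all: "(\<forall>\<mu>\<in>?P. Q \<mu>) \<longleftrightarrow> (\<forall>x\<in>?C. Q (Wt r x))" for Q
    using Wt_P_plus[OF r] Wt_surj[OF r] by metis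
  have eq: "mat_mul ?P A B = mat_mul ?P A' B' \<longleftrightarrow>
     (\<forall>x\<in>?C. \<forall>y\<in>?C. mat_mul ?P A B (Wt r x) (Wt r y) = mat_mul ?P A' B' (Wt r x) (Wt r y))" for A B A' B'
    using wmat_eqI[OF r, of "mat_mul ?P A B" "mat_mul ?P A' B'"] mat_mul_outside[of _ ?P] by metis
  have "S_const r \<noteq> 0" using S_const_nonzero r by simp
  then have S: "mat_mul ?P M (S_mat r 3) = mat_mul ?P (S_mat r 3) M \<longleftrightarrow> commutes ?C ?M ?S"
    unfolding eq commutes_def
    by (intro ball_cong HOL.refl) (simp add: mat_mul_Wt[OF r] mprod_def S_mat_Wt[OF r] mult.left_commute[of _ "S_const r"]
        mult.assoc flip: sum_distrib_left)
  have T1: "T_mat r 3 (Wt r x) (Wt r y) = (if x = y then T_const r * (Xphase r (fst x) * Gphase r (snd x)) else 0)"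
    if "x \<in> ?C" "y \<in> ?C" for x y
    using T_mat_Wt[OF r that(1)] Wt_inj[OF r that] by (auto simp: T_mat_def mat_on_def)
  have "mat_mul ?P M (T_mat r 3) (Wt r x) (Wt r y) = mat_mul ?P (T_mat r 3) M (Wt r x) (Wt r y) \<longleftrightarrow>
    (?M x y \<noteq> 0 \<longrightarrow> Xphase r (fst x) * Gphase r (snd x) = Xphase r (fst y) * Gphase r (snd y))"
    if xy: "x \<in> ?C" "y \<in> ?C" for x y
  proof -
    have "mat_mul ?P M (T_mat r 3) (Wt r x) (Wt r y) = (\<Sum>z\<in>?C. if z = y then ?M x y * T_mat r 3 (Wt r y) (Wt r y) else 0)"
      unfolding mat_mul_Wt[OF r xy] mprod_def using xy by (intro sum.cong) (auto simp: T1)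
    moreover have "mat_mul ?P (T_mat r 3) M (Wt r x) (Wt r y) = (\<Sum>z\<in>?C. if z = x then T_mat r 3 (Wt r x) (Wt r x) * ?M x y else 0)"
      unfolding mat_mul_Wt[OF r xy] mprod_def using xy by (intro sum.cong) (auto simp: T1)
    ultimately show ?thesis using xy T_const_nonzero[of r] by (auto simp: T1)
  qed
  then have T: "mat_mul ?P M (T_mat r 3) = mat_mul ?P (T_mat r 3) M \<longleftrightarrow>
    (\<forall>x\<in>?C. \<forall>y\<in>?C. ?M x y \<noteq> 0 \<longrightarrow> Xphase r (fst x) * Gphase r (snd x) = Xphase r (fst y) * Gphase r (snd y))"
    unfolding eq by (intro ball_cong HOL.refl) blast
  have v: "vacuum 3 = Wt r (0, g_e)"
    using r by (auto simp: vacuum_def Wt_def lamw_def fun_eq_iff)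
  show ?thesis unfolding physical_invariant_def S T v all ..
qed

lemma physical_invariant_product_form:
  assumes r: "r \<ge> 4" and M: "physical_invariant r 3 M"
  obtains a m where "a \<in> X_invs r" "m \<in> G_invs r" "M = lift r (ntens a m)"
proof -
  note p = M[unfolded physical_invariant_iff[OF r]]
  have "\<forall>x\<in>Cells r. \<forall>y\<in>Cells r. \<exists>k. M (Wt r x) (Wt r y) = of_nat k"
    using p unfolding Nats_def by blast
  then obtain N where N: "\<And>x y. x \<in> Cells r \<Longrightarrow> y \<in> Cells r \<Longrightarrow> M (Wt r x) (Wt r y) = of_nat (N x y)"
    by metis
  have e: "(0, g_e) \<in> Cells r" by (auto simp: Cells_def)
  interpret S_T_commutant r "2 * r + 1" "base_kappa r" N
  proof
    have "commutes (Cells r) (\<lambda>x y. of_nat (N x y)) (tens (Xmat r (base_kappa r)) (Gmat r)) \<longleftrightarrow>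
      commutes (Cells r) (\<lambda>x y. M (Wt r x) (Wt r y)) (tens (Xmat r (base_kappa r)) (Gmat r))"
      unfolding commutes_def mprod_def by (intro ball_cong HOL.refl) (simp add: N)
    then show "commutes (Cells r) (\<lambda>x y. of_nat (N x y)) (tens (Xmat r (base_kappa r)) (Gmat r))"
      using p by blast
  next
    fix j g k h assume "j < r + 2" "k < r + 2" and nz: "N (j, g) (k, h) \<noteq> 0"
    then have jk: "(j, g) \<in> Cells r" "(k, h) \<in> Cells r" by (auto simp: Cells_def)
    then have "M (Wt r (j, g)) (Wt r (k, h)) \<noteq> 0" using nz by (simp add: N)
    then show "Xphase r j * Gphase r g = Xphase r k * Gphase r h" using p jk by fastforce
  qed (use r in auto)
  have "N (0, g_e) (0, g_e) = 1" using p N[OF e e] by simp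
  from product_form[OF r base_nonzero(2) this]
  obtain a m where am: "a \<in> X_invs r" "m \<in> G_invs r"
    "\<And>j g k h. j < r + 2 \<Longrightarrow> k < r + 2 \<Longrightarrow> N (j, g) (k, h) = a j k * m g h" by blast
  have "M = lift r (ntens a m)"
    using p by (intro eq_liftI[OF r]) (auto simp: N ntens_def Cells_def am(3))
  then show ?thesis using am that by blast
qed

lemma physical_invariant_ntens:
  assumes r: "r \<ge> 4"
    and a: "commutes {..<r + 2} (\<lambda>j k. of_nat (a j k)) (Xmat r (base_kappa r))" "a 0 0 = 1"
      "\<And>j k. j < r + 2 \<Longrightarrow> k < r + 2 \<Longrightarrow> a j k \<noteq> 0 \<Longrightarrow> Xphase r j = Xphase r k"
    and m: "commutes UNIV (\<lambda>g h. of_nat (m g h)) (Gmat r)" "m g_e g_e = 1"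
      "\<And>g h. m g h \<noteq> 0 \<Longrightarrow> Gphase r g = Gphase r h"
  shows "physical_invariant r 3 (lift r (ntens a m))"
  unfolding physical_invariant_iff[OF r]
proof (intro conjI)
  have e: "(0, g_e) \<in> Cells r" by (auto simp: Cells_def)
  show "lift r (ntens a m) (Wt r (0, g_e)) (Wt r (0, g_e)) = 1"
    using a m by (simp add: lift_Wt[OF r e e] ntens_def)
  let ?a = "\<lambda>j k. complex_of_nat (a j k)" and ?m = "\<lambda>g h. complex_of_nat (m g h)"
  have "commutes (Cells r) (\<lambda>x y. lift r (ntens a m) (Wt r x) (Wt r y)) (tens (Xmat r (base_kappa r)) (Gmat r)) \<longleftrightarrow>
    commutes (Cells r) (tens ?a ?m) (tens (Xmat r (base_kappa r)) (Gmat r))"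
    unfolding commutes_def mprod_def by (intro ball_cong HOL.refl) (simp add: lift_Wt[OF r] ntens_def tens_def)
  also have "commutes (Cells r) (tens ?a ?m) (tens (Xmat r (base_kappa r)) (Gmat r))"
    unfolding commutes_def Cells_def mprod_tens
  proof (intro ballI)
    fix x y :: cell assume xy: "x \<in> {..<r + 2} \<times> UNIV" "y \<in> {..<r + 2} \<times> UNIV"
    then have "mprod {..<r + 2} ?a (Xmat r (base_kappa r)) (fst x) (fst y) = mprod {..<r + 2} (Xmat r (base_kappa r)) ?a (fst x) (fst y)"
      using a(1) by (auto simp: commutes_def)
    moreover have "mprod UNIV ?m (Gmat r) (snd x) (snd y) = mprod UNIV (Gmat r) ?m (snd x) (snd y)"
      using m(1) unfolding commutes_def by blast
    ultimately show "tens (mprod {..<r + 2} ?a (Xmat r (base_kappa r))) (mprod UNIV ?m (Gmat r)) x y =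
       tens (mprod {..<r + 2} (Xmat r (base_kappa r)) ?a) (mprod UNIV (Gmat r) ?m) x y"
      by (simp add: tens_def)
  qed
  finally show "commutes (Cells r) (\<lambda>x y. lift r (ntens a m) (Wt r x) (Wt r y)) (tens (Xmat r (base_kappa r)) (Gmat r))" .
qed (use a m r in \<open>auto simp: lift_outside lift_Wt ntens_def Cells_def\<close>)

text \<open>All conditions pass to products except the normalisation at the vacuum, which is
  therefore a premise.\<close>

lemma physical_invariant_mult:
  assumes r: "r \<ge> 4" and M: "physical_invariant r 3 M" and M': "physical_invariant r 3 M'"
    and v: "mat_mul (P_plus r 3) M M' (Wt r (0, g_e)) (Wt r (0, g_e)) = 1"
  shows "physical_invariant r 3 (mat_mul (P_plus r 3) M M')"
proof -
  let ?M = "\<lambda>x y. M (Wt r x) (Wt r y)" and ?M' = "\<lambda>x y. M' (Wt r x) (Wt r y)"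
  note p = M[unfolded physical_invariant_iff[OF r]] and p' = M'[unfolded physical_invariant_iff[OF r]]
  let ?S = "tens (Xmat r (base_kappa r)) (Gmat r)"
  show ?thesis
    unfolding physical_invariant_iff[OF r]
  proof (intro conjI v)
    have "commutes (Cells r) ?S (mprod (Cells r) ?M ?M')"
      using p p' by (intro commutes_mprod) (auto simp: commutes_def)
    then show "commutes (Cells r) (\<lambda>x y. mat_mul (P_plus r 3) M M' (Wt r x) (Wt r y)) ?S"
      unfolding commutes_def mprod_def by (auto simp: mat_mul_Wt[OF r] mprod_def)
    show "\<forall>x\<in>Cells r. \<forall>y\<in>Cells r. mat_mul (P_plus r 3) M M' (Wt r x) (Wt r y) \<noteq> 0 \<longrightarrow>
       Xphase r (fst x) * Gphase r (snd x) = Xphase r (fst y) * Gphase r (snd y)"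
    proof (intro ballI impI)
      fix x y assume xy: "x \<in> Cells r" "y \<in> Cells r" and nz: "mat_mul (P_plus r 3) M M' (Wt r x) (Wt r y) \<noteq> 0"
      then obtain z where z: "z \<in> Cells r" "?M x z * ?M' z y \<noteq> 0"
        unfolding mat_mul_Wt[OF r xy] mprod_def by (meson sum.neutral)
      then have "?M x z \<noteq> 0" "?M' z y \<noteq> 0" by auto
      then have "Xphase r (fst x) * Gphase r (snd x) = Xphase r (fst z) * Gphase r (snd z)"
        "Xphase r (fst z) * Gphase r (snd z) = Xphase r (fst y) * Gphase r (snd y)"
        using p[THEN conjunct2, THEN conjunct2, THEN conjunct1] p'[THEN conjunct2, THEN conjunct2, THEN conjunct1]
          xy z(1) by simp_all
      then show "Xphase r (fst x) * Gphase r (snd x) = Xphase r (fst y) * Gphase r (snd y)"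
        by simp
    qed
    show "\<forall>x\<in>Cells r. \<forall>y\<in>Cells r. mat_mul (P_plus r 3) M M' (Wt r x) (Wt r y) \<in> \<nat>"
    proof (intro ballI)
      fix x y assume xy: "x \<in> Cells r" "y \<in> Cells r"
      have "sum f I \<in> (\<nat> :: complex set)" if "\<And>z. z \<in> I \<Longrightarrow> f z \<in> \<nat>" for f and I :: "cell set"
        using that by (induction I rule: infinite_finite_induct) auto
      then show "mat_mul (P_plus r 3) M M' (Wt r x) (Wt r y) \<in> \<nat>"
        unfolding mat_mul_Wt[OF r xy] mprod_def
        using p[THEN conjunct2, THEN conjunct2, THEN conjunct2, THEN conjunct1, rule_format, OF xy(1)]
          p'[THEN conjunct2, THEN conjunct2, THEN conjunct2, THEN conjunct1, rule_format, OF _ xy(2)]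
        by (simp add: Nats_mult)
    qed
  qed (auto simp: mat_mul_outside)
qed

section \<open>The candidate factors commute with S and T\<close>

lemma commutes_perm_mat:
  assumes "finite I" and \<pi>: "bij_betw \<pi> I I" and A: "\<And>x y. x \<in> I \<Longrightarrow> y \<in> I \<Longrightarrow> A (\<pi> x) (\<pi> y) = A x y"
  shows "commutes I (\<lambda>x y. of_nat (perm_mat \<pi> x y)) A"
  unfolding commutes_def
proof (intro ballI)
  fix x y assume xy: "x \<in> I" "y \<in> I"
  have "mprod I (\<lambda>x y. of_nat (perm_mat \<pi> x y)) A x y = (\<Sum>k\<in>I. if k = \<pi> x then A (\<pi> x) y else 0)"
    unfolding mprod_def by (intro sum.cong) (auto simp: perm_mat_def)
  also have "\<dots> = A (\<pi> x) y" using assms(1) bij_betwE[OF \<pi>] xy by simp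
  finally have L: "mprod I (\<lambda>x y. of_nat (perm_mat \<pi> x y)) A x y = A (\<pi> x) y" .
  obtain z where z: "z \<in> I" "\<pi> z = y" using \<pi> xy(2) by (metis bij_betw_iff_bijections)
  have "mprod I A (\<lambda>x y. of_nat (perm_mat \<pi> x y)) x y = (\<Sum>k\<in>I. if k = z then A x z else 0)"
    unfolding mprod_def using z bij_betw_imp_inj_on[OF \<pi>] by (intro sum.cong) (auto simp: perm_mat_def dest: inj_onD)
  also have "\<dots> = A x z" using assms(1) z by simp
  finally show "mprod I (\<lambda>x y. of_nat (perm_mat \<pi> x y)) A x y = mprod I A (\<lambda>x y. of_nat (perm_mat \<pi> x y)) x y"
    unfolding L using A[OF xy(1) z(1)] z(2) by simp
qed

lemma i_power_mult_4: "4 dvd r \<Longrightarrow> \<i> ^ r = 1"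
  by (auto elim!: dvdE simp: power_mult)

lemma Gmat_4_dvd:
  assumes "4 dvd r"
  shows "Gmat r g h = (if g = g_e \<or> h = g_e \<or> g = h then 1 else -1)"
proof -
  obtain p q p' q' where gh: "g = (p, q)" "h = (p', q')" by fastforce
  show ?thesis
    unfolding gh by (cases p; cases q; cases p'; cases q') (simp_all add: Gmat_def i_power_mult_4[OF assms])
qed

lemma Gphase_mod_8:
  "r mod 8 = 4 \<Longrightarrow> Gphase r g = (if g = g_e then 1 else -1)"
  "8 dvd r \<Longrightarrow> Gphase r (True, q) = 1"
proof -
  have e: "zt 8 0 = 1" "zt 8 4 = -1" by (simp_all add: zt_def)
  show "Gphase r g = (if g = g_e then 1 else -1)" if "r mod 8 = 4"
  proof (cases g)
    case (Pair p q)
    have "int r mod 8 = 4" using arg_cong[OF that, of int] by (simp add: zmod_int)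
    then have "[3 * int r = 4] (mod 8)"
      unfolding cong_def by (simp add: mod_mult_right_eq[of 3 "int r" 8, symmetric])
    then have "zt 8 (3 * int r) = -1" using zt_eq_iff[of 8 "3 * int r" 4] e by simp
    then show ?thesis using Pair Gphase_spinor[of r q] by (cases p) (auto simp: Gphase_def[of r "(False, _)"])
  qed
  show "Gphase r (True, q) = 1" if "8 dvd r"
  proof -
    have "int 8 dvd int r" using that by (simp only: int_dvd_int_iff)
    then have "[3 * int r = 0] (mod 8)" by (simp add: cong_def)
    then show ?thesis using zt_eq_iff[of 8 "3 * int r" 0] e by (simp add: Gphase_spinor)
  qed
qed

text \<open>The converse of \<open>G_classification\<close>: the permutations preserve G, and for an
  extension both products reduce to two terms.\<close>

lemma G_invs_props:
  assumes "m \<in> G_invs r"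
  shows "commutes UNIV (\<lambda>g h. of_nat (m g h)) (Gmat r)" "m g_e g_e = 1"
    "\<And>g h. m g h \<noteq> 0 \<Longrightarrow> Gphase r g = Gphase r h"
proof -
  have bC: "bij gC" by (rule involuntory_imp_bij) (auto simp: gC_def)
  from assms consider "m = perm_mat id" | "m = perm_mat gC"
    | "m \<in> (if r mod 8 = 4 then {perm_mat \<tau> | \<tau>. bij \<tau> \<and> \<tau> g_e = g_e} else {})"
    | "m \<in> (if 8 dvd r then {ext_mat a b | a b. a \<in> {g_s, g_c} \<and> b \<in> {g_s, g_c}} else {})"
    unfolding G_invs_def by (elim UnE insertE emptyE) simp_all
  then have "commutes UNIV (\<lambda>g h. of_nat (m g h)) (Gmat r) \<and> m g_e g_e = 1 \<and> (\<forall>g h. m g h \<noteq> 0 \<longrightarrow> Gphase r g = Gphase r h)"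
  proof cases
    case 1
    have "commutes UNIV (\<lambda>g h. of_nat (perm_mat id g h)) (Gmat r)" by (intro commutes_perm_mat) auto
    then show ?thesis unfolding 1 by (auto simp: perm_mat_def split: if_splits)
  next
    case 2
    have "Gmat r (gC x) (gC y) = Gmat r x y" for x y
      by (cases x; cases y) (auto simp: Gmat_def gC_def)
    then have "commutes UNIV (\<lambda>g h. of_nat (perm_mat gC g h)) (Gmat r)" using bC by (intro commutes_perm_mat) auto
    then show ?thesis unfolding 2 by (auto simp: perm_mat_def gC_def Gphase_def split: if_splits)
  next
    case three: 3
    obtain \<tau> where 3: "r mod 8 = 4" "bij \<tau>" "\<tau> g_e = g_e" "m = perm_mat \<tau>"
      using three by (cases "r mod 8 = 4") auto
    have inj: "\<tau> x = \<tau> y \<longleftrightarrow> x = y" for x y using 3(2) by (simp add: bij_is_inj inj_eq)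
    have e: "\<tau> x = g_e \<longleftrightarrow> x = g_e" for x using inj[of x g_e] 3(3) by simp
    have "4 dvd r" using 3(1) by presburger
    then have "Gmat r (\<tau> x) (\<tau> y) = Gmat r x y" for x y by (simp add: Gmat_4_dvd inj e)
    then have "commutes UNIV (\<lambda>g h. of_nat (m g h)) (Gmat r)"
      unfolding 3(4) using 3(2) by (intro commutes_perm_mat) auto
    moreover have "Gphase r g = Gphase r (\<tau> g)" for g by (simp add: Gphase_mod_8(1)[OF 3(1)] e)
    ultimately show ?thesis unfolding 3(4) perm_mat_def using 3(3) by simp
  next
    case four: 4
    obtain a b where 4: "8 dvd r" "a \<in> {g_s, g_c}" "b \<in> {g_s, g_c}" "m = ext_mat a b"
    proof (cases "8 dvd r")
      case True
      then show ?thesis using four that unfolding if_P[OF True] mem_Collect_eq by metis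
    next
      case False
      then show ?thesis using four by simp
    qed
    have "4 dvd r" using 4(1) by auto
    note G = Gmat_4_dvd[OF this]
    have "commutes UNIV (\<lambda>g h. of_nat (m g h)) (Gmat r)"
      unfolding commutes_def
    proof (intro ballI)
      fix g h
      have "mprod UNIV (\<lambda>g h. of_nat (m g h)) (Gmat r) g h = of_nat (m g g_e) * Gmat r g_e h + of_nat (m g b) * Gmat r b h"
        unfolding mprod_def using 4(3,4) by (intro sum_pair) (auto simp: ext_mat_def)
      moreover have "mprod UNIV (Gmat r) (\<lambda>g h. of_nat (m g h)) g h = Gmat r g g_e * of_nat (m g_e h) + Gmat r g a * of_nat (m a h)"
        unfolding mprod_def using 4(2,4) by (intro sum_pair) (auto simp: ext_mat_def)
      ultimately show "mprod UNIV (\<lambda>g h. of_nat (m g h)) (Gmat r) g h = mprod UNIV (Gmat r) (\<lambda>g h. of_nat (m g h)) g h"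
        unfolding G 4(4) ext_mat_def using 4(2,3) by auto
    qed
    moreover have "Gphase r g_e = 1" by (simp add: Gphase_def)
    ultimately show ?thesis using 4 Gphase_mod_8(2)[OF 4(1)] by (auto simp: ext_mat_def split: if_splits)
  qed
  then show "commutes UNIV (\<lambda>g h. of_nat (m g h)) (Gmat r)" "m g_e g_e = 1"
    "\<And>g h. m g h \<noteq> 0 \<Longrightarrow> Gphase r g = Gphase r h" by blast+
qed

lemma physical_invariant_G:
  assumes r: "r \<ge> 4" and m: "m \<in> G_invs r"
  shows "physical_invariant r 3 (lift r (ntens (perm_mat id) m))"
  by (intro physical_invariant_ntens r G_invs_props[OF m] commutes_perm_mat)
    (auto simp: perm_mat_def split: if_splits)

section \<open>Conjugations and simple current invariants as tensor products\<close>

definition sw :: "nat \<Rightarrow> nat \<Rightarrow> nat" where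
  "sw r = Transposition.transpose r (r + 1)"

lemma sw_less: "j < r + 2 \<Longrightarrow> sw r j < r + 2"
  by (auto simp: sw_def Transposition.transpose_def)

text \<open>\<open>sw\<close> negates \<open>xsg\<close>, which enters X quadratically, so X is
  unchanged.\<close>

lemma physical_invariant_sw:
  assumes r: "r \<ge> 4"
  shows "physical_invariant r 3 (lift r (ntens (perm_mat (sw r)) (perm_mat gC)))"
proof (intro physical_invariant_ntens r)
  have "sw r permutes {..<r + 2}" unfolding sw_def by (intro permutes_swap_id) auto
  then have b: "bij_betw (sw r) {..<r + 2} {..<r + 2}" by (rule permutes_imp_bij)
  have s: "xsign r (sw r j) = xsign r j" "r - sw r j = r - j" "xsg r (sw r j) = - xsg r j" for j
    by (auto simp: sw_def Transposition.transpose_def xsign_def dhalf_def xsg_def)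
  show "commutes {..<r + 2} (\<lambda>j k. of_nat (perm_mat (sw r) j k)) (Xmat r (base_kappa r))"
    using b by (intro commutes_perm_mat) (auto simp: Xmat_def xform_def s)
  show "perm_mat (sw r) 0 0 = 1" using r by (auto simp: perm_mat_def sw_def Transposition.transpose_def)
  show "Xphase r j = Xphase r k" if "perm_mat (sw r) j k \<noteq> 0" for j k
    using that s(2)[of j] by (auto simp: perm_mat_def Xphase_def split: if_splits)
  have gC: "perm_mat gC \<in> G_invs r" by (simp add: G_invs_def)
  show "commutes UNIV (\<lambda>g h. of_nat (perm_mat gC g h)) (Gmat r)" "perm_mat gC g_e g_e = 1"
    "\<And>g h. perm_mat gC g h \<noteq> 0 \<Longrightarrow> Gphase r g = Gphase r h"
    by (rule G_invs_props[OF gC])+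
qed

definition spin_flip :: "nat \<Rightarrow> weight \<Rightarrow> weight" where
  "spin_flip r \<mu> = \<mu>(r - 1 := \<mu> r, r := \<mu> (r - 1))"

lemma spin_flip_labels:
  assumes "r \<ge> 4"
  shows "spin_flip r \<mu> 0 = \<mu> 0" "spin_flip r \<mu> 1 = \<mu> 1" "spin_flip r \<mu> (r - 1) = \<mu> r"
    "spin_flip r \<mu> r = \<mu> (r - 1)" "2 \<le> i \<Longrightarrow> i \<le> r - 2 \<Longrightarrow> spin_flip r \<mu> i = \<mu> i" "i > r \<Longrightarrow> spin_flip r \<mu> i = \<mu> i"
  using assms by (auto simp: spin_flip_def)

lemma spin_flip_J_v: "r \<ge> 4 \<Longrightarrow> spin_flip r (J_v r \<mu>) = J_v r (spin_flip r \<mu>)"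
  by (rule weight_eqI[where r = r]) (simp_all only: spin_flip_labels J_v_labels)

text \<open>The conjugation exchanges \<open>J_s\<close> and \<open>J_c\<close>; this is why it acts
  by \<open>gC\<close> on the currents.\<close>

lemma spin_flip_J_s:
  assumes r: "r \<ge> 4"
  shows "spin_flip r (J_s r \<mu>) = J_v r (J_s r (spin_flip r \<mu>))"
proof (rule weight_eqI[where r = r])
  fix i assume i: "2 \<le> i" "i \<le> r - 2"
  then have "2 \<le> r - i" "r - i \<le> r - 2" by auto
  then show "spin_flip r (J_s r \<mu>) i = J_v r (J_s r (spin_flip r \<mu>)) i"
    using i by (simp only: J_s_labels[OF r] J_v_labels[OF r] spin_flip_labels[OF r])
qed (cases "even r"; simp only: J_s_labels[OF r] J_v_labels[OF r] spin_flip_labels[OF r] if_True if_False simp_thms)+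

lemma spin_flip_lamw:
  assumes r: "r \<ge> 4" and j: "j < r + 2"
  shows "spin_flip r (lamw r j) = lamw r (sw r j)"
proof -
  have v: "lamw r r 0 = 1" "lamw r r 1 = 0" "lamw r r (r - 1) = 0" "lamw r r r = 2"
    "lamw r (r + 1) 0 = 1" "lamw r (r + 1) 1 = 0" "lamw r (r + 1) (r - 1) = 2" "lamw r (r + 1) r = 0"
    using r by (simp_all add: lamw_def)
  have m: "lamw r r i = 0" "lamw r (r + 1) i = 0" if "i \<noteq> 0" "i \<noteq> r - 1" "i \<noteq> r" for i
    using that by (simp_all add: lamw_def)
  have 1: "spin_flip r (lamw r r) = lamw r (r + 1)"
  proof (rule weight_eqI[where r = r])
    show "spin_flip r (lamw r r) i = lamw r (r + 1) i" if i: "2 \<le> i" "i \<le> r - 2" for i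
    proof -
      have n: "i \<noteq> 0" "i \<noteq> r - 1" "i \<noteq> r" using i r by linarith+
      show ?thesis unfolding spin_flip_labels(5)[OF r i] m[OF n] ..
    qed
    show "spin_flip r (lamw r r) i = lamw r (r + 1) i" if i: "i > r" for i
    proof -
      have n: "i \<noteq> 0" "i \<noteq> r - 1" "i \<noteq> r" using i r by linarith+
      show ?thesis unfolding spin_flip_labels(6)[OF r i] m[OF n] ..
    qed
  qed (simp_all only: spin_flip_labels[OF r] v)
  have 2: "spin_flip r (lamw r (r + 1)) = lamw r r"
    unfolding 1[symmetric] using r by (simp add: spin_flip_def fun_eq_iff)
  have 3: "spin_flip r (lamw r j) = lamw r j" if "j \<noteq> r" "j \<noteq> r + 1"
  proof -
    have "lamw r j (r - 1) = lamw r j r" unfolding lamw_values[OF r] using that by simp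
    then show ?thesis unfolding spin_flip_def by (metis fun_upd_triv)
  qed
  show ?thesis
    using 1 2 3 by (cases "j = r"; cases "j = r + 1") (simp_all add: sw_def Transposition.transpose_def)
qed

lemma spin_flip_Wt:
  assumes r: "r \<ge> 4" and j: "j < r + 2"
  shows "spin_flip r (Wt r (j, g)) = Wt r (sw r j, gC g)"
proof -
  obtain p q where g: "g = (p, q)" by (cases g)
  have m: "min (sw r j) r = min j r" by (auto simp: sw_def Transposition.transpose_def)
  show ?thesis
    unfolding g Wt_def gC_def prod.case fst_conv snd_conv m
    by (cases p; cases "q \<noteq> odd (min j r)")
      (simp_all add: spin_flip_J_v[OF r] spin_flip_J_s[OF r] spin_flip_lamw[OF r j] J_v_J_v[OF r])
qed

lemma J_v_Wt:
  assumes r: "r \<ge> 4"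
  shows "J_v r (Wt r (j, p, q)) = Wt r (j, p, \<not> q)"
  by (cases "q \<noteq> odd (min j r)") (simp_all add: Wt_def J_v_J_v[OF r])

lemma J_s_Wt:
  assumes r: "r \<ge> 4" "even r"
  shows "J_s r (Wt r (j, p, q)) = Wt r (j, \<not> p, q)"
  by (cases "q \<noteq> odd (min j r)"; cases p)
    (simp_all add: Wt_def J_s_J_s[OF r(1)] J_s_J_v[OF r(1)] r(2))

lemma Wt_eq_iff: "r \<ge> 4 \<Longrightarrow> x \<in> Cells r \<Longrightarrow> y \<in> Cells r \<Longrightarrow> Wt r x = Wt r y \<longleftrightarrow> x = y"
  using Wt_inj by blast

lemma perm_matrix_eq_lift:
  assumes r: "r \<ge> 4" and C: "\<And>j g. j < r + 2 \<Longrightarrow> C (Wt r (j, g)) = Wt r (\<pi> j, \<tau> g)"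
    and \<pi>: "\<And>j. j < r + 2 \<Longrightarrow> \<pi> j < r + 2"
  shows "mat_on (P_plus r 3) (\<lambda>\<mu> \<nu>. if \<nu> = C \<mu> then 1 else 0) = lift r (ntens (perm_mat \<pi>) (perm_mat \<tau>))"
proof (intro eq_liftI r)
  fix x y assume xy: "x \<in> Cells r" "y \<in> Cells r"
  obtain j g where x: "x = (j, g)" by (cases x)
  have j: "j < r + 2" using xy x by (auto simp: Cells_def)
  have "(\<pi> j, \<tau> g) \<in> Cells r" using \<pi>[OF j] by (simp add: Cells_def)
  then have "Wt r y = C (Wt r x) \<longleftrightarrow> y = (\<pi> j, \<tau> g)"
    unfolding x C[OF j] by (rule Wt_eq_iff[OF r xy(2)])
  then show "mat_on (P_plus r 3) (\<lambda>\<mu> \<nu>. if \<nu> = C \<mu> then 1 else 0) (Wt r x) (Wt r y) =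
      of_nat (ntens (perm_mat \<pi>) (perm_mat \<tau>) x y)"
    using Wt_P_plus[OF r] xy by (cases y) (auto simp: mat_on_def ntens_def perm_mat_def x)
qed (auto simp: mat_on_def)

lemma conj_mats_generic:
  assumes r: "r \<ge> 4" "r \<noteq> 4"
  shows "conj_mats r = {lift r (ntens (perm_mat id) (perm_mat id)), lift r (ntens (perm_mat (sw r)) (perm_mat gC))}"
proof -
  have "mat_on (P_plus r 3) (\<lambda>\<mu> \<nu>. if \<nu> = id \<mu> then 1 else 0) = lift r (ntens (perm_mat id) (perm_mat id))"
    by (rule perm_matrix_eq_lift[OF r(1)]) auto
  moreover have "mat_on (P_plus r 3) (\<lambda>\<mu> \<nu>. if \<nu> = spin_flip r \<mu> then 1 else 0) = lift r (ntens (perm_mat (sw r)) (perm_mat gC))"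
    by (rule perm_matrix_eq_lift[OF r(1)]) (auto simp: spin_flip_Wt[OF r(1)] sw_less)
  moreover have "conjugations r = {id, spin_flip r}"
    using r(2) by (simp add: conjugations_def spin_flip_def[abs_def])
  ultimately show ?thesis by (simp only: conj_mats_def image_insert image_empty)
qed

text \<open>A current of order 2 keeps the index \<open>j\<close>, so only its powers 1 and 2 occur,
  with the charge offsets R / 4 and R / 2.\<close>

lemma sc_invariant_eq_lift:
  assumes r: "r \<ge> 4" and J: "\<And>j g. j < r + 2 \<Longrightarrow> J (Wt r (j, g)) = Wt r (j, \<tau> g)" and \<tau>: "\<And>g. \<tau> (\<tau> g) = g"
    and A: "\<And>j g. j < r + 2 \<Longrightarrow> Q (Wt r (j, g)) + R / 4 \<in> \<int> \<longleftrightarrow> A g"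
    and B: "\<And>j g. j < r + 2 \<Longrightarrow> Q (Wt r (j, g)) + R / 2 \<in> \<int> \<longleftrightarrow> B g"
  shows "sc_invariant r J Q 2 R = lift r (ntens (perm_mat id)
    (\<lambda>g h. (if h = \<tau> g \<and> A g then 1 else 0) + (if h = g \<and> B g then 1 else 0)))"
proof (intro eq_liftI r)
  fix x y assume xy: "x \<in> Cells r" "y \<in> Cells r"
  obtain j g where x: "x = (j, g)" by (cases x)
  obtain k h where y: "y = (k, h)" by (cases y)
  have j: "j < r + 2" using xy x by (auto simp: Cells_def)
  have "(j, \<tau> g) \<in> Cells r" "(j, g) \<in> Cells r" using j by (simp_all add: Cells_def)
  then have e: "Wt r (j, \<tau> g) = Wt r y \<longleftrightarrow> k = j \<and> h = \<tau> g" "Wt r (j, g) = Wt r y \<longleftrightarrow> k = j \<and> h = g"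
    using Wt_eq_iff[OF r _ xy(2)] y by auto
  have "(\<Sum>l = 1..2. (if (J ^^ l) (Wt r x) = Wt r y then 1 else 0) * (if Q (Wt r x) + real l / (2 * real 2) * R \<in> \<int> then 1 else 0)) =
     (if J (Wt r x) = Wt r y then 1 else 0) * (if Q (Wt r x) + R / 4 \<in> \<int> then 1 else 0) +
     (if J (J (Wt r x)) = Wt r y then 1 else 0) * (if Q (Wt r x) + R / 2 \<in> \<int> then 1 else (0 :: complex))"
    by (simp add: numeral_2_eq_2)
  also have "\<dots> = (if k = j \<and> h = \<tau> g then 1 else 0) * (if A g then 1 else 0) + (if k = j \<and> h = g then 1 else 0) * (if B g then 1 else 0)"
    by (simp only: x J[OF j] \<tau> A[OF j] B[OF j] e)
  finally show "sc_invariant r J Q 2 R (Wt r x) (Wt r y) = of_nat (ntens (perm_mat id)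
    (\<lambda>g h. (if h = \<tau> g \<and> A g then 1 else 0) + (if h = g \<and> B g then 1 else 0)) x y)"
    using Wt_P_plus[OF r] xy by (simp add: sc_invariant_def mat_on_def ntens_def perm_mat_def x y)
qed (auto simp: sc_invariant_def mat_on_def)

lemma Ints_iff_cis: "(x :: real) \<in> \<int> \<longleftrightarrow> cis (2 * pi * x) = 1"
proof
  assume "x \<in> \<int>"
  then obtain k where "x = of_int k" by (rule Ints_cases)
  then show "cis (2 * pi * x) = 1" using cis_multiple_2pi[of "x"] by simp
next
  assume "cis (2 * pi * x) = 1"
  then have "cos (2 * pi * x) = 1" by (metis cis.simps(1) one_complex.simps(1))
  then obtain k :: int where "2 * pi * x = of_int k * 2 * pi" using cos_one_2pi_int by blast
  then have "x = of_int k" by simp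
  then show "x \<in> \<int>" by simp
qed

lemma cis_Q_v:
  assumes r: "r \<ge> 4" and j: "j < r + 2"
  shows "cis (2 * pi * Q_v r (Wt r (j, p, q))) = (if p then -1 else 1)"
proof -
  let ?\<mu> = "Wt r (j, p, q)"
  have e: "even (?\<mu> (r - 1) + ?\<mu> r) \<longleftrightarrow> \<not> p"
    using lamw_labels[OF r j]
    by (cases "q \<noteq> odd (min j r)"; cases p) (simp_all add: Wt_def add.commute J_v_labels[OF r] J_s_labels[OF r] del: One_nat_def even_add)
  have "2 * pi * Q_v r ?\<mu> = real (?\<mu> (r - 1) + ?\<mu> r) * pi" by (simp add: Q_v_def field_simps)
  then have "cis (2 * pi * Q_v r ?\<mu>) = (-1) ^ (?\<mu> (r - 1) + ?\<mu> r)" by (simp only: Complex.DeMoivre[symmetric] cis_pi)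
  then show ?thesis unfolding minus_one_power_iff e by simp
qed

lemma sum_fund_weight:
  assumes r: "r \<ge> 4" and k: "1 \<le> k" "k \<le> r"
  shows "(\<Sum>i=0..<r. fund_weight r k $ i) = (if k = r then r / 2 else if k = r - 1 then real (r - 2) / 2 else k)"
proof -
  consider "k = r" | "k = r - 1" | "k < r - 1" using k by linarith
  then show ?thesis
  proof cases
    case 1
    then show ?thesis by (simp add: fund_weight_def)
  next
    case 2
    have "(\<Sum>i=0..<r. fund_weight r k $ i) = (\<Sum>i=0..<r. 1 / 2 - (if i = r - 1 then 1 else 0))"
      using 2 r by (intro sum.cong) (auto simp: fund_weight_def)
    also have "\<dots> = real r / 2 - 1" using r by (simp add: sum_subtractf)
    finally show ?thesis using 2 r by (simp add: of_nat_diff field_simps)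
  next
    case 3
    have "(\<Sum>i=0..<r. fund_weight r k $ i) = (\<Sum>i\<in>{0..<k}. 1)"
      using 3 r by (intro sum.mono_neutral_cong_right) (auto simp: fund_weight_def)
    then show ?thesis using 3 by simp
  qed
qed

text \<open>Half the coordinate sum is the pairing with the spinor weight (1/2, ..., 1/2).
  \<open>Q_s\<close> differs from it in the sign of the last two labels, which for even
  \<open>r\<close> is an integer correction.\<close>

lemma Q_s_tot:
  assumes r: "r \<ge> 4"
  shows "Q_s r \<mu> = (tot r \<mu> - tot r (lamw r 0)) / 2 - real (r - 2) / 2 * real (\<mu> (r - 1)) - real r / 2 * real (\<mu> r)"
proof -
  define F where "F k = (if k = r then r / 2 else if k = r - 1 then real (r - 2) / 2 else real k)" for k
  have t: "tot r \<nu> = (\<Sum>k=1..r. (real (\<nu> k) + 1) * F k)" for \<nu>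
  proof -
    have "tot r \<nu> = (\<Sum>k=1..r. \<Sum>i=0..<r. (real (\<nu> k) + 1) * fund_weight r k $ i)"
      unfolding tot_def lw_def by (rule sum.swap)
    also have "\<dots> = (\<Sum>k=1..r. (real (\<nu> k) + 1) * F k)"
      by (intro sum.cong HOL.refl) (simp add: F_def sum_fund_weight[OF r] flip: sum_distrib_left)
    finally show ?thesis .
  qed
  have "tot r \<mu> - tot r (lamw r 0) = (\<Sum>k=1..r. real (\<mu> k) * F k)"
    unfolding t sum_subtractf[symmetric]
  proof (intro sum.cong HOL.refl)
    fix k assume "k \<in> {1..r}"
    then have "lamw r 0 k = 0" using r by (auto simp: lamw_def)
    then show "(real (\<mu> k) + 1) * F k - (real (lamw r 0 k) + 1) * F k = real (\<mu> k) * F k" by (simp add: ring_distribs)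
  qed
  also have "{1..r} = {1..r - 2} \<union> {r - 1, r}" using r by auto
  also have "(\<Sum>k\<in>{1..r - 2} \<union> {r - 1, r}. real (\<mu> k) * F k) = (\<Sum>k=1..r - 2. real (\<mu> k) * F k) + (\<Sum>k\<in>{r - 1, r}. real (\<mu> k) * F k)"
    using r by (intro sum.union_disjoint) auto
  also have "(\<Sum>k\<in>{r - 1, r}. real (\<mu> k) * F k) = real (\<mu> (r - 1)) * (real (r - 2) / 2) + real (\<mu> r) * (real r / 2)"
    using r by (simp add: F_def)
  also have "(\<Sum>k=1..r - 2. real (\<mu> k) * F k) = 2 * (\<Sum>k=1..r - 2. real k * real (\<mu> k) / 2)"
    unfolding sum_distrib_left using r by (intro sum.cong) (auto simp: F_def)
  finally show ?thesis unfolding Q_s_def using r by (simp add: of_nat_diff field_simps)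
qed

lemma cis_Q_s:
  assumes r: "r \<ge> 4" "4 dvd r" and j: "j < r + 2"
  shows "cis (2 * pi * Q_s r (Wt r (j, p, q))) = (if q then -1 else 1)"
proof -
  let ?\<mu> = "Wt r (j, p, q)"
  obtain m where m: "r = 4 * m" using r(2) by (rule dvdE)
  have m1: "m \<ge> 1" using m r(1) by simp
  have "2 * pi * Q_s r ?\<mu> = - (- (pi * tot r ?\<mu>)) + - (pi * tot r (lamw r 0)) + 2 * pi * of_int (- int (2 * m - 1) * int (?\<mu> (r - 1)) - int (2 * m) * int (?\<mu> r))"
  proof -
    have "real (r - 2) / 2 = of_int (int (2 * m - 1))" "real r / 2 = of_int (int (2 * m))" using m m1 by (auto simp: of_nat_diff)
    then show ?thesis unfolding Q_s_tot[OF r(1)] by (simp add: field_simps)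
  qed
  then have "cis (2 * pi * Q_s r ?\<mu>) = cis (- (- (pi * tot r ?\<mu>))) * tphase r (lamw r 0)"
    unfolding tphase_def by (simp only: cis_mult[symmetric]) simp
  also have "cis (- (- (pi * tot r ?\<mu>))) = inverse (tphase r ?\<mu>)" unfolding tphase_def cis_inverse ..
  also have "tphase r (lamw r 0) = 1" unfolding tphase_lamw[OF r(1), of 0, simplified] using m by simp
  also have "tphase r ?\<mu> = (if q then -1 else 1)" unfolding tphase_Wt[OF r(1) j] using i_power_mult_4[OF r(2)] m by auto
  finally show ?thesis by auto
qed

text \<open>The offset 6 / 4 is a half-integer and 6 / 2 an integer: spinor weights are moved by
  \<open>J_v\<close>, tensor weights stay. So \<open>I_v\<close> is a permutation of the
  currents.\<close>

lemma I_v_lift: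
  assumes r: "r \<ge> 4"
  shows "I_v r = lift r (ntens (perm_mat id) (perm_mat gC))"
proof -
  have c: "cis (2 * pi * (6 / 4)) = -1" "cis (2 * pi * (6 / 2)) = 1"
    using cis_multiple_2pi[of 1] cis_multiple_2pi[of 3] cis_mult[of "2 * pi" pi] by (simp_all add: mult_ac)
  have "I_v r = lift r (ntens (perm_mat id)
    (\<lambda>g h. (if h = (fst g, \<not> snd g) \<and> fst g then 1 else 0) + (if h = g \<and> \<not> fst g then 1 else 0)))"
    unfolding I_v_def
  proof (rule sc_invariant_eq_lift[OF r])
    fix j :: nat and g :: "bool \<times> bool" assume j: "j < r + 2"
    obtain p q where g: "g = (p, q)" by (cases g)
    show "J_v r (Wt r (j, g)) = Wt r (j, fst g, \<not> snd g)" by (simp add: g J_v_Wt[OF r])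
    show "Q_v r (Wt r (j, g)) + 6 / 4 \<in> \<int> \<longleftrightarrow> fst g" "Q_v r (Wt r (j, g)) + 6 / 2 \<in> \<int> \<longleftrightarrow> \<not> fst g"
      unfolding Ints_iff_cis distrib_left cis_mult[symmetric] c g cis_Q_v[OF r j] by auto
  qed auto
  also have "\<dots> = lift r (ntens (perm_mat id) (perm_mat gC))"
    by (rule lift_ntens_cong[OF r]) (auto simp: perm_mat_def gC_def prod_eq_iff)
  finally show ?thesis .
qed

text \<open>3 r / 8 is a half-integer here, so charged weights are moved and neutral ones
  stay.\<close>

lemma I_s_I_c_lift_4:
  assumes r: "r \<ge> 4" "r mod 8 = 4"
  shows "I_s r = lift r (ntens (perm_mat id) (perm_mat (\<lambda>(p, q). (p \<noteq> q, q))))"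
    "I_c r = lift r (ntens (perm_mat id) (perm_mat (\<lambda>(p, q). (q, p))))"
proof -
  define k where "k = r div 8"
  have k: "r = 8 * k + 4" using r(2) by (simp add: k_def) presburger
  have c: "cis (2 * pi * (3 * real r / 2 / 4)) = -1" "cis (2 * pi * (3 * real r / 2 / 2)) = 1"
  proof -
    have *: "2 * pi * (3 * real r / 2 / 4) = 2 * pi * of_nat (3 * k + 1) + pi" by (simp add: k field_simps)
    show "cis (2 * pi * (3 * real r / 2 / 4)) = -1"
      unfolding * cis_mult[symmetric] by (subst cis_multiple_2pi) auto
    have *: "2 * pi * (3 * real r / 2 / 2) = 2 * pi * of_nat (6 * k + 3)" by (simp add: k field_simps)
    show "cis (2 * pi * (3 * real r / 2 / 2)) = 1"
      unfolding * by (subst cis_multiple_2pi) auto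
  qed
  have r4: "4 dvd r" "even r" using r(2) by presburger+
  have "I_s r = lift r (ntens (perm_mat id)
    (\<lambda>g h. (if h = (\<not> fst g, snd g) \<and> snd g then 1 else 0) + (if h = g \<and> \<not> snd g then 1 else 0)))"
    unfolding I_s_def
  proof (rule sc_invariant_eq_lift[OF r(1)])
    fix j :: nat and g :: "bool \<times> bool" assume j: "j < r + 2"
    obtain p q where g: "g = (p, q)" by (cases g)
    show "J_s r (Wt r (j, g)) = Wt r (j, \<not> fst g, snd g)" by (simp add: g J_s_Wt[OF r(1) r4(2)])
    show "Q_s r (Wt r (j, g)) + 3 * real r / 2 / 4 \<in> \<int> \<longleftrightarrow> snd g" "Q_s r (Wt r (j, g)) + 3 * real r / 2 / 2 \<in> \<int> \<longleftrightarrow> \<not> snd g"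
      unfolding Ints_iff_cis distrib_left cis_mult[symmetric] c g cis_Q_s[OF r(1) r4(1) j] by auto
  qed auto
  also have "\<dots> = lift r (ntens (perm_mat id) (perm_mat (\<lambda>(p, q). (p \<noteq> q, q))))"
    by (rule lift_ntens_cong[OF r(1)]) (auto simp: perm_mat_def prod_eq_iff)
  finally show "I_s r = lift r (ntens (perm_mat id) (perm_mat (\<lambda>(p, q). (p \<noteq> q, q))))" .
  have "I_c r = lift r (ntens (perm_mat id)
    (\<lambda>g h. (if h = (\<not> fst g, \<not> snd g) \<and> fst g \<noteq> snd g then 1 else 0) + (if h = g \<and> fst g = snd g then 1 else 0)))"
    unfolding I_c_def
  proof (rule sc_invariant_eq_lift[OF r(1)])
    fix j :: nat and g :: "bool \<times> bool" assume j: "j < r + 2"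
    obtain p q where g: "g = (p, q)" by (cases g)
    show "J_c r (Wt r (j, g)) = Wt r (j, \<not> fst g, \<not> snd g)"
      by (simp add: g J_c_def J_s_Wt[OF r(1) r4(2)] J_v_Wt[OF r(1)])
    show "Q_c r (Wt r (j, g)) + 3 * real r / 2 / 4 \<in> \<int> \<longleftrightarrow> fst g \<noteq> snd g"
      "Q_c r (Wt r (j, g)) + 3 * real r / 2 / 2 \<in> \<int> \<longleftrightarrow> fst g = snd g"
      unfolding Ints_iff_cis Q_c_def distrib_left cis_mult[symmetric] c g cis_Q_s[OF r(1) r4(1) j] cis_Q_v[OF r(1) j] by auto
  qed auto
  also have "\<dots> = lift r (ntens (perm_mat id) (perm_mat (\<lambda>(p, q). (q, p))))"
    by (rule lift_ntens_cong[OF r(1)]) (auto simp: perm_mat_def prod_eq_iff)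
  finally show "I_c r = lift r (ntens (perm_mat id) (perm_mat (\<lambda>(p, q). (q, p))))" .
qed

text \<open>3 r / 8 is now an integer: neutral weights are summed over their orbit and charged ones
  are dropped.\<close>

lemma I_s_lift_8:
  assumes r: "r \<ge> 4" "8 dvd r"
  shows "I_s r = lift r (ntens (perm_mat id) (ext_mat g_s g_s))"
proof -
  obtain k where k: "r = 8 * k" using r(2) by (rule dvdE)
  have c: "cis (2 * pi * (3 * real r / 2 / 4)) = 1" "cis (2 * pi * (3 * real r / 2 / 2)) = 1"
  proof -
    have *: "3 * real r / 2 / 4 = of_nat (3 * k)" "3 * real r / 2 / 2 = of_nat (6 * k)" by (simp_all add: k)
    show "cis (2 * pi * (3 * real r / 2 / 4)) = 1" "cis (2 * pi * (3 * real r / 2 / 2)) = 1"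
      unfolding * by (rule cis_multiple_2pi, simp)+
  qed
  have r4: "4 dvd r" "even r" using r(2) by auto
  have "I_s r = lift r (ntens (perm_mat id)
    (\<lambda>g h. (if h = (\<not> fst g, snd g) \<and> \<not> snd g then 1 else 0) + (if h = g \<and> \<not> snd g then 1 else 0)))"
    unfolding I_s_def
  proof (rule sc_invariant_eq_lift[OF r(1)])
    fix j :: nat and g :: "bool \<times> bool" assume j: "j < r + 2"
    obtain p q where g: "g = (p, q)" by (cases g)
    show "J_s r (Wt r (j, g)) = Wt r (j, \<not> fst g, snd g)" by (simp add: g J_s_Wt[OF r(1) r4(2)])
    show "Q_s r (Wt r (j, g)) + 3 * real r / 2 / 4 \<in> \<int> \<longleftrightarrow> \<not> snd g" "Q_s r (Wt r (j, g)) + 3 * real r / 2 / 2 \<in> \<int> \<longleftrightarrow> \<not> snd g"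
      unfolding Ints_iff_cis distrib_left cis_mult[symmetric] c g cis_Q_s[OF r(1) r4(1) j] by auto
  qed auto
  also have "\<dots> = lift r (ntens (perm_mat id) (ext_mat g_s g_s))"
    by (rule lift_ntens_cong[OF r(1)]) (auto simp: ext_mat_def prod_eq_iff)
  finally show ?thesis .
qed

section \<open>The exceptional invariant\<close>

lemma cc7':
  "l \<in> {1, 2, 4, 7, 8} \<Longrightarrow> cc 7 1 6 l = - cc 7 1 3 l" "cc 7 1 6 6 = cc 7 1 3 3"
proof -
  have c: "ck 15 a = ck 15 b" if "[a = b] (mod 15) \<or> [a = - b] (mod 15)" for a b
    using that ck_cong[of 15 a b] ck_cong[of 15 a "- b"] by auto
  show "l \<in> {1, 2, 4, 7, 8} \<Longrightarrow> cc 7 1 6 l = - cc 7 1 3 l"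
    using c[of 24 6] c[of 20 5] c[of 12 3] by (auto simp: cc_def kern_def xsign_def dhalf_def cong_def)
  show "cc 7 1 6 6 = cc 7 1 3 3"
    using c[of 1 16] by (auto simp: cc_def kern_def xsign_def dhalf_def cong_def)
qed

lemma Xmat_7:
  "l \<in> {1, 2, 4, 7, 8} \<Longrightarrow> Xmat 7 \<kappa> 5 l = - Xmat 7 \<kappa> 0 l" "l \<in> {1, 2, 4, 7, 8} \<Longrightarrow> Xmat 7 \<kappa> 6 l = - Xmat 7 \<kappa> 3 l"
  "Xmat 7 \<kappa> 5 5 = Xmat 7 \<kappa> 0 0" "Xmat 7 \<kappa> 5 3 = Xmat 7 \<kappa> 0 6" "Xmat 7 \<kappa> 5 6 = Xmat 7 \<kappa> 0 3" "Xmat 7 \<kappa> 6 6 = Xmat 7 \<kappa> 3 3"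
proof -
  have *: "Xmat 7 \<kappa> j l = of_real (cc 7 1 j l)" if "j < 7" for j l
    using xform_cc[of 7 1 1 \<kappa> j l] that by (simp add: Xmat_def xsg_def)
  have X: "Xmat 7 \<kappa> 0 l = of_real (cc 7 1 0 l)" "Xmat 7 \<kappa> 3 l = of_real (cc 7 1 3 l)"
    "Xmat 7 \<kappa> 5 l = of_real (cc 7 1 5 l)" "Xmat 7 \<kappa> 6 l = of_real (cc 7 1 6 l)" for l
    by (rule *, simp)+
  show "l \<in> {1, 2, 4, 7, 8} \<Longrightarrow> Xmat 7 \<kappa> 5 l = - Xmat 7 \<kappa> 0 l" "l \<in> {1, 2, 4, 7, 8} \<Longrightarrow> Xmat 7 \<kappa> 6 l = - Xmat 7 \<kappa> 3 l"
    "Xmat 7 \<kappa> 5 5 = Xmat 7 \<kappa> 0 0" "Xmat 7 \<kappa> 5 3 = Xmat 7 \<kappa> 0 6" "Xmat 7 \<kappa> 5 6 = Xmat 7 \<kappa> 0 3" "Xmat 7 \<kappa> 6 6 = Xmat 7 \<kappa> 3 3"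
    by (simp_all only: X cc7 cc7' of_real_minus)
qed

lemma Xmat_sym: "Xmat r \<kappa> j k = Xmat r \<kappa> k j"
  by (simp add: Xmat_def xform_def kern_sym mult_ac)

lemma X_exc_mult:
  fixes f :: "nat \<Rightarrow> 'a :: semiring_1"
  shows "(\<Sum>l<7 + 2. of_nat (X_exc j l) * f l) = (if j \<in> {0, 5} then f 0 + f 5 else if j \<in> {3, 6} then f 3 + f 6 else 0)"
proof -
  have "(\<Sum>l<7 + 2. of_nat (X_exc j l) * f l) = (\<Sum>l\<in>(if j \<in> {0, 5} then {0, 5} else if j \<in> {3, 6} then {3, 6} else {}). f l)"
    by (intro sum.mono_neutral_cong_right) (auto simp: X_exc_def split: if_splits)
  then show ?thesis by auto
qed

text \<open>The sum of rows 0 and 5 of X and the sum of rows 3 and 6 vanish off the two classes and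
  are constant on each class; both products are made of these sums.\<close>

lemma commutes_X_exc: "commutes {..<7 + 2} (\<lambda>j k. of_nat (X_exc j k)) (Xmat 7 \<kappa>)"
  unfolding commutes_def
proof (intro ballI)
  let ?X = "Xmat 7 \<kappa>"
  fix j k :: nat assume jk: "j \<in> {..<7 + 2}" "k \<in> {..<7 + 2}"
  have L: "mprod {..<7 + 2} (\<lambda>j k. of_nat (X_exc j k)) ?X j k =
     (if j \<in> {0, 5} then ?X 0 k + ?X 5 k else if j \<in> {3, 6} then ?X 3 k + ?X 6 k else 0)"
    unfolding mprod_def by (rule X_exc_mult)
  have "mprod {..<7 + 2} ?X (\<lambda>j k. of_nat (X_exc j k)) j k = (\<Sum>l<7 + 2. of_nat (X_exc k l) * ?X l j)"
    unfolding mprod_def by (intro sum.cong) (auto simp: X_exc_def Xmat_sym[of 7 \<kappa> _ j] mult.commute)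
  then have R: "mprod {..<7 + 2} ?X (\<lambda>j k. of_nat (X_exc j k)) j k =
     (if k \<in> {0, 5} then ?X 0 j + ?X 5 j else if k \<in> {3, 6} then ?X 3 j + ?X 6 j else 0)"
    unfolding X_exc_mult .
  have z: "?X 0 l + ?X 5 l = 0" "?X 3 l + ?X 6 l = 0" if "l \<in> {1, 2, 4, 7, 8}" for l
    using that by (simp_all only: Xmat_7 add.right_inverse)
  have s: "?X 5 0 = ?X 0 5" "?X 3 0 = ?X 0 3" "?X 6 0 = ?X 0 6" "?X 3 5 = ?X 0 6" "?X 6 5 = ?X 0 3" "?X 6 3 = ?X 3 6"
    using Xmat_sym[of 7 \<kappa> 3 5] Xmat_sym[of 7 \<kappa> 6 5] unfolding Xmat_7 by (simp_all only: Xmat_sym[of 7 \<kappa> 5 0]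
      Xmat_sym[of 7 \<kappa> 3 0] Xmat_sym[of 7 \<kappa> 6 0] Xmat_sym[of 7 \<kappa> 6 3])
  have c: "l = 0 \<or> l = 5 \<or> l = 3 \<or> l = 6 \<or> l \<in> {1, 2, 4, 7, 8}" if "l \<in> {..<7 + 2}" for l :: nat
    using that by auto
  define a b d where "a = ?X 0 0 + ?X 0 5" and "b = ?X 0 3 + ?X 0 6" and "d = ?X 3 3 + ?X 3 6"
  have v: "?X 0 0 + ?X 5 0 = a" "?X 0 5 + ?X 5 5 = a" "?X 0 3 + ?X 5 3 = b" "?X 0 6 + ?X 5 6 = b"
    "?X 3 0 + ?X 6 0 = b" "?X 3 5 + ?X 6 5 = b" "?X 3 3 + ?X 6 3 = d" "?X 3 6 + ?X 6 6 = d"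
    unfolding a_def b_def d_def s Xmat_7(3-) by (simp_all only: add.commute)
  have P: "?X 0 l + ?X 5 l = (if l \<in> {0, 5} then a else if l \<in> {3, 6} then b else 0)" if "l \<in> {..<7 + 2}" for l
    using c[OF that] by (elim disjE) (simp_all only: v z, auto)
  have Q: "?X 3 l + ?X 6 l = (if l \<in> {0, 5} then b else if l \<in> {3, 6} then d else 0)" if "l \<in> {..<7 + 2}" for l
    using c[OF that] by (elim disjE) (simp_all only: v z, auto)
  show "mprod {..<7 + 2} (\<lambda>j k. of_nat (X_exc j k)) ?X j k = mprod {..<7 + 2} ?X (\<lambda>j k. of_nat (X_exc j k)) j k"
    unfolding L R P[OF jk(1)] P[OF jk(2)] Q[OF jk(1)] Q[OF jk(2)] by auto
qed

definition simple_current :: "nat \<Rightarrow> bool \<times> bool \<Rightarrow> weight \<Rightarrow> weight" where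
  "simple_current r g = (if snd g then J_v r else id) \<circ> (if fst g then J_s r else id)"

lemma simple_current_Wt:
  assumes r: "r \<ge> 4"
  shows "simple_current r (p, q) (Wt r (j, False, q')) = Wt r (j, p, q \<noteq> q')"
  by (cases "q' \<noteq> odd (min j r)"; cases p; cases q)
    (simp_all add: Wt_def simple_current_def J_s_J_v[OF r] J_v_J_v[OF r])

lemma sum_simple_currents:
  assumes r: "r \<ge> 4"
  shows "(\<Sum>J\<in>simple_currents r. f J) = (\<Sum>g\<in>UNIV. f (simple_current r g))"
proof -
  have "inj (simple_current r)"
  proof (rule injI)
    fix g h assume e: "simple_current r g = simple_current r h"
    have "simple_current r g (Wt r (0, g_e)) = Wt r (0, g)" for g
      using simple_current_Wt[OF r, of "fst g" "snd g" 0 False] by simp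
    then have "Wt r (0, g) = Wt r (0, h)" using e by metis
    then show "g = h" using Wt_eq_iff[OF r, of "(0, g)" "(0, h)"] by (simp add: Cells_def)
  qed
  moreover have "simple_currents r = range (simple_current r)"
  proof -
    have U: "(UNIV :: (bool \<times> bool) set) = {g_e, g_v, g_s, g_c}" by auto
    show ?thesis unfolding U by (simp add: simple_currents_def simple_current_def J_c_def)
  qed
  ultimately show ?thesis by (simp add: sum.reindex)
qed

text \<open>Owing to the parity shift in \<open>Wt\<close>, both weights of a square carry the same
  flag, \<open>g_e\<close> in the first sum and \<open>g_v\<close> in the second.\<close>

lemma E_D73_weights:
  "vacuum 3 = Wt 7 (0, g_e)"
  "with_level 7 3 (\<lambda>i. Lam 1 i + Lam 5 i) = Wt 7 (5, g_e)"
  "with_level 7 3 (Lam 3) = Wt 7 (3, g_v)"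
  "with_level 7 3 (\<lambda>i. Lam 1 i + Lam 6 i + Lam 7 i) = Wt 7 (6, g_v)"
proof -
  have s: "{2..7 - 2} = {2, 3, 4, 5 :: nat}" by auto
  show "vacuum 3 = Wt 7 (0, g_e)"
    by (auto simp: vacuum_def Wt_def lamw_def fun_eq_iff)
  show "with_level 7 3 (\<lambda>i. Lam 1 i + Lam 5 i) = Wt 7 (5, g_e)"
    unfolding with_level_def s by (auto simp: Lam_def Wt_def lamw_def J_v_def fun_eq_iff)
  show "with_level 7 3 (Lam 3) = Wt 7 (3, g_v)"
    unfolding with_level_def s by (auto simp: Lam_def Wt_def lamw_def J_v_def fun_eq_iff)
  show "with_level 7 3 (\<lambda>i. Lam 1 i + Lam 6 i + Lam 7 i) = Wt 7 (6, g_v)"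
    unfolding with_level_def s by (auto simp: Lam_def Wt_def lamw_def J_v_def fun_eq_iff)
qed

lemma E_D73_lift: "E_D73 = lift 7 (ntens X_exc (perm_mat id))"
proof (intro eq_liftI)
  fix x y :: cell assume xy: "x \<in> Cells 7" "y \<in> Cells 7"
  obtain j f where x: "x = (j, f)" by (cases x)
  obtain k h where y: "y = (k, h)" by (cases y)
  have chi: "chi (simple_current 7 g (Wt 7 (i, False, q'))) (Wt 7 z) = (if z = (i, fst g, snd g \<noteq> q') then 1 else 0)"
    if "z \<in> Cells 7" "i < 9" for g i q' z
    using that Wt_eq_iff[of 7 z "(i, fst g, snd g \<noteq> q')"] simple_current_Wt[of 7 "fst g" "snd g" i q']
    by (simp add: chi_def Cells_def)
  \<comment> \<open>Translation of the flags by \<open>g_v\<close>, from the second pair of weights;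
    being injective, it disappears from a sum over all currents.\<close>
  define \<phi> where "\<phi> g = (fst g, \<not> snd g)" for g :: "bool \<times> bool"
  have row1: "chi (simple_current 7 g (Wt 7 (0, g_e))) (Wt 7 z) + chi (simple_current 7 g (Wt 7 (5, g_e))) (Wt 7 z) =
      (if g = snd z then if fst z \<in> {0, 5} then 1 else 0 else 0)" if "z \<in> Cells 7" for g z
    unfolding chi[OF that, of 0, simplified] chi[OF that, of 5, simplified] by (cases z, cases g) auto
  have row2: "chi (simple_current 7 g (Wt 7 (3, g_v))) (Wt 7 z) + chi (simple_current 7 g (Wt 7 (6, g_v))) (Wt 7 z) =
      (if g = \<phi> (snd z) then if fst z \<in> {3, 6} then 1 else 0 else 0)" if "z \<in> Cells 7" for g z
    unfolding chi[OF that, of 3, simplified] chi[OF that, of 6, simplified] by (cases z, cases g) (auto simp: \<phi>_def)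
  have \<phi>: "\<phi> f = \<phi> h \<longleftrightarrow> f = h" by (auto simp: \<phi>_def prod_eq_iff)
  have sum: "(\<Sum>g\<in>UNIV. (if g = u then a else 0) * cnj (if g = v then b else 0)) = (if u = v then a * cnj b else 0)"
    for u v :: "bool \<times> bool" and a b
  proof -
    have "(\<Sum>g\<in>UNIV. (if g = u then a else 0) * cnj (if g = v then b else 0)) = (\<Sum>g\<in>UNIV. if g = u then (if u = v then a * cnj b else 0) else 0)"
      by (intro sum.cong) auto
    then show ?thesis by simp
  qed
  have "E_D73 (Wt 7 x) (Wt 7 y) =
    (\<Sum>g\<in>UNIV. sq_mod (\<lambda>\<kappa>. chi (simple_current 7 g (Wt 7 (0, g_e))) \<kappa> + chi (simple_current 7 g (Wt 7 (5, g_e))) \<kappa>) (Wt 7 x) (Wt 7 y)) +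
    (\<Sum>g\<in>UNIV. sq_mod (\<lambda>\<kappa>. chi (simple_current 7 g (Wt 7 (3, g_v))) \<kappa> + chi (simple_current 7 g (Wt 7 (6, g_v))) \<kappa>) (Wt 7 x) (Wt 7 y))"
    unfolding E_D73_def Let_def mat_on_def E_D73_weights
    using Wt_P_plus[of 7] xy by (simp add: sum_simple_currents)
  also have "\<dots> = of_nat (X_exc j k) * of_nat (perm_mat id f h)"
    unfolding sq_mod_def row1[OF xy(1)] row1[OF xy(2)] row2[OF xy(1)] row2[OF xy(2)] sum unfolding x y fst_conv snd_conv \<phi>
    by (auto simp: X_exc_def perm_mat_def)
  finally show "E_D73 (Wt 7 x) (Wt 7 y) = of_nat (ntens X_exc (perm_mat id) x y)"
    by (simp add: ntens_def x y)
qed (auto simp: E_D73_def Let_def mat_on_def)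

lemma physical_invariant_E_D73: "physical_invariant 7 3 E_D73"
  unfolding E_D73_lift
proof (intro physical_invariant_ntens)
  show "commutes {..<7 + 2} (\<lambda>j k. of_nat (X_exc j k)) (Xmat 7 (base_kappa 7))" by (rule commutes_X_exc)
  show "X_exc 0 0 = 1" by (simp add: X_exc_def)
  have "Xphase 7 5 = Xphase 7 0" "Xphase 7 6 = Xphase 7 3"
    unfolding Xphase_def by (subst zt_eq_iff; simp add: cong_def)+
  then show "Xphase 7 j = Xphase 7 k" if "X_exc j k \<noteq> 0" for j k
    using that by (auto simp: X_exc_def split: if_splits)
  have "perm_mat id \<in> G_invs 7" by (simp add: G_invs_def)
  from G_invs_props[OF this] show "commutes UNIV (\<lambda>g h. of_nat (perm_mat id g h)) (Gmat 7)" "perm_mat id g_e g_e = 1"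
    "\<And>g h. perm_mat id g h \<noteq> 0 \<Longrightarrow> Gphase 7 g = Gphase 7 h" by blast+
qed simp

section \<open>Triality\<close>

lemma det_mat_diag: "det (mat_diag n f) = (\<Prod>i=0..<n. f i)"
proof -
  have "upper_triangular (mat_diag n f)" by (auto simp: mat_diag_def upper_triangular_def)
  then have "det (mat_diag n f) = prod_list (diag_mat (mat_diag n f))" by (rule det_upper_triangular[OF _ mat_diag_dim])
  also have "\<dots> = (\<Prod>i=0..<n. mat_diag n f $$ (i, i))" by (simp add: prod_list_diag_prod mat_diag_def)
  also have "\<dots> = (\<Prod>i=0..<n. f i)" by (intro prod.cong) (auto simp: mat_diag_def)
  finally show ?thesis .
qed

text \<open>Subtracting from each column of cosines the next but one turns it into a column of sines,
  since \<open>2 cos ((m - 1)t) - 2 cos ((m + 1)t) = 4 sin t sin (m t)\<close>.\<close>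

lemma det_cosmat_sinmat:
  "det (cosmat r) = 2 * (-1) ^ r * ((\<Prod>i=0..<r. - sin2 (2 * r + 1) (real (r - i))) * det (sinmat r))"
proof -
  let ?n = "2 * r + 1"
  \<comment> \<open>Truncated subtraction is intended: j = 1 gives i = 0. The column two before
    column 1 would have the residue r + 1, whose cosines equal those of the residue \<open>r\<close>
    in column 0.\<close>
  define N :: "complex mat" where
    "N = mat (Suc r) (Suc r) (\<lambda>(i, j). if i = j then 1 else if j > 0 \<and> i = j - 2 then -1 else 0)"
  define P where "P = cosmat r * N"
  have N: "N \<in> carrier_mat (Suc r) (Suc r)" by (simp add: N_def)
  have PC: "P \<in> carrier_mat (Suc r) (Suc r)" unfolding P_def by (rule mult_carrier_mat[OF cosmat_carrier(1) N])
  have "upper_triangular N" by (auto simp: N_def upper_triangular_def)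
  then have "det N = prod_list (diag_mat N)" using N by (rule det_upper_triangular)
  also have "\<dots> = 1" unfolding prod_list_diag_prod by (simp add: N_def)
  finally have dP: "det P = det (cosmat r)" unfolding P_def det_mult[OF cosmat_carrier(1) N] by simp
  have P0: "P $$ (i, 0) = cosmat r $$ (i, 0)" if "i < Suc r" for i
  proof -
    have "P $$ (i, 0) = (\<Sum>k=0..<Suc r. cosmat r $$ (i, k) * N $$ (k, 0))"
      using that N by (simp add: P_def scalar_prod_def)
    also have "\<dots> = (\<Sum>k=0..<Suc r. if k = 0 then cosmat r $$ (i, 0) else 0)"
      by (intro sum.cong) (auto simp: N_def)
    finally show ?thesis by simp
  qed
  have PS: "P $$ (i, Suc j) = cosmat r $$ (i, Suc j) - cosmat r $$ (i, j - 1)" if "i < Suc r" "j < r" for i j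
  proof -
    have "P $$ (i, Suc j) = (\<Sum>k=0..<Suc r. cosmat r $$ (i, k) * N $$ (k, Suc j))"
      using that N by (simp add: P_def scalar_prod_def)
    also have "\<dots> = (\<Sum>k=0..<Suc r. (if k = Suc j then cosmat r $$ (i, Suc j) else 0) - (if k = j - 1 then cosmat r $$ (i, j - 1) else 0))"
      using that(2) by (intro sum.cong) (auto simp: N_def)
    also have "\<dots> = cosmat r $$ (i, Suc j) - cosmat r $$ (i, j - 1)"
      unfolding sum_subtractf using that(2) by (cases j) auto
    finally show ?thesis .
  qed
  have sinmat: "sinmat r \<in> carrier_mat r r" by (simp add: sinmat_def)
  have D: "mat_delete P r 0 = mat_diag r (\<lambda>i. - sin2 ?n (real (r - i))) * sinmat r"
    unfolding mat_diag_mult_left[OF sinmat]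
  proof (rule eq_matI)
    let ?B = "mat r r (\<lambda>(i, j). - sin2 ?n (real (r - i)) * sinmat r $$ (i, j))"
    show "dim_row (mat_delete P r 0) = dim_row ?B" "dim_col (mat_delete P r 0) = dim_col ?B"
      using PC by (auto simp: mat_delete_def)
    fix i j assume "i < dim_row ?B" "j < dim_col ?B"
    then have ij: "i < r" "j < r" by simp_all
    define t where "t = 2 * pi * real (r - i) / real ?n"
    have ck: "kern ?n 1 (r - i) b = cos (real b * t)" for b
      by (simp add: kern_def ck_def t_def mult_ac)
    have 1: "kern ?n 1 (r - i) (r - (j - 1)) = cos (real (r - j) * t + t)"
    proof (cases j)
      case 0
      have "t * real ?n = 2 * pi * real (r - i)" unfolding t_def by (simp del: of_nat_add of_nat_mult of_nat_Suc)
      then have "real (r - j) * t + t = 2 * pi * real (r - i) - real r * t"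
        by (simp add: 0 algebra_simps)
      then have "cos (real (r - j) * t + t) = cos (real r * t)"
        using cos_int_2pin[of "int (r - i)"] sin_int_2pin[of "int (r - i)"] by (simp add: cos_diff)
      then show ?thesis unfolding ck by (simp add: 0)
    next
      case (Suc m)
      then have "real (r - (j - 1)) = real (r - j) + 1" using ij by simp
      then have "real (r - (j - 1)) * t = real (r - j) * t + t" by (simp only: ring_distribs mult_1)
      then show ?thesis unfolding ck by (simp only:)
    qed
    have 2: "kern ?n 1 (r - i) (r - Suc j) = cos (real (r - j) * t - t)"
      unfolding ck using ij by (simp add: of_nat_diff algebra_simps)
    have "mat_delete P r 0 $$ (i, j) = P $$ (i, Suc j)"
      using ij PC by (simp add: mat_delete_def)
    also have "\<dots> = 2 * of_real (cos (real (r - j) * t - t)) - 2 * of_real (cos (real (r - j) * t + t))"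
      using ij unfolding PS[OF less_SucI[OF ij(1)] ij(2)] by (simp add: cosmat_def 1[simplified] 2[simplified])
    also have "\<dots> = - sin2 ?n (real (r - i)) * sin2 ?n (real (r - i) * real (r - j))"
    proof -
      have "sin2 ?n (real (r - i)) = - 2 * \<i> * of_real (sin t)" "sin2 ?n (real (r - i) * real (r - j)) = - 2 * \<i> * of_real (sin (real (r - j) * t))"
        unfolding sin2_def t_def by (simp_all add: mult_ac)
      then show ?thesis by (simp add: cos_add cos_diff complex_eq_iff)
    qed
    finally show "mat_delete P r 0 $$ (i, j) = ?B $$ (i, j)"
      using ij by (simp add: sinmat_def)
  qed
  \<comment> \<open>Row \<open>r\<close> is the residue 0, where all entries of
    \<open>cosmat\<close> are 2, so the differences vanish and only the first column
    contributes.\<close>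
  have "det P = (\<Sum>j<Suc r. P $$ (r, j) * cofactor P r j)"
    using PC by (rule laplace_expansion_row) simp
  also have "\<dots> = (\<Sum>j<Suc r. if j = 0 then 2 * cofactor P r 0 else 0)"
  proof (intro sum.cong HOL.refl)
    fix j assume "j \<in> {..<Suc r}"
    then show "P $$ (r, j) * cofactor P r j = (if j = 0 then 2 * cofactor P r 0 else 0)"
      using P0[of r] PS[of r "j - 1"] by (cases j) (auto simp: cosmat_def)
  qed
  also have "\<dots> = 2 * ((-1) ^ r * det (mat_delete P r 0))" by (simp add: cofactor_def)
  also have "det (mat_delete P r 0) = (\<Prod>i=0..<r. - sin2 ?n (real (r - i))) * det (sinmat r)"
    unfolding D by (subst det_mult[of _ r]) (simp_all add: det_mat_diag sinmat_def)
  finally show ?thesis unfolding dP by simp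
qed

text \<open>With x = pi / 9, three of the factors form sin x sin (pi / 3 + x) sin (pi / 3 - x) = sin
  (3 x) / 4, and the fourth is sin (pi / 3) = sin (3 x).\<close>

lemma prod_sin_9: "sin (2 * pi * 4 / 9) * sin (2 * pi * 3 / 9) * sin (2 * pi * 2 / 9) * sin (2 * pi / 9) = 3 / 16"
proof -
  define x where "x = pi / 9"
  have x: "2 * pi * 4 / 9 = pi - x" "2 * pi * 3 / 9 = pi - pi / 3" "2 * pi * 2 / 9 = pi / 3 + x" "2 * pi / 9 = pi / 3 - x" "3 * x = pi / 3"
    by (simp_all add: x_def)
  have 1: "sin (pi / 3) = 3 * sin x - 4 * sin x ^ 3"
  proof -
    have "2 * sin x * cos x * cos x = 2 * sin x * (1 - (sin x)\<^sup>2)"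
      unfolding cos_squared_eq[symmetric] by (simp add: power2_eq_square)
    then have "sin (2 * x + x) = 3 * sin x - 4 * sin x ^ 3"
      unfolding sin_add sin_double cos_double_sin by (simp add: power2_eq_square power3_eq_cube algebra_simps)
    then show ?thesis unfolding x(5)[symmetric] by simp
  qed
  have 2: "sin (pi / 3 + x) * sin (pi / 3 - x) = 3 / 4 - sin x ^ 2"
  proof -
    have "sin (pi / 3 + x) * sin (pi / 3 - x) = (sin (pi / 3))\<^sup>2 * (cos x)\<^sup>2 - (cos (pi / 3))\<^sup>2 * (sin x)\<^sup>2"
      by (simp add: sin_add sin_diff power2_eq_square algebra_simps)
    then show ?thesis by (simp add: sin_60 cos_60 cos_squared_eq power_divide field_simps)
  qed
  have "4 * (sin x * (sin (pi / 3 + x) * sin (pi / 3 - x))) = sin (pi / 3)"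
    unfolding 1 2 by (simp add: power3_eq_cube power2_eq_square algebra_simps)
  then have "sin x * (sin (pi / 3 + x) * sin (pi / 3 - x)) = sqrt 3 / 8" by (simp add: sin_60)
  then have "sin (pi / 3) * (sin x * (sin (pi / 3 + x) * sin (pi / 3 - x))) = sqrt 3 / 2 * (sqrt 3 / 8)"
    by (simp only: sin_60)
  then have "sin (pi / 3) * (sin x * (sin (pi / 3 + x) * sin (pi / 3 - x))) = 3 / 16" by simp
  then show ?thesis unfolding x(1-4) sin_pi_minus by (simp add: mult_ac)
qed

text \<open>The product of the four sines makes the cosine determinant 6 times the sine determinant,
  so \<kappa> = 9 / 12.\<close>

lemma base_kappa_4: "base_kappa 4 = 3 / 4"
proof -
  have "(\<Prod>i=0..<4. - sin2 (2 * 4 + 1) (real (4 - i))) =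
    sin2 9 4 * sin2 9 3 * sin2 9 2 * sin2 9 1"
    by (simp add: eval_nat_numeral)
  also have "\<dots> = 16 * of_real (sin (2 * pi * 4 / 9) * sin (2 * pi * 3 / 9) * sin (2 * pi * 2 / 9) * sin (2 * pi / 9))"
    by (simp add: sin2_def complex_eq_iff)
  also have "\<dots> = 3" unfolding prod_sin_9 by simp
  finally have "det (cosmat 4) = 6 * det (sinmat 4)" unfolding det_cosmat_sinmat by simp
  then show ?thesis using det_sinmat_nonzero[of 4] by (simp add: base_kappa_def base_const_def)
qed

text \<open>On the pair of residue 0 the entries are 1/4 + 3/4 = 1 and 1/4 - 3/4 = -1/2. They match
  those of the residue 3 = n / 3, which has 1 with itself and, by its weight and sign, -1/2 with the
  pair. In the other columns all three rows agree.\<close>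

lemma Xmat_4_perm:
  assumes \<rho>: "\<rho> permutes {1, 4, 5}" and jk: "j < 6" "k < 6"
  shows "Xmat 4 (base_kappa 4) (\<rho> j) (\<rho> k) = Xmat 4 (base_kappa 4) j k"
proof -
  let ?X = "Xmat 4 (base_kappa 4)"
  have c: "ck 9 a = ck 9 b" if "[a = b] (mod 9) \<or> [a = - b] (mod 9)" for a b
    using that ck_cong[of 9 a b] ck_cong[of 9 a "- b"] by auto
  have c3: "ck 9 3 = - 1 / 2"
    using cos_120 by (simp add: ck_def)
  have c': "ck 9 6 = - 1 / 2" "ck 9 12 = - 1 / 2" "ck 9 9 = 1"
    using c[of 6 3] c[of 12 3] c[of 9 0] c3 by (simp_all add: cong_def)
  have d: "?X j k = (if j = k then 1 else - 1 / 2)" if "j \<in> {1, 4, 5}" "k \<in> {1, 4, 5}" for j k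
    using that by (auto simp: Xmat_def xform_def base_kappa_4 xsign_def dhalf_def xsg_def kern_def c')
  have e: "?X j l = ?X 1 l" if "j \<in> {1, 4, 5}" "l \<in> {0, 2, 3}" for j l
    using that by (auto simp: Xmat_def xform_def base_kappa_4 xsign_def dhalf_def xsg_def kern_def c3 c')
  have s: "l \<in> {1, 4, 5} \<or> l \<in> {0, 2, 3}" if "l < 6" for l :: nat
    using that by auto
  have f: "\<rho> l = l" if "l \<in> {0, 2, 3}" for l using that permutes_not_in[OF \<rho>] by auto
  have i: "\<rho> l \<in> {1, 4, 5} \<longleftrightarrow> l \<in> {1, 4, 5}" for l using permutes_in_image[OF \<rho>] .
  have inj: "\<rho> j = \<rho> k \<longleftrightarrow> j = k" using permutes_inj[OF \<rho>] by (simp add: inj_eq)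
  from s[OF jk(1)] s[OF jk(2)] show ?thesis
  proof (elim disjE)
    assume "j \<in> {1, 4, 5}" "k \<in> {1, 4, 5}"
    then show ?thesis using d[of j k] d[of "\<rho> j" "\<rho> k"] i inj by simp
  next
    assume a: "j \<in> {1, 4, 5}" "k \<in> {0, 2, 3}"
    have "\<rho> j \<in> {1, 4, 5}" unfolding i by (rule a(1))
    then show ?thesis unfolding f[OF a(2)] using e[OF _ a(2)] a(1) by metis
  next
    assume a: "j \<in> {0, 2, 3}" "k \<in> {1, 4, 5}"
    have "\<rho> k \<in> {1, 4, 5}" unfolding i by (rule a(2))
    then show ?thesis unfolding f[OF a(1)] Xmat_sym[of 4 _ j] using e[OF _ a(1)] a(2) by metis
  next
    assume "j \<in> {0, 2, 3}" "k \<in> {0, 2, 3}"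
    then show ?thesis by (simp only: f)
  qed
qed

lemma physical_invariant_4:
  assumes \<rho>: "\<rho> permutes {1, 4, 5}" and \<tau>: "bij \<tau>" "\<tau> g_e = g_e"
  shows "physical_invariant 4 3 (lift 4 (ntens (perm_mat \<rho>) (perm_mat \<tau>)))"
proof (intro physical_invariant_ntens)
  have \<rho>6: "\<rho> permutes {..<4 + 2}" using \<rho> by (rule permutes_subset) auto
  show "commutes {..<4 + 2} (\<lambda>j k. of_nat (perm_mat \<rho> j k)) (Xmat 4 (base_kappa 4))"
    using permutes_imp_bij[OF \<rho>6] Xmat_4_perm[OF \<rho>] by (intro commutes_perm_mat) auto
  show "perm_mat \<rho> 0 0 = 1" using permutes_not_in[OF \<rho>, of 0] by (simp add: perm_mat_def)
  have X: "Xphase 4 j = 1" if "j \<in> {1, 4, 5}" for j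
    using that zt_eq_iff[of 9 36 0] by (auto simp: Xphase_def cong_def)
  show "Xphase 4 j = Xphase 4 k" if "perm_mat \<rho> j k \<noteq> 0" for j k
  proof -
    have k: "k = \<rho> j" using that by (simp add: perm_mat_def split: if_splits)
    show ?thesis
    proof (cases "j \<in> {1, 4, 5}")
      case True
      then have "\<rho> j \<in> {1, 4, 5}" unfolding permutes_in_image[OF \<rho>] .
      then show ?thesis unfolding k using X True by simp
    qed (simp add: k permutes_not_in[OF \<rho>])
  qed
  have "perm_mat \<tau> \<in> G_invs 4" unfolding G_invs_def using \<tau> by auto
  from G_invs_props[OF this] show "commutes UNIV (\<lambda>g h. of_nat (perm_mat \<tau> g h)) (Gmat 4)" "perm_mat \<tau> g_e g_e = 1"
    "\<And>g h. perm_mat \<tau> g h \<noteq> 0 \<Longrightarrow> Gphase 4 g = Gphase 4 h" by blast+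
qed simp

section \<open>Permutations of the labels 1, 3 and 4 acting on cells\<close>

lemma Wt_simple_current:
  assumes "r \<ge> 4"
  shows "Wt r (j, g) = simple_current r g (Wt r (j, g_e))"
  using simple_current_Wt[OF assms, of "fst g" "snd g" j False] by simp

lemma Wt_4_tensor:
  "Wt 4 (0, g_e) = (\<lambda>i. if i = 0 then 3 else 0)"
  "Wt 4 (1, g_e) = (\<lambda>i. if i = 0 then 1 else if i = 1 then 2 else 0)"
  "Wt 4 (2, g_e) = (\<lambda>i. if i = 0 \<or> i = 2 then 1 else 0)"
  "Wt 4 (3, g_e) = (\<lambda>i. if i = 1 \<or> i = 3 \<or> i = 4 then 1 else 0)"
  "Wt 4 (4, g_e) = (\<lambda>i. if i = 0 then 1 else if i = 4 then 2 else 0)"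
  "Wt 4 (5, g_e) = (\<lambda>i. if i = 0 then 1 else if i = 3 then 2 else 0)"
  by (auto simp: Wt_def lamw_def J_v_def fun_eq_iff)

lemma Wt_4_comp:
  assumes "\<And>\<mu> g. simple_current 4 g \<mu> \<circ> t = simple_current 4 (\<tau> g) (\<mu> \<circ> t)"
    and "\<And>j. j < 6 \<Longrightarrow> Wt 4 (j, g_e) \<circ> t = Wt 4 (\<rho> j, g_e)" and "j < 6"
  shows "Wt 4 (j, g) \<circ> t = Wt 4 (\<rho> j, \<tau> g)"
  using Wt_simple_current[of 4 j g] Wt_simple_current[of 4 "\<rho> j" "\<tau> g"] assms by simp

lemma transpose_Wt_4:
  "j < 6 \<Longrightarrow> Wt 4 (j, g) \<circ> Transposition.transpose 3 4 = Wt 4 (Transposition.transpose 4 5 j, gC g)"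
  "j < 6 \<Longrightarrow> Wt 4 (j, g) \<circ> Transposition.transpose 1 3 = Wt 4 (Transposition.transpose 1 5 j, fst g \<noteq> snd g, snd g)"
  "j < 6 \<Longrightarrow> Wt 4 (j, g) \<circ> Transposition.transpose 1 4 = Wt 4 (Transposition.transpose 1 4 j, snd g, fst g)"
proof -
  have six: "j = 0 \<or> j = 1 \<or> j = 2 \<or> j = 3 \<or> j = 4 \<or> j = 5" if "j < 6" for j :: nat using that by auto
  note defs = Transposition.transpose_def fun_eq_iff
  have sc: "simple_current 4 g \<mu> i = (if i > 4 then \<mu> i else if fst g \<and> snd g then \<mu> (if i = 0 then 3 else if i = 3 then 0 else if i = 1 then 4 else if i = 4 then 1 else 2)
     else if fst g then \<mu> (if i = 0 then 4 else if i = 4 then 0 else if i = 1 then 3 else if i = 3 then 1 else 2)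
     else if snd g then \<mu> (if i = 0 then 1 else if i = 1 then 0 else if i = 4 then 3 else if i = 3 then 4 else 2) else \<mu> i)" for g \<mu> i
  proof -
    have "i = 0 \<or> i = 1 \<or> i = 2 \<or> i = 3 \<or> i = 4 \<or> i > 4" by auto
    then show ?thesis by (elim disjE; cases "fst g"; cases "snd g") (simp_all add: simple_current_def J_v_def J_s_def)
  qed
  have five: "i = 0 \<or> i = 1 \<or> i = 2 \<or> i = 3 \<or> i = 4 \<or> i > 4" for i :: nat by auto
  show "Wt 4 (j, g) \<circ> Transposition.transpose 3 4 = Wt 4 (Transposition.transpose 4 5 j, gC g)" if j: "j < 6"
  proof (rule Wt_4_comp[OF _ _ j])
    show "simple_current 4 g \<mu> \<circ> Transposition.transpose 3 4 = simple_current 4 (gC g) (\<mu> \<circ> Transposition.transpose 3 4)" for \<mu> g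
    proof
      fix i
      show "(simple_current 4 g \<mu> \<circ> Transposition.transpose 3 4) i = simple_current 4 (gC g) (\<mu> \<circ> Transposition.transpose 3 4) i"
        using five[of i] by (elim disjE; cases "fst g"; cases "snd g") (simp_all add: sc gC_def Transposition.transpose_def)
    qed
    show "Wt 4 (j, g_e) \<circ> Transposition.transpose 3 4 = Wt 4 (Transposition.transpose 4 5 j, g_e)" if "j < 6" for j
      using six[OF that] by (elim disjE) (simp_all add: Wt_4_tensor[simplified] defs)
  qed
  show "Wt 4 (j, g) \<circ> Transposition.transpose 1 3 = Wt 4 (Transposition.transpose 1 5 j, fst g \<noteq> snd g, snd g)" if j: "j < 6"
  proof (rule Wt_4_comp[OF _ _ j])
    show "simple_current 4 g \<mu> \<circ> Transposition.transpose 1 3 = simple_current 4 (fst g \<noteq> snd g, snd g) (\<mu> \<circ> Transposition.transpose 1 3)" for \<mu> g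
    proof
      fix i
      show "(simple_current 4 g \<mu> \<circ> Transposition.transpose 1 3) i = simple_current 4 (fst g \<noteq> snd g, snd g) (\<mu> \<circ> Transposition.transpose 1 3) i"
        using five[of i] by (elim disjE; cases "fst g"; cases "snd g") (simp_all add: sc Transposition.transpose_def)
    qed
    show "Wt 4 (j, g_e) \<circ> Transposition.transpose 1 3 = Wt 4 (Transposition.transpose 1 5 j, g_e)" if "j < 6" for j
      using six[OF that] by (elim disjE) (simp_all add: Wt_4_tensor[simplified] defs)
  qed
  show "Wt 4 (j, g) \<circ> Transposition.transpose 1 4 = Wt 4 (Transposition.transpose 1 4 j, snd g, fst g)" if j: "j < 6"
  proof (rule Wt_4_comp[OF _ _ j])
    show "simple_current 4 g \<mu> \<circ> Transposition.transpose 1 4 = simple_current 4 (snd g, fst g) (\<mu> \<circ> Transposition.transpose 1 4)" for \<mu> g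
    proof
      fix i
      show "(simple_current 4 g \<mu> \<circ> Transposition.transpose 1 4) i = simple_current 4 (snd g, fst g) (\<mu> \<circ> Transposition.transpose 1 4) i"
        using five[of i] by (elim disjE; cases "fst g"; cases "snd g") (simp_all add: sc Transposition.transpose_def)
    qed
    show "Wt 4 (j, g_e) \<circ> Transposition.transpose 1 4 = Wt 4 (Transposition.transpose 1 4 j, g_e)" if "j < 6" for j
      using six[OF that] by (elim disjE) (simp_all add: Wt_4_tensor[simplified] defs)
  qed
qed

section \<open>The classification\<close>

definition acts_4 :: "(nat \<Rightarrow> nat) \<Rightarrow> (nat \<Rightarrow> nat) \<Rightarrow> (bool \<times> bool \<Rightarrow> bool \<times> bool) \<Rightarrow> bool" where
  "acts_4 \<pi> \<rho> \<tau> \<longleftrightarrow> \<pi> permutes {1, 3, 4} \<and> \<rho> permutes {1, 4, 5} \<and> bij \<tau> \<and> \<tau> g_e = g_e \<and>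
     (\<forall>j g. j < 6 \<longrightarrow> Wt 4 (j, g) \<circ> \<pi> = Wt 4 (\<rho> j, \<tau> g))"

lemma acts_4_id: "acts_4 id id id"
  by (simp add: acts_4_def permutes_id)

text \<open>Labels are permuted by composition on the right, so the order of composition is reversed
  on cells.\<close>

lemma acts_4_comp:
  assumes t: "acts_4 \<pi> \<rho> \<tau>" and p: "acts_4 \<pi>' \<rho>' \<tau>'"
  shows "acts_4 (\<pi> \<circ> \<pi>') (\<rho>' \<circ> \<rho>) (\<tau>' \<circ> \<tau>)"
  unfolding acts_4_def
proof (intro conjI allI impI)
  show "\<pi> \<circ> \<pi>' permutes {1, 3, 4}" "\<rho>' \<circ> \<rho> permutes {1, 4, 5}"
    using t p by (auto simp: acts_4_def intro: permutes_compose)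
  show "bij (\<tau>' \<circ> \<tau>)" "(\<tau>' \<circ> \<tau>) g_e = g_e" using t p by (auto simp: acts_4_def intro: bij_comp)
  fix j :: nat and g assume j: "j < 6"
  have "\<rho> permutes {..<6}" using t by (auto simp: acts_4_def intro: permutes_subset)
  then have "\<rho> j < 6" using j permutes_in_image[of \<rho> "{..<6}" j] by simp
  then have "Wt 4 (\<rho> j, \<tau> g) \<circ> \<pi>' = Wt 4 (\<rho>' (\<rho> j), \<tau>' (\<tau> g))"
    using p unfolding acts_4_def by blast
  moreover have "Wt 4 (j, g) \<circ> \<pi> = Wt 4 (\<rho> j, \<tau> g)"
    using t j unfolding acts_4_def by blast
  ultimately show "Wt 4 (j, g) \<circ> (\<pi> \<circ> \<pi>') = Wt 4 ((\<rho>' \<circ> \<rho>) j, (\<tau>' \<circ> \<tau>) g)"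
    unfolding comp_assoc[symmetric] by simp
qed

lemma acts_4_transpose:
  "\<exists>\<tau>. acts_4 (Transposition.transpose 3 4) (Transposition.transpose 4 5) \<tau>"
  "\<exists>\<tau>. acts_4 (Transposition.transpose 1 3) (Transposition.transpose 1 5) \<tau>"
  "\<exists>\<tau>. acts_4 (Transposition.transpose 1 4) (Transposition.transpose 1 4) \<tau>"
proof -
  have "bij gC" by (rule involuntory_imp_bij) (auto simp: gC_def)
  then have "acts_4 (Transposition.transpose 3 4) (Transposition.transpose 4 5) gC"
    unfolding acts_4_def using transpose_Wt_4(1) by (auto simp: gC_def intro!: permutes_swap_id)
  then show "\<exists>\<tau>. acts_4 (Transposition.transpose 3 4) (Transposition.transpose 4 5) \<tau>" by blast
  have "bij (\<lambda>g :: bool \<times> bool. (fst g \<noteq> snd g, snd g))" by (rule involuntory_imp_bij) auto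
  then have "acts_4 (Transposition.transpose 1 3) (Transposition.transpose 1 5) (\<lambda>g. (fst g \<noteq> snd g, snd g))"
    unfolding acts_4_def using transpose_Wt_4(2) by (auto intro!: permutes_swap_id)
  then show "\<exists>\<tau>. acts_4 (Transposition.transpose 1 3) (Transposition.transpose 1 5) \<tau>" by blast
  have "bij (\<lambda>g :: bool \<times> bool. (snd g, fst g))" by (rule involuntory_imp_bij) auto
  then have "acts_4 (Transposition.transpose 1 4) (Transposition.transpose 1 4) (\<lambda>g. (snd g, fst g))"
    unfolding acts_4_def using transpose_Wt_4(3) by (auto intro!: permutes_swap_id)
  then show "\<exists>\<tau>. acts_4 (Transposition.transpose 1 4) (Transposition.transpose 1 4) \<tau>" by blast
qed

lemma acts_4_of_permutes:
  assumes "\<pi> permutes {1, 3, 4}"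
  shows "\<exists>\<rho> \<tau>. acts_4 \<pi> \<rho> \<tau>"
proof -
  have "finite {1, 3, 4 :: nat}" by simp
  with assms show ?thesis
  proof (induction rule: permutes_induct)
    case (swap a b p)
    have "a = 3 \<and> b = 4 \<or> a = 4 \<and> b = 3 \<or> a = 1 \<and> b = 3 \<or> a = 3 \<and> b = 1 \<or> a = 1 \<and> b = 4 \<or> a = 4 \<and> b = 1"
      using swap(1-3) by auto
    then have "\<exists>\<rho> \<tau>. acts_4 (Transposition.transpose a b) \<rho> \<tau>"
      using acts_4_transpose transpose_commute[of b a] by (elim disjE conjE) metis+
    then show ?case using swap.IH acts_4_comp by blast
  qed (use acts_4_id in blast)
qed

text \<open>Transpositions of labels induce all transpositions of the three base indices, so every
  X-part for r = 4 is that of a conjugation.\<close>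

lemma acts_4_onto:
  assumes "\<rho> permutes {1, 4, 5}"
  shows "\<exists>\<pi> \<tau>. acts_4 \<pi> \<rho> \<tau>"
proof -
  have "finite {1, 4, 5 :: nat}" by simp
  then show ?thesis using assms
  proof (induction rule: permutes_rev_induct)
    case (swap a b p)
    have "a = 4 \<and> b = 5 \<or> a = 5 \<and> b = 4 \<or> a = 1 \<and> b = 5 \<or> a = 5 \<and> b = 1 \<or> a = 1 \<and> b = 4 \<or> a = 4 \<and> b = 1"
      using swap(1-3) by auto
    then have "\<exists>\<pi> \<tau>. acts_4 \<pi> (Transposition.transpose a b) \<tau>"
      using acts_4_transpose transpose_commute[of b a] by (elim disjE conjE) metis+
    then show ?case using swap.IH acts_4_comp by blast
  qed (use acts_4_id in blast)
qed

lemma acts_4_matrix: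
  assumes "acts_4 \<pi> \<rho> \<tau>"
  shows "mat_on (P_plus 4 3) (\<lambda>\<mu> \<nu>. if \<nu> = \<mu> \<circ> \<pi> then 1 else 0) = lift 4 (ntens (perm_mat \<rho>) (perm_mat \<tau>))"
proof (rule perm_matrix_eq_lift)
  have "\<rho> permutes {..<6}" using assms by (auto simp: acts_4_def intro: permutes_subset)
  then show "\<rho> j < 4 + 2" if "j < 4 + 2" for j using that permutes_in_image[of \<rho> "{..<6}" j] by simp
qed (use assms in \<open>auto simp: acts_4_def\<close>)

lemma G_perm_invs:
  assumes "bij \<tau>" "\<tau> g_e = g_e" "r mod 8 \<noteq> 4 \<longrightarrow> \<tau> = id \<or> \<tau> = gC"
  shows "perm_mat \<tau> \<in> G_invs r"
  using assms unfolding G_invs_def by (cases "r mod 8 = 4") auto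

lemma sw_sw [simp]: "sw r (sw r j) = j"
  by (simp add: sw_def)

lemma gC_gC [simp]: "gC (gC g) = g"
  by (cases g) (auto simp: gC_def)

lemma bij_gC: "bij gC"
  by (rule involuntory_imp_bij) simp

lemma gC_e: "gC g_e = g_e"
  by (simp add: gC_def)

lemma conj_mats_cases:
  assumes r: "r \<ge> 4" and C: "C \<in> conj_mats r"
  obtains \<rho> \<tau> where "\<rho> \<in> X_auts r" "bij \<tau>" "\<tau> g_e = g_e" "r \<noteq> 4 \<longrightarrow> \<tau> = id \<or> \<tau> = gC"
    "C = lift r (ntens (perm_mat \<rho>) (perm_mat \<tau>))" "physical_invariant r 3 C"
proof (cases "r = 4")
  case True
  then obtain \<pi> where \<pi>: "\<pi> permutes {1, 3, 4}" "C = mat_on (P_plus 4 3) (\<lambda>\<mu> \<nu>. if \<nu> = \<mu> \<circ> \<pi> then 1 else 0)"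
    using C unfolding conj_mats_def conjugations_def by auto
  then obtain \<rho> \<tau> where a: "acts_4 \<pi> \<rho> \<tau>" using acts_4_of_permutes by blast
  then have e: "C = lift 4 (ntens (perm_mat \<rho>) (perm_mat \<tau>))" unfolding \<pi>(2) by (rule acts_4_matrix)
  have p: "\<rho> permutes {1, 4, 5}" "bij \<tau>" "\<tau> g_e = g_e" using a by (simp_all add: acts_4_def)
  show ?thesis using that[of \<rho> \<tau>] p e physical_invariant_4[OF p] True by (simp add: X_auts_def)
next
  case False
  then consider "C = lift r (ntens (perm_mat id) (perm_mat id))" | "C = lift r (ntens (perm_mat (sw r)) (perm_mat gC))"
    using C conj_mats_generic[OF r] by blast
  then show ?thesis
  proof cases
    case 1
    have "perm_mat id \<in> G_invs r" by (simp add: G_invs_def)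
    then show ?thesis using that[of id id] 1 physical_invariant_G[OF r] False by (simp add: X_auts_def)
  next
    case 2
    then show ?thesis using that[of "sw r" gC] physical_invariant_sw[OF r] False bij_gC gC_e by (simp add: X_auts_def sw_def)
  qed
qed

text \<open>Every permutation X-part comes from a conjugation, which drags along some permutation of
  the currents.\<close>

lemma conj_mats_onto:
  assumes r: "r \<ge> 4" and \<rho>: "\<rho> \<in> X_auts r"
  obtains \<tau> where "bij \<tau>" "\<tau> g_e = g_e" "r \<noteq> 4 \<longrightarrow> \<tau> = id \<or> \<tau> = gC"
    "lift r (ntens (perm_mat \<rho>) (perm_mat \<tau>)) \<in> conj_mats r"
proof (cases "r = 4")
  case True
  then have "\<rho> permutes {1, 4, 5}" using \<rho> by (simp add: X_auts_def)
  then obtain \<pi> \<tau> where a: "acts_4 \<pi> \<rho> \<tau>" using acts_4_onto by blast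
  have "(\<lambda>\<mu>. \<mu> \<circ> \<pi>) \<in> conjugations 4" unfolding conjugations_def using a by (auto simp: acts_4_def)
  then have "lift 4 (ntens (perm_mat \<rho>) (perm_mat \<tau>)) \<in> conj_mats 4"
    unfolding conj_mats_def acts_4_matrix[OF a, symmetric] by (intro image_eqI[of _ _ "\<lambda>\<mu>. \<mu> \<circ> \<pi>"] HOL.refl)
  then show ?thesis using that[of \<tau>] a True by (simp add: acts_4_def)
next
  case False
  then have "\<rho> = id \<or> \<rho> = sw r" using \<rho> by (simp add: X_auts_def sw_def)
  then show ?thesis
  proof
    assume "\<rho> = id"
    then show ?thesis using conj_mats_generic[OF r False] by (intro that[of id]) simp_all
  next
    assume "\<rho> = sw r"
    then show ?thesis using conj_mats_generic[OF r False] bij_gC gC_e by (intro that[of gC]) simp_all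
  qed
qed

section \<open>Factoring invariants into the listed products\<close>

lemma mat_mul_auts_left:
  assumes r: "r \<ge> 4" and \<rho>: "\<rho> \<in> X_auts r"
  shows "mat_mul (P_plus r 3) (lift r (ntens (perm_mat \<rho>) (perm_mat \<tau>))) (lift r (ntens a m)) =
    lift r (ntens (\<lambda>j k. a (\<rho> j) k) (\<lambda>g h. m (\<tau> g) h))"
  using X_auts_image[OF r \<rho>] by (rule mat_mul_perm_left[OF r])

lemma mat_mul_conj_left:
  assumes "r \<ge> 4" "\<rho> \<in> X_auts r"
  shows "mat_mul (P_plus r 3) (lift r (ntens (perm_mat \<rho>) (perm_mat \<tau>))) (lift r (ntens (perm_mat id) m)) =
    lift r (ntens (perm_mat \<rho>) (\<lambda>g h. m (\<tau> g) h))"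
  unfolding mat_mul_auts_left[OF assms] by (simp add: perm_mat_def[abs_def])

lemma sum_perm_mat_right:
  assumes "\<And>z. \<sigma> (\<sigma> z) = z" "finite I" "\<sigma> y \<in> I"
  shows "(\<Sum>z\<in>I. b z * perm_mat \<sigma> z y) = b (\<sigma> y)"
proof -
  have "y = \<sigma> z \<longleftrightarrow> z = \<sigma> y" for z using assms(1) by metis
  then have "(\<Sum>z\<in>I. b z * perm_mat \<sigma> z y) = (\<Sum>z\<in>I. if z = \<sigma> y then b (\<sigma> y) else 0)"
    by (intro sum.cong) (auto simp: perm_mat_def)
  then show ?thesis using assms by simp
qed

lemma mat_mul_perm_right:
  assumes r: "r \<ge> 4" and \<pi>: "\<And>j. j < r + 2 \<Longrightarrow> \<pi> j < r + 2" "\<And>j. \<pi> (\<pi> j) = j" and \<tau>: "\<And>g. \<tau> (\<tau> g) = g"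
  shows "mat_mul (P_plus r 3) (lift r (ntens a m)) (lift r (ntens (perm_mat \<pi>) (perm_mat \<tau>))) =
    lift r (ntens (\<lambda>j k. a j (\<pi> k)) (\<lambda>g h. m g (\<tau> h)))"
  unfolding mat_mul_lift_ntens[OF r] using r \<pi> \<tau>
  by (intro lift_ntens_cong) (auto simp: sum_perm_mat_right)

lemma physical_invariant_conj_left:
  assumes r: "r \<ge> 4" and C: "C \<in> conj_mats r" and M: "physical_invariant r 3 M"
  shows "physical_invariant r 3 (mat_mul (P_plus r 3) C M)"
proof -
  obtain \<rho> \<tau> where c: "\<rho> \<in> X_auts r" "\<tau> g_e = g_e" "C = lift r (ntens (perm_mat \<rho>) (perm_mat \<tau>))" "physical_invariant r 3 C"
    using conj_mats_cases[OF r C] by metis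
  obtain a m where m: "M = lift r (ntens a m)" using physical_invariant_product_form[OF r M] by metis
  have e: "(0, g_e) \<in> Cells r" by (simp add: Cells_def)
  have "mat_mul (P_plus r 3) C M (Wt r (0, g_e)) (Wt r (0, g_e)) = M (Wt r (0, g_e)) (Wt r (0, g_e))"
    unfolding c(3) m mat_mul_auts_left[OF r c(1)] lift_Wt[OF r e e]
    using c(2) X_auts_0[OF r c(1)] by (simp add: ntens_def)
  then show ?thesis
    using M c(4) physical_invariant_iff[OF r, of M] by (intro physical_invariant_mult[OF r]) auto
qed

lemma mat_mul_id_right:
  assumes r: "r \<ge> 4"
  shows "mat_mul (P_plus r 3) (lift r (ntens a m)) (lift r (ntens (perm_mat id) (perm_mat id))) = lift r (ntens a m)"
  using mat_mul_perm_right[OF r, of id id a m] by simp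

lemma mat_mul_sw_right:
  assumes r: "r \<ge> 4"
  shows "mat_mul (P_plus r 3) (lift r (ntens a m)) (lift r (ntens (perm_mat (sw r)) (perm_mat gC))) =
    lift r (ntens (\<lambda>j k. a j (sw r k)) (\<lambda>g h. m g (gC h)))"
  using sw_less by (intro mat_mul_perm_right[OF r]) auto

lemma physical_invariant_conj_right:
  assumes r: "r \<ge> 4" "r \<noteq> 4" and C: "C \<in> conj_mats r" and M: "physical_invariant r 3 M"
  shows "physical_invariant r 3 (mat_mul (P_plus r 3) M C)"
proof -
  obtain a m where m: "M = lift r (ntens a m)" using physical_invariant_product_form[OF r(1) M] by metis
  have e: "(0, g_e) \<in> Cells r" by (simp add: Cells_def)
  have s: "sw r 0 = 0" using r by (simp add: sw_def Transposition.transpose_def)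
  have "C = lift r (ntens (perm_mat id) (perm_mat id)) \<or> C = lift r (ntens (perm_mat (sw r)) (perm_mat gC))"
    using C unfolding conj_mats_generic[OF r] by simp
  then have "mat_mul (P_plus r 3) M C (Wt r (0, g_e)) (Wt r (0, g_e)) = M (Wt r (0, g_e)) (Wt r (0, g_e))"
    unfolding m by (auto simp: mat_mul_id_right[OF r(1)] mat_mul_sw_right[OF r(1)] lift_Wt[OF r(1) e e] ntens_def s gC_e)
  moreover have "physical_invariant r 3 C" using conj_mats_cases[OF r(1) C] by metis
  ultimately show ?thesis
    using M physical_invariant_iff[OF r(1), of M] by (intro physical_invariant_mult[OF r(1)]) auto
qed

text \<open>The six permutations of the nontrivial currents: two transpositions come from
  \<open>I_s\<close> and \<open>I_c\<close>, the third is \<open>gC\<close> from \<open>I_v\<close>,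
  and the products of the first two are the 3-cycles.\<close>

lemma fixing_e_cases:
  assumes "bij \<tau>" and e: "\<tau> g_e = g_e"
  defines "\<sigma>s \<equiv> \<lambda>(p, q). (p \<noteq> q, q)" and "\<sigma>c \<equiv> \<lambda>(p, q). (q, p)"
  shows "\<tau> = id \<or> \<tau> = gC \<or> \<tau> = \<sigma>s \<or> \<tau> = \<sigma>c \<or> \<tau> = \<sigma>c \<circ> \<sigma>s \<or> \<tau> = \<sigma>s \<circ> \<sigma>c"
proof -
  have inj: "\<tau> x = \<tau> y \<longleftrightarrow> x = y" for x y using assms(1) by (simp add: bij_is_inj inj_eq)
  have four: "x = g_e \<or> x = g_v \<or> x = g_s \<or> x = g_c" for x :: "bool \<times> bool" by (cases x) auto
  have eqI: "\<tau> = \<tau>'" if "\<tau>' g_e = g_e" "\<tau>' g_v = \<tau> g_v" "\<tau>' g_s = \<tau> g_s" "\<tau>' g_c = \<tau> g_c" for \<tau>'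
  proof
    fix x show "\<tau> x = \<tau>' x" using four[of x] that e by (elim disjE) simp_all
  qed
  have ne: "\<tau> g_v \<noteq> g_e" "\<tau> g_s \<noteq> g_e" "\<tau> g_c \<noteq> g_e" "\<tau> g_v \<noteq> \<tau> g_s" "\<tau> g_v \<noteq> \<tau> g_c" "\<tau> g_s \<noteq> \<tau> g_c"
    using inj[of _ g_e] inj e by auto
  have "\<tau> g_v = g_v \<and> \<tau> g_s = g_s \<and> \<tau> g_c = g_c \<or> \<tau> g_v = g_v \<and> \<tau> g_s = g_c \<and> \<tau> g_c = g_s \<or>
    \<tau> g_v = g_s \<and> \<tau> g_s = g_v \<and> \<tau> g_c = g_c \<or> \<tau> g_v = g_s \<and> \<tau> g_s = g_c \<and> \<tau> g_c = g_v \<or>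
    \<tau> g_v = g_c \<and> \<tau> g_s = g_s \<and> \<tau> g_c = g_v \<or> \<tau> g_v = g_c \<and> \<tau> g_s = g_v \<and> \<tau> g_c = g_s"
    using four[of "\<tau> g_v"] four[of "\<tau> g_s"] four[of "\<tau> g_c"] ne by metis
  then show ?thesis
  proof (elim disjE conjE)
    assume "\<tau> g_v = g_v" "\<tau> g_s = g_s" "\<tau> g_c = g_c"
    then have "\<tau> = id" by (intro eqI) simp_all
    then show ?thesis by blast
  next
    assume "\<tau> g_v = g_v" "\<tau> g_s = g_c" "\<tau> g_c = g_s"
    then have "\<tau> = gC" by (intro eqI) (simp_all add: gC_def)
    then show ?thesis by blast
  next
    assume "\<tau> g_v = g_s" "\<tau> g_s = g_v" "\<tau> g_c = g_c"
    then have "\<tau> = \<sigma>c" by (intro eqI) (simp_all add: \<sigma>c_def)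
    then show ?thesis by blast
  next
    assume "\<tau> g_v = g_s" "\<tau> g_s = g_c" "\<tau> g_c = g_v"
    then have "\<tau> = \<sigma>s \<circ> \<sigma>c" by (intro eqI) (simp_all add: \<sigma>s_def \<sigma>c_def)
    then show ?thesis by blast
  next
    assume "\<tau> g_v = g_c" "\<tau> g_s = g_s" "\<tau> g_c = g_v"
    then have "\<tau> = \<sigma>s" by (intro eqI) (simp_all add: \<sigma>s_def)
    then show ?thesis by blast
  next
    assume "\<tau> g_v = g_c" "\<tau> g_s = g_v" "\<tau> g_c = g_s"
    then have "\<tau> = \<sigma>c \<circ> \<sigma>s" by (intro eqI) (simp_all add: \<sigma>s_def \<sigma>c_def)
    then show ?thesis by blast
  qed
qed

lemma perm_mat_comp: "(\<lambda>x y. perm_mat \<sigma> (\<tau> x) y) = perm_mat (\<sigma> \<circ> \<tau>)"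
  by (simp add: perm_mat_def[abs_def])

lemma id_X_auts: "id \<in> X_auts r"
  by (simp add: X_auts_def permutes_id)

lemma mat_mul_conj_perm:
  assumes "r \<ge> 4" "\<rho> \<in> X_auts r"
  shows "mat_mul (P_plus r 3) (lift r (ntens (perm_mat \<rho>) (perm_mat \<tau>))) (lift r (ntens (perm_mat id) (perm_mat \<sigma>))) =
    lift r (ntens (perm_mat \<rho>) (perm_mat (\<sigma> \<circ> \<tau>)))"
  unfolding mat_mul_conj_left[OF assms] perm_mat_comp[of \<sigma> \<tau>] ..

lemma I_s_I_c_products:
  assumes r: "r \<ge> 4" "r mod 8 = 4"
  defines "\<sigma>s \<equiv> \<lambda>(p, q). (p \<noteq> q, q)" and "\<sigma>c \<equiv> \<lambda>(p, q). (q, p)"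
  shows "I_s r = lift r (ntens (perm_mat id) (perm_mat \<sigma>s))" "I_c r = lift r (ntens (perm_mat id) (perm_mat \<sigma>c))"
    "mat_mul (P_plus r 3) (I_s r) (I_c r) = lift r (ntens (perm_mat id) (perm_mat (\<sigma>c \<circ> \<sigma>s)))"
    "mat_mul (P_plus r 3) (I_c r) (I_s r) = lift r (ntens (perm_mat id) (perm_mat (\<sigma>s \<circ> \<sigma>c)))"
    "bij \<sigma>s" "bij \<sigma>c" "\<sigma>s g_e = g_e" "\<sigma>c g_e = g_e"
proof -
  note e = I_s_I_c_lift_4[OF r, folded \<sigma>s_def \<sigma>c_def]
  show "I_s r = lift r (ntens (perm_mat id) (perm_mat \<sigma>s))" "I_c r = lift r (ntens (perm_mat id) (perm_mat \<sigma>c))"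
    by (fact e)+
  show "mat_mul (P_plus r 3) (I_s r) (I_c r) = lift r (ntens (perm_mat id) (perm_mat (\<sigma>c \<circ> \<sigma>s)))"
    "mat_mul (P_plus r 3) (I_c r) (I_s r) = lift r (ntens (perm_mat id) (perm_mat (\<sigma>s \<circ> \<sigma>c)))"
    unfolding e mat_mul_conj_perm[OF r(1) id_X_auts] by (rule HOL.refl)+
  show "bij \<sigma>s" "bij \<sigma>c" by (rule involuntory_imp_bij, auto simp: \<sigma>s_def \<sigma>c_def)+
  show "\<sigma>s g_e = g_e" "\<sigma>c g_e = g_e" by (simp_all add: \<sigma>s_def \<sigma>c_def)
qed

lemma I_v_I_s_8:
  assumes r: "r \<ge> 4" "8 dvd r"
  shows "mat_mul (P_plus r 3) (I_v r) (I_s r) = lift r (ntens (perm_mat id) (ext_mat g_c g_s))"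
  unfolding I_v_lift[OF r(1)] I_s_lift_8[OF r] mat_mul_conj_left[OF r(1) id_X_auts]
  by (rule lift_ntens_cong[OF r(1)]) (auto simp: ext_mat_def gC_def prod_eq_iff)

text \<open>A conjugation with the required X-part is split off. It brings its own permutation of
  the currents, so the factor that remains is the quotient of \<tau>' by that permutation.\<close>

lemma perm_part_factors:
  assumes r: "r \<ge> 4" and \<rho>: "\<rho> \<in> X_auts r" and \<tau>': "bij \<tau>'" "\<tau>' g_e = g_e"
    and g: "r mod 8 \<noteq> 4 \<longrightarrow> \<tau>' = id \<or> \<tau>' = gC"
  obtains C \<sigma> where "C \<in> conj_mats r" "bij \<sigma>" "\<sigma> g_e = g_e" "r mod 8 \<noteq> 4 \<longrightarrow> \<sigma> = id \<or> \<sigma> = gC"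
    "lift r (ntens (perm_mat \<rho>) (perm_mat \<tau>')) = mat_mul (P_plus r 3) C (lift r (ntens (perm_mat id) (perm_mat \<sigma>)))"
    "\<sigma> = id \<longrightarrow> lift r (ntens (perm_mat \<rho>) (perm_mat \<tau>')) = C"
proof -
  obtain \<tau> where t: "bij \<tau>" "\<tau> g_e = g_e" "r \<noteq> 4 \<longrightarrow> \<tau> = id \<or> \<tau> = gC"
    and C: "lift r (ntens (perm_mat \<rho>) (perm_mat \<tau>)) \<in> conj_mats r"
    using conj_mats_onto[OF r \<rho>] by metis
  define \<sigma> where "\<sigma> = \<tau>' \<circ> inv_into UNIV \<tau>"
  have st: "\<sigma> \<circ> \<tau> = \<tau>'" using t(1) by (simp add: \<sigma>_def comp_assoc bij_is_inj)
  have "bij \<sigma>" unfolding \<sigma>_def by (intro bij_comp bij_imp_bij_inv t \<tau>')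
  moreover have "\<sigma> g_e = g_e" using st t(2) \<tau>'(2) by (metis comp_apply)
  moreover have "r mod 8 \<noteq> 4 \<longrightarrow> \<sigma> = id \<or> \<sigma> = gC"
  proof
    assume r8: "r mod 8 \<noteq> 4"
    then have "r \<noteq> 4" by auto
    have gg: "gC \<circ> gC = id" by (simp add: fun_eq_iff)
    have "\<tau> = id \<or> \<tau> = gC" using t(3) \<open>r \<noteq> 4\<close> by blast
    then have "inv_into UNIV \<tau> = \<tau>" by (metis gg comp_id inv_unique_comp)
    then show "\<sigma> = id \<or> \<sigma> = gC"
      unfolding \<sigma>_def using \<open>\<tau> = id \<or> \<tau> = gC\<close> g r8 gg by (metis comp_id id_comp)
  qed
  moreover have "lift r (ntens (perm_mat \<rho>) (perm_mat \<tau>')) =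
      mat_mul (P_plus r 3) (lift r (ntens (perm_mat \<rho>) (perm_mat \<tau>))) (lift r (ntens (perm_mat id) (perm_mat \<sigma>)))"
    unfolding mat_mul_conj_perm[OF r \<rho>] st ..
  moreover have "\<sigma> = id \<longrightarrow> lift r (ntens (perm_mat \<rho>) (perm_mat \<tau>')) = lift r (ntens (perm_mat \<rho>) (perm_mat \<tau>))"
    using st by auto
  ultimately show ?thesis by (rule that[OF C])
qed

lemma listed_imp_physical_invariant:
  assumes r: "r \<ge> 4"
  shows "C \<in> conj_mats r \<Longrightarrow> physical_invariant r 3 C"
    "C \<in> conj_mats r \<Longrightarrow> physical_invariant r 3 (C \<odot>\<^bsub>r\<^esub> I_v r)"
    "r mod 8 = 4 \<Longrightarrow> C \<in> conj_mats r \<Longrightarrow> M \<in> {I_s r, I_c r, I_s r \<odot>\<^bsub>r\<^esub> I_c r, I_c r \<odot>\<^bsub>r\<^esub> I_s r} \<Longrightarrow>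
      physical_invariant r 3 (C \<odot>\<^bsub>r\<^esub> M)"
    "8 dvd r \<Longrightarrow> C \<in> conj_mats r \<Longrightarrow> C' \<in> conj_mats r \<Longrightarrow> M \<in> {I_s r, I_v r \<odot>\<^bsub>r\<^esub> I_s r} \<Longrightarrow>
      physical_invariant r 3 (C \<odot>\<^bsub>r\<^esub> M \<odot>\<^bsub>r\<^esub> C')"
    "r = 7 \<Longrightarrow> C \<in> conj_mats r \<Longrightarrow> physical_invariant r 3 (C \<odot>\<^bsub>r\<^esub> E_D73)"
proof -
  note left = physical_invariant_conj_left[OF r]
  show "C \<in> conj_mats r \<Longrightarrow> physical_invariant r 3 C" by (erule conj_mats_cases[OF r])
  have "perm_mat gC \<in> G_invs r" by (simp add: G_invs_def)
  then show "C \<in> conj_mats r \<Longrightarrow> physical_invariant r 3 (C \<odot>\<^bsub>r\<^esub> I_v r)"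
    unfolding I_v_lift[OF r] by (intro left physical_invariant_G r)
  show "physical_invariant r 3 (C \<odot>\<^bsub>r\<^esub> M)"
    if "r mod 8 = 4" "C \<in> conj_mats r" "M \<in> {I_s r, I_c r, I_s r \<odot>\<^bsub>r\<^esub> I_c r, I_c r \<odot>\<^bsub>r\<^esub> I_s r}"
  proof (rule left[OF that(2)])
    note e = I_s_I_c_products[OF r that(1)]
    have "\<exists>\<tau>. bij \<tau> \<and> \<tau> g_e = g_e \<and> M = lift r (ntens (perm_mat id) (perm_mat \<tau>))"
      using that(3)
    proof (elim insertE emptyE)
      assume "M = I_s r" then show ?thesis using e(1,5,7) by blast
    next
      assume "M = I_c r" then show ?thesis using e(2,6,8) by blast
    next
      assume M: "M = I_s r \<odot>\<^bsub>r\<^esub> I_c r"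
      show ?thesis unfolding M e(3) by (intro exI[of _ "(\<lambda>(p, q). (q, p)) \<circ> (\<lambda>(p, q). (p \<noteq> q, q))"] conjI bij_comp e(5,6)) simp_all
    next
      assume M: "M = I_c r \<odot>\<^bsub>r\<^esub> I_s r"
      show ?thesis unfolding M e(4) by (intro exI[of _ "(\<lambda>(p, q). (p \<noteq> q, q)) \<circ> (\<lambda>(p, q). (q, p))"] conjI bij_comp e(5,6)) simp_all
    qed
    then obtain \<tau> where t: "bij \<tau>" "\<tau> g_e = g_e" and M: "M = lift r (ntens (perm_mat id) (perm_mat \<tau>))" by blast
    show "physical_invariant r 3 M"
      unfolding M using G_perm_invs[OF t, of r] that(1) by (intro physical_invariant_G r) simp
  qed
  show "physical_invariant r 3 (C \<odot>\<^bsub>r\<^esub> M \<odot>\<^bsub>r\<^esub> C')"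
    if "8 dvd r" "C \<in> conj_mats r" "C' \<in> conj_mats r" "M \<in> {I_s r, I_v r \<odot>\<^bsub>r\<^esub> I_s r}"
  proof -
    have r4: "r \<noteq> 4" using that(1) by auto
    have "M = lift r (ntens (perm_mat id) (ext_mat g_s g_s)) \<or> M = lift r (ntens (perm_mat id) (ext_mat g_c g_s))"
      using that(4) unfolding I_v_I_s_8[OF r that(1)] unfolding I_s_lift_8[OF r that(1)] by simp
    moreover have "ext_mat g_s g_s \<in> G_invs r" "ext_mat g_c g_s \<in> G_invs r"
      unfolding G_invs_def if_P[OF that(1)] by blast+
    ultimately have "physical_invariant r 3 M" using physical_invariant_G[OF r] by metis
    then show ?thesis by (intro physical_invariant_conj_right[OF r r4 that(3)] left[OF that(2)])
  qed
  show "r = 7 \<Longrightarrow> C \<in> conj_mats r \<Longrightarrow> physical_invariant r 3 (C \<odot>\<^bsub>r\<^esub> E_D73)"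
    using left physical_invariant_E_D73 by blast
qed

text \<open>The left spinor is \<open>g_s\<close> for \<open>I_s\<close> and \<open>g_c\<close> for
  its product with \<open>I_v\<close>; the right one is \<open>g_s\<close> in both. The right
  conjugation sets \<open>b\<close>, the left one corrects the X-part. A nontrivial left conjugation
  also exchanges the left spinor, so the middle factor is then chosen for
  \<open>gC a\<close>.\<close>

lemma ext_part_factors:
  assumes r: "r \<ge> 4" "8 dvd r" and \<rho>: "\<rho> \<in> X_auts r" and ab: "a \<in> {g_s, g_c}" "b \<in> {g_s, g_c}"
  shows "\<exists>C\<in>conj_mats r. \<exists>C'\<in>conj_mats r. \<exists>M\<in>{I_s r, I_v r \<odot>\<^bsub>r\<^esub> I_s r}.
    lift r (ntens (perm_mat \<rho>) (ext_mat a b)) = C \<odot>\<^bsub>r\<^esub> M \<odot>\<^bsub>r\<^esub> C'"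
proof -
  let ?L = "\<lambda>\<rho> m. lift r (ntens (perm_mat \<rho>) m)"
  let ?M = "\<lambda>a. if a = g_s then I_s r else I_v r \<odot>\<^bsub>r\<^esub> I_s r"
  have r4: "r \<noteq> 4" using r(2) by auto
  have C: "?L id (perm_mat id) \<in> conj_mats r" "?L (sw r) (perm_mat gC) \<in> conj_mats r"
    unfolding conj_mats_generic[OF r(1) r4] by simp_all
  have sw: "sw r \<in> X_auts r" using r4 by (simp add: X_auts_def sw_def)
  have M: "?M a = ?L id (ext_mat a g_s)" "?M a \<in> {I_s r, I_v r \<odot>\<^bsub>r\<^esub> I_s r}" if "a \<in> {g_s, g_c}" for a
    unfolding I_v_I_s_8[OF r] unfolding I_s_lift_8[OF r] using that by auto
  have gC: "gC a \<in> {g_s, g_c}" using ab by (auto simp: gC_def)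
  have ext: "(\<lambda>g h. ext_mat (gC a) g_s (gC g) h) = ext_mat a g_s" "(\<lambda>g h. ext_mat a g_s g (gC h)) = ext_mat a g_c"
    using ab by (auto simp: ext_mat_def gC_def fun_eq_iff prod_eq_iff)
  have sw2: "(\<lambda>j k. perm_mat \<sigma> j (sw r k)) = perm_mat (sw r \<circ> \<sigma>)" for \<sigma>
    by (auto simp: perm_mat_def fun_eq_iff) (metis sw_sw)+
  have id_left: "?L id (perm_mat id) \<odot>\<^bsub>r\<^esub> ?M a = ?L id (ext_mat a g_s)"
    unfolding M(1)[OF ab(1)] mat_mul_conj_left[OF r(1) id_X_auts] by simp
  have sw_left: "?L (sw r) (perm_mat gC) \<odot>\<^bsub>r\<^esub> ?M (gC a) = ?L (sw r) (ext_mat a g_s)"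
    unfolding M(1)[OF gC] mat_mul_conj_left[OF r(1) sw] ext ..
  have ss: "sw r \<circ> sw r = id" "sw r \<circ> id = sw r" by (simp_all add: fun_eq_iff)
  have sw_right: "?L id (ext_mat a g_s) \<odot>\<^bsub>r\<^esub> ?L (sw r) (perm_mat gC) = ?L (sw r) (ext_mat a g_c)"
    "?L (sw r) (ext_mat a g_s) \<odot>\<^bsub>r\<^esub> ?L (sw r) (perm_mat gC) = ?L id (ext_mat a g_c)"
    unfolding mat_mul_sw_right[OF r(1)] sw2 ext ss by (rule HOL.refl)+
  have id_right: "?L \<rho> (ext_mat a g_s) \<odot>\<^bsub>r\<^esub> ?L id (perm_mat id) = ?L \<rho> (ext_mat a g_s)" for \<rho>
    by (rule mat_mul_id_right[OF r(1)])
  have "\<rho> = id \<or> \<rho> = sw r" using \<rho> r4 by (simp add: X_auts_def sw_def)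
  moreover have "b = g_s \<or> b = g_c" using ab(2) by blast
  ultimately consider "\<rho> = id" "b = g_s" | "\<rho> = id" "b = g_c" | "\<rho> = sw r" "b = g_s" | "\<rho> = sw r" "b = g_c" by blast
  then show ?thesis
  proof cases
    case 1
    show ?thesis unfolding 1
      by (rule bexI[OF _ C(1)], rule bexI[OF _ C(1)], rule bexI[OF _ M(2)[OF ab(1)]]) (simp only: id_left id_right)
  next
    case 2
    show ?thesis unfolding 2
      by (rule bexI[OF _ C(2)], rule bexI[OF _ C(2)], rule bexI[OF _ M(2)[OF gC]]) (simp only: sw_left sw_right)
  next
    case 3
    show ?thesis unfolding 3
      by (rule bexI[OF _ C(2)], rule bexI[OF _ C(1)], rule bexI[OF _ M(2)[OF gC]]) (simp only: sw_left id_right)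
  next
    case 4
    show ?thesis unfolding 4
      by (rule bexI[OF _ C(1)], rule bexI[OF _ C(2)], rule bexI[OF _ M(2)[OF ab(1)]])
        (simp only: id_left sw_right)
  qed
qed

text \<open>\<open>X_exc\<close> vanishes on the pair exchanged by C_1, so C_1 acts on it through
  \<open>gC\<close> alone; multiplication by \<open>I_v\<close> has the same effect and gives
  nothing new.\<close>

lemma exceptional_part_factors:
  assumes "\<tau> = id \<or> \<tau> = gC"
  shows "\<exists>C\<in>conj_mats 7. lift 7 (ntens X_exc (perm_mat \<tau>)) = C \<odot>\<^bsub>7\<^esub> E_D73"
proof -
  have c: "conj_mats 7 = {lift 7 (ntens (perm_mat id) (perm_mat id)), lift 7 (ntens (perm_mat (sw 7)) (perm_mat gC))}"
    by (rule conj_mats_generic) simp_all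
  have "id \<in> X_auts 7" "sw 7 \<in> X_auts 7" by (simp_all add: X_auts_def sw_def)
  note L = this[THEN mat_mul_auts_left[rotated], of _ X_exc "perm_mat id", folded E_D73_lift, simplified]
  have x: "(\<lambda>j. X_exc (sw 7 j)) = X_exc"
    by (intro ext) (auto simp: X_exc_def sw_def Transposition.transpose_def)
  have g: "(\<lambda>x. perm_mat id (gC x)) = perm_mat gC" by (simp add: perm_mat_def[abs_def])
  from assms show ?thesis
  proof
    assume "\<tau> = id"
    then show ?thesis unfolding c using L(1)[of id] by simp
  next
    assume "\<tau> = gC"
    then show ?thesis unfolding c using L(2)[of gC] by (simp add: x g)
  qed
qed

theorem theorem2p4:
  fixes r :: nat
  assumes "r \<ge> 4"
  shows "{M. physical_invariant r 3 M} =
      conj_mats r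
    \<union> {C \<odot>\<^bsub>r\<^esub> I_v r | C. C \<in> conj_mats r}
    \<union> (if r mod 8 = 4
       then {C \<odot>\<^bsub>r\<^esub> M | C M. C \<in> conj_mats r \<and>
               M \<in> {I_s r, I_c r, I_s r \<odot>\<^bsub>r\<^esub> I_c r, I_c r \<odot>\<^bsub>r\<^esub> I_s r}}
       else {})
    \<union> (if 8 dvd r
       then {C \<odot>\<^bsub>r\<^esub> M \<odot>\<^bsub>r\<^esub> C' | C M C'. C \<in> conj_mats r \<and> C' \<in> conj_mats r \<and>
               M \<in> {I_s r, I_v r \<odot>\<^bsub>r\<^esub> I_s r}}
       else {})
    \<union> (if r = 7 then {C \<odot>\<^bsub>r\<^esub> E_D73 | C. C \<in> conj_mats r} else {})"
    (is "_ = ?A \<union> ?B \<union> ?D \<union> ?E \<union> ?F")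
proof (intro equalityI subsetI)
  note L = listed_imp_physical_invariant[OF assms]
  fix M assume "M \<in> ?A \<union> ?B \<union> ?D \<union> ?E \<union> ?F"
  then show "M \<in> {M. physical_invariant r 3 M}"
  proof (elim UnE)
    assume "M \<in> ?A" then show ?thesis using L(1) by blast
  next
    assume "M \<in> ?B" then show ?thesis using L(2) by blast
  next
    assume "M \<in> ?D" then show ?thesis using L(3) by (cases "r mod 8 = 4") (simp, blast, simp)
  next
    assume "M \<in> ?E" then show ?thesis using L(4) by (cases "8 dvd r") (simp, blast, simp)
  next
    assume "M \<in> ?F" then show ?thesis using L(5) by (cases "r = 7") (simp, blast, simp)
  qed
next
  fix M assume "M \<in> {M. physical_invariant r 3 M}"
  then obtain a m where am: "a \<in> X_invs r" "m \<in> G_invs r" and M: "M = lift r (ntens a m)"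
    using physical_invariant_product_form[OF assms] by blast
  have m_cases: "(\<exists>\<tau>. bij \<tau> \<and> \<tau> g_e = g_e \<and> (r mod 8 \<noteq> 4 \<longrightarrow> \<tau> = id \<or> \<tau> = gC) \<and> m = perm_mat \<tau>) \<or>
    (8 dvd r \<and> (\<exists>a\<in>{g_s, g_c}. \<exists>b\<in>{g_s, g_c}. m = ext_mat a b))"
    using am(2) unfolding G_invs_def
  proof (elim UnE insertE emptyE)
    assume "m = perm_mat id" then show ?thesis by (intro disjI1 exI[of _ id]) simp
  next
    assume "m = perm_mat gC" then show ?thesis using bij_gC gC_e by blast
  next
    assume "m \<in> (if r mod 8 = 4 then {perm_mat \<tau> | \<tau>. bij \<tau> \<and> \<tau> g_e = g_e} else {})"
    then show ?thesis by (cases "r mod 8 = 4") (simp, blast, simp)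
  next
    assume "m \<in> (if 8 dvd r then {ext_mat a b | a b. a \<in> {g_s, g_c} \<and> b \<in> {g_s, g_c}} else {})"
    then have "8 dvd r \<and> m \<in> {ext_mat a b | a b. a \<in> {g_s, g_c} \<and> b \<in> {g_s, g_c}}"
      by (cases "8 dvd r") (simp_all only: if_True if_False empty_iff simp_thms)
    then show ?thesis by blast
  qed
  show "M \<in> ?A \<union> ?B \<union> ?D \<union> ?E \<union> ?F"
  proof (cases "r = 7 \<and> a = X_exc")
    case True
    \<comment> \<open>For r = 7 the current part is \<open>id\<close> or \<open>gC\<close>, and
      conjugations of \<open>E_D73\<close> reach both.\<close>
    then have "r mod 8 \<noteq> 4" "\<not> 8 dvd r" by simp_all
    then obtain \<tau> where \<tau>: "\<tau> = id \<or> \<tau> = gC" "m = perm_mat \<tau>" using m_cases by blast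
    have r7: "r = 7" and a: "a = X_exc" using True by blast+
    have "M \<in> ?F" using exceptional_part_factors[OF \<tau>(1)] unfolding M r7 a \<tau>(2) if_P[OF HOL.refl] by blast
    then show ?thesis by blast
  next
    case False
    then obtain \<rho> where \<rho>: "\<rho> \<in> X_auts r" "a = perm_mat \<rho>" using am(1) unfolding X_invs_def by (auto split: if_splits)
    from m_cases show ?thesis
    proof
      assume "\<exists>\<tau>. bij \<tau> \<and> \<tau> g_e = g_e \<and> (r mod 8 \<noteq> 4 \<longrightarrow> \<tau> = id \<or> \<tau> = gC) \<and> m = perm_mat \<tau>"
      then obtain \<tau> where \<tau>: "bij \<tau>" "\<tau> g_e = g_e" "r mod 8 \<noteq> 4 \<longrightarrow> \<tau> = id \<or> \<tau> = gC" "m = perm_mat \<tau>" by blast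
      obtain C \<sigma> where C: "C \<in> conj_mats r" "bij \<sigma>" "\<sigma> g_e = g_e" "r mod 8 \<noteq> 4 \<longrightarrow> \<sigma> = id \<or> \<sigma> = gC"
        "M = C \<odot>\<^bsub>r\<^esub> lift r (ntens (perm_mat id) (perm_mat \<sigma>))" "\<sigma> = id \<longrightarrow> M = C"
        using perm_part_factors[OF assms \<rho>(1) \<tau>(1-3)] unfolding M \<rho>(2) \<tau>(4) by metis
      show ?thesis
      proof (cases "\<sigma> = id \<or> \<sigma> = gC")
        case True
        then show ?thesis
        proof
          assume "\<sigma> = id"
          then have "M \<in> ?A" using C(1,6) by simp
          then show ?thesis by blast
        next
          assume "\<sigma> = gC"
          then have "M = C \<odot>\<^bsub>r\<^esub> I_v r" using C(5) I_v_lift[OF assms] by simp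
          then have "M \<in> ?B" using C(1) by blast
          then show ?thesis by blast
        qed
      next
        case False
        then have r4: "r mod 8 = 4" using C(4) by blast
        \<comment> \<open>With \<open>id\<close> and \<open>gC\<close> excluded, the four remaining
          permutations are those of the four listed matrices.\<close>
        have "lift r (ntens (perm_mat id) (perm_mat \<sigma>)) \<in> {I_s r, I_c r, I_s r \<odot>\<^bsub>r\<^esub> I_c r, I_c r \<odot>\<^bsub>r\<^esub> I_s r}"
          unfolding insert_iff empty_iff I_s_I_c_products(3,4)[OF assms r4] unfolding I_s_I_c_products(1,2)[OF assms r4]
          using fixing_e_cases[OF C(2,3)] False by (elim disjE) (simp_all only: simp_thms)
        then have "M \<in> ?D" unfolding if_P[OF r4] C(5) using C(1) by blast
        then show ?thesis by blast
      qed
    next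
      assume e: "8 dvd r \<and> (\<exists>a\<in>{g_s, g_c}. \<exists>b\<in>{g_s, g_c}. m = ext_mat a b)"
      then have r8: "8 dvd r" by blast
      from e have "\<exists>C\<in>conj_mats r. \<exists>C'\<in>conj_mats r. \<exists>M'\<in>{I_s r, I_v r \<odot>\<^bsub>r\<^esub> I_s r}. M = C \<odot>\<^bsub>r\<^esub> M' \<odot>\<^bsub>r\<^esub> C'"
        using ext_part_factors[OF assms r8 \<rho>(1)] unfolding M \<rho>(2) by metis
      then have "M \<in> ?E" unfolding if_P[OF r8] by blast
      then show ?thesis by blast
    qed
  qed
qed

end
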